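(* Let $(X,\sigma_X)$ be a non-trivial mixing shift of finite type. Then there exist real numbers $0<E\le 1\le F$ and $s\in\mathbb{N}$ (depending on $(X,\sigma_X)$) such that, writing $\mathcal{C}_\sigma = PS_{E,F,s^2}$, for every integer $k\ge 1$ the local $\mathcal{C}_\sigma$ entropy of the leveled group $\left(\mathrm{Aut}^{(\infty)}(\sigma_X),\sigma_X^k\right)$ is given by $$h_{\mathcal{C}_\sigma}\left(\mathrm{Aut}^{(\infty)}(\sigma_X),\sigma_X^k\right)=h_{top}(\sigma_X^k).$$
   Context: A subshift $(X,\sigma_X)$ is a nonempty closed shift-invariant subset $X\subset\mathcal{A}^{\mathbb{Z}}$ ($\mathcal{A}$ a finite alphabet) with $\sigma_X$ the restriction of the left shift $(\sigma x)_i=x_{i+1}$. It is a shift of finite type if $X$ is the set of all points avoiding some finite set of forbidden words. It is mixing if for all words $u,v$ in its language there is $M$ such that for all $m\ge M$ there is a word $w$ of length $m$ with $uwv$ in the language. A mixing shift of finite type is trivial if it consists of only one finite orbit. $h_{top}$ denotes topological entropy. For a homeomorphism $T$ of a compact metric space $X$, $\mathrm{Aut}(T)$ is the group of homeomorphisms of $X$ commuting with $T$, and $\mathrm{Aut}^{(\infty)}(T)=\bigcup_{n\ge1}\mathrm{Aut}(T^n)$, a subgroup of $\mathrm{Homeo}(X)$. A leveled group $(G,g)$ is a group $G$ with an element $g\in G$ of infinite order. $C(g)$ denotes the centralizer of $g$ in $G$. Let $\mathcal{P}$ be a class of finite groups closed under isomorphism. A subgroup $H\subset G$ is $g$-locally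 $\mathcal{P}$ if (1) $H\cap C(g^j)$ is finite for all $j\ge1$; (2) there is $J\ge 1$ such that $H\cap C(g^j)\in\mathcal{P}$ for all $j\ge J$; (3) $H\cap C(g)\neq\{e\}$. If $G$ contains a $g$-locally $\mathcal{P}$ subgroup (in which case the local $\mathcal{P}$ entropy is said to exist), the local $\mathcal{P}$ entropy is $$h_{\mathcal{P}}(G,g)=\sup_{H}\limsup_{n\to\infty}\frac1n\log\log|H\cap C(g^n)|,$$ the supremum being over all $g$-locally $\mathcal{P}$ subgroups $H$ of $G$. For real numbers $0<C\le 1\le D$ and $r\in\mathbb{N}$, $PS_{C,D,r}$ is the class of finite groups $G$ for which there exist finite simple non-abelian groups $G_1,\dots,G_r$ with $G\cong\prod_{i=1}^rG_i$ and $|G_i|^C\le|G_j|\le|G_i|^D$ for all $1\le i,j\le r$. *)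

theory Defs
  imports
    "HOL-Analysis.Analysis"
    "HOL-Algebra.Bij"
    "HOL-Algebra.SimpleGroups"
    "HOL-Algebra.Product_Groups"
begin

section \<open>Subshifts\<close>

definition shift :: "(int \<Rightarrow> 'a) \<Rightarrow> (int \<Rightarrow> 'a)" where
  "shift x = (\<lambda>i. x (i + 1))"

definition full_shift_topology :: "'a set \<Rightarrow> (int \<Rightarrow> 'a) topology" where
  "full_shift_topology A = product_topology (\<lambda>_. discrete_topology A) UNIV"

definition subshift :: "'a set \<Rightarrow> (int \<Rightarrow> 'a) set \<Rightarrow> bool" where
  "subshift A X \<longleftrightarrow>
     finite A \<and> X \<noteq> {} \<and> closedin (full_shift_topology A) X \<and> shift ` X = X"

definition subshift_topology :: "'a set \<Rightarrow> (int \<Rightarrow> 'a) set \<Rightarrow> (int \<Rightarrow> 'a) topology" where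
  "subshift_topology A X = subtopology (full_shift_topology A) X"

definition subshift_map :: "(int \<Rightarrow> 'a) set \<Rightarrow> (int \<Rightarrow> 'a) \<Rightarrow> (int \<Rightarrow> 'a)" where
  "subshift_map X = restrict shift X"

definition occurs_in :: "'a list \<Rightarrow> (int \<Rightarrow> 'a) \<Rightarrow> bool" where
  "occurs_in w x \<longleftrightarrow> (\<exists>i::int. \<forall>j<length w. w ! j = x (i + int j))"

definition language :: "(int \<Rightarrow> 'a) set \<Rightarrow> 'a list set" where
  "language X = {w. \<exists>x\<in>X. occurs_in w x}"

definition shift_of_finite_type :: "'a set \<Rightarrow> (int \<Rightarrow> 'a) set \<Rightarrow> bool" where
  "shift_of_finite_type A X \<longleftrightarrow>
     subshift A X \<and>
     (\<exists>F. finite F \<and> F \<subseteq> lists A \<and> X = {x. range x \<subseteq> A \<and> (\<forall>w\<in>F. \<not> occurs_in w x)})"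

definition mixing :: "(int \<Rightarrow> 'a) set \<Rightarrow> bool" where
  "mixing X \<longleftrightarrow>
     (\<forall>u\<in>language X. \<forall>v\<in>language X. \<exists>M. \<forall>m\<ge>M. \<exists>w. length w = m \<and> u @ w @ v \<in> language X)"

definition shift_orbit :: "(int \<Rightarrow> 'a) \<Rightarrow> (int \<Rightarrow> 'a) set" where
  "shift_orbit x = {y. \<exists>n::int. y = (\<lambda>i. x (i + n))}"

definition trivial_shift :: "(int \<Rightarrow> 'a) set \<Rightarrow> bool" where
  "trivial_shift X \<longleftrightarrow> (\<exists>x. finite (shift_orbit x) \<and> X = shift_orbit x)"

section \<open>Topological entropy\<close>

definition open_cover :: "'x topology \<Rightarrow> 'x set set \<Rightarrow> bool" where
  "open_cover X \<U> \<longleftrightarrow> (\<forall>U\<in>\<U>. openin X U) \<and> \<Union>\<U> = topspace X"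

text \<open>The number below is meaningful for compact spaces, where a finite subcover exists.\<close>

definition min_subcover :: "'x topology \<Rightarrow> 'x set set \<Rightarrow> nat" where
  "min_subcover X \<U> = (LEAST n. \<exists>\<V>\<subseteq>\<U>. finite \<V> \<and> card \<V> = n \<and> \<Union>\<V> = topspace X)"

text \<open>The join of the covers \<open>\<U>, T\<^sup>-\<^sup>1\<U>, \<dots>, T\<^sup>-\<^sup>(\<^sup>n\<^sup>-\<^sup>1\<^sup>)\<U>\<close>.\<close>

definition iterated_join :: "'x topology \<Rightarrow> ('x \<Rightarrow> 'x) \<Rightarrow> 'x set set \<Rightarrow> nat \<Rightarrow> 'x set set" where
  "iterated_join X T \<U> n =
     {V. \<exists>U. (\<forall>i<n. U i \<in> \<U>) \<and> V = {x \<in> topspace X. \<forall>i<n. (T ^^ i) x \<in> U i}}"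

text \<open>Entropy in the sense of Adler, Konheim and McAndrew. For compact \<open>X\<close> and continuous \<open>T\<close>
  the limit superior is a limit, by subadditivity.\<close>

definition topological_entropy :: "'x topology \<Rightarrow> ('x \<Rightarrow> 'x) \<Rightarrow> ereal" where
  "topological_entropy X T =
     (SUP \<U>\<in>{\<U>. open_cover X \<U>}.
        limsup (\<lambda>n. ereal (ln (real (min_subcover X (iterated_join X T \<U> n))) / real n)))"

section \<open>Centralizers and stabilized automorphism groups\<close>

definition centralizer :: "('g, 'm) monoid_scheme \<Rightarrow> 'g \<Rightarrow> 'g set" where
  "centralizer G g = {x \<in> carrier G. x \<otimes>\<^bsub>G\<^esub> g = g \<otimes>\<^bsub>G\<^esub> x}"

text \<open>Elements are extensional functions, so that each homeomorphism of \<open>topspace X\<close> is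
  represented exactly once.\<close>

definition homeo_group :: "'x topology \<Rightarrow> ('x \<Rightarrow> 'x) monoid" where
  "homeo_group X =
     (BijGroup (topspace X))
       \<lparr>carrier := {f \<in> Bij (topspace X). homeomorphic_map X X f}\<rparr>"

definition aut :: "'x topology \<Rightarrow> ('x \<Rightarrow> 'x) \<Rightarrow> ('x \<Rightarrow> 'x) set" where
  "aut X T = centralizer (homeo_group X) T"

definition stabilized_aut_group :: "'x topology \<Rightarrow> ('x \<Rightarrow> 'x) \<Rightarrow> ('x \<Rightarrow> 'x) monoid" where
  "stabilized_aut_group X T =
     (homeo_group X)\<lparr>carrier := (\<Union>n\<in>{1::nat..}. aut X (T [^]\<^bsub>homeo_group X\<^esub> n))\<rparr>"

section \<open>Leveled groups and local entropy\<close>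

definition leveled_group :: "('g, 'm) monoid_scheme \<Rightarrow> 'g \<Rightarrow> bool" where
  "leveled_group G g \<longleftrightarrow>
     group G \<and> g \<in> carrier G \<and> (\<forall>n::nat. n \<ge> 1 \<longrightarrow> g [^]\<^bsub>G\<^esub> n \<noteq> \<one>\<^bsub>G\<^esub>)"

definition locally_in_class ::
    "('g monoid \<Rightarrow> bool) \<Rightarrow> 'g monoid \<Rightarrow> 'g \<Rightarrow> 'g set \<Rightarrow> bool" where
  "locally_in_class P G g H \<longleftrightarrow>
     subgroup H G \<and>
     (\<forall>j::nat. j \<ge> 1 \<longrightarrow> finite (H \<inter> centralizer G (g [^]\<^bsub>G\<^esub> j))) \<and>
     (\<exists>J::nat. J \<ge> 1 \<and> (\<forall>j\<ge>J. P (G\<lparr>carrier := H \<inter> centralizer G (g [^]\<^bsub>G\<^esub> j)\<rparr>))) \<and>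
     H \<inter> centralizer G g \<noteq> {\<one>\<^bsub>G\<^esub>}"

definition local_entropy_exists :: "('g monoid \<Rightarrow> bool) \<Rightarrow> 'g monoid \<Rightarrow> 'g \<Rightarrow> bool" where
  "local_entropy_exists P G g \<longleftrightarrow> (\<exists>H. locally_in_class P G g H)"

definition local_entropy :: "('g monoid \<Rightarrow> bool) \<Rightarrow> 'g monoid \<Rightarrow> 'g \<Rightarrow> ereal" where
  "local_entropy P G g =
     (SUP H\<in>{H. locally_in_class P G g H}.
        limsup (\<lambda>n. ereal (ln (ln (real (card (H \<inter> centralizer G (g [^]\<^bsub>G\<^esub> n))))) / real n)))"

text \<open>The simple factors are taken with carriers in \<open>nat\<close>. This is no restriction, since every
  finite group is isomorphic to one of this kind.\<close>

definition PS :: "real \<Rightarrow> real \<Rightarrow> nat \<Rightarrow> 'g monoid \<Rightarrow> bool" where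
  "PS C D r G \<longleftrightarrow>
     group G \<and> finite (carrier G) \<and>
     (\<exists>S :: nat \<Rightarrow> nat monoid.
        (\<forall>i\<in>{1..r}. simple_group (S i) \<and> finite (carrier (S i)) \<and> \<not> comm_group (S i)) \<and>
        G \<cong> product_group {1..r} S \<and>
        (\<forall>i\<in>{1..r}. \<forall>j\<in>{1..r}.
           real (order (S i)) powr C \<le> real (order (S j)) \<and>
           real (order (S j)) \<le> real (order (S i)) powr D))"

end

theory Submission
  imports Defs "HOL-Combinatorics.Permutations"
begin

text \<open>
  Upper bound. A nontrivial element of \<open>H\<close> that commutes with \<open>\<sigma>\<^sup>k\<close> moves, for all large \<open>n\<close>, a point fixed
  by \<open>\<sigma>\<^sup>k\<^sup>n\<close>. So a simple factor of \<open>H \<inter> C(\<sigma>\<^sup>k\<^sup>n)\<close> embeds in the symmetric group of \<open>Fix(\<sigma>\<^sup>k\<^sup>n)\<close>, and as the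
  factors have comparable orders, \<open>|H \<inter> C(\<sigma>\<^sup>k\<^sup>n)|\<close> is at most a fixed power of \<open>|Fix(\<sigma>\<^sup>k\<^sup>n)|!\<close>.

  Lower bound. \<open>X\<close> is recoded as the edge shift of a primitive graph with vertex set \<open>V\<close> and at least
  \<open>16 |V|\<^sup>2 + 2\<close> edges between one pair of vertices; \<open>16 |V|\<^sup>2\<close> of them form the set \<open>E0\<close>. A permutation of
  the paths of length \<open>n\<close> with fixed end points acts on the edge shift block by block and then commutes
  with \<open>\<sigma>\<^sup>n\<close>. At level \<open>n\<close> the paths that meet \<open>E0\<close> are paired by an involution, one path of each pair is
  marked, and the group consists of the permutations that respect the pairing and are alternating on
  the unmarked paths between any two given vertices. It is a product of \<open>|V|\<^sup>2\<close> alternating groups, which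
  explains the exponent \<open>s\<^sup>2\<close> with \<open>s = |V|\<close>. The pairing makes the group of level \<open>N\<close>, acting diagonally,
  part of the group of level \<open>3 m N\<close>: a diagonal permutation acts in the same way on the unmarked and on
  the marked paths, and its restriction to the classes is again alternating. Twisting the marking by a
  code of the orbits of the diagonal action ensures that conversely only diagonal elements commute with
  \<open>\<sigma>\<^sup>m\<^sup>N\<close>. The union of the groups along \<open>n = k 3\<^sup>u\<close> then meets each centralizer in exactly one level.
\<close>

section \<open>Groups generated by 3-cycles\<close>

text \<open>The centralizers dictate how low the tower must start. An exponent \<open>j\<close>
  prime to 3, however large, sees only the lowest level, so that level must already be a product of
  |V|^2 simple groups of comparable order, with constants independent of \<open>k\<close>. This is
  the origin of the parallel edges: the simplicity proof asks for eight points, the pairing doubles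
  them, there are |V|^2 classes, and two more edges stay outside \<open>E0\<close> to build
  connections that no element of the groups moves. The other obstacle is parity. Whether a diagonal
  permutation is even depends on how many paths contain a given block, so an odd permutation can
  become even on longer paths, and with plain alternating groups such elements could appear in the
  centralizers. The twisted marking excludes them. Conversely, the evenness of a diagonal
  permutation is never computed: the groups are generated by elements of order three, a diagonal
  permutation built from such an element has order three again, and order three implies
  even.\<close>

abbreviation finv :: "('b \<Rightarrow> 'c) \<Rightarrow> 'c \<Rightarrow> 'b" where
  "finv \<equiv> inv_into UNIV"

definition three_cycle :: "'b \<Rightarrow> 'b \<Rightarrow> 'b \<Rightarrow> 'b \<Rightarrow> 'b" where
  "three_cycle a b c = (\<lambda>x. if x = a then b else if x = b then c else if x = c then a else x)"

text \<open>Generation by 3-cycles yields the alternating group without any mention of parity.\<close>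

inductive_set alt_perms :: "'b set \<Rightarrow> ('b \<Rightarrow> 'b) set" for T where
  id: "id \<in> alt_perms T"
| step: "f \<in> alt_perms T \<Longrightarrow> a \<in> T \<Longrightarrow> b \<in> T \<Longrightarrow> c \<in> T \<Longrightarrow> a \<noteq> b \<Longrightarrow> b \<noteq> c \<Longrightarrow> a \<noteq> c
    \<Longrightarrow> three_cycle a b c \<circ> f \<in> alt_perms T"

lemma three_cycle_inverse:
  "a \<noteq> b \<Longrightarrow> b \<noteq> c \<Longrightarrow> a \<noteq> c \<Longrightarrow> three_cycle a b c \<circ> three_cycle a c b = id"
  by (auto simp: three_cycle_def fun_eq_iff)

lemma three_cycle_permutes:
  assumes "a \<in> T" "b \<in> T" "c \<in> T" "a \<noteq> b" "b \<noteq> c" "a \<noteq> c"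
  shows "three_cycle a b c permutes T"
proof -
  have "bij (three_cycle a b c)"
    using three_cycle_inverse[of a b c] three_cycle_inverse[of a c b] assms
    by (intro o_bij[of "three_cycle a c b"]) auto
  hence "three_cycle a b c permutes UNIV" by (simp add: permutes_univ bij_iff)
  thus ?thesis using assms by (auto simp: permutes_def three_cycle_def)
qed

lemma alt_perms_permutes: "f \<in> alt_perms T \<Longrightarrow> f permutes T"
proof (induction rule: alt_perms.induct)
  case id
  then show ?case by (rule permutes_id)
next
  case (step f a b c)
  then show ?case by (intro permutes_compose three_cycle_permutes) auto
qed

lemma three_cycle_in_alt_perms:
  "a \<in> T \<Longrightarrow> b \<in> T \<Longrightarrow> c \<in> T \<Longrightarrow> a \<noteq> b \<Longrightarrow> b \<noteq> c \<Longrightarrow> a \<noteq> c \<Longrightarrow> three_cycle a b c \<in> alt_perms T"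
  using alt_perms.step[OF alt_perms.id, of a T b c] by simp

lemma alt_perms_comp: "f \<in> alt_perms T \<Longrightarrow> g \<in> alt_perms T \<Longrightarrow> f \<circ> g \<in> alt_perms T"
proof (induction rule: alt_perms.induct)
  case id
  then show ?case by simp
next
  case (step f a b c)
  then show ?case using alt_perms.step[of "f \<circ> g" T a b c] by (metis comp_assoc)
qed

lemma alt_perms_inv: "f \<in> alt_perms T \<Longrightarrow> finv f \<in> alt_perms T"
proof (induction rule: alt_perms.induct)
  case id
  then show ?case using alt_perms.id by (simp only: inv_id)
next
  case (step f a b c)
  have b1: "bij f" using step alt_perms_permutes permutes_bij by blast
  have b2: "bij (three_cycle a b c)"
    using step three_cycle_permutes[of a UNIV b c] permutes_bij by blast
  have "finv (three_cycle a b c) = three_cycle a c b"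
    using step three_cycle_inverse[of a b c] three_cycle_inverse[of a c b]
    by (metis b2 bij_is_inj inv_unique_comp)
  hence "finv (three_cycle a b c \<circ> f) = finv f \<circ> three_cycle a c b"
    using b1 b2 by (simp add: o_inv_distrib)
  then show ?case using step by (metis alt_perms_comp three_cycle_in_alt_perms)
qed

lemma alt_perms_mono: "f \<in> alt_perms S \<Longrightarrow> S \<subseteq> T \<Longrightarrow> f \<in> alt_perms T"
  by (induction rule: alt_perms.induct) (blast intro: alt_perms.intros)+

text \<open>The cycle through one moved point is split off and the remaining permutation has smaller
  support. This takes the place of all sign computations: a permutation of order dividing three is
  even on every finite set that it preserves.\<close>

lemma order_three_in_alt_perms:
  assumes "finite T" "p permutes T" "\<And>x. p (p (p x)) = x"
  shows "p \<in> alt_perms T"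
proof -
  have "finite U \<Longrightarrow> U = {x. q x \<noteq> x} \<Longrightarrow> q permutes T \<Longrightarrow> (\<And>x. q (q (q x)) = x) \<Longrightarrow> q \<in> alt_perms T" for q U
  proof (induction "card U" arbitrary: q U rule: less_induct)
    case less
    show ?case
    proof (cases "U = {}")
      case True
      hence "q = id" using less by auto
      then show ?thesis by (simp add: alt_perms.id)
    next
      case False
      then obtain x where x: "q x \<noteq> x" using less by auto
      have i: "q u = q v \<Longrightarrow> u = v" for u v using less(5) by metis
      have d: "q x \<noteq> x" "q (q x) \<noteq> q x" "q (q x) \<noteq> x" using x less(5)[of x] i by metis+
      have xT: "x \<in> T" using x less(4) by (auto simp: permutes_def)
      have qT: "q x \<in> T" "q (q x) \<in> T" using xT less(4) by (simp_all add: permutes_in_image)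
      \<comment> \<open>Multiplying by the inverse of the cycle through \<open>x\<close> fixes its
        three points and changes nothing elsewhere.\<close>
      define r where "r = q \<circ> three_cycle x (q (q x)) (q x)"
      have rx: "r x = x" "r (q x) = q x" "r (q (q x)) = q (q x)"
        using d less(5) by (auto simp: r_def three_cycle_def)
      have ry: "r y = q y" if "y \<notin> {x, q x, q (q x)}" for y
        using that by (auto simp: r_def three_cycle_def)
      have qy: "q y \<notin> {x, q x, q (q x)}" if "y \<notin> {x, q x, q (q x)}" for y
        using that i less(5)[of x] by (metis insert_iff empty_iff)
      have r3: "r (r (r y)) = y" for y
      proof (cases "y \<in> {x, q x, q (q x)}")
        case True thus ?thesis using rx by auto
      next
        case False
        thus ?thesis using ry qy less(5) by metis
      qed
      have rp: "r permutes T"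
        unfolding r_def using less(4) three_cycle_permutes xT qT d
        by (intro permutes_compose three_cycle_permutes) auto
      have sub: "{y. r y \<noteq> y} \<subset> U"
      proof
        show "{y. r y \<noteq> y} \<subseteq> U" using rx ry less(3) by (smt (verit) insertE mem_Collect_eq singletonD subsetI)
        show "{y. r y \<noteq> y} \<noteq> U" using rx x less(3) by auto
      qed
      have "r \<in> alt_perms T"
        using less(1)[OF psubset_card_mono[OF less(2) sub] _ refl rp r3] finite_subset less(2) sub by blast
      moreover have "q = r \<circ> three_cycle x (q x) (q (q x))"
        unfolding r_def comp_assoc using three_cycle_inverse[of x "q (q x)" "q x"] d by auto
      ultimately show ?thesis
        using alt_perms_comp three_cycle_in_alt_perms xT qT d by metis
    qed
  qed
  moreover have "finite {x. p x \<noteq> x}"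
    using assms(1) permutes_not_in[OF assms(2)] by (auto intro!: finite_subset[of _ T])
  ultimately show ?thesis using assms(2,3) by blast
qed

lemma finite_alt_perms: "finite T \<Longrightarrow> finite (alt_perms T)"
  using finite_permutations[of T] alt_perms_permutes
  by (metis (no_types, lifting) finite_subset mem_Collect_eq subsetI)

lemma card_alt_perms_le: "finite T \<Longrightarrow> card (alt_perms T) \<le> fact (card T)"
  using card_mono[of "{p. p permutes T}" "alt_perms T"] card_permutations[of T "card T"]
    finite_permutations[of T] alt_perms_permutes by fastforce

text \<open>Adding a point \<open>x\<close> multiplies the order by at least the new degree:
  elements of \<open>alt_perms T\<close> fix \<open>x\<close>, and the maps \<open>c y\<close>,
  which send \<open>x\<close> to \<open>y\<close>, separate their cosets. The factor 2 is the index
  in the symmetric group and also pays for the degrees up to two, where the group is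
  trivial.\<close>

lemma fact_le_card_alt_perms:
  assumes "finite T" shows "fact (card T) \<le> 2 * card (alt_perms T)"
  using assms
proof (induction T rule: finite_induct)
  case empty
  have "card (alt_perms {}) \<ge> 1"
    using finite_alt_perms[of "{}"] alt_perms.id by (metis One_nat_def Suc_leI card_gt_0_iff empty_iff finite.emptyI)
  then show ?case by simp
next
  case (insert x T)
  have fin: "finite (alt_perms (insert x T))" using insert(1) by (simp add: finite_alt_perms)
  show ?case
  proof (cases "card T \<ge> 2")
    case False
    hence "fact (card (insert x T)) \<le> (2::nat)"
      using insert(1,2) fact_mono[of "card (insert x T)" 2, where 'a = nat] by (simp add: fact_2 del: fact_Suc)
    moreover have "card (alt_perms (insert x T)) \<ge> 1"
      using fin alt_perms.id by (metis One_nat_def Suc_leI card_gt_0_iff empty_iff)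
    ultimately show ?thesis by simp
  next
    case True
    have "\<exists>c\<in>alt_perms (insert x T). c x = y" if "y \<in> insert x T" for y
    proof (cases "y = x")
      case True
      then show ?thesis by (intro bexI[OF _ alt_perms.id]) simp
    next
      case False
      have "\<not> T \<subseteq> {y}" using card_mono[of "{y}" T] True by auto
      then obtain z where "z \<in> T" "z \<noteq> y" by auto
      then show ?thesis using False that insert
        by (intro bexI[of _ "three_cycle x y z"] three_cycle_in_alt_perms) (auto simp: three_cycle_def)
    qed
    then obtain c where c: "\<And>y. y \<in> insert x T \<Longrightarrow> c y \<in> alt_perms (insert x T) \<and> c y x = y"
      by metis
    have gx: "g x = x" if "g \<in> alt_perms T" for g
      using alt_perms_permutes[OF that] insert by (auto simp: permutes_def)
    have "inj_on (\<lambda>(y, g). c y \<circ> g) (insert x T \<times> alt_perms T)"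
    proof (rule inj_onI, clarify)
      fix y g y' g'
      assume a: "y \<in> insert x T" "g \<in> alt_perms T" "y' \<in> insert x T" "g' \<in> alt_perms T"
        and e: "c y \<circ> g = c y' \<circ> g'"
      have yy: "y = y'" using fun_cong[OF e, of x] gx[OF a(2)] gx[OF a(4)] c[OF a(1)] c[OF a(3)] by simp
      have "inj (c y)" using c a alt_perms_permutes permutes_inj by metis
      hence "g = g'" using e yy by (auto simp: fun_eq_iff inj_def)
      thus "y = y' \<and> g = g'" using yy by simp
    qed
    moreover have "(\<lambda>(y, g). c y \<circ> g) ` (insert x T \<times> alt_perms T) \<subseteq> alt_perms (insert x T)"
      using c alt_perms_mono[of _ T "insert x T"] alt_perms_comp by fastforce
    ultimately have "card (insert x T \<times> alt_perms T) \<le> card (alt_perms (insert x T))"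
      using fin card_inj_on_le by blast
    hence "card (insert x T) * card (alt_perms T) \<le> card (alt_perms (insert x T))"
      by (simp add: card_cartesian_product)
    moreover have "fact (card (insert x T)) = card (insert x T) * fact (card T)"
      using insert by simp
    moreover have "card (insert x T) * fact (card T) \<le> card (insert x T) * (2 * card (alt_perms T))"
      using insert.IH mult_le_mono2 by blast
    ultimately show ?thesis by linarith
  qed
qed

section \<open>Simplicity of the alternating groups of degree at least eight\<close>

definition alt_on :: "'b set \<Rightarrow> ('b \<Rightarrow> 'b) monoid" where
  "alt_on T = \<lparr>carrier = alt_perms T, mult = (\<circ>), one = id\<rparr>"

lemma alt_on_simps [simp]:
  "carrier (alt_on T) = alt_perms T" "mult (alt_on T) = (\<circ>)" "one (alt_on T) = id"
  by (simp_all add: alt_on_def)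

lemma group_alt_on: "group (alt_on T)"
proof (rule groupI)
  fix f assume "f \<in> carrier (alt_on T)"
  hence "finv f \<circ> f = id" "finv f \<in> alt_perms T"
    using alt_perms_permutes[of f T] alt_perms_inv[of f T] permutes_inv_o(2)[of f T] by (auto simp del: o_apply)
  thus "\<exists>y\<in>carrier (alt_on T). y \<otimes>\<^bsub>alt_on T\<^esub> f = \<one>\<^bsub>alt_on T\<^esub>" by auto
qed (auto simp: alt_perms_comp alt_perms.id comp_assoc)

lemma inv_alt_on: "f \<in> alt_perms T \<Longrightarrow> inv\<^bsub>alt_on T\<^esub> f = finv f"
  using group.inv_equality[OF group_alt_on, where y = "finv f" and x = f and T1 = T] alt_perms_permutes[of f T] permutes_inv_o(2)[of f T] alt_perms_inv[of f T]
  by simp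

lemma conj_three_cycle:
  assumes "bij p" shows "p \<circ> three_cycle a b c \<circ> finv p = three_cycle (p a) (p b) (p c)"
proof
  fix x
  have "finv p x = y \<longleftrightarrow> x = p y" for y using assms by (metis bij_inv_eq_iff)
  moreover have "p (finv p x) = x" using assms by (simp add: bij_is_surj surj_f_inv_f)
  ultimately show "(p \<circ> three_cycle a b c \<circ> finv p) x = three_cycle (p a) (p b) (p c) x"
    by (auto simp: three_cycle_def)
qed

text \<open>A nontrivial normal subgroup contains the commutator of one of its elements with a suitable
  3-cycle. That commutator moves at most six points; its commutator with a 3-cycle that meets its
  support in a single point is again a 3-cycle.\<close>

lemma normal_alt_perms_eq:
  assumes fin: "finite T" and card: "8 \<le> card T"
    and N: "N \<subseteq> alt_perms T" "\<And>f g. f \<in> N \<Longrightarrow> g \<in> N \<Longrightarrow> f \<circ> g \<in> N" "\<And>f. f \<in> N \<Longrightarrow> finv f \<in> N" "id \<in> N"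
    and conj: "\<And>f p. f \<in> N \<Longrightarrow> p \<in> alt_perms T \<Longrightarrow> p \<circ> f \<circ> finv p \<in> N"
    and nt: "g \<in> N" "g \<noteq> id"
  shows "N = alt_perms T"
proof -
  have bijs: "bij p" if "p \<in> alt_perms T" for p using alt_perms_permutes[OF that] permutes_bij by blast
  \<comment> \<open>Never more than seven points have to be avoided at once, hence the bound 8 on
    the degree.\<close>
  have fresh: "\<exists>x\<in>T. x \<notin> set xs" if "length xs < 8" for xs
  proof (rule ccontr)
    assume "\<not> ?thesis" hence "T \<subseteq> set xs" by blast
    hence "card T \<le> length xs" using card_mono[of "set xs" T] card_length[of xs] by simp
    thus False using that card by linarith
  qed
  have comm: "f \<circ> p \<circ> finv f \<circ> finv p \<in> N" "p \<circ> f \<circ> finv p \<circ> finv f \<in> N" if "f \<in> N" "p \<in> alt_perms T" for f p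
  proof -
    have "f \<circ> (p \<circ> finv f \<circ> finv p) \<in> N" using that N conj by blast
    thus "f \<circ> p \<circ> finv f \<circ> finv p \<in> N" by (simp add: comp_assoc)
    show "p \<circ> f \<circ> finv p \<circ> finv f \<in> N" using that N conj by blast
  qed
  have inv3: "finv (three_cycle a b c) = three_cycle a c b" if "a \<noteq> b" "b \<noteq> c" "a \<noteq> c" for a b c :: 'a
    using that three_cycle_inverse[of a b c] three_cycle_inverse[of a c b]
    by (intro inv_unique_comp) auto
  obtain a where a: "g a \<noteq> a" using nt by (auto simp: fun_eq_iff)
  have gp: "g permutes T" using nt N alt_perms_permutes by blast
  have aT: "a \<in> T" "g a \<in> T" using a gp by (auto simp: permutes_def permutes_in_image[OF gp]) 
  obtain c where c: "c \<in> T" "c \<notin> {a, g a}" using fresh[of "[a, g a]"] by auto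
  obtain d where d: "d \<in> T" "d \<notin> {a, g a, c}" using fresh[of "[a, g a, c]"] by auto
  define t where "t = three_cycle a c d"
  have tT: "t \<in> alt_perms T" unfolding t_def using aT c d by (intro three_cycle_in_alt_perms) auto
  define n where "n = g \<circ> t \<circ> finv g \<circ> finv t"
  have nN: "n \<in> N" unfolding n_def using comm nt tT by blast
  have n_eq: "n = three_cycle (g a) (g c) (g d) \<circ> three_cycle a d c"
    unfolding n_def using conj_three_cycle[of g a c d] bijs nt N inv3[of a c d] c d
    by (auto simp: t_def)
  have supp: "n x = x" if "x \<notin> {a, c, d, g a, g c, g d}" for x
    using that unfolding n_eq by (auto simp: three_cycle_def)
  have "\<exists>x. n x \<noteq> x"
  proof (rule ccontr)
    assume "\<not> ?thesis" hence "n (g a) = g a" by simp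
    moreover have "three_cycle a d c (g a) = g a" using a c d by (auto simp: three_cycle_def)
    ultimately have "g a = g c" by (simp add: n_eq three_cycle_def)
    thus False using c permutes_inj[OF gp] by (auto simp: inj_def)
  qed
  then obtain x where x: "n x \<noteq> x" by blast
  have np: "n permutes T" using nN N alt_perms_permutes by blast
  have xT: "x \<in> T" "n x \<in> T" using x np by (auto simp: permutes_def permutes_in_image[OF np])
  obtain e where e: "e \<in> T" "e \<notin> {a, c, d, g a, g c, g d}"
    using fresh[of "[a, c, d, g a, g c, g d]"] by auto
  then obtain f where f: "f \<in> T" "f \<notin> insert e {a, c, d, g a, g c, g d}"
    using fresh[of "[e, a, c, d, g a, g c, g d]"] by auto
  have ne: "n e = e" "n f = f" using supp e f by auto
  have xne: "x \<noteq> e" "x \<noteq> f" "e \<noteq> f" "n x \<noteq> e" "n x \<noteq> f"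
    using x ne f permutes_inj[OF np] by (auto simp: inj_def)
  define s where "s = three_cycle x e f"
  have sT: "s \<in> alt_perms T" unfolding s_def using xT e f xne by (intro three_cycle_in_alt_perms) auto
  have "n \<circ> s \<circ> finv n \<circ> finv s \<in> N" using comm nN sT by blast
  moreover have "n \<circ> s \<circ> finv n = three_cycle (n x) e f"
    unfolding s_def using conj_three_cycle[of n x e f] bijs nN N ne by auto
  moreover have "finv s = three_cycle x f e" unfolding s_def using inv3 xne by auto
  ultimately have "three_cycle (n x) e f \<circ> three_cycle x f e \<in> N" by simp
  moreover have "three_cycle (n x) e f \<circ> three_cycle x f e = three_cycle x (n x) e"
    using xne x by (auto simp: three_cycle_def fun_eq_iff)
  ultimately have c3: "three_cycle x (n x) e \<in> N" by simp
  have move: "three_cycle p' q' r' \<in> N"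
    if "three_cycle p q r \<in> N" "u \<in> alt_perms T" "u p = p'" "u q = q'" "u r = r'" for p q r p' q' r' u
    using conj[OF that(1,2)] conj_three_cycle[of u p q r] bijs[OF that(2)] that by simp
  \<comment> \<open>Conjugation by a 3-cycle that sends \<open>p\<close> to \<open>p'\<close> and
    avoids \<open>q\<close> and \<open>r\<close> replaces a single entry; \<open>y\<close> is a
    fresh third point for it.\<close>
  have one: "three_cycle p' q r \<in> N" 
    if "three_cycle p q r \<in> N" "{p, q, r, p'} \<subseteq> T" "p \<noteq> q" "q \<noteq> r" "p \<noteq> r" "p' \<noteq> q" "p' \<noteq> r" for p q r p'
  proof (cases "p' = p")
    case False
    obtain y where y: "y \<in> T" "y \<notin> {p, q, r, p'}" using fresh[of "[p, q, r, p']"] by auto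
    have "three_cycle p p' y \<in> alt_perms T" using that y False by (intro three_cycle_in_alt_perms) auto
    from move[OF that(1) this] show ?thesis using that y False by (auto simp: three_cycle_def)
  qed (use that in auto)
  have rot: "three_cycle q r p = three_cycle p q r" if "p \<noteq> q" "q \<noteq> r" "p \<noteq> r" for p q r :: 'a
    using that by (auto simp: three_cycle_def fun_eq_iff)
  \<comment> \<open>The entries are replaced one at a time by way of \<open>a1\<close> and
    \<open>a2\<close>, which lie on neither cycle, so that no two entries ever coincide.\<close>
  have all3: "three_cycle p q r \<in> N" if "{p, q, r} \<subseteq> T" "p \<noteq> q" "q \<noteq> r" "p \<noteq> r" for p q r
  proof -
    obtain a1 where a1: "a1 \<in> T" "a1 \<notin> {x, n x, e, p, q, r}"
      using fresh[of "[x, n x, e, p, q, r]"] by auto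
    then obtain a2 where a2: "a2 \<in> T" "a2 \<notin> insert a1 {x, n x, e, p, q, r}"
      using fresh[of "[a1, x, n x, e, p, q, r]"] by auto
    have "three_cycle a1 (n x) e \<in> N" using one[OF c3, of a1] a1 xT e x xne by auto
    hence "three_cycle (n x) e a1 \<in> N" using rot a1 xne by (metis insert_iff)
    hence "three_cycle a2 e a1 \<in> N" using one[of "n x" e a1 a2] a1 a2 xT e x xne by auto
    hence "three_cycle e a1 a2 \<in> N" using rot a1 a2 xne by (metis insert_iff)
    hence "three_cycle r a1 a2 \<in> N" using one[of e a1 a2 r] a1 a2 xT e that by auto
    hence "three_cycle a1 a2 r \<in> N" using rot a1 a2 xne by (metis insert_iff)
    hence "three_cycle p a2 r \<in> N" using one[of a1 a2 r p] a1 a2 that by auto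
    hence "three_cycle a2 r p \<in> N" using rot a1 a2 that by (metis insert_iff)
    hence "three_cycle q r p \<in> N" using one[of a2 r p q] a1 a2 that by auto
    thus ?thesis using rot that by metis
  qed
  have "h \<in> N" if "h \<in> alt_perms T" for h
    using that
  proof (induction rule: alt_perms.induct)
    case id
    show ?case by (rule N(4))
  next
    case (step f a b c)
    thus ?case by (intro N(2) all3) auto
  qed
  thus ?thesis using N by blast
qed

lemma simple_alt_on:
  assumes "finite T" "8 \<le> card T" shows "simple_group (alt_on T)"
proof -
  interpret group "alt_on T" by (rule group_alt_on)
  show ?thesis
  proof
    have "fact 8 \<le> (fact (card T) :: nat)" using assms fact_mono by blast
    hence "fact 8 \<le> 2 * card (alt_perms T)" using fact_le_card_alt_perms[OF assms(1)] by linarith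
    thus "1 < order (alt_on T)" by (simp add: order_def fact_numeral)
  next
    fix H assume H: "H \<lhd> alt_on T"
    hence sg: "subgroup H (alt_on T)" by (simp add: normal_def)
    show "H = carrier (alt_on T) \<or> H = {\<one>\<^bsub>alt_on T\<^esub>}"
    proof (cases "H = {id}")
      case False
      have sub: "H \<subseteq> alt_perms T" using subgroup.subset[OF sg] by simp
      have idH: "id \<in> H" using subgroup.one_closed[OF sg] by simp
      obtain g where g: "g \<in> H" "g \<noteq> id" using False idH by auto
      have "H = alt_perms T"
      proof (rule normal_alt_perms_eq[OF assms sub _ _ idH _ g])
        show "f \<circ> g \<in> H" if "f \<in> H" "g \<in> H" for f g using subgroup.m_closed[OF sg that] by simp
        show "finv f \<in> H" if "f \<in> H" for f
          using subgroup.m_inv_closed[OF sg that] inv_alt_on that sub by fastforce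
        show "p \<circ> f \<circ> finv p \<in> H" if "f \<in> H" "p \<in> alt_perms T" for f p
          using normal.inv_op_closed2[OF H, of p f] that inv_alt_on by fastforce
      qed
      thus ?thesis by simp
    qed auto
  qed
qed

lemma not_comm_alt_on:
  assumes "finite T" "8 \<le> card T" shows "\<not> comm_group (alt_on T)"
proof
  assume "comm_group (alt_on T)"
  then interpret comm_group "alt_on T" .
  obtain U where U: "U \<subseteq> T" "card U = 4" using obtain_subset_with_card_n[of 4 T] assms by auto
  then obtain a b c d where abcd: "U = {a, b, c, d}" "distinct [a, b, c, d]"
    by (auto simp: card_Suc_eq numeral_eq_Suc)
  have "three_cycle a b c \<circ> three_cycle a b d = three_cycle a b d \<circ> three_cycle a b c"
    using m_comm[of "three_cycle a b c" "three_cycle a b d"] abcd U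
    by (auto intro!: three_cycle_in_alt_perms)
  hence "three_cycle a b c (three_cycle a b d a) = three_cycle a b d (three_cycle a b c a)"
    by (metis comp_apply)
  thus False using abcd by (auto simp: three_cycle_def)
qed

section \<open>Block permutations of edge shifts\<close>

text \<open>By \<open>src_tgt_image\<close> every edge has a successor and a predecessor, so that
  every finite path occurs in a bi-infinite one.\<close>

locale edge_graph =
  fixes E :: "'e set" and src tgt :: "'e \<Rightarrow> 'v"
  assumes finite_edges: "finite E"
    and src_tgt_image: "src ` E = tgt ` E"
begin

definition paths :: "nat \<Rightarrow> 'e list set" where
  "paths n = {w. length w = n \<and> set w \<subseteq> E \<and> successively (\<lambda>e e'. tgt e = src e') w}"

definition edge_shift :: "(int \<Rightarrow> 'e) set" where
  "edge_shift = {y. \<forall>i. y i \<in> E \<and> tgt (y i) = src (y (i + 1))}"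

definition ends :: "'e list \<Rightarrow> 'v \<times> 'v" where
  "ends w = (src (hd w), tgt (last w))"

text \<open>Keeping both end vertices is what allows the blocks of a point to be replaced
  independently of one another. As \<open>permutes\<close> forces the identity off the paths,
  equality of functions is equality of the actions on paths.\<close>

definition end_perm :: "nat \<Rightarrow> ('e list \<Rightarrow> 'e list) \<Rightarrow> bool" where
  "end_perm n g \<longleftrightarrow> g permutes paths n \<and> (\<forall>w\<in>paths n. ends (g w) = ends w)"

end

section \<open>Blocks of points and chunks of words\<close>

definition block :: "nat \<Rightarrow> (int \<Rightarrow> 'e) \<Rightarrow> int \<Rightarrow> 'e list" where
  "block n y l = map (\<lambda>i. y (l * int n + int i)) [0..<n]"

definition block_act :: "nat \<Rightarrow> ('e list \<Rightarrow> 'e list) \<Rightarrow> (int \<Rightarrow> 'e) \<Rightarrow> (int \<Rightarrow> 'e)" where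
  "block_act n g y = (\<lambda>i. g (block n y (i div int n)) ! nat (i mod int n))"

definition shift_by :: "int \<Rightarrow> (int \<Rightarrow> 'e) \<Rightarrow> (int \<Rightarrow> 'e)" where
  "shift_by a y = (\<lambda>i. y (i + a))"

definition chunk :: "nat \<Rightarrow> 'e list \<Rightarrow> nat \<Rightarrow> 'e list" where
  "chunk n w l = take n (drop (l * n) w)"

text \<open>A crude comparison of linear and exponential growth by way of
  \<open>k * k \<le> 2 ^ k\<close>. It is applied to the number of still paths and to the number of
  states of the coding graph.\<close>

lemma linear_le_power_two:
  assumes "(k::nat) \<ge> a + b + 4" shows "a * k + b \<le> 2 ^ k"
proof -
  have "k * k \<le> 2 ^ k" if "k \<ge> 4" for k :: nat
    using that
  proof (induction k rule: dec_induct)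
    case (step n)
    have "2 * n + 1 \<le> n * n" using step(1) mult_le_mono1[of 4 n n] by linarith
    thus ?case using step by simp
  qed simp
  hence "k * k \<le> 2 ^ k" using assms by simp
  moreover have "a * k + b \<le> (a + b) * k" using assms by (simp add: add_mult_distrib)
  moreover have "(a + b) * k \<le> k * k" using assms by simp
  ultimately show ?thesis by linarith
qed

lemma length_block [simp]: "length (block n y l) = n"
  by (simp add: block_def)

lemma block_nth [simp]: "i < n \<Longrightarrow> block n y l ! i = y (l * int n + int i)"
  by (simp add: block_def)

lemma block_ext:
  assumes "n > 0" "\<And>l. block n y l = block n z l" shows "y = z"
proof
  fix i
  have "block n y (i div int n) ! nat (i mod int n) = block n z (i div int n) ! nat (i mod int n)"
    using assms by simp
  moreover have "nat (i mod int n) < n" using assms by (simp add: nat_less_iff)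
  ultimately have "y (i div int n * int n + i mod int n) = z (i div int n * int n + i mod int n)"
    using assms(1) by simp
  thus "y i = z i" by simp
qed

lemma block_glue:
  assumes "n > 0" "\<And>l. length (W l) = n"
  shows "block n (\<lambda>i. W (i div int n) ! nat (i mod int n)) l = W l"
  using assms by (intro nth_equalityI) auto

lemma shift_by_shift_by [simp]: "shift_by a (shift_by b y) = shift_by (a + b) y"
  by (simp add: shift_by_def algebra_simps)

lemma shift_by_0 [simp]: "shift_by 0 y = y"
  by (simp add: shift_by_def)

lemma block_shift_by: "block n (shift_by (a * int n) y) l = block n y (l + a)"
  by (simp add: block_def shift_by_def algebra_simps)

lemma chunk_block: "j < m \<Longrightarrow> chunk n (block (m * n) y l) j = block n y (l * int m + int j)"
proof (intro nth_equalityI)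
  assume j: "j < m"
  have "(j + 1) * n \<le> m * n" using j by (intro mult_right_mono) auto
  hence le: "j * n + n \<le> m * n" by simp
  show "length (chunk n (block (m * n) y l) j) = length (block n y (l * int m + int j))"
    using le by (simp add: chunk_def)
  fix i assume i: "i < length (chunk n (block (m * n) y l) j)"
  hence i': "i < n" by (simp add: chunk_def)
  have "j * n + i < m * n" "j * n \<le> length (block (m * n) y l)" using i' le by (simp_all only: length_block)
  thus "chunk n (block (m * n) y l) j ! i = block n y (l * int m + int j) ! i"
    using i' by (simp add: chunk_def nth_drop algebra_simps)
qed

lemma chunk_concat:
  assumes "\<And>w. w \<in> set ws \<Longrightarrow> length w = n" "l < length ws"
  shows "chunk n (concat ws) l = ws ! l"
  using assms
proof (induction ws arbitrary: l)
  case (Cons a ws)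
  show ?case
  proof (cases l)
    case 0
    then show ?thesis using Cons.prems(1)[of a] by (simp add: chunk_def)
  next
    case (Suc k)
    then show ?thesis using Cons.IH[of k] Cons.prems by (simp add: chunk_def)
  qed
qed simp

lemma concat_chunks: "length w = m * n \<Longrightarrow> concat (map (chunk n w) [0..<m]) = w"
proof (induction m arbitrary: w)
  case (Suc m)
  have "map (chunk n w) [0..<Suc m] = take n w # map (chunk n (drop n w)) [0..<m]"
    by (simp add: chunk_def map_upt_Suc add.commute del: upt_Suc)
  moreover have "concat (map (chunk n (drop n w)) [0..<m]) = drop n w"
    using Suc by simp
  ultimately show ?case by (simp del: upt_Suc)
qed simp

lemma length_chunk: "length w = m * n \<Longrightarrow> l < m \<Longrightarrow> length (chunk n w l) = n"
proof -
  assume "length w = m * n" "l < m"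
  moreover have "(l + 1) * n \<le> m * n" using \<open>l < m\<close> by (intro mult_right_mono) auto
  ultimately show ?thesis by (simp add: chunk_def)
qed

lemma chunk_ext:
  "length w = m * n \<Longrightarrow> length w' = m * n \<Longrightarrow> (\<And>l. l < m \<Longrightarrow> chunk n w l = chunk n w' l) \<Longrightarrow> w = w'"
  by (metis (no_types, lifting) concat_chunks map_cong atLeastLessThan_iff atLeastLessThan_upt)

lemma set_chunks: "length w = m * n \<Longrightarrow> set w = (\<Union>l<m. set (chunk n w l))"
  using arg_cong[OF concat_chunks[of w m n], of set] by (simp add: atLeast0LessThan)

section \<open>Paths and the action of block permutations\<close>

context edge_graph
begin

lemma pathsD: "w \<in> paths n \<Longrightarrow> length w = n" "w \<in> paths n \<Longrightarrow> set w \<subseteq> E"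
  by (auto simp: paths_def)

lemma finite_paths [simp]: "finite (paths n)"
  using finite_lists_length_eq[OF finite_edges, of n] by (rule finite_subset[rotated]) (auto simp: paths_def)

lemma paths_append:
  assumes "length u > 0" "length v > 0"
  shows "u @ v \<in> paths n \<longleftrightarrow>
    u \<in> paths (length u) \<and> v \<in> paths (length v) \<and> n = length u + length v \<and> snd (ends u) = fst (ends v)"
  using assms by (auto simp: paths_def successively_append_iff ends_def)

lemma ends_append: "length u > 0 \<Longrightarrow> length v > 0 \<Longrightarrow> ends (u @ v) = (fst (ends u), snd (ends v))"
  by (auto simp: ends_def)

lemma concat_in_paths:
  assumes "n > 0" "ws \<noteq> []" "\<And>w. w \<in> set ws \<Longrightarrow> w \<in> paths n"
    "\<And>i. Suc i < length ws \<Longrightarrow> snd (ends (ws ! i)) = fst (ends (ws ! Suc i))"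
  shows "concat ws \<in> paths (length ws * n) \<and> ends (concat ws) = (fst (ends (hd ws)), snd (ends (last ws)))"
  using assms(2-)
proof (induction ws)
  case (Cons a ws)
  show ?case
  proof (cases "ws = []")
    case True
    then show ?thesis using Cons.prems by simp
  next
    case False
    have a: "a \<in> paths n" "length a = n" using Cons.prems pathsD by auto
    have "snd (ends (ws ! i)) = fst (ends (ws ! Suc i))" if "Suc i < length ws" for i
      using Cons.prems(3)[of "Suc i"] that by simp
    hence IH: "concat ws \<in> paths (length ws * n)" "ends (concat ws) = (fst (ends (hd ws)), snd (ends (last ws)))"
      using Cons.IH False Cons.prems by auto
    have l: "length (concat ws) = length ws * n" using IH pathsD by blast
    hence pos: "length (concat ws) > 0" using assms(1) False by simp
    have "snd (ends a) = fst (ends (hd ws))" using Cons.prems(3)[of 0] False by (simp add: hd_conv_nth)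
    hence "a @ concat ws \<in> paths (n + length ws * n)"
      using a IH l pos assms(1) by (subst paths_append) auto
    moreover have "ends (a @ concat ws) = (fst (ends a), snd (ends (last ws)))"
      using ends_append[of a "concat ws"] a pos assms(1) IH by auto
    ultimately show ?thesis using False by simp
  qed
qed simp

lemma sub_path:
  assumes "w \<in> paths n" "i + k \<le> n"
  shows "take k (drop i w) \<in> paths k"
proof -
  have "w = take i w @ take k (drop i w) @ drop (i + k) w"
    by (metis append_take_drop_id add.commute drop_drop)
  hence "successively (\<lambda>e e'. tgt e = src e') (take k (drop i w))"
    using assms by (metis (no_types, lifting) paths_def mem_Collect_eq successively_append_iff)
  moreover have "set (take k (drop i w)) \<subseteq> E"
    using pathsD(2)[OF assms(1)] by (meson dual_order.trans set_drop_subset set_take_subset)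
  ultimately show ?thesis using assms pathsD(1)[OF assms(1)] by (auto simp: paths_def)
qed

lemma chunk_in_paths: "w \<in> paths (m * n) \<Longrightarrow> l < m \<Longrightarrow> chunk n w l \<in> paths n"
proof -
  assume "w \<in> paths (m * n)" "l < m"
  moreover have "(l + 1) * n \<le> m * n" using \<open>l < m\<close> by (intro mult_right_mono) auto
  ultimately show ?thesis unfolding chunk_def by (intro sub_path) auto
qed

lemma chunk_ends:
  assumes "w \<in> paths (m * n)" "n > 0"
  shows "Suc l < m \<Longrightarrow> snd (ends (chunk n w l)) = fst (ends (chunk n w (Suc l)))"
    and "m > 0 \<Longrightarrow> ends w = (fst (ends (chunk n w 0)), snd (ends (chunk n w (m - 1))))"
proof -
  assume l: "Suc l < m"
  have "(Suc l + 1) * n \<le> m * n" using l by (intro mult_right_mono) auto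
  hence "take (n + n) (drop (l * n) w) \<in> paths (n + n)"
    using assms by (intro sub_path) auto
  moreover have "take (n + n) (drop (l * n) w) = chunk n w l @ chunk n w (Suc l)"
    by (simp add: chunk_def take_add add.commute)
  moreover have "length (chunk n w l) = n" "length (chunk n w (Suc l)) = n"
    using assms(1) l by (auto intro!: length_chunk dest!: pathsD(1))
  ultimately show "snd (ends (chunk n w l)) = fst (ends (chunk n w (Suc l)))"
    using paths_append assms(2) by metis
next
  assume m: "m > 0"
  have len: "length w = m * n" using assms pathsD by blast
  have lw: "w = concat (map (chunk n w) [0..<m])" using concat_chunks[OF len] by simp
  have "0 < length (chunk n w l)" if "l < m" for l using length_chunk[OF len that] assms by simp
  hence ne: "chunk n w l \<noteq> []" if "l < m" for l using that by force
  have "hd w = hd (chunk n w 0)"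
    using assms m len by (auto simp: chunk_def hd_take)
  moreover have "last w = last (chunk n w (m - 1))"
  proof -
    obtain k where k: "m = Suc k" using m by (cases m) auto
    have "w = concat (map (chunk n w) [0..<k]) @ chunk n w k" using lw k by simp
    thus ?thesis using ne[of k] k by (metis diff_Suc_1 last_appendR lessI)
  qed
  ultimately show "ends w = (fst (ends (chunk n w 0)), snd (ends (chunk n w (m - 1))))"
    by (simp add: ends_def)
qed

lemma block_in_paths: "y \<in> edge_shift \<Longrightarrow> block n y l \<in> paths n"
  by (auto simp: paths_def edge_shift_def successively_conv_nth block_def algebra_simps)

lemma block_ends: "y \<in> edge_shift \<Longrightarrow> n > 0 \<Longrightarrow> ends (block n y l) = (src (y (l * int n)), src (y ((l + 1) * int n)))"
proof -
  assume y: "y \<in> edge_shift" "n > 0"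
  have "last (block n y l) = y ((l + 1) * int n - 1)"
    using y by (simp add: last_conv_nth block_def algebra_simps)
  moreover have "tgt (y ((l + 1) * int n - 1)) = src (y ((l + 1) * int n))"
    using y(1) by (auto simp: edge_shift_def dest: spec[of _ "(l + 1) * int n - 1"])
  moreover have "hd (block n y l) = y (l * int n)"
    using y by (simp add: block_def hd_map)
  ultimately show ?thesis by (simp add: ends_def)
qed

lemma shift_by_edge_shift [simp]: "y \<in> edge_shift \<Longrightarrow> shift_by a y \<in> edge_shift"
  by (auto simp: edge_shift_def shift_by_def algebra_simps)

lemma glue_in_edge_shift:
  assumes n: "n > 0" and W: "\<And>l. W l \<in> paths n" "\<And>l. snd (ends (W l)) = fst (ends (W (l + 1)))"
  shows "(\<lambda>i. W (i div int n) ! nat (i mod int n)) \<in> edge_shift" (is "?y \<in> _")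
proof -
  have len: "length (W l) = n" for l using W pathsD by blast
  have "?y i \<in> E \<and> tgt (?y i) = src (?y (i + 1))" for i
  proof -
    define l where "l = i div int n"
    define j where "j = nat (i mod int n)"
    have i: "i = l * int n + int j" "j < n" using n by (auto simp: l_def j_def nat_less_iff)
    have yi: "?y i = W l ! j" by (simp add: l_def j_def)
    have E: "W l ! j \<in> E" using i len[of l] pathsD(2)[OF W(1)] by (metis nth_mem subsetD)
    show ?thesis
    proof (cases "Suc j < n")
      case True
      have "i + 1 = l * int n + int (Suc j)" using i by simp
      hence "(i + 1) div int n = l \<and> (i + 1) mod int n = int (Suc j)"
        using True by (intro conjI int_div_pos_eq[where r = "int (Suc j)"] int_mod_pos_eq[where q = l]) auto
      moreover have "nat (int (Suc j)) = Suc j" by simp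
      ultimately have "?y (i + 1) = W l ! Suc j" by metis
      moreover have "tgt (W l ! j) = src (W l ! Suc j)"
        using W(1)[of l] True len[of l] by (auto simp: paths_def successively_conv_nth)
      ultimately show ?thesis using E yi by simp
    next
      case False
      hence j: "j = n - 1" using i by simp
      have "i + 1 = (l + 1) * int n" using i j n by (simp add: algebra_simps)
      hence "?y (i + 1) = W (l + 1) ! 0" using n by simp
      moreover have "W (l + 1) \<noteq> []" "W l \<noteq> []" using len n by (metis length_greater_0_conv)+
      hence "W (l + 1) ! 0 = hd (W (l + 1))" "W l ! j = last (W l)"
        using len[of l] j by (simp_all add: hd_conv_nth last_conv_nth)
      ultimately show ?thesis using E yi W(2)[of l] by (simp add: ends_def)
    qed
  qed
  thus ?thesis by (simp add: edge_shift_def)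
qed

lemma end_permD:
  assumes "end_perm n g" "w \<in> paths n"
  shows "g w \<in> paths n" "ends (g w) = ends w"
  using assms by (auto simp: end_perm_def permutes_in_image)

lemma block_block_act:
  assumes "n > 0" "end_perm n g" "y \<in> edge_shift"
  shows "block n (block_act n g y) l = g (block n y l)"
  unfolding block_act_def
  using block_glue[of n "\<lambda>l. g (block n y l)" l] assms end_permD(1)[OF assms(2)] block_in_paths pathsD(1)
  by metis

lemma block_act_in_edge_shift:
  assumes "n > 0" "end_perm n g" "y \<in> edge_shift"
  shows "block_act n g y \<in> edge_shift"
  unfolding block_act_def
  using assms end_permD[OF assms(2) block_in_paths[OF assms(3)]]
  by (intro glue_in_edge_shift) (auto simp: block_ends)

lemma block_act_comp:
  assumes "n > 0" "end_perm n g" "end_perm n h" "y \<in> edge_shift"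
  shows "block_act n (g \<circ> h) y = block_act n g (block_act n h y)"
proof (rule block_ext[OF assms(1)])
  fix l
  have "end_perm n (g \<circ> h)"
    using assms by (auto simp: end_perm_def permutes_compose permutes_in_image)
  thus "block n (block_act n (g \<circ> h) y) l = block n (block_act n g (block_act n h y)) l"
    using assms by (simp add: block_block_act block_act_in_edge_shift)
qed

lemma end_perm_comp: "end_perm n g \<Longrightarrow> end_perm n h \<Longrightarrow> end_perm n (g \<circ> h)"
  by (auto simp: end_perm_def permutes_compose permutes_in_image)

lemma end_perm_id: "end_perm n id"
  unfolding end_perm_def by (simp only: id_apply permutes_id) simp

lemma end_perm_inv: "end_perm n g \<Longrightarrow> end_perm n (finv g)"
  unfolding end_perm_def using permutes_inv permutes_inverses(1) permutes_in_image
  by (metis (no_types, lifting))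

lemma block_act_id:
  assumes "n > 0" "y \<in> edge_shift" shows "block_act n id y = y"
  using block_ext[OF assms(1)] block_block_act[OF assms(1) end_perm_id assms(2)] by (metis id_apply)

lemma block_act_inv:
  assumes "n > 0" "end_perm n g" "y \<in> edge_shift"
  shows "block_act n (finv g) (block_act n g y) = y" "block_act n g (block_act n (finv g) y) = y"
  using block_act_comp[OF assms(1) end_perm_inv[OF assms(2)] assms(2,3)]
    block_act_comp[OF assms(1) assms(2) end_perm_inv[OF assms(2)] assms(3)]
    block_act_id[OF assms(1,3)] assms(2) permutes_inv_o[of g "paths n"]
  by (simp_all add: end_perm_def)

lemma block_act_shift_by:
  assumes "n > 0" "end_perm n g" "y \<in> edge_shift"
  shows "block_act n g (shift_by (a * int n) y) = shift_by (a * int n) (block_act n g y)"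
  using assms by (intro block_ext[of n]) (auto simp: block_block_act block_shift_by)

text \<open>The path is continued to the right by iterating a chosen successor \<open>nx\<close> of
  its last edge, and to the left by iterating a chosen predecessor \<open>pv\<close> of its first
  edge.\<close>

lemma paths_extend:
  assumes "w \<in> paths n" "n > 0"
  shows "\<exists>y\<in>edge_shift. block n y 0 = w"
proof -
  have "\<forall>e\<in>E. \<exists>e'\<in>E. src e' = tgt e" "\<forall>e\<in>E. \<exists>e'\<in>E. tgt e' = src e"
    using src_tgt_image by (metis (mono_tags, lifting) imageE imageI)+
  then obtain nx pv where nx: "\<And>e. e \<in> E \<Longrightarrow> nx e \<in> E \<and> src (nx e) = tgt e"
    and pv: "\<And>e. e \<in> E \<Longrightarrow> pv e \<in> E \<and> tgt (pv e) = src e" by metis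
  have wE: "w ! i \<in> E" if "i < n" for i using assms pathsD that by (metis nth_mem subsetD)
  have nxE: "(nx ^^ k) (w ! (n - 1)) \<in> E" for k using nx wE assms by (induction k) auto
  have pvE: "(pv ^^ k) (w ! 0) \<in> E" for k using pv wE assms by (induction k) auto
  define y where "y = (\<lambda>i. if i < 0 then (pv ^^ nat (- i)) (w ! 0) else if i < int n then w ! nat i
     else (nx ^^ nat (i - int n + 1)) (w ! (n - 1)))"
  have "y i \<in> E \<and> tgt (y i) = src (y (i + 1))" for i
  proof -
    consider "i < -1" | "i = -1" | "0 \<le> i" "i + 1 < int n" | "i + 1 = int n" | "i \<ge> int n" by linarith
    thus ?thesis
    proof cases
      case 1
      have "nat (- i) = Suc (nat (- (i + 1)))" using 1 by simp
      thus ?thesis using 1 pv pvE by (simp add: y_def)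
    next
      case 2
      thus ?thesis using pv pvE[of 0] wE assms by (simp add: y_def)
    next
      case 3
      hence "nat (i + 1) = Suc (nat i)" "Suc (nat i) < n" by auto
      thus ?thesis using 3 assms(1) wE by (auto simp: y_def paths_def successively_conv_nth)
    next
      case 4
      hence "nat i = n - 1" by simp
      thus ?thesis using 4 nx nxE[of 0] wE assms by (simp add: y_def)
    next
      case 5
      hence "nat (i + 1 - int n + 1) = Suc (nat (i - int n + 1))" by simp
      thus ?thesis using 5 nx nxE by (simp add: y_def del: funpow.simps) (metis comp_apply funpow.simps(2))
    qed
  qed
  moreover have "block n y 0 = w"
    using pathsD(1)[OF assms(1)] by (intro nth_equalityI) (auto simp: y_def)
  ultimately show ?thesis by (auto simp: edge_shift_def)
qed

lemma block_act_inject: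
  assumes "n > 0" "end_perm n g" "end_perm n h" "\<And>y. y \<in> edge_shift \<Longrightarrow> block_act n g y = block_act n h y"
  shows "g = h"
proof
  fix w
  show "g w = h w"
  proof (cases "w \<in> paths n")
    case True
    then obtain y where "y \<in> edge_shift" "block n y 0 = w" using paths_extend assms by blast
    then show ?thesis using block_block_act[OF assms(1)] assms(2-4) by metis
  next
    case False
    then show ?thesis using assms by (auto simp: end_perm_def permutes_def)
  qed
qed

text \<open>A block permutation that also commutes with the shift by the shorter length \<open>Q\<close> acts on a
  \<open>Q\<close>-block in a way that depends neither on its left nor on its right neighbours, as one sees by
  splicing two points at the block.\<close>

lemma block_act_commute_shift:
  assumes Q: "Q > 0" and m: "m > 0" and g: "end_perm (m * Q) g"
    and comm: "\<And>y. y \<in> edge_shift \<Longrightarrow>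
      block_act (m * Q) g (shift_by (int Q) y) = shift_by (int Q) (block_act (m * Q) g y)"
  shows "\<exists>h. end_perm Q h \<and> (\<forall>y\<in>edge_shift. block_act (m * Q) g y = block_act Q h y)"
proof -
  define F where "F = block_act (m * Q) g"
  have mQ: "m * Q > 0" using Q m by simp
  have FY: "F y \<in> edge_shift" if "y \<in> edge_shift" for y
    unfolding F_def using block_act_in_edge_shift[OF mQ g that] .
  have cnat: "F (shift_by (int a * int Q) y) = shift_by (int a * int Q) (F y)" if "y \<in> edge_shift" for a y
    using that
  proof (induction a)
    case (Suc a)
    have e: "shift_by (int (Suc a) * int Q) z = shift_by (int Q) (shift_by (int a * int Q) z)" for z :: "int \<Rightarrow> 'e"
      by (simp add: algebra_simps)
    show ?case using comm[of "shift_by (int a * int Q) y"] Suc unfolding e F_def[symmetric] by simp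
  qed simp
  have cint: "F (shift_by (a * int Q) y) = shift_by (a * int Q) (F y)" if "y \<in> edge_shift" for a y
  proof (cases "a \<ge> 0")
    case True
    then show ?thesis using cnat[OF that, of "nat a"] by simp
  next
    case False
    have "F y = shift_by (- a * int Q) (F (shift_by (a * int Q) y))"
      using cnat[of "shift_by (a * int Q) y" "nat (- a)"] that False by simp
    then show ?thesis by simp
  qed
  have loc: "F y i = F z i" if "y \<in> edge_shift" "z \<in> edge_shift" "0 \<le> i" "i < int (m * Q)"
    "\<And>j. 0 \<le> j \<Longrightarrow> j < int (m * Q) \<Longrightarrow> y j = z j" for y z i
  proof -
    have b: "block (m * Q) y 0 = block (m * Q) z 0" using that(5) by (simp add: block_def del: of_nat_mult)
    have "block (m * Q) (F y) 0 = block (m * Q) (F z) 0"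
      unfolding F_def using b block_block_act[OF mQ g that(1), of 0] block_block_act[OF mQ g that(2), of 0] by metis
    moreover have "F y i = block (m * Q) (F y) 0 ! nat i" "F z i = block (m * Q) (F z) 0 ! nat i"
      using that(3,4) by (auto simp: nat_less_iff simp del: of_nat_mult)
    ultimately show ?thesis by simp
  qed
  have single: "block Q (F y) 0 = block Q (F z) 0"
    if "y \<in> edge_shift" "z \<in> edge_shift" "block Q y 0 = block Q z 0" for y z
  proof -
    have eq: "y j = z j" if "0 \<le> j" "j < int Q" for j
    proof -
      have "block Q y 0 ! nat j = block Q z 0 ! nat j" using \<open>block Q y 0 = block Q z 0\<close> by simp
      thus ?thesis using that by (auto simp: nat_less_iff)
    qed
    define u where "u = (\<lambda>i. if i < 0 then y i else z i)"
    have u: "u \<in> edge_shift"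
    proof -
      have "u i \<in> E \<and> tgt (u i) = src (u (i + 1))" for i
      proof (cases "i = -1")
        case True
        have "tgt (y (-1)) = src (y (-1 + 1))" "y (-1) \<in> E" using that(1) unfolding edge_shift_def by blast+
        thus ?thesis using eq[of 0] Q True by (simp add: u_def)
      next
        case False
        then show ?thesis using that by (auto simp: u_def edge_shift_def)
      qed
      thus ?thesis by (auto simp: edge_shift_def)
    qed
    show ?thesis
    proof (intro nth_equalityI)
      fix i assume "i < length (block Q (F y) 0)"
      hence i: "i < Q" by simp
      have "1 * Q \<le> m * Q" using m by (intro mult_right_mono) auto
      hence QmQ: "int i < int (m * Q)" using i by linarith
      \<comment> \<open>Here the \<open>Q\<close>-block is the first one in its long block, which
        sees only coordinates from 0 on, where \<open>u\<close> is \<open>z\<close>.\<close>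
      have 1: "F u (int i) = F z (int i)"
        using loc[OF u that(2) _ QmQ] by (simp add: u_def)
      \<comment> \<open>After the shift by \<open>a * int Q\<close> the same \<open>Q\<close>-block
        is the last one in its long block, which sees only coordinates below \<open>Q\<close>, where
        \<open>u\<close> agrees with \<open>y\<close>.\<close>
      define a where "a = - (int m - 1)"
      have a: "- a * int Q = int (m * Q) - int Q" by (simp add: a_def algebra_simps)
      have "F (shift_by (a * int Q) u) (int i + (- a) * int Q) = F (shift_by (a * int Q) y) (int i + (- a) * int Q)"
      proof (rule loc)
        show "0 \<le> int i + - a * int Q" using m by (simp add: a_def)
        show "int i + - a * int Q < int (m * Q)" using a i by simp
        fix j assume j: "0 \<le> j" "j < int (m * Q)"
        have "a * int Q = int Q - int (m * Q)" using a by simp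
        hence "j + a * int Q < int Q" using j by linarith
        thus "shift_by (a * int Q) u j = shift_by (a * int Q) y j"
          using eq[of "j + a * int Q"] by (auto simp: u_def shift_by_def)
      qed (use u that in auto)
      hence "F u (int i) = F y (int i)" using cint u that by (simp add: shift_by_def)
      thus "block Q (F y) 0 ! i = block Q (F z) 0 ! i" using 1 i by simp
    qed simp
  qed
  obtain ext where ext: "\<And>w. w \<in> paths Q \<Longrightarrow> ext w \<in> edge_shift \<and> block Q (ext w) 0 = w"
    using paths_extend[OF _ Q] by metis
  \<comment> \<open>By \<open>single\<close> the value does not depend on the chosen extension
    \<open>ext w\<close>.\<close>
  define h where "h = (\<lambda>w. if w \<in> paths Q then block Q (F (ext w)) 0 else w)"
  have h0: "h (block Q y 0) = block Q (F y) 0" if "y \<in> edge_shift" for y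
    using single[OF _ that] ext block_in_paths[OF that] by (auto simp: h_def)
  have hl: "h (block Q y l) = block Q (F y) l" if "y \<in> edge_shift" for y l
    using h0[of "shift_by (l * int Q) y"] that cint[OF that, of l] by (simp add: block_shift_by)
  have s0: "src (F y 0) = src (y 0)" if "y \<in> edge_shift" for y
  proof -
    have "ends (block (m * Q) (F y) 0) = ends (block (m * Q) y 0)"
      unfolding F_def using block_block_act[OF mQ g that, of 0] end_permD(2)[OF g block_in_paths[OF that, of _ 0]] by simp
    thus ?thesis using block_ends[OF FY[OF that] mQ, of 0] block_ends[OF that mQ, of 0] by simp
  qed
  \<comment> \<open>The right end of a \<open>Q\<close>-block is the left end of the next one, which
    is reached by the shift that \<open>F\<close> commutes with.\<close>
  have sQ: "src (F y (int Q)) = src (y (int Q))" if "y \<in> edge_shift" for y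
    using s0[OF shift_by_edge_shift[OF that, of "int Q"]] cint[OF that, of 1] by (simp add: shift_by_def)
  have h_in: "h w \<in> paths Q" if "w \<in> paths Q" for w
    using that ext block_in_paths FY by (auto simp: h_def)
  have h_ends: "ends (h w) = ends w" if "w \<in> paths Q" for w
  proof -
    have "ends (h w) = ends (block Q (F (ext w)) 0)" using that by (simp add: h_def)
    also have "\<dots> = ends (block Q (ext w) 0)"
      using block_ends[OF FY Q, of "ext w" 0] block_ends[OF _ Q, of "ext w" 0] s0 sQ ext[OF that] by simp
    finally show ?thesis using ext[OF that] by simp
  qed
  have "h ` paths Q = paths Q"
  proof
    show "paths Q \<subseteq> h ` paths Q"
    proof
      fix w assume w: "w \<in> paths Q"
      define y where "y = block_act (m * Q) (finv g) (ext w)"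
      have y: "y \<in> edge_shift" unfolding y_def using ext[OF w] block_act_in_edge_shift[OF mQ end_perm_inv[OF g]] by blast
      have "F y = ext w" unfolding F_def y_def using block_act_inv(2)[OF mQ g] ext[OF w] by blast
      hence "h (block Q y 0) = w" using h0[OF y] ext[OF w] by simp
      thus "w \<in> h ` paths Q" using block_in_paths[OF y] by blast
    qed
  qed (use h_in in auto)
  hence "h permutes paths Q"
    using eq_card_imp_inj_on[of "paths Q" h] by (intro bij_imp_permutes) (auto simp: bij_betw_def h_def)
  hence h: "end_perm Q h" using h_ends by (simp add: end_perm_def)
  have "F y = block_act Q h y" if "y \<in> edge_shift" for y
    using block_ext[OF Q] block_block_act[OF Q h that] hl[OF that] by metis
  thus ?thesis using h by (auto simp: F_def)
qed

section \<open>Diagonal permutations\<close>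

definition diag :: "nat \<Rightarrow> nat \<Rightarrow> ('e list \<Rightarrow> 'e list) \<Rightarrow> 'e list \<Rightarrow> 'e list" where
  "diag m n g w = (if w \<in> paths (m * n) then concat (map (\<lambda>l. g (chunk n w l)) [0..<m]) else w)"

lemma diag_path:
  assumes "n > 0" "m > 0" "end_perm n g" "w \<in> paths (m * n)"
  shows "diag m n g w \<in> paths (m * n)" "ends (diag m n g w) = ends w"
    "l < m \<Longrightarrow> chunk n (diag m n g w) l = g (chunk n w l)"
proof -
  let ?ws = "map (\<lambda>l. g (chunk n w l)) [0..<m]"
  have c: "g (chunk n w l) \<in> paths n" "ends (g (chunk n w l)) = ends (chunk n w l)" if "l < m" for l
    using end_permD[OF assms(3)] chunk_in_paths[OF assms(4) that] by auto
  have "concat ?ws \<in> paths (length ?ws * n) \<and> ends (concat ?ws) = (fst (ends (hd ?ws)), snd (ends (last ?ws)))"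
    using assms(1,2) c chunk_ends(1)[OF assms(4,1)] by (intro concat_in_paths) auto
  moreover have "hd ?ws = g (chunk n w 0)" "last ?ws = g (chunk n w (m - 1))"
    using assms(2) by (auto simp: hd_map last_map)
  ultimately show "diag m n g w \<in> paths (m * n)" "ends (diag m n g w) = ends w"
    using assms(2,4) c chunk_ends(2)[OF assms(4,1,2)] by (simp_all add: diag_def)
  show "chunk n (diag m n g w) l = g (chunk n w l)" if "l < m"
  proof -
    have "chunk n (concat ?ws) l = ?ws ! l" using c(1) that pathsD(1) by (intro chunk_concat) auto
    thus ?thesis using that assms(4) by (simp add: diag_def)
  qed
qed

lemma diag_comp:
  assumes "n > 0" "m > 0" "end_perm n g" "end_perm n h"
  shows "diag m n (g \<circ> h) = diag m n g \<circ> diag m n h"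
proof
  fix w
  show "diag m n (g \<circ> h) w = (diag m n g \<circ> diag m n h) w"
  proof (cases "w \<in> paths (m * n)")
    case True
    have p: "diag m n h w \<in> paths (m * n)" using diag_path(1)[OF assms(1,2,4) True] .
    have "diag m n (g \<circ> h) w = diag m n g (diag m n h w)"
    proof (rule chunk_ext)
      show "length (diag m n (g \<circ> h) w) = m * n"
        using diag_path(1)[OF assms(1,2) end_perm_comp[OF assms(3,4)] True] pathsD(1) by blast
      show "length (diag m n g (diag m n h w)) = m * n"
        using diag_path(1)[OF assms(1,2,3) p] pathsD(1) by blast
      fix l assume l: "l < m"
      show "chunk n (diag m n (g \<circ> h) w) l = chunk n (diag m n g (diag m n h w)) l"
        using diag_path(3)[OF assms(1,2) end_perm_comp[OF assms(3,4)] True l]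
          diag_path(3)[OF assms(1,2,3) p l] diag_path(3)[OF assms(1,2,4) True l] by simp
    qed
    then show ?thesis by simp
  qed (simp add: diag_def)
qed

lemma diag_id: "diag m n id = id"
  by (auto simp: diag_def fun_eq_iff concat_chunks[OF pathsD(1)])

lemma end_perm_diag:
  assumes "n > 0" "m > 0" "end_perm n g" shows "end_perm (m * n) (diag m n g)"
proof -
  have i: "finv g \<circ> g = id" "g \<circ> finv g = id" using assms(3) permutes_inv_o[of g] by (auto simp: end_perm_def)
  have "diag m n (finv g) \<circ> diag m n g = id" "diag m n g \<circ> diag m n (finv g) = id"
    using diag_comp[OF assms(1,2) end_perm_inv[OF assms(3)] assms(3)]
      diag_comp[OF assms(1,2,3) end_perm_inv[OF assms(3)]] i diag_id[of m n] by metis+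
  hence "bij (diag m n g)" by (rule o_bij)
  moreover have "diag m n g ` paths (m * n) \<subseteq> paths (m * n)" using diag_path(1)[OF assms] by blast
  ultimately have "bij_betw (diag m n g) (paths (m * n)) (paths (m * n))"
    by (metis bij_betw_def bij_is_inj endo_inj_surj finite_paths inj_on_subset top_greatest)
  hence "diag m n g permutes paths (m * n)" by (intro bij_imp_permutes) (auto simp: diag_def)
  thus ?thesis using diag_path(2)[OF assms] by (simp add: end_perm_def)
qed

text \<open>Groups of different block lengths become comparable through this identity, as groups of
  maps of one and the same space.\<close>

lemma block_act_diag:
  assumes "n > 0" "m > 0" "end_perm n g" "y \<in> edge_shift"
  shows "block_act (m * n) (diag m n g) y = block_act n g y"
proof (rule block_ext[OF assms(1)])
  fix l
  have mn: "m * n > 0" using assms by simp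
  define a where "a = l div int m"
  define j where "j = nat (l mod int m)"
  have l: "l = a * int m + int j" "j < m" using assms by (auto simp: a_def j_def nat_less_iff)
  have "block n (block_act (m * n) (diag m n g) y) l = chunk n (block (m * n) (block_act (m * n) (diag m n g) y) a) j"
    using chunk_block[OF l(2)] l(1) by metis
  also have "\<dots> = chunk n (diag m n g (block (m * n) y a)) j"
    using block_block_act[OF mn end_perm_diag[OF assms(1-3)] assms(4)] by simp
  also have "\<dots> = g (chunk n (block (m * n) y a) j)"
    using diag_path(3)[OF assms(1-3) block_in_paths[OF assms(4)] l(2)] .
  also have "\<dots> = g (block n y l)" using chunk_block[OF l(2)] l(1) by metis
  finally show "block n (block_act (m * n) (diag m n g) y) l = block n (block_act n g y) l"
    using block_block_act[OF assms(1,3,4)] by simp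
qed

end

section \<open>Alternating groups on paired sets\<close>

definition restr :: "'b set \<Rightarrow> ('b \<Rightarrow> 'b) \<Rightarrow> 'b \<Rightarrow> 'b" where
  "restr S g = (\<lambda>x. if x \<in> S then g x else x)"

text \<open>The pairs are \<open>{w, f w}\<close>, and \<open>d\<close> marks one member of each.
  The classes \<open>T i\<close> may divide the unmarked points in any way; at the lowest level of
  the tower they are not given by the end vertices.\<close>

locale paired_partition =
  fixes M :: "'b set" and f :: "'b \<Rightarrow> 'b" and d :: "'b \<Rightarrow> bool" and I :: "'i set" and T :: "'i \<Rightarrow> 'b set"
  assumes finM: "finite M" and finI: "finite I"
    and f_in: "\<And>w. w \<in> M \<Longrightarrow> f w \<in> M" and ff: "\<And>w. w \<in> M \<Longrightarrow> f (f w) = w"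
    and df: "\<And>w. w \<in> M \<Longrightarrow> d (f w) \<longleftrightarrow> \<not> d w"
    and UT: "(\<Union>i\<in>I. T i) = {w \<in> M. \<not> d w}"
    and disj: "\<And>i j. i \<in> I \<Longrightarrow> j \<in> I \<Longrightarrow> i \<noteq> j \<Longrightarrow> T i \<inter> T j = {}"
begin

definition paired_alt :: "('b \<Rightarrow> 'b) set" where
  "paired_alt = {g. g permutes M \<and> (\<forall>w\<in>M. g (f w) = f (g w)) \<and> (\<forall>i\<in>I. restr (T i) g \<in> alt_perms (T i))}"

text \<open>Extension of a permutation of the unmarked points to the marked ones, by conjugation
  with \<open>f\<close>.\<close>

definition lift :: "('b \<Rightarrow> 'b) \<Rightarrow> 'b \<Rightarrow> 'b" where
  "lift b = (\<lambda>w. if w \<in> M then (if d w then f (b (f w)) else b w) else w)"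

lemma T_sub: "i \<in> I \<Longrightarrow> T i \<subseteq> {w \<in> M. \<not> d w}"
  unfolding UT[symmetric] by (rule UN_upper)

lemma finite_T: "i \<in> I \<Longrightarrow> finite (T i)"
  using T_sub finM by (metis (no_types, lifting) finite_subset mem_Collect_eq subset_iff)

text \<open>Preservation of the marks is a consequence and not a part of the definition: the classes
  are preserved and cover the unmarked points, and the marked points are the images of these under
  \<open>f\<close>.\<close>

lemma paired_altD:
  assumes "g \<in> paired_alt"
  shows "g permutes M" "w \<in> M \<Longrightarrow> g (f w) = f (g w)" "i \<in> I \<Longrightarrow> restr (T i) g \<in> alt_perms (T i)"
    "i \<in> I \<Longrightarrow> w \<in> T i \<Longrightarrow> g w \<in> T i" "w \<in> M \<Longrightarrow> d (g w) = d w"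
proof -
  show 1: "g permutes M" using assms unfolding paired_alt_def by blast
  show 2: "g (f w) = f (g w)" if "w \<in> M" for w using assms that unfolding paired_alt_def by blast
  show 3: "restr (T i) g \<in> alt_perms (T i)" if "i \<in> I" for i using assms that unfolding paired_alt_def by blast
  show 4: "g w \<in> T i" if "i \<in> I" "w \<in> T i" for i w
    using alt_perms_permutes[OF 3[OF that(1)]] that(2) permutes_in_image[of "restr (T i) g" "T i" w]
    by (simp add: restr_def)
  have 5: "\<not> d (g w)" if "w \<in> M" "\<not> d w" for w
  proof -
    have "w \<in> (\<Union>i\<in>I. T i)" unfolding UT using that by simp
    then obtain i where i: "i \<in> I" "w \<in> T i" by (rule UN_E)
    thus ?thesis using 4[OF i] T_sub[OF i(1)] by blast
  qed
  show "d (g w) = d w" if "w \<in> M"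
  proof (cases "d w")
    case True
    hence "\<not> d (g (f w))" using 5 f_in df that by blast
    moreover have "g w \<in> M" using 1 that by (simp add: permutes_in_image)
    ultimately show ?thesis using 2 df True that by metis
  qed (use 5 that in auto)
qed

lemma restr_comp:
  assumes "\<And>w. w \<in> S \<Longrightarrow> h w \<in> S" shows "restr S (g \<circ> h) = restr S g \<circ> restr S h"
  using assms by (auto simp: restr_def fun_eq_iff)

lemma paired_alt_id: "id \<in> paired_alt"
proof -
  have "restr (T i) id = id" for i by (auto simp: restr_def)
  hence "restr (T i) id \<in> alt_perms (T i)" for i by (metis alt_perms.id)
  moreover have "id permutes M" by (rule permutes_id)
  ultimately show ?thesis by (simp add: paired_alt_def del: id_apply) simp
qed

lemma paired_alt_comp:
  assumes "g \<in> paired_alt" "h \<in> paired_alt" shows "g \<circ> h \<in> paired_alt"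
proof -
  note g = paired_altD[OF assms(1)] and h = paired_altD[OF assms(2)]
  have "g \<circ> h permutes M" using permutes_compose[OF h(1) g(1)] .
  moreover have "(g \<circ> h) (f w) = f ((g \<circ> h) w)" if "w \<in> M" for w
    using g(2)[of "h w"] h(2)[OF that] permutes_in_image[OF h(1)] that by simp
  moreover have "restr (T i) (g \<circ> h) \<in> alt_perms (T i)" if "i \<in> I" for i
    using restr_comp[of "T i" h g] h(4)[OF that] alt_perms_comp[OF g(3)[OF that] h(3)[OF that]] by metis
  ultimately show ?thesis by (simp add: paired_alt_def del: comp_apply)
qed

lemma paired_alt_inv:
  assumes "g \<in> paired_alt" shows "finv g \<in> paired_alt"
proof -
  note g = paired_altD[OF assms]
  have "finv g (f w) = f (finv g w)" if "w \<in> M" for w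
  proof -
    have "finv g w \<in> M" using that permutes_in_image[OF permutes_inv[OF g(1)]] by simp
    hence "g (f (finv g w)) = f w" using g(2) permutes_inverses(1)[OF g(1)] by simp
    thus ?thesis using permutes_inverses(2)[OF g(1)] by metis
  qed
  moreover have "restr (T i) (finv g) \<in> alt_perms (T i)" if i: "i \<in> I" for i
  proof -
    note r = alt_perms_permutes[OF g(3)[OF i]]
    have "restr (T i) (finv g) = finv (restr (T i) g)"
    proof
      fix w
      show "restr (T i) (finv g) w = finv (restr (T i) g) w"
      proof (cases "w \<in> T i")
        case True
        define u where "u = finv (restr (T i) g) w"
        have "u \<in> T i" using True permutes_in_image[OF permutes_inv[OF r]] by (simp add: u_def)
        moreover have "restr (T i) g u = w" unfolding u_def using permutes_inverses(1)[OF r] by simp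
        ultimately have "g u = w" by (simp add: restr_def)
        hence "finv g w = u" using permutes_inverses(2)[OF g(1)] by metis
        thus ?thesis using True by (simp add: restr_def u_def)
      next
        case False
        thus ?thesis using permutes_not_in[OF permutes_inv[OF r] False] by (simp add: restr_def)
      qed
    qed
    thus ?thesis using alt_perms_inv[OF g(3)[OF i]] by simp
  qed
  ultimately show ?thesis using permutes_inv[OF g(1)] by (simp add: paired_alt_def)
qed

lemma lift_comp:
  assumes "b permutes {w \<in> M. \<not> d w}" "c permutes {w \<in> M. \<not> d w}"
  shows "lift (b \<circ> c) = lift b \<circ> lift c"
proof
  fix w
  have c: "c u \<in> M \<and> \<not> d (c u)" if "u \<in> M" "\<not> d u" for u
    using permutes_in_image[OF assms(2), of u] that by simp
  consider "w \<notin> M" | "w \<in> M" "d w" | "w \<in> M" "\<not> d w" by blast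
  thus "lift (b \<circ> c) w = (lift b \<circ> lift c) w"
  proof cases
    case 2
    hence "f w \<in> M" "\<not> d (f w)" using f_in df by auto
    hence "c (f w) \<in> M" "\<not> d (c (f w))" using c by auto
    hence "f (c (f w)) \<in> M" "d (f (c (f w)))" "f (f (c (f w))) = c (f w)" using f_in df ff by auto
    then show ?thesis using 2 by (simp add: lift_def)
  next
    case 3
    then show ?thesis using c by (simp add: lift_def)
  qed (simp add: lift_def)
qed

lemma lift_id: "lift id = id"
  using ff by (auto simp: lift_def fun_eq_iff)

lemma lift_in:
  assumes "b permutes {w \<in> M. \<not> d w}" "\<And>i. i \<in> I \<Longrightarrow> restr (T i) b \<in> alt_perms (T i)"
  shows "lift b \<in> paired_alt"
proof -
  have "lift b \<circ> lift (finv b) = id" "lift (finv b) \<circ> lift b = id"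
    using lift_comp[OF assms(1) permutes_inv[OF assms(1)]] lift_comp[OF permutes_inv[OF assms(1)] assms(1)]
      permutes_inv_o[OF assms(1)] lift_id by auto
  hence bij: "bij (lift b)" using o_bij by blast
  have b: "b u \<in> M \<and> \<not> d (b u)" if "u \<in> M" "\<not> d u" for u
    using permutes_in_image[OF assms(1), of u] that by simp
  have "lift b ` M \<subseteq> M" using b f_in df by (auto simp: lift_def)
  hence "bij_betw (lift b) M M"
    using finM bij by (metis bij_betw_def bij_is_inj endo_inj_surj inj_on_subset top_greatest)
  hence "lift b permutes M" by (intro bij_imp_permutes) (auto simp: lift_def)
  moreover have "lift b (f w) = f (lift b w)" if "w \<in> M" for w
  proof (cases "d w")
    case True
    then show ?thesis using that f_in df ff b[of "f w"] by (simp add: lift_def)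
  next
    case False
    then show ?thesis using that f_in df ff by (simp add: lift_def)
  qed
  moreover have "restr (T i) (lift b) = restr (T i) b" if "i \<in> I" for i
    using T_sub[OF that] by (auto simp: restr_def lift_def fun_eq_iff)
  ultimately show ?thesis using assms(2) by (simp add: paired_alt_def)
qed

lemma lift_single_in:
  assumes "i \<in> I" "a \<in> alt_perms (T i)" shows "lift a \<in> paired_alt"
proof (rule lift_in)
  show "a permutes {w \<in> M. \<not> d w}"
    using permutes_subset[OF alt_perms_permutes[OF assms(2)] T_sub[OF assms(1)]] .
  fix j assume j: "j \<in> I"
  show "restr (T j) a \<in> alt_perms (T j)"
  proof (cases "j = i")
    case True
    have "restr (T i) a = a"
      using permutes_not_in[OF alt_perms_permutes[OF assms(2)]] by (auto simp: restr_def fun_eq_iff)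
    thus ?thesis using assms True by simp
  next
    case False
    hence "x \<notin> T i" if "x \<in> T j" for x using disj[OF assms(1) j] that by blast
    hence "restr (T j) a = id"
      using permutes_not_in[OF alt_perms_permutes[OF assms(2)]] by (auto simp: restr_def fun_eq_iff)
    thus ?thesis using alt_perms.id by metis
  qed
qed

lemma paired_alt_eqI:
  assumes "g \<in> paired_alt" "h \<in> paired_alt" "\<And>i w. i \<in> I \<Longrightarrow> w \<in> T i \<Longrightarrow> g w = h w"
  shows "g = h"
proof
  fix w
  have 1: "g w = h w" if "w \<in> M" "\<not> d w" for w
  proof -
    have "w \<in> (\<Union>i\<in>I. T i)" unfolding UT using that by simp
    thus ?thesis using assms(3) by (elim UN_E)
  qed
  consider "w \<notin> M" | "w \<in> M" "d w" | "w \<in> M" "\<not> d w" by blast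
  thus "g w = h w"
  proof cases
    case 1
    thus ?thesis using assms permutes_not_in paired_altD(1) by metis
  next
    case 2
    hence "g (f w) = h (f w)" using 1 f_in df by blast
    hence "f (g w) = f (h w)" using 2 paired_altD(2) assms by metis
    moreover have "g w \<in> M" "h w \<in> M" using 2 assms paired_altD(1) permutes_in_image by metis+
    ultimately show ?thesis using ff by metis
  qed (use 1 in auto)
qed

text \<open>An element is the product of the lifts of its restrictions to the finitely many classes,
  and each restriction is a product of 3-cycles. The principle serves to show that diagonal
  permutations are even, which for elements of order three follows from the equation
  \<open>g (g (g w)) = w\<close>.\<close>

lemma paired_alt_induct [consumes 1, case_names id comp order_three]:
  assumes "g \<in> paired_alt" and "P id"
    and "\<And>g h. g \<in> paired_alt \<Longrightarrow> h \<in> paired_alt \<Longrightarrow> P g \<Longrightarrow> P h \<Longrightarrow> P (g \<circ> h)"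
    and "\<And>g. g \<in> paired_alt \<Longrightarrow> (\<And>w. g (g (g w)) = w) \<Longrightarrow> P g"
  shows "P g"
proof -
  have single: "P (lift a)" if i: "i \<in> I" and a: "a \<in> alt_perms (T i)" for i a
    using a
  proof (induction rule: alt_perms.induct)
    case id
    show ?case using assms(2) lift_id by metis
  next
    case (step h a b c)
    have t: "three_cycle a b c \<in> alt_perms (T i)" using step by (intro three_cycle_in_alt_perms)
    have perm: "p permutes {w \<in> M. \<not> d w}" if "p \<in> alt_perms (T i)" for p
      using permutes_subset[OF alt_perms_permutes[OF that] T_sub[OF i]] .
    let ?t = "three_cycle a b c"
    have "?t \<circ> (?t \<circ> ?t) = id" using step by (auto simp: three_cycle_def fun_eq_iff)
    hence "lift ?t \<circ> (lift ?t \<circ> lift ?t) = id"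
      using lift_comp[OF perm[OF t] permutes_compose[OF perm[OF t] perm[OF t]]]
        lift_comp[OF perm[OF t] perm[OF t]] lift_id by metis
    hence "P (lift ?t)"
      using assms(4)[OF lift_single_in[OF i t]] by (metis comp_apply id_apply)
    hence "P (lift ?t \<circ> lift h)"
      using assms(3) lift_single_in[OF i t] lift_single_in[OF i step(1)] step.IH by blast
    thus ?case using lift_comp[OF perm[OF t] perm[OF step(1)]] by metis
  qed
  \<comment> \<open>\<open>J\<close> collects the classes on which \<open>g\<close> may still be
    nontrivial.\<close>
  have "finite J \<Longrightarrow> J \<subseteq> I \<Longrightarrow> g \<in> paired_alt \<Longrightarrow> (\<And>i w. i \<in> I - J \<Longrightarrow> w \<in> T i \<Longrightarrow> g w = w) \<Longrightarrow> P g" for J g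
  proof (induction J arbitrary: g rule: finite_induct)
    case empty
    hence "g = id" by (intro paired_alt_eqI paired_alt_id) auto
    thus ?case using assms(2) by metis
  next
    case (insert i J)
    have i: "i \<in> I" using insert by simp
    define a where "a = restr (T i) g"
    have a: "a \<in> alt_perms (T i)" unfolding a_def using paired_altD(3) insert i by blast
    have perm: "p permutes {w \<in> M. \<not> d w}" if "p \<in> alt_perms (T i)" for p
      using permutes_subset[OF alt_perms_permutes[OF that] T_sub[OF i]] .
    note ia = alt_perms_inv[OF a]
    define h where "h = lift (finv a) \<circ> g"
    have h: "h \<in> paired_alt" unfolding h_def using paired_alt_comp lift_single_in[OF i ia] insert by blast
    have "h w = w" if "j \<in> I - J" "w \<in> T j" for j w
    proof (cases "j = i")
      case True
      have "g w = a w" using that True by (simp add: a_def restr_def)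
      moreover have "g w \<in> T i" using paired_altD(4)[OF insert.prems(2) i] that True by blast
      hence "g w \<in> M" "\<not> d (g w)" using T_sub[OF i] by auto
      ultimately show ?thesis
        using permutes_inverses(2)[OF alt_perms_permutes[OF a]] by (simp add: h_def lift_def)
    next
      case False
      hence "g w = w" using insert.prems(3) that by blast
      moreover have "w \<notin> T i" using disj[of i j] that False i by blast
      moreover have "w \<in> M" "\<not> d w" using T_sub that by blast+
      ultimately show ?thesis
        using permutes_not_in[OF alt_perms_permutes[OF ia]] by (simp add: h_def lift_def)
    qed
    hence "P h" using insert.IH h insert.prems by blast
    moreover have "lift a \<circ> h = g"
    proof -
      have "lift a \<circ> h = (lift a \<circ> lift (finv a)) \<circ> g" by (simp add: h_def comp_assoc)
      also have "lift a \<circ> lift (finv a) = lift (a \<circ> finv a)" using lift_comp perm a ia by simp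
      also have "a \<circ> finv a = id" using permutes_inv_o(1)[OF alt_perms_permutes[OF a]] .
      finally show ?thesis by (simp only: lift_id id_comp)
    qed
    ultimately show ?case using assms(3)[OF lift_single_in[OF i a] h single[OF i a]] by simp
  qed
  from this[OF finI order_refl assms(1)] show ?thesis by blast
qed

lemma order_three_in_paired_alt:
  assumes "g permutes M" "\<And>w. w \<in> M \<Longrightarrow> g (f w) = f (g w)" "\<And>i w. i \<in> I \<Longrightarrow> w \<in> T i \<Longrightarrow> g w \<in> T i"
    "\<And>w. g (g (g w)) = w"
  shows "g \<in> paired_alt"
proof -
  have "restr (T i) g \<in> alt_perms (T i)" if i: "i \<in> I" for i
  proof (rule order_three_in_alt_perms)
    have "inj_on g (T i)" using permutes_inj[OF assms(1)] by (simp add: inj_on_def inj_def)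
    moreover have "g ` T i \<subseteq> T i" using assms(3)[OF i] by blast
    ultimately have "bij_betw g (T i) (T i)"
      using endo_inj_surj[OF finite_T[OF i]] by (simp add: bij_betw_def)
    hence "bij_betw (restr (T i) g) (T i) (T i)" by (subst bij_betw_cong[of _ _ g]) (auto simp: restr_def)
    thus "restr (T i) g permutes T i" by (intro bij_imp_permutes) (auto simp: restr_def)
    show "restr (T i) g (restr (T i) g (restr (T i) g x)) = x" for x
      using assms(3)[OF i] assms(4) by (simp add: restr_def)
  qed (use finite_T i in auto)
  thus ?thesis using assms by (simp add: paired_alt_def)
qed

definition paired_group :: "('b \<Rightarrow> 'b) monoid" where
  "paired_group = \<lparr>carrier = paired_alt, mult = (\<circ>), one = id\<rparr>"

text \<open>Permutations of the single classes glue to a permutation of the unmarked points, which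
  has exactly one extension that commutes with \<open>f\<close>. So the marked points repeat the
  action and contribute no further factors.\<close>

lemma paired_group_iso:
  "(\<lambda>g. \<lambda>i\<in>I. restr (T i) g) \<in> iso paired_group (product_group I (\<lambda>i. alt_on (T i)))"
proof (rule isoI)
  show "(\<lambda>g. \<lambda>i\<in>I. restr (T i) g) \<in> hom paired_group (product_group I (\<lambda>i. alt_on (T i)))"
  proof (rule homI)
    fix g assume "g \<in> carrier paired_group"
    thus "(\<lambda>i\<in>I. restr (T i) g) \<in> carrier (product_group I (\<lambda>i. alt_on (T i)))"
      using paired_altD(3) by (auto simp: paired_group_def)
  next
    fix g h assume "g \<in> carrier paired_group" "h \<in> carrier paired_group"
    hence "restr (T i) (g \<circ> h) = restr (T i) g \<circ> restr (T i) h" if "i \<in> I" for i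
      using paired_altD(4)[of h i] that by (intro restr_comp) (auto simp: paired_group_def)
    thus "(\<lambda>i\<in>I. restr (T i) (g \<otimes>\<^bsub>paired_group\<^esub> h)) =
      (\<lambda>i\<in>I. restr (T i) g) \<otimes>\<^bsub>product_group I (\<lambda>i. alt_on (T i))\<^esub> (\<lambda>i\<in>I. restr (T i) h)"
      by (auto simp: paired_group_def fun_eq_iff restrict_def)
  qed
  show "bij_betw (\<lambda>g. \<lambda>i\<in>I. restr (T i) g) (carrier paired_group) (carrier (product_group I (\<lambda>i. alt_on (T i))))"
    unfolding bij_betw_def
  proof
    show "inj_on (\<lambda>g. \<lambda>i\<in>I. restr (T i) g) (carrier paired_group)"
    proof (rule inj_onI)
      fix g h assume gh: "g \<in> carrier paired_group" "h \<in> carrier paired_group"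
        and e: "(\<lambda>i\<in>I. restr (T i) g) = (\<lambda>i\<in>I. restr (T i) h)"
      show "g = h"
      proof (rule paired_alt_eqI)
        fix i w assume iw: "i \<in> I" "w \<in> T i"
        hence "restr (T i) g w = restr (T i) h w" using fun_cong[OF e, of i] by simp
        thus "g w = h w" using iw by (simp add: restr_def)
      qed (use gh in \<open>auto simp: paired_group_def\<close>)
    qed
    show "(\<lambda>g. \<lambda>i\<in>I. restr (T i) g) ` carrier paired_group = carrier (product_group I (\<lambda>i. alt_on (T i)))"
    proof
      show "(\<lambda>g. \<lambda>i\<in>I. restr (T i) g) ` carrier paired_group \<subseteq> carrier (product_group I (\<lambda>i. alt_on (T i)))"
        using paired_altD(3) by (auto simp: paired_group_def)
      show "carrier (product_group I (\<lambda>i. alt_on (T i))) \<subseteq> (\<lambda>g. \<lambda>i\<in>I. restr (T i) g) ` carrier paired_group"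
      proof
        fix a assume "a \<in> carrier (product_group I (\<lambda>i. alt_on (T i)))"
        hence a: "a \<in> (\<Pi>\<^sub>E i\<in>I. alt_perms (T i))" by simp
        define ix where "ix = (\<lambda>w. THE i. i \<in> I \<and> w \<in> T i)"
        have ix: "ix w = i" if "i \<in> I" "w \<in> T i" for i w
          unfolding ix_def using that disj by (intro the_equality) auto
        let ?U = "{w \<in> M. \<not> d w}"
        define b where "b = (\<lambda>w. if w \<in> ?U then a (ix w) w else w)"
        have ap: "a i permutes T i" if "i \<in> I" for i using a that alt_perms_permutes by (auto simp: PiE_iff)
        have bT: "b w = a i w \<and> b w \<in> T i" if "i \<in> I" "w \<in> T i" for i w
          using that ix T_sub ap permutes_in_image[OF ap] by (auto simp: b_def)
        have bU: "b w \<in> ?U" if w: "w \<in> ?U" for w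
        proof -
          have "w \<in> (\<Union>i\<in>I. T i)" unfolding UT using w .
          then obtain i where i: "i \<in> I" "w \<in> T i" by (rule UN_E)
          thus ?thesis using bT[OF i] T_sub[OF i(1)] by blast
        qed
        have "inj_on b ?U"
        proof (rule inj_onI)
          fix w w' assume w: "w \<in> ?U" "w' \<in> ?U" "b w = b w'"
          have "w \<in> (\<Union>i\<in>I. T i)" "w' \<in> (\<Union>i\<in>I. T i)" unfolding UT using w by simp_all
          then obtain i j where ij: "i \<in> I" "w \<in> T i" "j \<in> I" "w' \<in> T j" by (elim UN_E)
          hence "i = j" using bT[OF ij(1,2)] bT[OF ij(3,4)] disj w(3) by (metis disjoint_iff)
          thus "w = w'" using bT[OF ij(1,2)] bT[OF ij(3,4)] w(3) permutes_inj[OF ap[OF ij(1)]] by (metis inj_eq)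
        qed
        moreover have "b ` ?U \<subseteq> ?U" using bU by blast
        moreover have fU: "finite ?U" using finM by simp
        ultimately have "bij_betw b ?U ?U" using endo_inj_surj[OF fU, of b] unfolding bij_betw_def by blast
        hence bp: "b permutes ?U" by (intro bij_imp_permutes) (auto simp: b_def)
        have rb: "restr (T i) b = a i" if "i \<in> I" for i
          using bT[OF that] permutes_not_in[OF ap[OF that]] by (auto simp: restr_def fun_eq_iff)
        have lb: "lift b \<in> paired_alt" using bp rb a by (intro lift_in) (auto simp: PiE_iff)
        have "restr (T i) (lift b) = a i" if "i \<in> I" for i
        proof -
          have "restr (T i) (lift b) = restr (T i) b"
            using T_sub[OF that] by (auto simp: restr_def lift_def fun_eq_iff)
          thus ?thesis using rb[OF that] by metis
        qed
        hence "(\<lambda>i\<in>I. restr (T i) (lift b)) = a"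
          using a by (intro extensionalityI[of _ I]) (auto simp: PiE_def)
        thus "a \<in> (\<lambda>g. \<lambda>i\<in>I. restr (T i) g) ` carrier paired_group"
          using lb by (auto simp: paired_group_def intro!: image_eqI[of _ _ "lift b"])
      qed
    qed
  qed
qed

lemma finite_paired_alt: "finite paired_alt"
  using finite_permutations[OF finM] paired_altD(1) by (metis (no_types, lifting) finite_subset mem_Collect_eq subsetI)

lemma card_paired_alt_ge:
  assumes "i \<in> I" shows "card (alt_perms (T i)) \<le> card paired_alt"
proof (rule card_inj_on_le[OF _ _ finite_paired_alt])
  show "lift ` alt_perms (T i) \<subseteq> paired_alt" using lift_single_in[OF assms] by blast
  show "inj_on lift (alt_perms (T i))"
  proof (rule inj_onI, rule ext)
    fix a b w assume a: "a \<in> alt_perms (T i)" "b \<in> alt_perms (T i)" "lift a = lift b"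
    show "a w = b w"
    proof (cases "w \<in> T i")
      case True
      thus ?thesis using fun_cong[OF a(3), of w] T_sub[OF assms] by (auto simp: lift_def)
    next
      case False
      thus ?thesis using a alt_perms_permutes permutes_not_in by metis
    qed
  qed
qed

end

section \<open>Levels over a graph with parallel edges\<close>

text \<open>The edge \<open>e1\<close> replaces the edges of \<open>E0\<close> in connecting paths;
  together with \<open>e2\<close> it yields distinct loops of equal length that avoid
  \<open>E0\<close>.\<close>

locale parallel_graph = edge_graph E src tgt for E :: "'e set" and src tgt :: "'e \<Rightarrow> 'v" +
  fixes E0 :: "'e set" and e1 e2 :: 'e
  assumes E0_sub: "E0 \<subseteq> E"
    and spare: "e1 \<in> E - E0" "e2 \<in> E - E0" "e1 \<noteq> e2"
    and parallel: "\<And>e. e \<in> E0 \<Longrightarrow> src e = src e1 \<and> tgt e = tgt e1" "src e2 = src e1" "tgt e2 = tgt e1"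
    and primitive: "\<exists>n0. \<forall>n\<ge>n0. \<forall>u\<in>src ` E. \<forall>v\<in>src ` E. \<exists>w\<in>paths n. ends w = (u, v)"
begin

definition V :: "'v set" where "V = src ` E"

definition moved :: "nat \<Rightarrow> 'e list set" where "moved n = {w \<in> paths n. set w \<inter> E0 \<noteq> {}}"

text \<open>The level groups and their diagonal permutations fix these paths, which therefore serve
  as spacers and as code words.\<close>

definition still :: "nat \<Rightarrow> 'e list set" where "still n = {w \<in> paths n. set w \<inter> E0 = {}}"

text \<open>The successor makes the length positive, so that paths of this length have meaningful
  ends.\<close>

definition conn_len :: nat where
  "conn_len = Suc (SOME n0. \<forall>n\<ge>n0. \<forall>u\<in>V. \<forall>v\<in>V. \<exists>w\<in>paths n. ends w = (u, v))"

lemma finite_V: "finite V" by (simp add: V_def finite_edges)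

lemma tgt_V: "e \<in> E \<Longrightarrow> tgt e \<in> V" "e \<in> E \<Longrightarrow> src e \<in> V"
  using src_tgt_image by (auto simp: V_def)

lemma paths_still_moved: "w \<in> paths n \<Longrightarrow> w \<in> still n \<or> w \<in> moved n"
  by (auto simp: still_def moved_def)

lemma stillD: "w \<in> still n \<Longrightarrow> w \<in> paths n" "w \<in> still n \<Longrightarrow> w \<notin> moved n"
  by (auto simp: still_def moved_def)

lemma movedD: "w \<in> moved n \<Longrightarrow> w \<in> paths n" "w \<in> moved n \<Longrightarrow> w \<notin> still n"
  by (auto simp: still_def moved_def)

lemma finite_moved: "finite (moved n)" "finite (still n)"
  by (auto simp: moved_def still_def)

lemma ends_V:
  assumes "w \<in> paths n" "n > 0" shows "fst (ends w) \<in> V" "snd (ends w) \<in> V" "ends w \<in> V \<times> V"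
proof -
  have "w \<noteq> []" using assms pathsD(1) by fastforce
  hence "hd w \<in> E" "last w \<in> E" using pathsD(2)[OF assms(1)] by auto
  thus "fst (ends w) \<in> V" "snd (ends w) \<in> V" "ends w \<in> V \<times> V" using tgt_V by (auto simp: ends_def)
qed

lemma append_path:
  assumes "a \<in> paths p" "b \<in> paths q" "p > 0" "q > 0" "snd (ends a) = fst (ends b)"
  shows "a @ b \<in> paths (p + q)" "ends (a @ b) = (fst (ends a), snd (ends b))"
  using assms pathsD(1)[OF assms(1)] pathsD(1)[OF assms(2)] by (auto simp: paths_append ends_append)

lemma append_still:
  assumes "a \<in> still p" "b \<in> still q" "p > 0" "q > 0" "snd (ends a) = fst (ends b)"
  shows "a @ b \<in> still (p + q)"
  using append_path(1)[of a p b q] assms by (auto simp: still_def)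

lemma append_moved:
  assumes "a \<in> paths p" "b \<in> paths q" "p > 0" "q > 0" "snd (ends a) = fst (ends b)" "a \<in> moved p \<or> b \<in> moved q"
  shows "a @ b \<in> moved (p + q)"
  using append_path(1)[of a p b q] assms by (auto simp: moved_def)

lemma single_still: "e \<in> E - E0 \<Longrightarrow> [e] \<in> still 1"
  by (auto simp: still_def paths_def)

text \<open>Replacing each edge of \<open>E0\<close> by its parallel \<open>e1\<close> turns a
  connecting path into one that avoids \<open>E0\<close> and has the same ends.\<close>

lemma connect:
  assumes "n \<ge> conn_len" "u \<in> V" "v \<in> V"
  shows "\<exists>w\<in>still n. ends w = (u, v)"
proof -
  have "\<forall>n\<ge>conn_len. \<forall>u\<in>V. \<forall>v\<in>V. \<exists>w\<in>paths n. ends w = (u, v)"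
    using someI_ex[OF primitive] unfolding conn_len_def V_def by auto
  then obtain w where w: "w \<in> paths n" "ends w = (u, v)" using assms by blast
  define r where "r = (\<lambda>e. if e \<in> E0 then e1 else e)"
  have r: "src (r e) = src e" "tgt (r e) = tgt e" for e using parallel by (auto simp: r_def)
  have "w \<noteq> []" using pathsD(1)[OF w(1)] assms(1) by (auto simp: conn_len_def)
  hence "ends (map r w) = ends w" by (simp add: ends_def hd_map last_map r)
  moreover have "map r w \<in> still n"
    using w(1) spare by (auto simp: still_def paths_def successively_map r) (auto simp: r_def split: if_splits)
  ultimately show ?thesis using w by auto
qed

lemma conn_len_pos: "conn_len > 0" by (simp add: conn_len_def)

lemma e1_V: "src e1 \<in> V" "tgt e1 \<in> V" using tgt_V spare by auto

text \<open>The two loops coincide except at one place, where one uses \<open>e1\<close> and the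
  other \<open>e2\<close>.\<close>

lemma two_loops:
  assumes "u \<in> V"
  shows "\<exists>s1\<in>still (2 * conn_len + 1). \<exists>s2\<in>still (2 * conn_len + 1). s1 \<noteq> s2 \<and> ends s1 = (u, u) \<and> ends s2 = (u, u)"
proof -
  obtain a where a: "a \<in> still conn_len" "ends a = (u, src e1)" using connect[OF order_refl assms e1_V(1)] by blast
  obtain b where b: "b \<in> still conn_len" "ends b = (tgt e1, u)" using connect[OF order_refl e1_V(2) assms] by blast
  have *: "a @ [e] @ b \<in> still (2 * conn_len + 1) \<and> ends (a @ [e] @ b) = (u, u)" if "e \<in> {e1, e2}" for e
  proof -
    have e: "[e] \<in> still 1" "ends [e] = (src e1, tgt e1)"
      using that single_still spare parallel by (auto simp: ends_def)
    note eb = append_still[OF e(1) b(1)] append_path(2)[OF stillD(1)[OF e(1)] stillD(1)[OF b(1)]]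
    have eb: "[e] @ b \<in> still (1 + conn_len)" "ends ([e] @ b) = (src e1, u)"
      using eb conn_len_pos e b by auto
    have "a @ ([e] @ b) \<in> still (conn_len + (1 + conn_len))" "ends (a @ ([e] @ b)) = (u, u)"
      using append_still[OF a(1) eb(1)] append_path(2)[OF stillD(1)[OF a(1)] stillD(1)[OF eb(1)]]
        conn_len_pos a eb by auto
    thus ?thesis by (simp add: mult_2 add.assoc)
  qed
  from *[of e1] *[of e2] show ?thesis using spare by (intro bexI[of _ "a @ [e1] @ b"] bexI[of _ "a @ [e2] @ b"]) auto
qed

text \<open>Each of \<open>k\<close> initial loops at \<open>u\<close> is chosen from two loops of
  equal length.\<close>

lemma card_still_ge:
  assumes "u \<in> V" "v \<in> V" "Q \<ge> conn_len + k * (2 * conn_len + 1)"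
  shows "2 ^ k \<le> card {w \<in> still Q. ends w = (u, v)}"
  using assms(3)
proof (induction k arbitrary: Q)
  case 0
  then obtain w where "w \<in> {w \<in> still Q. ends w = (u, v)}" using connect[of Q u v] assms by auto
  moreover have "finite {w \<in> still Q. ends w = (u, v)}" using finite_moved by simp
  ultimately have "card {w \<in> still Q. ends w = (u, v)} > 0" using card_gt_0_iff by blast
  then show ?case by simp
next
  case (Suc k)
  define D where "D = 2 * conn_len + 1"
  obtain s1 s2 where s: "s1 \<in> still D" "s2 \<in> still D" "s1 \<noteq> s2" "ends s1 = (u, u)" "ends s2 = (u, u)"
    using two_loops[OF assms(1)] by (auto simp: D_def)
  define Q' where "Q' = Q - D"
  have Q': "Q = D + Q'" "Q' \<ge> conn_len + k * D" using Suc.prems by (simp_all add: Q'_def D_def)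
  have pos: "D > 0" "Q' > 0" using Q' conn_len_pos by (auto simp: D_def)
  let ?S = "{w \<in> still Q'. ends w = (u, v)}"
  have "inj_on (\<lambda>(s, w). s @ w) ({s1, s2} \<times> ?S)"
  proof (rule inj_onI, clarify)
    fix s w s' w' assume "s \<in> {s1, s2}" "s' \<in> {s1, s2}" "s @ w = s' @ w'"
    moreover have "length s1 = length s2" using s stillD pathsD(1) by metis
    ultimately show "s = s' \<and> w = w'" by auto
  qed
  moreover have "(\<lambda>(s, w). s @ w) ` ({s1, s2} \<times> ?S) \<subseteq> {w \<in> still Q. ends w = (u, v)}"
  proof clarify
    fix s w assume a: "s \<in> {s1, s2}" "w \<in> still Q'" "ends w = (u, v)"
    hence sw: "s \<in> still D" "ends s = (u, u)" using s by auto
    show "s @ w \<in> still Q \<and> ends (s @ w) = (u, v)"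
      using append_still[OF sw(1) a(2) pos] append_path(2)[OF stillD(1)[OF sw(1)] stillD(1)[OF a(2)] pos] sw a Q'
      by simp
  qed
  ultimately have "card ({s1, s2} \<times> ?S) \<le> card {w \<in> still Q. ends w = (u, v)}"
    using finite_moved by (intro card_inj_on_le) auto
  moreover have "card ({s1, s2} \<times> ?S) = 2 * card ?S" using s(3) by (simp add: card_cartesian_product)
  moreover have "2 ^ k \<le> card ?S" using Suc.IH[of Q'] Q' by (simp add: D_def)
  ultimately show ?case by simp
qed

text \<open>The number grows exponentially with \<open>Q\<close>. It has to exceed a multiple of
  \<open>Q\<close> because sets of still paths will encode the paths of length \<open>Q\<close>, of
  which there may be as many as \<open>2 ^ (card E * Q)\<close>.\<close>

lemma card_still_large:
  "\<exists>Q0. \<forall>Q\<ge>Q0. \<forall>u\<in>V. \<forall>v\<in>V. C * Q + C < card {w \<in> still Q. ends w = (u, v)}"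
proof -
  define D where "D = 2 * conn_len + 1"
  define a where "a = C * D"
  define b where "b = C * (conn_len + D) + C + 1"
  define Q0 where "Q0 = conn_len + (a + b + 4) * D"
  have "C * Q + C < card {w \<in> still Q. ends w = (u, v)}" if Q: "Q \<ge> Q0" "u \<in> V" "v \<in> V" for Q u v
  proof -
    define k where "k = (Q - conn_len) div D"
    have D: "D > 0" by (simp add: D_def)
    have c: "conn_len \<le> Q" using Q by (simp add: Q0_def)
    have "k * D \<le> Q - conn_len" "Q - conn_len < k * D + D"
      using D dividend_less_div_times[of D "Q - conn_len"] by (simp_all add: k_def)
    hence kD: "Q \<ge> conn_len + k * D" "Q < conn_len + k * D + D" using c by linarith+
    have "(a + b + 4) * D \<le> Q - conn_len" using Q(1) unfolding Q0_def by linarith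
    hence "k \<ge> a + b + 4" unfolding k_def by (simp add: less_eq_div_iff_mult_less_eq D)
    hence "a * k + b \<le> 2 ^ k" by (rule linear_le_power_two)
    moreover have "C * Q + C < a * k + b"
    proof -
      have "C * Q \<le> C * (conn_len + k * D + D)" using kD(2) by (intro mult_left_mono) auto
      also have "\<dots> = a * k + C * (conn_len + D)" by (simp add: a_def algebra_simps)
      finally show ?thesis by (simp add: b_def)
    qed
    moreover have "2 ^ k \<le> card {w \<in> still Q. ends w = (u, v)}"
      using card_still_ge[OF Q(2,3)] kD(1) by (simp add: D_def)
    ultimately show ?thesis by linarith
  qed
  thus ?thesis by blast
qed

lemma card_paths_le: "card (paths n) \<le> 2 ^ (card E * n)"
proof -
  have "card (paths n) \<le> card {w. set w \<subseteq> E \<and> length w = n}"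
    using finite_lists_length_eq[OF finite_edges] by (intro card_mono) (auto simp: paths_def)
  also have "\<dots> = card E ^ n" using card_lists_length_eq[OF finite_edges] .
  also have "\<dots> \<le> (2 ^ card E) ^ n" by (intro power_mono) auto
  finally show ?thesis by (simp add: power_mult)
qed

lemma concat_map_path:
  assumes "w \<in> paths (j * N)" "N > 0" "j > 0" "\<And>l. l < j \<Longrightarrow> h l \<in> paths N \<and> ends (h l) = ends (chunk N w l)"
  shows "concat (map h [0..<j]) \<in> paths (j * N)" "ends (concat (map h [0..<j])) = ends w"
    "l < j \<Longrightarrow> chunk N (concat (map h [0..<j])) l = h l"
proof -
  let ?ws = "map h [0..<j]"
  have "concat ?ws \<in> paths (length ?ws * N) \<and> ends (concat ?ws) = (fst (ends (hd ?ws)), snd (ends (last ?ws)))"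
    using assms chunk_ends(1)[OF assms(1,2)] by (intro concat_in_paths) auto
  moreover have "hd ?ws = h 0" "last ?ws = h (j - 1)"
    using assms(3) by (auto simp: hd_map last_map)
  ultimately show "concat ?ws \<in> paths (j * N)" "ends (concat ?ws) = ends w"
    using assms chunk_ends(2)[OF assms(1,2,3)] by simp_all
  show "chunk N (concat ?ws) l = h l" if "l < j"
  proof -
    have "chunk N (concat ?ws) l = ?ws ! l" using assms(4) that pathsD(1) by (intro chunk_concat) auto
    thus ?thesis using that by simp
  qed
qed

lemma moved_iff_chunk:
  assumes "w \<in> paths (j * N)"
  shows "w \<in> moved (j * N) \<longleftrightarrow> (\<exists>l<j. chunk N w l \<in> moved N)"
  using set_chunks[OF pathsD(1)[OF assms]] chunk_in_paths[OF assms] assms by (auto simp: moved_def)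

lemma chunk_chunk:
  "l < m \<Longrightarrow> chunk N (chunk (m * N) w i) l = chunk N w (i * m + l)"
proof -
  assume l: "l < m"
  have "(l + 1) * N \<le> m * N" using l by (intro mult_right_mono) auto
  hence le: "N + l * N \<le> m * N" by simp
  have "take N (drop (l * N) (take (m * N) (drop (i * (m * N)) w))) = take N (take (m * N - l * N) (drop (l * N) (drop (i * (m * N)) w)))"
    by (simp add: drop_take)
  also have "\<dots> = take N (drop (l * N) (drop (i * (m * N)) w))" using le by (simp add: min_def)
  also have "\<dots> = take N (drop ((i * m + l) * N) w)" by (simp add: algebra_simps)
  finally show ?thesis by (simp add: chunk_def)
qed

text \<open>The members of a class share their ends, but the index of the class need not be that
  pair of ends: at length 1 the edges of \<open>E0\<close> all have the same ends and are
  nevertheless divided into one class for each pair of vertices. Eight is the degree that gives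
  simplicity.\<close>

definition level :: "nat \<Rightarrow> ('e list \<Rightarrow> 'e list) \<Rightarrow> ('e list \<Rightarrow> bool) \<Rightarrow> ('v \<times> 'v \<Rightarrow> 'e list set) \<Rightarrow> bool" where
  "level n f d T \<longleftrightarrow> n > 0 \<and> paired_partition (moved n) f d (V \<times> V) T \<and> (\<forall>w\<in>moved n. ends (f w) = ends w)
    \<and> (\<forall>i\<in>V \<times> V. 8 \<le> card (T i) \<and> (\<forall>w\<in>T i. \<forall>w'\<in>T i. ends w = ends w'))"

definition level_group :: "nat \<Rightarrow> ('e list \<Rightarrow> 'e list) \<Rightarrow> ('v \<times> 'v \<Rightarrow> 'e list set) \<Rightarrow> ('e list \<Rightarrow> 'e list) set" where
  "level_group n f T = paired_partition.paired_alt (moved n) f (V \<times> V) T"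

lemma V_ne: "V \<noteq> {}" using e1_V by auto

text \<open>Ends are preserved on unmarked paths because they are constant on classes, and on marked
  paths because \<open>f\<close> preserves them.\<close>

lemma level_group_facts:
  assumes "level n f d T" "g \<in> level_group n f T"
  shows "end_perm n g" "w \<in> still n \<Longrightarrow> g w = w" "w \<in> moved n \<Longrightarrow> g w \<in> moved n"
    "w \<in> moved n \<Longrightarrow> d (g w) = d w" "w \<in> moved n \<Longrightarrow> g (f w) = f (g w)"
proof -
  interpret paired_partition "moved n" f d "V \<times> V" T using assms by (simp add: level_def)
  have g: "g \<in> paired_alt" using assms(2) by (simp add: level_group_def)
  note gg = paired_altD[OF g]
  show "g w = w" if "w \<in> still n" for w using permutes_not_in[OF gg(1)] stillD(2)[OF that] .
  show "g w \<in> moved n" if "w \<in> moved n" for w using that permutes_in_image[OF gg(1)] by simp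
  show "d (g w) = d w" if "w \<in> moved n" for w using gg(5)[OF that] .
  show "g (f w) = f (g w)" if "w \<in> moved n" for w using gg(2)[OF that] .
  have 1: "ends (g w) = ends w" if "w \<in> moved n" "\<not> d w" for w
  proof -
    have "w \<in> (\<Union>i\<in>V \<times> V. T i)" unfolding UT using that by simp
    then obtain i where i: "i \<in> V \<times> V" "w \<in> T i" by (rule UN_E)
    hence "g w \<in> T i" using gg(4) by blast
    thus ?thesis using i assms(1) unfolding level_def by blast
  qed
  have 2: "ends (g w) = ends w" if w: "w \<in> moved n" for w
  proof (cases "d w")
    case True
    have fw: "f w \<in> moved n" "\<not> d (f w)" using f_in[OF w] df[OF w] True by auto
    have "ends (f (g w)) = ends (f w)" using 1[OF fw] gg(2)[OF w] by simp
    moreover have "g w \<in> moved n" using w permutes_in_image[OF gg(1)] by simp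
    ultimately show ?thesis using assms(1) w by (simp add: level_def)
  qed (use 1 w in auto)
  have "ends (g w) = ends w" if "w \<in> paths n" for w
    using paths_still_moved[OF that] 2 permutes_not_in[OF gg(1) stillD(2)] by metis
  moreover have "g permutes paths n" using permutes_subset[OF gg(1)] by (auto simp: moved_def)
  ultimately show "end_perm n g" by (simp add: end_perm_def)
qed

lemma level_group_closed:
  assumes "level n f d T"
  shows "id \<in> level_group n f T" "g \<in> level_group n f T \<Longrightarrow> h \<in> level_group n f T \<Longrightarrow> g \<circ> h \<in> level_group n f T"
    "g \<in> level_group n f T \<Longrightarrow> finv g \<in> level_group n f T" "finite (level_group n f T)"
proof -
  interpret paired_partition "moved n" f d "V \<times> V" T using assms by (simp add: level_def)
  show "id \<in> level_group n f T" "g \<in> level_group n f T \<Longrightarrow> h \<in> level_group n f T \<Longrightarrow> g \<circ> h \<in> level_group n f T"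
    "g \<in> level_group n f T \<Longrightarrow> finv g \<in> level_group n f T" "finite (level_group n f T)"
    using paired_alt_id paired_alt_comp paired_alt_inv finite_paired_alt by (simp_all only: level_group_def)
qed

end

section \<open>Flips and marks on concatenations of blocks\<close>

context parallel_graph
begin

text \<open>Diagonal actions keep still chunks still and moved chunks moved, so they do not change
  this position. A pairing and a marking that look only at this chunk are therefore compatible with
  them.\<close>

definition first_moved :: "nat \<Rightarrow> 'e list \<Rightarrow> nat" where
  "first_moved N w = (LEAST l. chunk N w l \<in> moved N)"

definition flip :: "nat \<Rightarrow> ('e list \<Rightarrow> 'e list) \<Rightarrow> nat \<Rightarrow> 'e list \<Rightarrow> 'e list" where
  "flip N f j w = concat (map (\<lambda>l. if l = first_moved N w then f (chunk N w l) else chunk N w l) [0..<j])"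

definition mark :: "nat \<Rightarrow> ('e list \<Rightarrow> bool) \<Rightarrow> 'e list \<Rightarrow> bool" where
  "mark N d w = d (chunk N w (first_moved N w))"

lemma first_moved:
  assumes "w \<in> moved (j * N)"
  shows "first_moved N w < j" "chunk N w (first_moved N w) \<in> moved N"
    "l < first_moved N w \<Longrightarrow> chunk N w l \<notin> moved N"
proof -
 obtain l0 where l: "l0 < j" "chunk N w l0 \<in> moved N" using moved_iff_chunk[OF movedD(1)[OF assms]] assms by blast
  have "first_moved N w \<le> l0" unfolding first_moved_def using l(2) by (rule Least_le)
  thus "first_moved N w < j" using l by simp
  show "chunk N w (first_moved N w) \<in> moved N" unfolding first_moved_def using l(2) by (rule LeastI)
  show "chunk N w l \<notin> moved N" if "l < first_moved N w"
    using that unfolding first_moved_def by (rule not_less_Least)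
qed

lemma first_moved_eqI:
  assumes "chunk N w l \<in> moved N" "\<And>k. k < l \<Longrightarrow> chunk N w k \<notin> moved N"
  shows "first_moved N w = l"
  unfolding first_moved_def using assms by (intro Least_equality) (auto simp: not_less[symmetric])

end

locale level_step = parallel_graph E src tgt E0 e1 e2
  for E :: "'e set" and src tgt :: "'e \<Rightarrow> 'v" and E0 e1 e2 +
  fixes N f d T
  assumes lev: "level N f d T"
begin

sublocale P: paired_partition "moved N" f d "V \<times> V" T
  using lev by (simp add: level_def)

abbreviation "G \<equiv> level_group N f T"

lemma N_pos: "N > 0" using lev by (simp add: level_def)

lemma ends_f: "w \<in> moved N \<Longrightarrow> ends (f w) = ends w" using lev unfolding level_def by blast

lemmas G_facts = level_group_facts[OF lev]
lemmas G_closed = level_group_closed[OF lev]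

lemma diag_still:
  assumes "g \<in> G" "j > 0" "w \<in> still (j * N)" shows "diag j N g w = w"
proof (rule chunk_ext[of _ j N])
  have w: "w \<in> paths (j * N)" using stillD assms by blast
  note dp = diag_path[OF N_pos assms(2) G_facts(1)[OF assms(1)] w]
  show "length (diag j N g w) = j * N" "length w = j * N" using dp(1) w pathsD by blast+
  fix l assume l: "l < j"
  have "chunk N w l \<notin> moved N" using moved_iff_chunk[OF w] stillD(2)[OF assms(3)] l by blast
  hence "chunk N w l \<in> still N" using paths_still_moved chunk_in_paths[OF w l] by blast
  thus "chunk N (diag j N g w) l = chunk N w l" using dp(3)[OF l] G_facts(2)[OF assms(1)] by simp
qed

lemma G_moved_iff: "g \<in> G \<Longrightarrow> w \<in> paths N \<Longrightarrow> g w \<in> moved N \<longleftrightarrow> w \<in> moved N"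
  using G_facts(2,3) paths_still_moved movedD(2) stillD(2) by metis

lemma diag_moved:
  assumes "g \<in> G" "j > 0" "w \<in> moved (j * N)"
  shows "diag j N g w \<in> moved (j * N)" "first_moved N (diag j N g w) = first_moved N w"
    "mark N d (diag j N g w) = mark N d w"
proof -
  have w: "w \<in> paths (j * N)" using movedD assms by blast
  note dp = diag_path[OF N_pos assms(2) G_facts(1)[OF assms(1)] w]
  note fm = first_moved[OF assms(3)]
  have c: "chunk N (diag j N g w) l \<in> moved N \<longleftrightarrow> chunk N w l \<in> moved N" if "l < j" for l
    using dp(3)[OF that] G_moved_iff[OF assms(1) chunk_in_paths[OF w that]] by simp
  show "diag j N g w \<in> moved (j * N)" using c[OF fm(1)] fm moved_iff_chunk[OF dp(1)] by blast
  show *: "first_moved N (diag j N g w) = first_moved N w"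
  proof (rule first_moved_eqI)
    show "chunk N (diag j N g w) (first_moved N w) \<in> moved N" using c[OF fm(1)] fm by blast
    show "chunk N (diag j N g w) k \<notin> moved N" if "k < first_moved N w" for k
      using c[of k] fm that by (meson order_less_trans)
  qed
  show "mark N d (diag j N g w) = mark N d w"
    unfolding mark_def * using dp(3)[OF fm(1)] G_facts(4)[OF assms(1) fm(2)] by simp
qed

lemma flip:
  assumes "j > 0" "w \<in> moved (j * N)"
  shows "flip N f j w \<in> moved (j * N)" "ends (flip N f j w) = ends w"
    "first_moved N (flip N f j w) = first_moved N w"
    "l < j \<Longrightarrow> chunk N (flip N f j w) l = (if l = first_moved N w then f (chunk N w l) else chunk N w l)"
    "mark N d (flip N f j w) \<longleftrightarrow> \<not> mark N d w" "flip N f j (flip N f j w) = w"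
proof -
  have w: "w \<in> paths (j * N)" using movedD assms by blast
  note fm = first_moved[OF assms(2)]
  let ?h = "\<lambda>l. if l = first_moved N w then f (chunk N w l) else chunk N w l"
  have h: "?h l \<in> paths N \<and> ends (?h l) = ends (chunk N w l)" if "l < j" for l
    using P.f_in[OF fm(2)] movedD(1) ends_f[OF fm(2)] chunk_in_paths[OF w that] by auto
  note cm = concat_map_path[where h = ?h, OF w N_pos assms(1) h, folded flip_def]
  show 4: "chunk N (flip N f j w) l = ?h l" if "l < j" for l using cm(3) that by blast
  show "ends (flip N f j w) = ends w" using cm(2) .
  have fmc: "chunk N (flip N f j w) (first_moved N w) = f (chunk N w (first_moved N w))" using 4[OF fm(1)] by simp
  show 1: "flip N f j w \<in> moved (j * N)"
    using moved_iff_chunk[OF cm(1)] fm(1) fmc P.f_in[OF fm(2)] by metis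
  show 3: "first_moved N (flip N f j w) = first_moved N w"
  proof (rule first_moved_eqI)
    show "chunk N (flip N f j w) (first_moved N w) \<in> moved N" using fmc P.f_in[OF fm(2)] by simp
    show "chunk N (flip N f j w) k \<notin> moved N" if "k < first_moved N w" for k
      using 4[of k] fm that by auto
  qed
  show "mark N d (flip N f j w) \<longleftrightarrow> \<not> mark N d w"
    unfolding mark_def 3 fmc using P.df[OF fm(2)] .
  have c1: "flip N f j w \<in> paths (j * N)" using cm(1) .
  have h': "(\<lambda>l. if l = first_moved N (flip N f j w) then f (chunk N (flip N f j w) l) else chunk N (flip N f j w) l) l
      = chunk N w l" if "l < j" for l
    using 4[OF that] 3 P.ff[OF fm(2)] by auto
  have "flip N f j (flip N f j w) = concat (map (chunk N w) [0..<j])"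
    unfolding flip_def[of N f j "flip N f j w"] using h' by (intro arg_cong[where f = concat] map_cong) auto
  thus "flip N f j (flip N f j w) = w" using concat_chunks[OF pathsD(1)[OF w]] by simp
qed

lemma flip_diag:
  assumes "g \<in> G" "j > 0" "w \<in> moved (j * N)"
  shows "flip N f j (diag j N g w) = diag j N g (flip N f j w)"
proof (rule chunk_ext[of _ j N])
  note dm = diag_moved[OF assms] and fl = flip[OF assms(2,3)]
  note fd = flip[OF assms(2) dm(1)] and df = diag_moved[OF assms(1,2) fl(1)]
  show "length (flip N f j (diag j N g w)) = j * N" "length (diag j N g (flip N f j w)) = j * N"
    using fd(1) df(1) movedD pathsD by blast+
  fix l assume l: "l < j"
  note fm = first_moved[OF assms(3)]
  show "chunk N (flip N f j (diag j N g w)) l = chunk N (diag j N g (flip N f j w)) l"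
    using fd(4)[OF l] fl(4)[OF l] dm(2) diag_path(3)[OF N_pos assms(2) G_facts(1)[OF assms(1)] movedD(1)[OF assms(3)] l]
      diag_path(3)[OF N_pos assms(2) G_facts(1)[OF assms(1)] movedD(1)[OF fl(1)] l] G_facts(5)[OF assms(1) fm(2)]
    by auto
qed

text \<open>The first moved \<open>N\<close>-chunk lies in the first third, so the mark is read
  there and the flip leaves the other two thirds alone.\<close>

lemma first_third:
  assumes "m > 0" "w \<in> paths (3 * m * N)" "chunk (m * N) w 0 \<in> moved (m * N)"
  shows "w \<in> moved (3 * m * N)" "first_moved N w = first_moved N (chunk (m * N) w 0)"
    "mark N d w = mark N d (chunk (m * N) w 0)"
    "chunk (m * N) (flip N f (3 * m) w) 0 = flip N f m (chunk (m * N) w 0)"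
    "i \<in> {1, 2} \<Longrightarrow> chunk (m * N) (flip N f (3 * m) w) i = chunk (m * N) w i"
proof -
  let ?x = "chunk (m * N) w 0"
  note fm = first_moved[OF assms(3)]
  have cc: "chunk N ?x l = chunk N w l" if "l < m" for l using chunk_chunk[OF that, of N w 0] by simp
  show 2: "first_moved N w = first_moved N ?x"
    using fm cc by (intro first_moved_eqI) (auto simp: order_less_trans)
  have "first_moved N ?x < 3 * m" using fm(1) by simp
  thus 1: "w \<in> moved (3 * m * N)" using moved_iff_chunk[OF assms(2)] fm(2) cc[OF fm(1)] by metis
  show "mark N d w = mark N d ?x" unfolding mark_def 2 using cc[OF fm(1)] by simp
  have m3: "3 * m > 0" using assms by simp
  note fl = flip[OF m3 1] and fx = flip[OF assms(1,3)]
  have wp: "flip N f (3 * m) w \<in> paths (3 * (m * N))" using movedD(1)[OF fl(1)] by (simp add: mult.assoc)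
  have wp': "w \<in> paths (3 * (m * N))" using assms(2) by (simp add: mult.assoc)
  show "chunk (m * N) (flip N f (3 * m) w) 0 = flip N f m ?x"
  proof (rule chunk_ext[of _ m N])
    show "length (chunk (m * N) (flip N f (3 * m) w) 0) = m * N"
      using chunk_in_paths[OF wp, of 0] pathsD by simp
    show "length (flip N f m ?x) = m * N" using fx(1) movedD pathsD by blast
    fix l assume l: "l < m"
    show "chunk N (chunk (m * N) (flip N f (3 * m) w) 0) l = chunk N (flip N f m ?x) l"
      unfolding chunk_chunk[OF l, of N "flip N f (3 * m) w" 0] fx(4)[OF l] cc[OF l] using fl(4)[of l] l 2 by simp
  qed
  show "chunk (m * N) (flip N f (3 * m) w) i = chunk (m * N) w i" if i: "i \<in> {1, 2}"
  proof (rule chunk_ext[of _ m N])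
    show "length (chunk (m * N) (flip N f (3 * m) w) i) = m * N" "length (chunk (m * N) w i) = m * N"
      using chunk_in_paths[OF wp, of i] chunk_in_paths[OF wp', of i] i pathsD by auto
    fix l assume l: "l < m"
    have "i * m + l < 3 * m" "i * m + l \<noteq> first_moved N w" using i l 2 fm(1) by auto
    thus "chunk N (chunk (m * N) (flip N f (3 * m) w) i) l = chunk N (chunk (m * N) w i) l"
      unfolding chunk_chunk[OF l] using fl(4)[of "i * m + l"] by simp
  qed
qed

lemma chunk_diag:
  assumes "m > 0" "w \<in> paths (3 * m * N)" "g \<in> G" "i < 3"
  shows "chunk (m * N) (diag (3 * m) N g w) i = diag m N g (chunk (m * N) w i)"
proof (rule chunk_ext[of _ m N])
  have m3: "3 * m > 0" using assms by simp
  have wp': "w \<in> paths (3 * (m * N))" using assms(2) by (simp add: mult.assoc)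
  note dp = diag_path[OF N_pos m3 G_facts(1)[OF assms(3)] assms(2)]
  have wp: "diag (3 * m) N g w \<in> paths (3 * (m * N))" using dp(1) by (simp add: mult.assoc)
  have ci: "chunk (m * N) w i \<in> paths (m * N)" using chunk_in_paths[OF wp' assms(4)] .
  note di = diag_path[OF N_pos assms(1) G_facts(1)[OF assms(3)] ci]
  show "length (chunk (m * N) (diag (3 * m) N g w) i) = m * N" "length (diag m N g (chunk (m * N) w i)) = m * N"
    using chunk_in_paths[OF wp assms(4)] di(1) pathsD by blast+
  fix l assume l: "l < m"
  have "i * m + l < 3 * m" 
  proof -
    have "i * m + m \<le> 3 * m" using assms(4) mult_le_mono1[of "i + 1" 3 m] by simp
    thus ?thesis using l by linarith
  qed
  thus "chunk N (chunk (m * N) (diag (3 * m) N g w) i) l = chunk N (diag m N g (chunk (m * N) w i)) l"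
    unfolding chunk_chunk[OF l] di(3)[OF l] using dp(3)[of "i * m + l"] by simp
qed

text \<open>The moved blocks are strung together by still connections whose lengths are multiples of
  \<open>N\<close>; thus each of them starts at a multiple of \<open>N\<close> and appears as a
  chunk.\<close>

lemma covering_path:
  "\<exists>m0. \<forall>m\<ge>m0. \<exists>w\<in>paths (m * N). \<forall>b\<in>moved N. \<exists>l<m. chunk N w l = b"
proof -
  have "\<exists>m0>0. \<forall>m\<ge>m0. \<exists>w\<in>paths (m * N). \<forall>b\<in>S. \<exists>l<m. chunk N w l = b" if "finite S" "S \<subseteq> moved N" for S
    using that
  proof (induction S rule: finite_induct)
    case empty
    have "\<exists>w\<in>paths (m * N). True" if "m \<ge> conn_len" for m
    proof -
      have "1 \<le> N" using N_pos by simp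
      hence "m * N \<ge> m * 1" by (intro mult_left_mono) auto
      hence "m * N \<ge> conn_len" using that by linarith
      thus ?thesis using connect[of "m * N" "src e1" "src e1"] e1_V stillD by blast
    qed
    thus ?case using conn_len_pos by (intro exI[of _ conn_len]) auto
  next
    case (insert b S)
    then obtain m0 where m0: "m0 > 0" "\<And>m. m \<ge> m0 \<Longrightarrow> \<exists>w\<in>paths (m * N). \<forall>b\<in>S. \<exists>l<m. chunk N w l = b" by auto
    define c where "c = conn_len"
    have N1: "1 \<le> N" using N_pos by simp
    have cN: "c * N \<ge> c * 1" "c > 0" using conn_len_pos mult_left_mono[OF N1, of c] by (auto simp: c_def)
    have b: "b \<in> paths N" using insert movedD by blast
    have "\<exists>w\<in>paths (m * N). \<forall>b\<in>insert b S. \<exists>l<m. chunk N w l = b" if m: "m \<ge> m0 + c + 1" for m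
    proof -
      define k where "k = m - (c + 1)"
      have k: "m = k + c + 1" "k \<ge> m0" "k > 0" using m m0(1) by (auto simp: k_def)
      obtain w where w: "w \<in> paths (k * N)" "\<And>b. b \<in> S \<Longrightarrow> \<exists>l<k. chunk N w l = b" using m0(2)[OF k(2)] by blast
      have kN: "k * N > 0" using k N_pos by simp
      obtain a where a: "a \<in> paths (c * N)" "ends a = (snd (ends w), fst (ends b))"
        using connect[of "c * N" "snd (ends w)" "fst (ends b)"] cN ends_V[OF w(1) kN] ends_V[OF b N_pos] stillD
        by (auto simp: c_def)
      have ab: "a @ b \<in> paths (c * N + N)" "ends (a @ b) = (snd (ends w), snd (ends b))"
        using append_path[OF a(1) b] cN N_pos a by auto
      have wab: "w @ a @ b \<in> paths (k * N + (c * N + N))"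
        using append_path[OF w(1) ab(1) kN] N_pos ab by auto
      have lw: "length w = k * N" "length a = c * N" "length b = N" using w a b pathsD by auto
      have "chunk N (w @ a @ b) l = chunk N w l" if "l < k" for l
      proof -
        have "(l + 1) * N \<le> k * N" using that by (intro mult_right_mono) auto
        thus ?thesis using lw by (simp add: chunk_def)
      qed
      moreover have "chunk N (w @ a @ b) (k + c) = b" using lw by (simp add: chunk_def algebra_simps)
      moreover have "k < m" "k + c < m" using k by simp_all
      ultimately have "\<exists>l<m. chunk N (w @ a @ b) l = b'" if "b' \<in> insert b S" for b'
        using w(2) that by (metis insert_iff order_less_trans)
      moreover have "k * N + (c * N + N) = m * N" using k by (simp add: algebra_simps)
      ultimately show ?thesis using wab by metis
    qed
    thus ?case by (intro exI[of _ "m0 + c + 1"]) auto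
  qed
  from this[OF finite_moved(1) order_refl] show ?thesis by blast
qed

end

section \<open>Twisted markings and rigidity\<close>

context parallel_graph
begin

definition end_classes :: "nat \<Rightarrow> ('e list \<Rightarrow> bool) \<Rightarrow> 'v \<times> 'v \<Rightarrow> 'e list set" where
  "end_classes n d i = {w \<in> moved n. ends w = i \<and> \<not> d w}"

text \<open>A fixed prefix that ends with an edge of \<open>E0\<close> makes every continuation
  moved.\<close>

lemma card_moved_ge:
  assumes "e \<in> E0" "u \<in> V" and n: "n > 0"
  shows "card {w \<in> paths n. ends w = (tgt e1, v)} \<le> card {w \<in> moved (conn_len + 1 + n). ends w = (u, v)}"
proof -
  obtain a where a: "a \<in> still conn_len" "ends a = (u, src e1)" using connect[OF order_refl assms(2) e1_V(1)] by blast
  have e: "[e] \<in> moved 1" "ends [e] = (src e1, tgt e1)"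
    using assms(1) parallel(1)[OF assms(1)] E0_sub by (auto simp: moved_def paths_def ends_def)
  have ae: "a @ [e] \<in> moved (conn_len + 1)" "ends (a @ [e]) = (u, tgt e1)"
    using append_moved[OF stillD(1)[OF a(1)] movedD(1)[OF e(1)]] append_path(2)[OF stillD(1)[OF a(1)] movedD(1)[OF e(1)]]
      conn_len_pos a e by auto
  show ?thesis
  proof (rule card_inj_on_le[where f = "\<lambda>w. (a @ [e]) @ w"])
    show "inj_on (\<lambda>w. (a @ [e]) @ w) {w \<in> paths n. ends w = (tgt e1, v)}" by (auto simp: inj_on_def)
    show "(\<lambda>w. (a @ [e]) @ w) ` {w \<in> paths n. ends w = (tgt e1, v)} \<subseteq> {w \<in> moved (conn_len + 1 + n). ends w = (u, v)}"
    proof clarify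
      fix w assume w: "w \<in> paths n" "ends w = (tgt e1, v)"
      show "(a @ [e]) @ w \<in> moved (conn_len + 1 + n) \<and> ends ((a @ [e]) @ w) = (u, v)"
        using append_moved[OF movedD(1)[OF ae(1)] w(1) _ n] append_path(2)[OF movedD(1)[OF ae(1)] w(1) _ n]
          ae w by simp
    qed
    show "finite {w \<in> moved (conn_len + 1 + n). ends w = (u, v)}" using finite_moved by simp
  qed
qed

end

text \<open>The codes \<open>\<kappa> z\<close> are sets of still blocks and not single blocks,
  since moved blocks may outnumber still ones. Injectivity is asked among blocks with the same
  start, because the middle block already determines where \<open>z\<close> starts. The bound 16
  leaves 8 unmarked paths in each class.\<close>

locale step_data = level_step E src tgt E0 e1 e2 N f d T
  for E :: "'e set" and src tgt :: "'e \<Rightarrow> 'v" and E0 e1 e2 N f d T +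
  fixes m w0 \<kappa> c0
  assumes m_pos: "m > 0" and conn: "m * N \<ge> conn_len"
    and w0: "w0 \<in> paths (m * N)" and cover: "\<And>b. b \<in> moved N \<Longrightarrow> \<exists>l<m. chunk N w0 l = b"
    and kap: "\<And>z. z \<in> moved (m * N) \<Longrightarrow> \<kappa> z \<noteq> {}"
      "\<And>z. z \<in> moved (m * N) \<Longrightarrow> \<kappa> z \<subseteq> {c \<in> still (m * N). ends c = (snd (ends w0), fst (ends z))} - {c0 (fst (ends z))}"
    and c0: "\<And>v. v \<in> V \<Longrightarrow> c0 v \<in> still (m * N) \<and> ends (c0 v) = (snd (ends w0), v)"
    and kinj: "\<And>z z'. z \<in> moved (m * N) \<Longrightarrow> z' \<in> moved (m * N) \<Longrightarrow> fst (ends z) = fst (ends z') \<Longrightarrow> \<kappa> z = \<kappa> z' \<Longrightarrow> z = z'"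
    and large: "\<And>i. i \<in> V \<times> V \<Longrightarrow> 16 \<le> card {w \<in> moved (3 * m * N). ends w = i}"
begin

abbreviation "Q \<equiv> m * N"

text \<open>The block \<open>w0\<close> contains every moved \<open>N\<close>-block, so \<open>G\<close> acts freely on the diagonal orbit of \<open>w0\<close>, and
  \<open>\<kappa> z\<close> identifies \<open>z\<close> among the blocks with the same start. The middle block is fixed by the diagonal
  action. Hence a permutation that acts separately on the three blocks and respects the twist must
  carry any \<open>z\<close> by the same \<open>g\<close> as \<open>w0\<close>. The block \<open>c0\<close>, which lies in no \<open>\<kappa> z\<close>, provides untwisted
  paths for comparison.\<close>

definition twist :: "'e list \<Rightarrow> bool" where
  "twist w \<longleftrightarrow> (\<exists>g\<in>G. \<exists>z\<in>moved Q. (chunk Q w 0 = diag m N g w0 \<or> chunk Q w 0 = flip N f m (diag m N g w0))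
     \<and> chunk Q w 2 = diag m N g z \<and> chunk Q w 1 \<in> \<kappa> z)"

text \<open>Twists are invariant under flips and under diagonal actions. The exclusive or therefore
  retains both properties of \<open>mark\<close>: flips exchange marked and unmarked paths, and
  diagonal elements preserve the marking.\<close>

definition mark' :: "'e list \<Rightarrow> bool" where "mark' w \<longleftrightarrow> mark N d w \<noteq> twist w"

abbreviation "flip' \<equiv> flip N f (3 * m)"

abbreviation "T' \<equiv> end_classes (3 * m * N) mark'"

lemma m3: "3 * m > 0" using m_pos by simp

lemma Q_pos: "Q > 0" using m_pos N_pos by simp

lemma moved_ne: "moved N \<noteq> {}"
proof
  assume "moved N = {}"
  obtain u where u: "u \<in> V" using V_ne by blast
  have "8 \<le> card (T (u, u))" using lev u unfolding level_def by blast
  hence "T (u, u) \<noteq> {}" by auto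
  thus False using P.T_sub[of "(u, u)"] u \<open>moved N = {}\<close> by blast
qed

lemma w0_moved: "w0 \<in> moved Q"
  using moved_ne cover moved_iff_chunk[OF w0] by blast

text \<open>All moved \<open>N\<close>-blocks occur as chunks of \<open>w0\<close>, and on
  everything else both permutations are the identity.\<close>

lemma diag_w0_eq_iff:
  assumes "g \<in> G" "h \<in> G" "diag m N g w0 = diag m N h w0" shows "g = h"
proof
  fix b
  show "g b = h b"
  proof (cases "b \<in> moved N")
    case True
    then obtain l where l: "l < m" "chunk N w0 l = b" using cover by blast
    show ?thesis
      using diag_path(3)[OF N_pos m_pos G_facts(1)[OF assms(1)] w0 l(1)]
        diag_path(3)[OF N_pos m_pos G_facts(1)[OF assms(2)] w0 l(1)] l assms(3) by simp
  next
    case False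
    have "p b = b" if "p \<in> G" for p
      using P.paired_altD(1)[of p] that permutes_not_in[OF _ False] by (simp add: level_group_def)
    from this[OF assms(1)] this[OF assms(2)] show ?thesis by simp
  qed
qed

lemma diag_diag: "g \<in> G \<Longrightarrow> h \<in> G \<Longrightarrow> j > 0 \<Longrightarrow> diag j N g (diag j N h w) = diag j N (g \<circ> h) w"
  using diag_comp[OF N_pos _ G_facts(1) G_facts(1), of j g h] by simp

lemma twist_moved:
  assumes "twist w" shows "chunk Q w 0 \<in> moved Q"
  using assms diag_moved(1)[OF _ m_pos w0_moved] flip(1)[OF m_pos] by (auto simp: twist_def)

text \<open>The witness \<open>g\<close> becomes \<open>h \<circ> g\<close>; the middle block is
  still, hence fixed, and stays in \<open>\<kappa> z\<close>.\<close>

lemma twist_diag_imp: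
  assumes "w \<in> paths (3 * m * N)" "h \<in> G" "twist w" shows "twist (diag (3 * m) N h w)"
proof -
  obtain g z where gz: "g \<in> G" "z \<in> moved Q" "chunk Q w 0 = diag m N g w0 \<or> chunk Q w 0 = flip N f m (diag m N g w0)"
    "chunk Q w 2 = diag m N g z" "chunk Q w 1 \<in> \<kappa> z" using assms(3) by (auto simp: twist_def)
  have c: "chunk Q (diag (3 * m) N h w) i = diag m N h (chunk Q w i)" if "i < 3" for i
    using chunk_diag[OF m_pos assms(1,2) that] .
  have "chunk Q (diag (3 * m) N h w) 0 = diag m N (h \<circ> g) w0 \<or>
    chunk Q (diag (3 * m) N h w) 0 = flip N f m (diag m N (h \<circ> g) w0)"
    using gz(3)
  proof
    assume "chunk Q w 0 = diag m N g w0"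
    thus ?thesis using c[of 0] diag_diag[OF assms(2) gz(1) m_pos] by simp
  next
    assume "chunk Q w 0 = flip N f m (diag m N g w0)"
    thus ?thesis using c[of 0] diag_diag[OF assms(2) gz(1) m_pos]
        flip_diag[OF assms(2) m_pos diag_moved(1)[OF gz(1) m_pos w0_moved]] by simp
  qed
  moreover have "chunk Q (diag (3 * m) N h w) 2 = diag m N (h \<circ> g) z"
    using c[of 2] gz(4) diag_diag[OF assms(2) gz(1) m_pos] by simp
  moreover have "chunk Q w 1 \<in> still Q" using kap(2)[OF gz(2)] gz(5) by blast
  hence "chunk Q (diag (3 * m) N h w) 1 \<in> \<kappa> z" using c[of 1] gz(5) diag_still[OF assms(2) m_pos] by simp
  moreover have "h \<circ> g \<in> G" using G_closed(2)[OF assms(2) gz(1)] .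
  ultimately show ?thesis using gz(2) unfolding twist_def by blast
qed

lemma twist_diag:
  assumes "w \<in> paths (3 * m * N)" "h \<in> G" shows "twist (diag (3 * m) N h w) = twist w"
proof -
  have "diag (3 * m) N (finv h) (diag (3 * m) N h w) = w"
  proof -
    have "finv h \<circ> h = id" using permutes_inv_o(2)[of h "paths N"] G_facts(1)[OF assms(2)] by (simp add: end_perm_def)
    thus ?thesis using diag_diag[OF G_closed(3)[OF assms(2)] assms(2) m3] diag_id by (metis id_apply)
  qed
  moreover have "diag (3 * m) N h w \<in> paths (3 * m * N)" using diag_path(1)[OF N_pos m3 G_facts(1)[OF assms(2)] assms(1)] .
  ultimately show ?thesis using twist_diag_imp[OF assms] twist_diag_imp[OF _ G_closed(3)[OF assms(2)]] by metis
qed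

text \<open>A flip changes only the first block and exchanges the two alternatives that
  \<open>twist\<close> admits for it.\<close>

lemma twist_flip_imp:
  assumes "w \<in> moved (3 * m * N)" "twist w" shows "twist (flip' w)"
proof -
  obtain g z where gz: "g \<in> G" "z \<in> moved Q" "chunk Q w 0 = diag m N g w0 \<or> chunk Q w 0 = flip N f m (diag m N g w0)"
    "chunk Q w 2 = diag m N g z" "chunk Q w 1 \<in> \<kappa> z" using assms(2) by (auto simp: twist_def)
  note ft = first_third[OF m_pos movedD(1)[OF assms(1)] twist_moved[OF assms(2)]]
  have "chunk Q (flip' w) 0 = diag m N g w0 \<or> chunk Q (flip' w) 0 = flip N f m (diag m N g w0)"
    using gz(3) ft(4) flip(6)[OF m_pos diag_moved(1)[OF gz(1) m_pos w0_moved]] by auto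
  thus ?thesis using gz ft(5)[of 1] ft(5)[of 2] unfolding twist_def by auto
qed

lemma twist_flip: "w \<in> moved (3 * m * N) \<Longrightarrow> twist (flip' w) = twist w"
  using twist_flip_imp flip(1,6)[OF m3] by metis

text \<open>\<open>flip'\<close> matches the marked with the unmarked paths between the same
  vertices.\<close>

lemma card_end_classes:
  assumes "i \<in> V \<times> V" shows "2 * card (T' i) = card {w \<in> moved (3 * m * N). ends w = i}"
proof -
  let ?A = "{w \<in> moved (3 * m * N). ends w = i}"
  have m': "mark' (flip' w) \<longleftrightarrow> \<not> mark' w" if "w \<in> moved (3 * m * N)" for w
    using flip(5)[OF m3 that] twist_flip[OF that] by (auto simp: mark'_def)
  have "bij_betw flip' {w \<in> ?A. mark' w} {w \<in> ?A. \<not> mark' w}"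
    by (rule bij_betw_byWitness[where f' = flip']) (use flip[OF m3] m' in auto)
  hence "card {w \<in> ?A. mark' w} = card {w \<in> ?A. \<not> mark' w}" by (rule bij_betw_same_card)
  moreover have "card ?A = card {w \<in> ?A. mark' w} + card {w \<in> ?A. \<not> mark' w}"
    using finite_moved by (subst card_Un_disjoint[symmetric]) (auto intro!: arg_cong[where f = card])
  ultimately show ?thesis by (simp add: end_classes_def conj_assoc)
qed

lemma level': "level (3 * m * N) flip' mark' T'"
  unfolding level_def
proof (intro conjI ballI)
  show "paired_partition (moved (3 * m * N)) flip' mark' (V \<times> V) T'"
  proof
    show "mark' (flip' w) \<longleftrightarrow> \<not> mark' w" if "w \<in> moved (3 * m * N)" for w
      using flip(5)[OF m3 that] twist_flip[OF that] by (auto simp: mark'_def)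
    have "ends w \<in> V \<times> V" if "w \<in> moved (3 * m * N)" for w
      using ends_V(3)[OF movedD(1)[OF that]] m_pos N_pos by simp
    thus "(\<Union>i\<in>V \<times> V. T' i) = {w \<in> moved (3 * m * N). \<not> mark' w}" by (auto simp: end_classes_def)
  qed (use finite_moved finite_V flip[OF m3] in \<open>auto simp: end_classes_def\<close>)
  show "ends (flip' w) = ends w" if "w \<in> moved (3 * m * N)" for w using flip(2)[OF m3 that] .
  show "8 \<le> card (T' i)" if "i \<in> V \<times> V" for i using card_end_classes[OF that] large[OF that] by simp
qed (use m_pos N_pos in \<open>auto simp: end_classes_def\<close>)

abbreviation "G' \<equiv> level_group (3 * m * N) flip' T'"

sublocale P': paired_partition "moved (3 * m * N)" flip' mark' "V \<times> V" T'
  using level' by (simp add: level_def)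

text \<open>By generation an element of order three may be assumed. The diagonal permutation then
  has order three as well, which makes it even on every class.\<close>

lemma diag_in_G':
  assumes "g \<in> G" shows "diag (3 * m) N g \<in> G'"
proof -
  have "g \<in> P.paired_alt" using assms by (simp add: level_group_def)
  thus ?thesis
  proof (induction rule: P.paired_alt_induct)
    case id
    show ?case using diag_id level_group_closed(1)[OF level'] by metis
  next
    case (comp g h)
    hence "g \<in> G" "h \<in> G" by (simp_all add: level_group_def)
    thus ?case using diag_comp[OF N_pos m3 G_facts(1) G_facts(1)] level_group_closed(2)[OF level'] comp by metis
  next
    case (order_three g)
    hence g: "g \<in> G" by (simp add: level_group_def)
    let ?D = "diag (3 * m) N g"
    have ep: "end_perm (3 * m * N) ?D" using end_perm_diag[OF N_pos m3 G_facts(1)[OF g]] .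
    have "?D permutes moved (3 * m * N)"
    proof (rule permutes_superset)
      show "?D permutes paths (3 * m * N)" using ep by (simp add: end_perm_def)
      show "?D w = w" if "w \<in> paths (3 * m * N) - moved (3 * m * N)" for w
        using that paths_still_moved diag_still[OF g m3] by blast
    qed
    moreover have "?D (flip' w) = flip' (?D w)" if "w \<in> moved (3 * m * N)" for w
      using flip_diag[OF g m3 that] by simp
    moreover have "?D w \<in> T' i" if "w \<in> T' i" for i w
    proof -
      have w: "w \<in> moved (3 * m * N)" "ends w = i" "\<not> mark' w" using that by (auto simp: end_classes_def)
      note dm = diag_moved[OF g m3 w(1)]
      have "\<not> mark' (?D w)" using w(3) dm(3) twist_diag[OF movedD(1)[OF w(1)] g] by (simp add: mark'_def)
      moreover have "ends (?D w) = i" using diag_path(2)[OF N_pos m3 G_facts(1)[OF g] movedD(1)[OF w(1)]] w(2) by simp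
      ultimately show ?thesis using dm(1) by (simp add: end_classes_def)
    qed
    moreover have "?D (?D (?D w)) = w" for w
    proof -
      have "g \<circ> (g \<circ> g) = id" using order_three(2) by (auto simp: fun_eq_iff)
      thus ?thesis using diag_diag[OF g g m3] diag_diag[OF g G_closed(2)[OF g g] m3] diag_id by (metis id_apply)
    qed
    ultimately show ?case
      unfolding level_group_def by (intro P'.order_three_in_paired_alt)
  qed
qed

text \<open>The invariance of \<open>mark'\<close> is tested on the paths \<open>w0 @ c @ z\<close>
  with still \<open>c\<close>. The diagonal element carries them to
  \<open>\<tau> w0 @ c @ \<tau> z\<close>, and letting \<open>c\<close> vary recovers the code of
  \<open>z\<close>.\<close>

lemma rigid:
  assumes \<tau>: "end_perm Q \<tau>" and D: "diag 3 Q \<tau> \<in> G'"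
  shows "\<exists>g\<in>G. \<forall>w\<in>paths Q. \<tau> w = diag m N g w"
proof -
  have eq3: "3 * Q = 3 * m * N" by (simp add: mult.assoc)
  let ?D = "diag 3 Q \<tau>"
  note D_facts = level_group_facts[OF level' D]
  have three: "x @ c @ z \<in> paths (3 * m * N) \<and> chunk Q (x @ c @ z) 0 = x \<and> chunk Q (x @ c @ z) 1 = c \<and> chunk Q (x @ c @ z) 2 = z"
    if "x \<in> paths Q" "c \<in> paths Q" "z \<in> paths Q" "snd (ends x) = fst (ends c)" "snd (ends c) = fst (ends z)" for x c z
  proof -
    have cz: "c @ z \<in> paths (Q + Q)" "ends (c @ z) = (fst (ends c), snd (ends z))"
      using append_path[OF that(2,3) Q_pos Q_pos that(5)] by auto
    have "x @ c @ z \<in> paths (Q + (Q + Q))"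
      using append_path(1)[OF that(1) cz(1) Q_pos] Q_pos cz(2) that(4) by simp
    moreover have "Q + (Q + Q) = 3 * m * N" by simp
    moreover have "length x = Q" "length c = Q" "length z = Q" using that pathsD by auto
    ultimately show ?thesis by (simp add: chunk_def)
  qed
  have Dc: "chunk Q (?D w) i = \<tau> (chunk Q w i)" if "w \<in> paths (3 * m * N)" "i < 3" for w i
    using diag_path(3)[OF Q_pos _ \<tau>, of 3 w i] that eq3 by simp
  \<comment> \<open>A still block is prolonged by still loops to a still path of triple length, and
    elements of \<open>G'\<close> fix such paths.\<close>
  have \<tau>_still: "\<tau> c = c" if c: "c \<in> still Q" for c
  proof -
    have cV: "snd (ends c) \<in> V" using ends_V(2)[OF stillD(1)[OF c] Q_pos] .
    obtain y where y: "y \<in> still Q" "ends y = (snd (ends c), snd (ends c))" using connect[OF conn cV cV] by blast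
    have p: "c @ y @ y \<in> paths (3 * m * N)" "chunk Q (c @ y @ y) 0 = c"
      using three[of c y y] y c stillD by auto
    have "c @ y @ y \<in> still (3 * m * N)" using p(1) c y by (auto simp: still_def)
    hence "?D (c @ y @ y) = c @ y @ y" using D_facts(2) by blast
    thus ?thesis using Dc[OF p(1), of 0] p(2) by simp
  qed
  have \<tau>p: "\<tau> x \<in> paths Q" "ends (\<tau> x) = ends x" if "x \<in> paths Q" for x using end_permD[OF \<tau> that] .
  have \<tau>_moved: "\<tau> x \<in> moved Q" if "x \<in> moved Q" for x
  proof (rule ccontr)
    assume "\<tau> x \<notin> moved Q"
    hence "\<tau> x \<in> still Q" using \<tau>p(1)[OF movedD(1)[OF that]] paths_still_moved by blast
    hence "\<tau> (\<tau> x) = \<tau> x" using \<tau>_still by blast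
    hence "\<tau> x = x" using \<tau> permutes_inj by (metis end_perm_def injD)
    thus False using \<open>\<tau> x \<notin> moved Q\<close> that by simp
  qed
  have tw: "(mark N d (\<tau> w0) \<noteq> twist (\<tau> w0 @ c @ \<tau> z)) = (mark N d w0 \<noteq> twist (w0 @ c @ z))"
    if c: "c \<in> still Q" "ends c = (snd (ends w0), fst (ends z))" and z: "z \<in> moved Q" for c z
  proof -
    have p: "w0 @ c @ z \<in> paths (3 * m * N)" "chunk Q (w0 @ c @ z) 0 = w0" "chunk Q (w0 @ c @ z) 1 = c" "chunk Q (w0 @ c @ z) 2 = z"
      using three[of w0 c z] w0 c z stillD movedD by auto
    have q: "\<tau> w0 @ c @ \<tau> z \<in> paths (3 * m * N)" "chunk Q (\<tau> w0 @ c @ \<tau> z) 0 = \<tau> w0"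
      "chunk Q (\<tau> w0 @ c @ \<tau> z) 1 = c" "chunk Q (\<tau> w0 @ c @ \<tau> z) 2 = \<tau> z"
      using three[of "\<tau> w0" c "\<tau> z"] \<tau>p[OF w0] \<tau>p[OF movedD(1)[OF z]] c stillD by auto
    have "?D (w0 @ c @ z) = \<tau> w0 @ c @ \<tau> z"
    proof (rule chunk_ext[of _ 3 Q])
      show "length (?D (w0 @ c @ z)) = 3 * Q" using diag_path(1)[OF Q_pos _ \<tau>, of 3 "w0 @ c @ z"] p(1) pathsD(1) eq3 by simp
      show "length (\<tau> w0 @ c @ \<tau> z) = 3 * Q" using q(1) pathsD(1) eq3 by metis
      fix i :: nat assume "i < 3"
      hence "i = 0 \<or> i = 1 \<or> i = 2" by auto
      thus "chunk Q (?D (w0 @ c @ z)) i = chunk Q (\<tau> w0 @ c @ \<tau> z) i"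
        using Dc[OF p(1)] p q \<tau>_still[OF c(1)] by auto
    qed
    moreover have "w0 @ c @ z \<in> moved (3 * m * N)" using first_third(1)[OF m_pos p(1)] p(2) w0_moved by simp
    moreover have "mark N d (w0 @ c @ z) = mark N d w0" using first_third(3)[OF m_pos p(1)] p(2) w0_moved by simp
    moreover have "mark N d (\<tau> w0 @ c @ \<tau> z) = mark N d (\<tau> w0)"
      using first_third(3)[OF m_pos q(1)] q(2) \<tau>_moved[OF w0_moved] by simp
    ultimately show ?thesis using D_facts(4)[of "w0 @ c @ z"] by (simp add: mark'_def)
  qed
  have twist3: "twist (x @ c @ z) \<longleftrightarrow> (\<exists>g\<in>G. \<exists>z'\<in>moved Q. (x = diag m N g w0 \<or> x = flip N f m (diag m N g w0)) \<and> z = diag m N g z' \<and> c \<in> \<kappa> z')"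
    if "x \<in> paths Q" "c \<in> paths Q" "z \<in> paths Q" "snd (ends x) = fst (ends c)" "snd (ends c) = fst (ends z)" for x c z
    using three[OF that] unfolding twist_def by simp
  \<comment> \<open>With the reserved block \<open>c0\<close> in the middle neither path is twisted,
    so \<open>tw\<close> compares the bare marks.\<close>
  have mark_eq: "mark N d (\<tau> w0) = mark N d w0"
  proof -
    let ?c = "c0 (fst (ends w0))"
    have v: "fst (ends w0) \<in> V" using ends_V(1)[OF w0 Q_pos] .
    note c = c0[OF v]
    have no: "\<not> twist (x @ ?c @ z)" if xz: "x \<in> paths Q" "z \<in> paths Q" "ends x = ends w0" "ends z = ends w0" for x z
    proof
      assume "twist (x @ ?c @ z)"
      then obtain g z' where gz: "g \<in> G" "z' \<in> moved Q" "z = diag m N g z'" "?c \<in> \<kappa> z'"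
        using twist3[OF xz(1) stillD(1)[OF conjunct1[OF c]] xz(2)] c xz(3,4) by auto
      have "ends z = ends z'" using diag_path(2)[OF N_pos m_pos G_facts(1)[OF gz(1)] movedD(1)[OF gz(2)]] gz by simp
      thus False using kap(2)[OF gz(2)] gz(4) xz by auto
    qed
    show ?thesis using tw[of ?c w0] c w0_moved no[of "\<tau> w0" "\<tau> w0"] no[of w0 w0] \<tau>p[OF w0] w0 by auto
  qed
  have mark_diag: "mark N d (diag m N g w0) = mark N d w0" if "g \<in> G" for g
    using diag_moved(3)[OF that m_pos w0_moved] .
  have mark_flip: "mark N d (flip N f m (diag m N g w0)) \<longleftrightarrow> \<not> mark N d w0" if "g \<in> G" for g
    using flip(5)[OF m_pos diag_moved(1)[OF that m_pos w0_moved]] mark_diag[OF that] by simp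
  have tw': "twist (\<tau> w0 @ c @ \<tau> z) = twist (w0 @ c @ z)"
    if "c \<in> still Q" "ends c = (snd (ends w0), fst (ends z))" "z \<in> moved Q" for c z
    using tw[OF that] mark_eq by blast
  \<comment> \<open>The flipped alternative would change the mark of \<open>w0\<close>, and the
    other one forces \<open>g = id\<close> by freeness.\<close>
  have base: "twist (w0 @ c @ z) \<longleftrightarrow> c \<in> \<kappa> z"
    if c: "c \<in> still Q" "ends c = (snd (ends w0), fst (ends z))" and z: "z \<in> moved Q" for c z
  proof -
    note t3 = twist3[of w0 c z]
    have "(\<exists>g\<in>G. \<exists>z'\<in>moved Q. (w0 = diag m N g w0 \<or> w0 = flip N f m (diag m N g w0)) \<and> z = diag m N g z' \<and> c \<in> \<kappa> z') \<longleftrightarrow> c \<in> \<kappa> z"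
    proof
      assume "\<exists>g\<in>G. \<exists>z'\<in>moved Q. (w0 = diag m N g w0 \<or> w0 = flip N f m (diag m N g w0)) \<and> z = diag m N g z' \<and> c \<in> \<kappa> z'"
      then obtain g z' where gz: "g \<in> G" "z' \<in> moved Q" "w0 = diag m N g w0 \<or> w0 = flip N f m (diag m N g w0)"
        "z = diag m N g z'" "c \<in> \<kappa> z'" by blast
      have "w0 = diag m N g w0" using gz(3) mark_flip[OF gz(1)] by metis
      hence "g = id" using diag_w0_eq_iff[OF gz(1) G_closed(1)] diag_id by simp
      thus "c \<in> \<kappa> z" using gz diag_id by simp
    next
      assume "c \<in> \<kappa> z"
      moreover have "w0 = diag m N id w0" "z = diag m N id z" by (simp_all only: diag_id id_apply)
      ultimately show "\<exists>g\<in>G. \<exists>z'\<in>moved Q. (w0 = diag m N g w0 \<or> w0 = flip N f m (diag m N g w0)) \<and> z = diag m N g z' \<and> c \<in> \<kappa> z'"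
        using G_closed(1) z by metis
    qed
    thus ?thesis using t3 w0 c z stillD movedD by auto
  qed
  \<comment> \<open>Since \<open>\<kappa> w0\<close> is nonempty, there is a twisted path that
    starts with \<open>w0\<close>; the twist of its image exhibits the element
    \<open>g\<close>.\<close>
  obtain c1 where c1: "c1 \<in> \<kappa> w0" using kap(1)[OF w0_moved] by blast
  have c1': "c1 \<in> still Q" "ends c1 = (snd (ends w0), fst (ends w0))" using kap(2)[OF w0_moved] c1 by auto
  have "twist (\<tau> w0 @ c1 @ \<tau> w0)" using tw'[OF c1' w0_moved] base[OF c1' w0_moved] c1 by simp
  then obtain g z' where gz: "g \<in> G" "\<tau> w0 = diag m N g w0 \<or> \<tau> w0 = flip N f m (diag m N g w0)"
    using twist3[of "\<tau> w0" c1 "\<tau> w0"] \<tau>p[OF w0] c1' stillD by auto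
  hence \<tau>w0: "\<tau> w0 = diag m N g w0" using mark_flip[OF gz(1)] mark_eq by metis
  have main: "\<tau> z = diag m N g z" if z: "z \<in> moved Q" for z
  proof -
    \<comment> \<open>\<open>z1\<close> is the block that \<open>g\<close> carries to
      \<open>\<tau> z\<close>. It has the same start as \<open>z\<close>, so equality of the codes
      will give \<open>z = z1\<close>.\<close>
    define z1 where "z1 = diag m N (finv g) (\<tau> z)"
    have ig: "finv g \<in> G" using G_closed(3)[OF gz(1)] .
    have gi: "g \<circ> finv g = id" "finv g \<circ> g = id"
      using permutes_inv_o[of g "paths N"] G_facts(1)[OF gz(1)] by (simp_all add: end_perm_def)
    have z1: "z1 \<in> moved Q" unfolding z1_def using diag_moved(1)[OF ig m_pos \<tau>_moved[OF z]] .
    have \<tau>z: "\<tau> z = diag m N g z1" unfolding z1_def using diag_diag[OF gz(1) ig m_pos] gi diag_id by simp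
    have ez: "ends z1 = ends z"
      using diag_path(2)[OF N_pos m_pos G_facts(1)[OF ig] movedD(1)[OF \<tau>_moved[OF z]]] \<tau>p(2)[OF movedD(1)[OF z]] by (simp add: z1_def)
    have "c \<in> \<kappa> z \<longleftrightarrow> c \<in> \<kappa> z1" if c: "c \<in> still Q" "ends c = (snd (ends w0), fst (ends z))" for c
    proof -
      have "c \<in> \<kappa> z \<longleftrightarrow> twist (\<tau> w0 @ c @ \<tau> z)" using tw'[OF c z] base[OF c z] by simp
      also have "\<dots> \<longleftrightarrow> (\<exists>h\<in>G. \<exists>z'\<in>moved Q. (\<tau> w0 = diag m N h w0 \<or> \<tau> w0 = flip N f m (diag m N h w0)) \<and> \<tau> z = diag m N h z' \<and> c \<in> \<kappa> z')"
        using twist3[of "\<tau> w0" c "\<tau> z"] \<tau>p[OF w0] \<tau>p[OF movedD(1)[OF z]] c stillD by auto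
      also have "\<dots> \<longleftrightarrow> c \<in> \<kappa> z1"
      proof
        assume "\<exists>h\<in>G. \<exists>z'\<in>moved Q. (\<tau> w0 = diag m N h w0 \<or> \<tau> w0 = flip N f m (diag m N h w0)) \<and> \<tau> z = diag m N h z' \<and> c \<in> \<kappa> z'"
        then obtain h z' where hz: "h \<in> G" "z' \<in> moved Q" "\<tau> w0 = diag m N h w0 \<or> \<tau> w0 = flip N f m (diag m N h w0)"
          "\<tau> z = diag m N h z'" "c \<in> \<kappa> z'" by blast
        have "\<tau> w0 = diag m N h w0" using hz(3) mark_flip[OF hz(1)] mark_eq by metis
        hence "h = g" by (intro diag_w0_eq_iff[OF hz(1) gz(1)]) (simp only: \<tau>w0)
        hence "z1 = z'" unfolding z1_def using hz(4) diag_diag[OF ig gz(1) m_pos] gi diag_id by simp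
        thus "c \<in> \<kappa> z1" using hz by simp
      next
        assume "c \<in> \<kappa> z1"
        thus "\<exists>h\<in>G. \<exists>z'\<in>moved Q. (\<tau> w0 = diag m N h w0 \<or> \<tau> w0 = flip N f m (diag m N h w0)) \<and> \<tau> z = diag m N h z' \<and> c \<in> \<kappa> z'"
          using gz(1) z1 \<tau>w0 \<tau>z by blast
      qed
      finally show ?thesis .
    qed
    hence "\<kappa> z = \<kappa> z1" using kap(2)[OF z] kap(2)[OF z1] ez by auto
    hence "z = z1" using kinj[OF z z1] ez by simp
    thus ?thesis using \<tau>z by simp
  qed
  have "\<tau> w = diag m N g w" if "w \<in> paths Q" for w
    using paths_still_moved[OF that] main \<tau>_still diag_still[OF gz(1) m_pos] by auto
  thus ?thesis using gz(1) by blast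
qed

end

text \<open>The strict inequality leaves room to discard the empty set, which could not be witnessed
  by any middle block.\<close>

lemma card_le_imp_inj_code:
  assumes "finite Z" "finite S" "card Z < 2 ^ card S"
  shows "\<exists>\<kappa>. inj_on \<kappa> Z \<and> (\<forall>z\<in>Z. \<kappa> z \<subseteq> S \<and> \<kappa> z \<noteq> {})"
proof -
  have "card (Pow S - {{}}) = 2 ^ card S - 1" using assms by (simp add: card_Pow)
  hence "card Z \<le> card (Pow S - {{}})" using assms(3) by simp
  then obtain \<kappa> where "\<kappa> ` Z \<subseteq> Pow S - {{}}" "inj_on \<kappa> Z" using card_le_inj[OF assms(1), of "Pow S - {{}}"] assms(2) by auto
  thus ?thesis by (intro exI[of _ \<kappa>]) auto
qed

context level_step
begin

text \<open>All requirements hold from some \<open>m0\<close> on, so that \<open>m\<close> can later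
  be taken as a prescribed number times a power of 3.\<close>

lemma step_exists:
  "\<exists>m0. \<forall>m\<ge>m0. m > 0 \<longrightarrow> (\<exists>f' d'. level (3 * m * N) f' d' (end_classes (3 * m * N) d') \<and>
     (\<forall>g\<in>G. diag (3 * m) N g \<in> level_group (3 * m * N) f' (end_classes (3 * m * N) d')) \<and>
     (\<forall>\<tau>. end_perm (m * N) \<tau> \<longrightarrow> diag 3 (m * N) \<tau> \<in> level_group (3 * m * N) f' (end_classes (3 * m * N) d') \<longrightarrow>
        (\<exists>g\<in>G. \<forall>w\<in>paths (m * N). \<tau> w = diag m N g w)))"
proof -
  obtain mc where mc: "\<And>m. m \<ge> mc \<Longrightarrow> \<exists>w\<in>paths (m * N). \<forall>b\<in>moved N. \<exists>l<m. chunk N w l = b"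
    using covering_path by blast
  \<comment> \<open>The summand \<open>card E\<close> makes the subsets of still blocks outnumber
    all paths; the summand 20 provides at least 16 still paths with given ends.\<close>
  define C where "C = card E + 20"
  obtain Q0 where Q0: "\<And>Q u v. Q \<ge> Q0 \<Longrightarrow> u \<in> V \<Longrightarrow> v \<in> V \<Longrightarrow> C * Q + C < card {w \<in> still Q. ends w = (u, v)}"
    using card_still_large[of C] by blast
  obtain u0 where u0: "u0 \<in> V" using V_ne by blast
  have "8 \<le> card (T (u0, u0))" using lev u0 unfolding level_def by blast
  hence "T (u0, u0) \<noteq> {}" by auto
  hence "moved N \<noteq> {}" using P.T_sub[of "(u0, u0)"] u0 by blast
  then obtain e0 where e0: "e0 \<in> E0" by (auto simp: moved_def)
  have "\<exists>f' d'. level (3 * m * N) f' d' (end_classes (3 * m * N) d') \<and>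
     (\<forall>g\<in>G. diag (3 * m) N g \<in> level_group (3 * m * N) f' (end_classes (3 * m * N) d')) \<and>
     (\<forall>\<tau>. end_perm (m * N) \<tau> \<longrightarrow> diag 3 (m * N) \<tau> \<in> level_group (3 * m * N) f' (end_classes (3 * m * N) d') \<longrightarrow>
        (\<exists>g\<in>G. \<forall>w\<in>paths (m * N). \<tau> w = diag m N g w))"
    if m: "m \<ge> mc + Q0 + conn_len + 1" for m
  proof -
    have N1: "1 \<le> N" using N_pos by simp
    have Qm: "m \<le> m * N" using mult_le_mono2[OF N1, of m] by simp
    let ?Q = "m * N"
    have Q_pos: "?Q > 0" "m > 0" using Qm m by linarith+
    have conn: "?Q \<ge> conn_len" "?Q \<ge> Q0" using Qm m by linarith+
    obtain w0 where w0: "w0 \<in> paths ?Q" "\<And>b. b \<in> moved N \<Longrightarrow> \<exists>l<m. chunk N w0 l = b" using mc[of m] m by auto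
    have t0: "snd (ends w0) \<in> V" using ends_V[OF w0(1) Q_pos(1)] by simp
    define S where "S = (\<lambda>v. {c \<in> still ?Q. ends c = (snd (ends w0), v)})"
    have S: "C * ?Q + C < card (S v)" if "v \<in> V" for v using Q0[OF conn(2) t0 that] by (simp add: S_def)
    have "\<exists>c. c \<in> S v" if "v \<in> V" for v using S[OF that] by (metis card.empty ex_in_conv not_less_zero)
    then obtain c0 where c0: "\<And>v. v \<in> V \<Longrightarrow> c0 v \<in> S v" by metis
    have finS: "finite (S v)" for v using finite_moved by (simp add: S_def)
    have exK: "\<exists>\<kappa>. inj_on \<kappa> {z \<in> moved ?Q. fst (ends z) = v} \<and>
        (\<forall>z\<in>{z \<in> moved ?Q. fst (ends z) = v}. \<kappa> z \<subseteq> S v - {c0 v} \<and> \<kappa> z \<noteq> {})" if v: "v \<in> V" for v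
    proof (rule card_le_imp_inj_code)
      have "card {z \<in> moved ?Q. fst (ends z) = v} \<le> card (paths ?Q)"
        using movedD(1) by (intro card_mono) auto
      also have "\<dots> \<le> 2 ^ (card E * ?Q)" by (rule card_paths_le)
      also have "\<dots> < 2 ^ card (S v - {c0 v})"
      proof (rule power_strict_increasing)
        have "card (S v - {c0 v}) = card (S v) - 1" using c0[OF v] finS by simp
        moreover have "card E * ?Q \<le> C * ?Q" unfolding C_def by (intro mult_right_mono) auto
        moreover have "C \<ge> 1" by (simp add: C_def)
        ultimately show "card E * ?Q < card (S v - {c0 v})" using S[OF v] by linarith
      qed simp
      finally show "card {z \<in> moved ?Q. fst (ends z) = v} < 2 ^ card (S v - {c0 v})" .
    qed (use finite_moved finS in auto)
    define code where "code = (\<lambda>v \<kappa>. inj_on \<kappa> {z \<in> moved ?Q. fst (ends z) = v} \<and>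
        (\<forall>z\<in>{z \<in> moved ?Q. fst (ends z) = v}. \<kappa> z \<subseteq> S v - {c0 v} \<and> \<kappa> z \<noteq> {}))"
    have "\<forall>v\<in>V. \<exists>\<kappa>. code v \<kappa>" using exK unfolding code_def by (intro ballI)
    from bchoice[OF this] obtain K where K0: "\<forall>v\<in>V. code v (K v)" by (elim exE)
    have K: "inj_on (K v) {z \<in> moved ?Q. fst (ends z) = v}" if "v \<in> V" for v using bspec[OF K0 that] unfolding code_def by (elim conjE)
    have K2: "K v z \<subseteq> S v - {c0 v} \<and> K v z \<noteq> {}" if "v \<in> V" "z \<in> moved ?Q" "fst (ends z) = v" for v z
      using bspec[OF K0 that(1)] that(2,3) unfolding code_def by simp
    \<comment> \<open>The codes are chosen separately for each start vertex.\<close>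
    define \<kappa> where "\<kappa> = (\<lambda>z. K (fst (ends z)) z)"
    have zV: "fst (ends z) \<in> V" if "z \<in> moved ?Q" for z using ends_V(1)[OF movedD(1)[OF that] Q_pos(1)] .
    interpret step_data E src tgt E0 e1 e2 N f d T m w0 \<kappa> c0
    proof
      show "m > 0" "m * N \<ge> conn_len" using Q_pos conn by auto
      show "w0 \<in> paths (m * N)" using w0 by simp
      show "\<exists>l<m. chunk N w0 l = b" if "b \<in> moved N" for b using w0(2)[OF that] .
      show "\<kappa> z \<noteq> {}" if "z \<in> moved ?Q" for z using K2[OF zV[OF that] that refl] by (simp add: \<kappa>_def)
      show "\<kappa> z \<subseteq> {c \<in> still ?Q. ends c = (snd (ends w0), fst (ends z))} - {c0 (fst (ends z))}" if "z \<in> moved ?Q" for z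
        using K2[OF zV[OF that] that refl] by (simp add: \<kappa>_def S_def)
      show "c0 v \<in> still ?Q \<and> ends (c0 v) = (snd (ends w0), v)" if "v \<in> V" for v using c0[OF that] by (simp add: S_def)
      show "z = z'" if z: "z \<in> moved ?Q" "z' \<in> moved ?Q" "fst (ends z) = fst (ends z')" "\<kappa> z = \<kappa> z'" for z z'
        using K[OF zV[OF z(1)]] z by (auto simp: \<kappa>_def inj_on_def)
      show "16 \<le> card {w \<in> moved (3 * m * N). ends w = i}" if "i \<in> V \<times> V" for i
      proof -
        have i: "i = (fst i, snd i)" "fst i \<in> V" "snd i \<in> V" using that by auto
        \<comment> \<open>The first \<open>conn_len + 1\<close> edges lead to \<open>e0\<close> and
          traverse it; the remaining \<open>n\<close> are free.\<close>
        define n where "n = 3 * m * N - (conn_len + 1)"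
        have "3 * m * N = m * N + m * N + m * N" by simp
        hence n: "3 * m * N = conn_len + 1 + n" "n \<ge> Q0" "n > 0"
          using Qm m unfolding n_def by linarith+
        have "16 \<le> card {w \<in> still n. ends w = (tgt e1, snd i)}"
          using Q0[OF n(2) e1_V(2) i(3)] by (simp add: C_def)
        also have "\<dots> \<le> card {w \<in> paths n. ends w = (tgt e1, snd i)}" using stillD(1) by (intro card_mono) auto
        also have "\<dots> \<le> card {w \<in> moved (3 * m * N). ends w = i}"
          unfolding n(1) using card_moved_ge[OF e0 i(2) n(3), of "snd i"] by simp
        finally show ?thesis .
      qed
    qed
    show ?thesis using level' diag_in_G' rigid by (intro exI[of _ flip'] exI[of _ mark'] conjI allI impI ballI) auto
  qed
  thus ?thesis by blast
qed

end

section \<open>The tower of levels\<close>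

context parallel_graph
begin

text \<open>\<open>b\<close> lists \<open>E0\<close> by class, position among eight, and a bit. The
  involution switches the bit, which is also the mark. The edges are all parallel, so their
  distribution over the classes is arbitrary.\<close>

lemma level_base:
  assumes b: "bij_betw b ((V \<times> V) \<times> {..<8::nat} \<times> (UNIV :: bool set)) E0"
  shows "\<exists>f d T. level 1 f d T \<and> (\<forall>i\<in>V \<times> V. card (T i) = 8)"
proof -
  let ?D = "(V \<times> V) \<times> {..<8::nat} \<times> (UNIV :: bool set)"
  define c where "c = inv_into ?D b"
  have c: "c (b x) = x" if "x \<in> ?D" for x unfolding c_def using bij_betw_inv_into_left[OF b that] .
  have bE: "b x \<in> E0" if "x \<in> ?D" for x using b that by (auto simp: bij_betw_def)
  have M: "moved 1 = (\<lambda>e. [e]) ` E0"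
    using E0_sub by (auto simp: moved_def paths_def length_Suc_conv)
  have M': "moved 1 = (\<lambda>x. [b x]) ` ?D" unfolding M using b by (auto simp: bij_betw_def)
  define f where "f = (\<lambda>w. case c (hd w) of (i, j, x) \<Rightarrow> [b (i, j, \<not> x)])"
  define d where "d = (\<lambda>w :: 'e list. snd (snd (c (hd w))))"
  define T where "T = (\<lambda>i. (\<lambda>j. [b (i, j, False)]) ` {..<8::nat})"
  have fd: "f [b (i, j, x)] = [b (i, j, \<not> x)]" "d [b (i, j, x)] = x" if "i \<in> V \<times> V" "j < 8" for i j x
    using c[of "(i, j, x)"] that by (auto simp: f_def d_def)
  have Mex: "\<exists>i\<in>V \<times> V. \<exists>j<8. \<exists>x. w = [b (i, j, x)]" if "w \<in> moved 1" for w using that unfolding M' by blast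
  have Mb: "[b (i, j, x)] \<in> moved 1" if "i \<in> V \<times> V" "j < 8" for i j x unfolding M' using that by blast
  have par: "ends [b x] = (src e1, tgt e1)" if "x \<in> ?D" for x using parallel(1)[OF bE[OF that]] by (simp add: ends_def)
  have "level 1 f d T"
    unfolding level_def
  proof (intro conjI ballI)
    show "paired_partition (moved 1) f d (V \<times> V) T"
    proof
      show "f w \<in> moved 1" if "w \<in> moved 1" for w using Mex[OF that] fd(1) Mb by fastforce
      show "f (f w) = w" if "w \<in> moved 1" for w using Mex[OF that] fd(1) by fastforce
      show "d (f w) \<longleftrightarrow> \<not> d w" if "w \<in> moved 1" for w using Mex[OF that] fd by fastforce
      show "(\<Union>i\<in>V \<times> V. T i) = {w \<in> moved 1. \<not> d w}"
      proof
        show "(\<Union>i\<in>V \<times> V. T i) \<subseteq> {w \<in> moved 1. \<not> d w}" using Mb fd(2) by (auto simp: T_def)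
        show "{w \<in> moved 1. \<not> d w} \<subseteq> (\<Union>i\<in>V \<times> V. T i)"
        proof clarify
          fix w assume w: "w \<in> moved 1" "\<not> d w"
          obtain i j x where ij: "i \<in> V \<times> V" "j < 8" "w = [b (i, j, x)]" using Mex[OF w(1)] by blast
          hence "\<not> x" using w(2) fd(2) by auto
          hence "w \<in> T i" using ij by (auto simp: T_def)
          thus "w \<in> (\<Union>i\<in>V \<times> V. T i)" using ij(1) by blast
        qed
      qed
      show "T i \<inter> T j = {}" if "i \<in> V \<times> V" "j \<in> V \<times> V" "i \<noteq> j" for i j
      proof -
        have "b (i, k, False) \<noteq> b (j, l, False)" if "k < 8" "l < 8" for k l
        proof
          assume "b (i, k, False) = b (j, l, False)"
          moreover have "(i, k, False) \<in> ?D" "(j, l, False) \<in> ?D" using \<open>i \<in> V \<times> V\<close> \<open>j \<in> V \<times> V\<close> that by blast+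
          ultimately have "(i, k, False) = (j, l, False)" using c by metis
          thus False using \<open>i \<noteq> j\<close> by simp
        qed
        thus ?thesis by (auto simp: T_def)
      qed
    qed (use finite_moved finite_V in auto)
    show "ends (f w) = ends w" if "w \<in> moved 1" for w
      using Mex[OF that] fd(1) par by fastforce
    show "ends w = ends w'" if "i \<in> V \<times> V" "w \<in> T i" "w' \<in> T i" for i w w'
      using that par by (auto simp: T_def)
  next
    fix i assume i: "i \<in> V \<times> V"
    have "inj_on (\<lambda>j. [b (i, j, False)]) {..<8::nat}"
    proof (rule inj_onI)
      fix j l :: nat assume "j \<in> {..<8}" "l \<in> {..<8}" "[b (i, j, False)] = [b (i, l, False)]"
      moreover from this have "(i, j, False) \<in> ?D" "(i, l, False) \<in> ?D" using i by blast+
      ultimately have "(i, j, False) = (i, l, False)" using c by (metis list.inject)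
      thus "j = l" by simp
    qed
    thus "8 \<le> card (T i)" by (simp add: T_def card_image)
  qed simp
  moreover have "card (T i) = 8" if "i \<in> V \<times> V" for i
  proof -
    have "card (T i) \<le> card {..<8::nat}" unfolding T_def by (rule card_image_le) simp
    moreover have "8 \<le> card (T i)" using calculation \<open>level 1 f d T\<close> that unfolding level_def by blast
    ultimately show ?thesis by simp
  qed
  ultimately show ?thesis by blast
qed

text \<open>As maps of the edge shift the elements no longer remember their block length, and the
  inclusion of one level in the next becomes literal.\<close>

definition level_acts :: "nat \<Rightarrow> ('e list \<Rightarrow> 'e list) \<Rightarrow> ('v \<times> 'v \<Rightarrow> 'e list set) \<Rightarrow> ((int \<Rightarrow> 'e) \<Rightarrow> (int \<Rightarrow> 'e)) set" where
  "level_acts n f T = (\<lambda>g. restrict (block_act n g) edge_shift) ` level_group n f T"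

text \<open>An element that commutes with the shift by \<open>m * N\<close> acts on blocks of that
  length by some \<open>\<tau>\<close>. A block permutation is determined by its action on the edge
  shift, so the given one is the diagonal of \<open>\<tau>\<close>, and rigidity applies.\<close>

lemma level_acts_step:
  assumes lev: "level N f d T" and m: "m > 0" and lev': "level (3 * m * N) f' d' T'"
    and incl: "\<forall>g\<in>level_group N f T. diag (3 * m) N g \<in> level_group (3 * m * N) f' T'"
    and rig: "\<forall>\<tau>. end_perm (m * N) \<tau> \<longrightarrow> diag 3 (m * N) \<tau> \<in> level_group (3 * m * N) f' T' \<longrightarrow>
        (\<exists>g\<in>level_group N f T. \<forall>w\<in>paths (m * N). \<tau> w = diag m N g w)"
  shows "level_acts N f T \<subseteq> level_acts (3 * m * N) f' T'"
    and "F \<in> level_acts (3 * m * N) f' T' \<Longrightarrow>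
      (\<And>y. y \<in> edge_shift \<Longrightarrow> F (shift_by (int (m * N)) y) = shift_by (int (m * N)) (F y)) \<Longrightarrow> F \<in> level_acts N f T"
proof -
  have N: "N > 0" using lev by (simp add: level_def)
  have Q: "m * N > 0" using m N by simp
  have eq3: "3 * (m * N) = 3 * m * N" by simp
  show "level_acts N f T \<subseteq> level_acts (3 * m * N) f' T'"
  proof
    fix F assume "F \<in> level_acts N f T"
    then obtain g where g: "g \<in> level_group N f T" "F = restrict (block_act N g) edge_shift" by (auto simp: level_acts_def)
    have "F = restrict (block_act (3 * m * N) (diag (3 * m) N g)) edge_shift"
      unfolding g(2) using block_act_diag[OF N _ level_group_facts(1)[OF lev g(1)], of "3 * m"] m
      by (intro restrict_ext) simp
    thus "F \<in> level_acts (3 * m * N) f' T'" using incl g(1) by (auto simp: level_acts_def)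
  qed
  assume F: "F \<in> level_acts (3 * m * N) f' T'"
    and comm: "\<And>y. y \<in> edge_shift \<Longrightarrow> F (shift_by (int (m * N)) y) = shift_by (int (m * N)) (F y)"
  obtain h where h: "h \<in> level_group (3 * m * N) f' T'" "F = restrict (block_act (3 * m * N) h) edge_shift"
    using F by (auto simp: level_acts_def)
  note hp = level_group_facts(1)[OF lev' h(1)]
  have "\<exists>\<tau>. end_perm (m * N) \<tau> \<and> (\<forall>y\<in>edge_shift. block_act (3 * (m * N)) h y = block_act (m * N) \<tau> y)"
  proof (rule block_act_commute_shift[OF Q])
    show "end_perm (3 * (m * N)) h" using hp by (simp only: eq3)
    show "block_act (3 * (m * N)) h (shift_by (int (m * N)) y) = shift_by (int (m * N)) (block_act (3 * (m * N)) h y)"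
      if "y \<in> edge_shift" for y unfolding eq3 using comm[OF that] that h(2) by simp
  qed simp
  then obtain \<tau> where \<tau>: "end_perm (m * N) \<tau>" "\<And>y. y \<in> edge_shift \<Longrightarrow> block_act (3 * (m * N)) h y = block_act (m * N) \<tau> y"
    by blast
  have "h = diag 3 (m * N) \<tau>"
  proof (rule block_act_inject)
    show "3 * (m * N) > 0" using Q by simp
    show "end_perm (3 * (m * N)) h" using hp by (simp only: eq3)
    show "end_perm (3 * (m * N)) (diag 3 (m * N) \<tau>)" using end_perm_diag[OF Q _ \<tau>(1)] by simp
    show "block_act (3 * (m * N)) h y = block_act (3 * (m * N)) (diag 3 (m * N) \<tau>) y" if "y \<in> edge_shift" for y
      using \<tau>(2)[OF that] block_act_diag[OF Q _ \<tau>(1) that, of 3] by simp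
  qed
  then obtain g where g: "g \<in> level_group N f T" "\<And>w. w \<in> paths (m * N) \<Longrightarrow> \<tau> w = diag m N g w" using rig \<tau>(1) h(1) by blast
  note gp = level_group_facts(1)[OF lev g(1)]
  have "\<tau> w = diag m N g w" for w
    using g(2)[of w] \<tau>(1) end_perm_diag[OF N m gp] by (cases "w \<in> paths (m * N)") (auto simp: end_perm_def permutes_def)
  hence "\<tau> = diag m N g" by blast
  hence "block_act (3 * m * N) h y = block_act N g y" if "y \<in> edge_shift" for y
    using \<tau>(2)[OF that] block_act_diag[OF N m gp that] eq3 by simp
  hence "F = restrict (block_act N g) edge_shift" unfolding h(2) by (intro restrict_ext)
  thus "F \<in> level_acts N f T" using g(1) by (auto simp: level_acts_def)
qed

text \<open>The blocks at level \<open>i + 1\<close> have length \<open>k * 3 ^ (u + 1)\<close>, so that being fixed by the shift of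
  length \<open>k * 3 ^ u\<close> already forces an element down to level \<open>i\<close>.\<close>

lemma level_chain:
  assumes lev0: "level 1 f0 d0 T0" and k: "k > 0"
  shows "\<exists>N f d T. N (0::nat) = 1 \<and> f 0 = f0 \<and> d 0 = d0 \<and> T 0 = T0 \<and> (\<forall>i. level (N i) (f i) (d i) (T i) \<and>
     T (Suc i) = end_classes (N (Suc i)) (d (Suc i)) \<and>
     level_acts (N i) (f i) (T i) \<subseteq> level_acts (N (Suc i)) (f (Suc i)) (T (Suc i)) \<and>
     (\<exists>u. N (Suc i) = k * 3 ^ Suc u \<and> N i dvd k * 3 ^ u \<and>
       (\<forall>F\<in>level_acts (N (Suc i)) (f (Suc i)) (T (Suc i)).
          (\<forall>y\<in>edge_shift. F (shift_by (int (k * 3 ^ u)) y) = shift_by (int (k * 3 ^ u)) (F y))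
          \<longrightarrow> F \<in> level_acts (N i) (f i) (T i))))"
proof -
  \<comment> \<open>The length and the classes have a uniform description only above the lowest
    level, whose length is 1 whatever \<open>k\<close> is.\<close>
  define St where "St = (\<lambda>(i::nat) (N, f, d, T). level N f d T \<and>
    (if i = 0 then (N, f, d, T) = (1, f0, d0, T0) else (\<exists>u. N = k * 3 ^ u) \<and> T = end_classes N d))"
  define R where "R = (\<lambda>(i::nat) (N :: nat, f, d :: 'e list \<Rightarrow> bool, T) (N', f', d' :: 'e list \<Rightarrow> bool, T').
     level_acts N f T \<subseteq> level_acts N' f' T' \<and>
     (\<exists>u. N' = k * 3 ^ Suc u \<and> N dvd k * 3 ^ u \<and>
       (\<forall>F\<in>level_acts N' f' T'.
          (\<forall>y\<in>edge_shift. F (shift_by (int (k * 3 ^ u)) y) = shift_by (int (k * 3 ^ u)) (F y))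
          \<longrightarrow> F \<in> level_acts N f T)))"
  have "\<exists>x. St 0 x" using lev0 by (auto simp: St_def)
  have ex: "\<exists>y. St (Suc i) y \<and> R i x y" if "St i x" for x i
  proof -
    obtain N f d T where x: "x = (N, f, d, T)" by (cases x)
    have lev: "level N f d T" using that by (simp add: St_def x split: if_splits)
    \<comment> \<open>The length \<open>N\<close> divides some \<open>k * 3 ^ v\<close>, since it is
      1 or already of this form.\<close>
    have "\<exists>a v. N * a = k * 3 ^ v"
    proof (cases "i = 0")
      case True
      hence "N = 1" using that by (simp add: St_def x)
      thus ?thesis by (intro exI[of _ "k"] exI[of _ 0]) simp
    next
      case False
      hence "\<exists>u. N = k * 3 ^ u" using that by (simp add: St_def x)
      then obtain u where "N = k * 3 ^ u" by blast
      thus ?thesis by (intro exI[of _ 1] exI[of _ u]) simp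
    qed
    then obtain a v where av: "N * a = k * 3 ^ v" by blast
    have a: "a > 0" using av k by (cases a) auto
    interpret level_step E src tgt E0 e1 e2 N f d T by unfold_locales (rule lev)
    obtain m0 where m0: "\<And>m. m \<ge> m0 \<Longrightarrow> m > 0 \<Longrightarrow> \<exists>f' d'. level (3 * m * N) f' d' (end_classes (3 * m * N) d') \<and>
     (\<forall>g\<in>G. diag (3 * m) N g \<in> level_group (3 * m * N) f' (end_classes (3 * m * N) d')) \<and>
     (\<forall>\<tau>. end_perm (m * N) \<tau> \<longrightarrow> diag 3 (m * N) \<tau> \<in> level_group (3 * m * N) f' (end_classes (3 * m * N) d') \<longrightarrow>
        (\<exists>g\<in>G. \<forall>w\<in>paths (m * N). \<tau> w = diag m N g w))"
      using step_exists by blast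
    \<comment> \<open>The factor \<open>a\<close> brings \<open>m * N\<close> into the form
      \<open>k * 3 ^ u\<close>, and the power of 3 makes \<open>m\<close> as large as the step
      demands.\<close>
    define m where "m = a * 3 ^ m0"
    have "m0 < 3 ^ m0" by (rule less_exp[THEN order_less_le_trans]) (simp add: power_mono)
    also have "\<dots> \<le> m" using a by (simp add: m_def)
    finally have m: "m \<ge> m0" "m > 0" by auto
    obtain f' d' where fd: "level (3 * m * N) f' d' (end_classes (3 * m * N) d')"
      "\<forall>g\<in>G. diag (3 * m) N g \<in> level_group (3 * m * N) f' (end_classes (3 * m * N) d')"
      "\<forall>\<tau>. end_perm (m * N) \<tau> \<longrightarrow> diag 3 (m * N) \<tau> \<in> level_group (3 * m * N) f' (end_classes (3 * m * N) d') \<longrightarrow>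
        (\<exists>g\<in>G. \<forall>w\<in>paths (m * N). \<tau> w = diag m N g w)" using m0[OF m] by blast
    have mN: "m * N = k * 3 ^ (v + m0)" using av by (simp add: m_def power_add algebra_simps)
    have N': "3 * m * N = k * 3 ^ Suc (v + m0)" using mN by simp
    let ?y = "(3 * m * N, f', d', end_classes (3 * m * N) d')"
    have "\<exists>u. 3 * m * N = k * 3 ^ u" using N' by blast
    hence "St (Suc i) ?y" using fd(1) unfolding St_def prod.case by simp
    moreover have "R i x ?y"
      unfolding R_def x prod.case
    proof (intro conjI exI[of _ "v + m0"] ballI impI)
      note ls = level_acts_step[OF lev m(2) fd]
      show "level_acts N f T \<subseteq> level_acts (3 * m * N) f' (end_classes (3 * m * N) d')" using ls(1) .
      show "3 * m * N = k * 3 ^ Suc (v + m0)" using N' .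
      show "N dvd k * 3 ^ (v + m0)" using mN by (metis dvd_triv_right)
      show "F \<in> level_acts N f T" if "F \<in> level_acts (3 * m * N) f' (end_classes (3 * m * N) d')"
        "\<forall>y\<in>edge_shift. F (shift_by (int (k * 3 ^ (v + m0))) y) = shift_by (int (k * 3 ^ (v + m0))) (F y)" for F
        using ls(2)[OF that(1)] that(2) unfolding mN by blast
    qed
    ultimately show ?thesis by blast
  qed
  obtain X where X: "\<And>i. St i (X i)" "\<And>i. R i (X i) (X (Suc i))"
    using dependent_nat_choice[of St R] \<open>\<exists>x. St 0 x\<close> ex by metis
  show ?thesis
    using X(1)[of 0] X(1) X(1)[of "Suc _"] X(2)
    by (intro exI[of _ "\<lambda>i. fst (X i)"] exI[of _ "\<lambda>i. fst (snd (X i))"] exI[of _ "\<lambda>i. fst (snd (snd (X i)))"]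
        exI[of _ "\<lambda>i. snd (snd (snd (X i)))"]) (auto simp: St_def R_def split_beta)
qed

end

section \<open>Counting paths\<close>

text \<open>Splitting off \<open>t\<close> points costs a binomial coefficient of at most
  \<open>2 ^ (Suc R * t)\<close>, and \<open>2 ^ t \<le> fact t\<close>, valid from
  \<open>t = 4\<close> on, turns this into \<open>Suc R\<close> further factors
  \<open>fact t\<close>.\<close>

lemma fact_mult_le_power:
  fixes t R :: nat assumes "4 \<le> t"
  shows "fact (R * t) \<le> (fact t :: nat) ^ (R * (R + 1))"
proof (induction R)
  case (Suc R)
  have two: "(2::nat) ^ t \<le> fact t"
    using assms
  proof (induction t rule: dec_induct)
    case base
    show ?case by (simp add: fact_numeral)
  next
    case (step n)
    have "2 * 2 ^ n \<le> Suc n * (fact n :: nat)" using step by (intro mult_mono) auto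
    thus ?case by simp
  qed
  have "fact (R * t) * fact t * (Suc R * t choose t) = (fact (Suc R * t) :: nat)"
    using binomial_fact_lemma[of t "Suc R * t"] by (simp add: algebra_simps)
  moreover have "(Suc R * t choose t) \<le> 2 ^ (Suc R * t)" by (rule binomial_le_pow2)
  ultimately have "fact (Suc R * t) \<le> fact (R * t) * fact t * (2::nat) ^ (Suc R * t)"
    by (metis mult_le_mono2)
  also have "(2::nat) ^ (Suc R * t) = (2 ^ t) ^ Suc R" by (simp only: power_mult[symmetric] mult.commute)
  also have "fact (R * t) * fact t * (2 ^ t) ^ Suc R \<le> (fact t :: nat) ^ (R * (R + 1)) * fact t * fact t ^ Suc R"
    using two by (intro mult_mono Suc.IH power_mono) auto
  also have "\<dots> = (fact t :: nat) ^ (R * (R + 1) + 1 + Suc R)" by (simp add: power_add)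
  also have "\<dots> \<le> fact t ^ (Suc R * (Suc R + 1))" by (intro power_increasing) (auto simp: fact_ge_1)
  finally show ?case .
qed simp

text \<open>The exponent for the symmetric groups is doubled to absorb the index 2, which is
  possible because \<open>alt_perms S\<close> has at least two elements.\<close>

lemma card_alt_perms_compare:
  assumes "finite S" "finite T" "8 \<le> card S" "card T \<le> R * card S"
  shows "card (alt_perms T) \<le> card (alt_perms S) ^ (2 * (R * (R + 1)))"
proof -
  let ?a = "card (alt_perms S)"
  have "fact 8 \<le> (fact (card S) :: nat)" using assms fact_mono by blast
  hence "2 \<le> ?a" using fact_le_card_alt_perms[OF assms(1)] by (simp add: fact_numeral)
  hence "2 * ?a \<le> ?a * ?a" by (rule mult_le_mono1)
  hence f: "fact (card S) \<le> ?a ^ 2" using fact_le_card_alt_perms[OF assms(1)] unfolding power2_eq_square by linarith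
  have "card (alt_perms T) \<le> fact (card T)" by (rule card_alt_perms_le[OF assms(2)])
  also have "\<dots> \<le> fact (R * card S)" using assms(4) by (rule fact_mono)
  also have "\<dots> \<le> fact (card S) ^ (R * (R + 1))" using assms(3) by (intro fact_mult_le_power) simp
  also have "\<dots> \<le> (?a ^ 2) ^ (R * (R + 1))" using f by (intro power_mono) auto
  finally show ?thesis by (simp only: power_mult)
qed

context parallel_graph
begin

lemma card_paths_add: "card (paths (p + q)) \<le> card (paths p) * card (paths q)"
proof -
  have "card (paths (p + q)) \<le> card (paths p \<times> paths q)"
  proof (rule card_inj_on_le[where f = "\<lambda>w. (take p w, drop p w)"])
    show "inj_on (\<lambda>w. (take p w, drop p w)) (paths (p + q))" by (auto simp: inj_on_def) (metis append_take_drop_id)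
    show "(\<lambda>w. (take p w, drop p w)) ` paths (p + q) \<subseteq> paths p \<times> paths q"
    proof clarify
      fix w assume w: "w \<in> paths (p + q)"
      have "drop p w = take q (drop p w)" using pathsD(1)[OF w] by simp
      thus "take p w \<in> paths p \<and> drop p w \<in> paths q" using sub_path[OF w, of 0 p] sub_path[OF w, of p q] by simp
    qed
  qed simp
  thus ?thesis by (simp add: card_cartesian_product)
qed

text \<open>A prefix through \<open>E0\<close> and a still suffix, both chosen according to the ends
  of \<open>w\<close>, complete \<open>w\<close> to a moved path from \<open>u\<close> to
  \<open>v\<close>.\<close>

lemma card_paths_le_moved:
  assumes "e \<in> E0" "u \<in> V" "v \<in> V" "n > 0"
  shows "card (paths n) \<le> card {w \<in> moved (2 * conn_len + 1 + n + conn_len). ends w = (u, v)}"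
proof -
  let ?c = "2 * conn_len + 1"
  have "\<exists>p\<in>moved ?c. ends p = (u, a)" if a: "a \<in> V" for a
  proof -
    obtain q where q: "q \<in> still conn_len" "ends q = (tgt e1, a)" using connect[OF order_refl e1_V(2) a] by blast
    have "q \<in> {w \<in> paths conn_len. ends w = (tgt e1, a)}" using q stillD by simp
    hence "card {w \<in> paths conn_len. ends w = (tgt e1, a)} > 0" by (intro card_gt_0_iff[THEN iffD2]) auto
    hence "card {w \<in> moved (conn_len + 1 + conn_len). ends w = (u, a)} > 0"
      using card_moved_ge[OF assms(1,2) conn_len_pos, of a] by linarith
    hence "{w \<in> moved (conn_len + 1 + conn_len). ends w = (u, a)} \<noteq> {}" by (metis card.empty less_irrefl)
    then obtain p where "p \<in> moved (conn_len + 1 + conn_len)" "ends p = (u, a)" by blast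
    moreover have "conn_len + 1 + conn_len = ?c" by simp
    ultimately show ?thesis by metis
  qed
  then obtain p where p: "\<And>a. a \<in> V \<Longrightarrow> p a \<in> moved ?c \<and> ends (p a) = (u, a)" by metis
  obtain s where s: "\<And>a. a \<in> V \<Longrightarrow> s a \<in> still conn_len \<and> ends (s a) = (a, v)"
    using connect[OF order_refl _ assms(3)] by metis
  show ?thesis
  proof (rule card_inj_on_le[where f = "\<lambda>w. p (fst (ends w)) @ w @ s (snd (ends w))"])
    have V: "fst (ends w) \<in> V" "snd (ends w) \<in> V" if "w \<in> paths n" for w using ends_V[OF that assms(4)] by auto
    show "inj_on (\<lambda>w. p (fst (ends w)) @ w @ s (snd (ends w))) (paths n)"
    proof (rule inj_onI)
      fix w w' assume w: "w \<in> paths n" "w' \<in> paths n"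
        and e: "p (fst (ends w)) @ w @ s (snd (ends w)) = p (fst (ends w')) @ w' @ s (snd (ends w'))"
      have "length (p (fst (ends w))) = length (p (fst (ends w')))"
        using p[OF V(1)[OF w(1)]] p[OF V(1)[OF w(2)]] movedD(1) pathsD(1) by metis
      hence "w @ s (snd (ends w)) = w' @ s (snd (ends w'))" using e by simp
      moreover have "length w = length w'" using w pathsD by auto
      ultimately show "w = w'" by simp
    qed
    show "(\<lambda>w. p (fst (ends w)) @ w @ s (snd (ends w))) ` paths n \<subseteq> {w \<in> moved (?c + n + conn_len). ends w = (u, v)}"
    proof clarify
      fix w assume w: "w \<in> paths n"
      note pw = p[OF V(1)[OF w]] and sw = s[OF V(2)[OF w]]
      have a: "w @ s (snd (ends w)) \<in> paths (n + conn_len)" "ends (w @ s (snd (ends w))) = (fst (ends w), v)"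
        using append_path[OF w stillD(1)[OF conjunct1[OF sw]] assms(4) conn_len_pos] sw by auto
      show "p (fst (ends w)) @ w @ s (snd (ends w)) \<in> moved (?c + n + conn_len) \<and>
          ends (p (fst (ends w)) @ w @ s (snd (ends w))) = (u, v)"
        using append_moved[OF movedD(1)[OF conjunct1[OF pw]] a(1)] append_path(2)[OF movedD(1)[OF conjunct1[OF pw]] a(1)]
          pw a conn_len_pos by (simp add: add.assoc)
    qed
  qed (use finite_moved in simp)
qed

lemma level_card_end_classes:
  assumes "level n f d (end_classes n d)"
  shows "2 * card (end_classes n d i) = card {w \<in> moved n. ends w = i}"
proof -
  interpret paired_partition "moved n" f d "V \<times> V" "end_classes n d" using assms by (simp add: level_def)
  have e: "ends (f w) = ends w" if "w \<in> moved n" for w using assms that unfolding level_def by blast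
  let ?A = "{w \<in> moved n. ends w = i}"
  have "bij_betw f {w \<in> ?A. d w} {w \<in> ?A. \<not> d w}"
    by (rule bij_betw_byWitness[where f' = f]) (use f_in ff df e in auto)
  hence "card {w \<in> ?A. d w} = card {w \<in> ?A. \<not> d w}" by (rule bij_betw_same_card)
  moreover have "card ?A = card {w \<in> ?A. d w} + card {w \<in> ?A. \<not> d w}"
    using finite_moved by (subst card_Un_disjoint[symmetric]) (auto intro!: arg_cong[where f = card])
  ultimately show ?thesis by (simp add: end_classes_def conj_assoc)
qed

text \<open>A bound for the number of paths of length up to \<open>3 * conn_len + 1\<close>, the
  total length of the pieces that connect a path to arbitrary ends.\<close>

definition class_ratio :: nat where "class_ratio = (card E + 1) ^ (3 * conn_len + 2)"

lemma card_paths_le': "card (paths n) \<le> (card E + 1) ^ n"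
proof -
  have "card (paths n) \<le> card {w. set w \<subseteq> E \<and> length w = n}"
    using finite_lists_length_eq[OF finite_edges] by (intro card_mono) (auto simp: paths_def)
  also have "\<dots> = card E ^ n" using card_lists_length_eq[OF finite_edges] .
  also have "\<dots> \<le> (card E + 1) ^ n" by (intro power_mono) auto
  finally show ?thesis .
qed

text \<open>For large \<open>n\<close> all classes lie between common bounds: each holds at most
  half of all paths of length \<open>n\<close> and at least half as many elements as there are paths
  shorter by \<open>3 * conn_len + 1\<close>. For small \<open>n\<close> the number of all paths is
  bounded by \<open>class_ratio\<close>.\<close>

lemma end_classes_ratio:
  assumes "level n f d (end_classes n d)" "i \<in> V \<times> V" "j \<in> V \<times> V"
  shows "card (end_classes n d j) \<le> class_ratio * card (end_classes n d i)"
proof -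
  let ?m = "\<lambda>i. card {w \<in> moved n. ends w = i}"
  have "8 \<le> card (end_classes n d i)" using assms unfolding level_def by blast
  hence i1: "1 \<le> ?m i" using level_card_end_classes[OF assms(1), of i] by simp
  hence "{w \<in> moved n. ends w = i} \<noteq> {}" by (metis card.empty not_one_le_zero)
  then obtain e where e: "e \<in> E0" by (auto simp: moved_def)
  have j: "?m j \<le> card (paths n)" using movedD by (intro card_mono) auto
  have "?m j \<le> class_ratio * ?m i"
  proof (cases "n \<ge> 3 * conn_len + 2")
    case False
    have "card (paths n) \<le> (card E + 1) ^ n" by (rule card_paths_le')
    also have "\<dots> \<le> class_ratio" unfolding class_ratio_def using False by (intro power_increasing) auto
    also have "\<dots> \<le> class_ratio * ?m i" using i1 by simp
    finally show ?thesis using j by linarith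
  next
    case True
    define n' where "n' = n - (3 * conn_len + 1)"
    have n: "n = (3 * conn_len + 1) + n'" "n = 2 * conn_len + 1 + n' + conn_len" "n' > 0"
      using True by (auto simp: n'_def)
    have "card (paths n) \<le> card (paths (3 * conn_len + 1)) * card (paths n')" unfolding n(1) by (rule card_paths_add)
    also have "\<dots> \<le> class_ratio * ?m i"
    proof (rule mult_mono)
      have "card (paths (3 * conn_len + 1)) \<le> (card E + 1) ^ (3 * conn_len + 1)" by (rule card_paths_le')
      also have "\<dots> \<le> class_ratio" unfolding class_ratio_def by (intro power_increasing) auto
      finally show "card (paths (3 * conn_len + 1)) \<le> class_ratio" .
      show "card (paths n') \<le> ?m i"
        using card_paths_le_moved[OF e, of "fst i" "snd i" n'] assms(2) n by auto
    qed auto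
    finally show ?thesis using j by linarith
  qed
  hence "2 * card (end_classes n d j) \<le> class_ratio * (2 * card (end_classes n d i))"
    by (simp only: level_card_end_classes[OF assms(1)])
  also have "\<dots> = 2 * (class_ratio * card (end_classes n d i))" by simp
  finally show ?thesis by linarith
qed

lemma finite_end_classes: "finite (end_classes n d i)"
  using finite_moved by (simp add: end_classes_def)

text \<open>One factor, the alternating group over the loops at a single vertex, is already large
  enough.\<close>

lemma card_level_group_ge:
  assumes "level n f d (end_classes n d)" "n = n' + 3 * conn_len + 1" "n' > 0"
  shows "fact (card (paths n') div 2) \<le> 2 * card (level_group n f (end_classes n d))"
proof -
  interpret paired_partition "moved n" f d "V \<times> V" "end_classes n d" using assms by (simp add: level_def)
  obtain u where u: "u \<in> V" using V_ne by blast
  have "8 \<le> card (end_classes n d (u, u))" using assms(1) u unfolding level_def by blast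
  hence "end_classes n d (u, u) \<noteq> {}" by auto
  then obtain e where e: "e \<in> E0" by (auto simp: end_classes_def moved_def)
  have "card (paths n') \<le> 2 * card (end_classes n d (u, u))"
    unfolding level_card_end_classes[OF assms(1)]
    using card_paths_le_moved[OF e u u assms(3)] assms(2) by (simp add: algebra_simps)
  hence "card (paths n') div 2 \<le> card (end_classes n d (u, u))" by simp
  hence "fact (card (paths n') div 2) \<le> (fact (card (end_classes n d (u, u))) :: nat)" by (rule fact_mono)
  also have "\<dots> \<le> 2 * card (alt_perms (end_classes n d (u, u)))" by (rule fact_le_card_alt_perms[OF finite_end_classes])
  also have "\<dots> \<le> 2 * card (level_group n f (end_classes n d))"
    unfolding level_group_def using card_paired_alt_ge[of "(u, u)"] u by simp
  finally show ?thesis .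
qed

end

section \<open>Products of simple groups of comparable order\<close>

text \<open>\<open>PS\<close> asks for simple factors with carriers in \<open>nat\<close>, whereas
  the alternating groups consist of functions on lists.\<close>

lemma nat_copy:
  assumes "group H" "finite (carrier H)"
  shows "\<exists>(N :: nat monoid) h. group N \<and> h \<in> iso H N"
proof -
  interpret H: group H by fact
  obtain h where h: "bij_betw h (carrier H) {0..<card (carrier H)}"
    using ex_bij_betw_finite_nat[OF assms(2)] by blast
  define k where "k = inv_into (carrier H) h"
  define N :: "nat monoid" where
    "N = \<lparr>carrier = h ` carrier H, mult = (\<lambda>a b. h (k a \<otimes>\<^bsub>H\<^esub> k b)), one = h \<one>\<^bsub>H\<^esub>\<rparr>"
  have k: "k (h x) = x" if "x \<in> carrier H" for x
    unfolding k_def using h that by (simp add: bij_betw_def inv_into_f_f)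
  have hom: "h \<in> hom H N" by (rule homI) (auto simp: N_def k)
  have bij: "bij_betw h (carrier H) (carrier N)" using h by (simp add: N_def bij_betw_def)
  have "group N"
  proof (rule groupI)
    show "\<exists>y\<in>carrier N. y \<otimes>\<^bsub>N\<^esub> x = \<one>\<^bsub>N\<^esub>" if x: "x \<in> carrier N" for x
    proof -
      obtain a where a: "a \<in> carrier H" "x = h a" using x by (auto simp: N_def)
      thus ?thesis using k by (intro bexI[of _ "h (inv\<^bsub>H\<^esub> a)"]) (auto simp: N_def)
    qed
  qed (auto simp: N_def k H.m_assoc)
  thus ?thesis using hom bij by (auto simp: iso_def)
qed

lemma comm_group_iso:
  assumes "comm_group N" "group H" "h \<in> iso H N" shows "comm_group H"
proof -
  interpret N: comm_group N by fact
  interpret H: group H by fact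
  have hom: "h \<in> hom H N" and inj: "inj_on h (carrier H)" using assms(3) by (auto simp: iso_def bij_betw_def)
  show ?thesis
  proof (rule H.group_comm_groupI)
    fix x y assume xy: "x \<in> carrier H" "y \<in> carrier H"
    have "h (x \<otimes>\<^bsub>H\<^esub> y) = h (y \<otimes>\<^bsub>H\<^esub> x)"
      using hom_mult[OF hom] xy N.m_comm hom_in_carrier[OF hom] by simp
    thus "x \<otimes>\<^bsub>H\<^esub> y = y \<otimes>\<^bsub>H\<^esub> x" using inj xy by (auto simp: inj_on_def)
  qed
qed

lemma product_group_cong_iso:
  assumes b: "bij_betw b J I" and h: "\<And>j. j \<in> J \<Longrightarrow> h j \<in> iso (S (b j)) (S' j)"
    and S: "\<And>i. i \<in> I \<Longrightarrow> group (S i)" 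
  shows "(\<lambda>a. \<lambda>j\<in>J. h j (a (b j))) \<in> iso (product_group I S) (product_group J S')"
proof (rule isoI)
  have bI: "b j \<in> I" if "j \<in> J" for j using b that by (auto simp: bij_betw_def)
  have hom: "h j \<in> hom (S (b j)) (S' j)" if "j \<in> J" for j using h[OF that] by (simp add: iso_def)
  have bij: "bij_betw (h j) (carrier (S (b j))) (carrier (S' j))" if "j \<in> J" for j using h[OF that] by (simp add: iso_def)
  show "(\<lambda>a. \<lambda>j\<in>J. h j (a (b j))) \<in> hom (product_group I S) (product_group J S')"
  proof (rule homI)
    fix x assume "x \<in> carrier (product_group I S)"
    thus "(\<lambda>j\<in>J. h j (x (b j))) \<in> carrier (product_group J S')"
      using bI hom_in_carrier[OF hom] by (auto simp: PiE_iff)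
  next
    fix x y assume "x \<in> carrier (product_group I S)" "y \<in> carrier (product_group I S)"
    hence "x (b j) \<in> carrier (S (b j))" "y (b j) \<in> carrier (S (b j))" if "j \<in> J" for j
      using bI[OF that] by (auto simp: PiE_iff)
    thus "(\<lambda>j\<in>J. h j ((x \<otimes>\<^bsub>product_group I S\<^esub> y) (b j))) =
        (\<lambda>j\<in>J. h j (x (b j))) \<otimes>\<^bsub>product_group J S'\<^esub> (\<lambda>j\<in>J. h j (y (b j)))"
      using bI hom_mult[OF hom] by (auto simp: fun_eq_iff restrict_def)
  qed
  show "bij_betw (\<lambda>a. \<lambda>j\<in>J. h j (a (b j))) (carrier (product_group I S)) (carrier (product_group J S'))"
    unfolding bij_betw_def
  proof
    show "inj_on (\<lambda>a. \<lambda>j\<in>J. h j (a (b j))) (carrier (product_group I S))"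
    proof (rule inj_onI)
      fix x y assume xy: "x \<in> carrier (product_group I S)" "y \<in> carrier (product_group I S)"
        and e: "(\<lambda>j\<in>J. h j (x (b j))) = (\<lambda>j\<in>J. h j (y (b j)))"
      show "x = y"
      proof (rule extensionalityI[of _ I])
        show "x \<in> extensional I" "y \<in> extensional I" using xy by (auto simp: PiE_def)
        fix i assume "i \<in> I"
        then obtain j where j: "j \<in> J" "i = b j" using b by (auto simp: bij_betw_def)
        hence "h j (x i) = h j (y i)" using fun_cong[OF e, of j] by simp
        moreover have "x i \<in> carrier (S i)" "y i \<in> carrier (S i)" using xy j bI by (auto simp: PiE_iff)
        ultimately show "x i = y i" using bij[OF j(1)] j by (auto simp: bij_betw_def inj_on_def)
      qed
    qed
    show "(\<lambda>a. \<lambda>j\<in>J. h j (a (b j))) ` carrier (product_group I S) = carrier (product_group J S')"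
    proof
      show "(\<lambda>a. \<lambda>j\<in>J. h j (a (b j))) ` carrier (product_group I S) \<subseteq> carrier (product_group J S')"
        using bI hom_in_carrier[OF hom] by (auto simp: PiE_iff)
      show "carrier (product_group J S') \<subseteq> (\<lambda>a. \<lambda>j\<in>J. h j (a (b j))) ` carrier (product_group I S)"
      proof
        fix y assume y: "y \<in> carrier (product_group J S')"
        define c where "c = inv_into J b"
        have c: "c (b j) = j" if "j \<in> J" for j unfolding c_def using bij_betw_inv_into_left[OF b that] .
        define x where "x = (\<lambda>i\<in>I. inv_into (carrier (S i)) (h (c i)) (y (c i)))"
        have xb: "x (b j) \<in> carrier (S (b j)) \<and> h j (x (b j)) = y j" if j: "j \<in> J" for j
        proof -
          have "y j \<in> h j ` carrier (S (b j))" using y j bij[OF j] by (auto simp: PiE_iff bij_betw_def)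
          thus ?thesis using c[OF j] bI[OF j] inv_into_into[of "y j" "h j"] f_inv_into_f[of "y j" "h j"] by (simp add: x_def)
        qed
        have "x \<in> carrier (product_group I S)"
        proof -
          have "x i \<in> carrier (S i)" if i: "i \<in> I" for i
          proof -
            obtain j where "j \<in> J" "i = b j" using b i by (auto simp: bij_betw_def)
            thus ?thesis using xb by blast
          qed
          thus ?thesis by (auto simp: x_def)
        qed
        moreover have "(\<lambda>j\<in>J. h j (x (b j))) = y"
          using xb y by (intro extensionalityI[of _ J]) (auto simp: PiE_def)
        ultimately show "y \<in> (\<lambda>a. \<lambda>j\<in>J. h j (a (b j))) ` carrier (product_group I S)" by blast
      qed
    qed
  qed
qed

text \<open>One polynomial comparison of the orders gives both bounds of \<open>PS\<close>: the
  lower one results from exchanging \<open>i\<close> and \<open>j\<close> and taking a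
  \<open>K\<close>-th root.\<close>

lemma PS_I:
  assumes G: "group G" and I: "finite I" "card I = r" and iso: "\<phi> \<in> iso G (product_group I S)"
    and S: "\<And>i. i \<in> I \<Longrightarrow> simple_group (S i) \<and> finite (carrier (S i)) \<and> \<not> comm_group (S i)"
    and K: "K \<ge> 1" and size: "\<And>i j. i \<in> I \<Longrightarrow> j \<in> I \<Longrightarrow> order (S j) \<le> order (S i) ^ K"
  shows "PS (1 / real K) (real K) r G"
proof -
  have grp: "group (S i)" if "i \<in> I" for i using S[OF that] by (simp add: simple_group_def)
  obtain b where b: "bij_betw b {1..r} I" using ex_bij_betw_nat_finite_1[OF I(1)] I(2) by blast
  have bI: "b j \<in> I" if "j \<in> {1..r}" for j using b that by (auto simp: bij_betw_def)
  have "\<exists>(N :: nat monoid) h. group N \<and> h \<in> iso (S (b j)) N" if "j \<in> {1..r}" for j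
    using nat_copy grp S bI[OF that] by blast
  then obtain N :: "nat \<Rightarrow> nat monoid" and h where N: "\<And>j. j \<in> {1..r} \<Longrightarrow> group (N j) \<and> h j \<in> iso (S (b j)) (N j)"
    by metis
  have card: "order (N j) = order (S (b j))" if "j \<in> {1..r}" for j
    using N[OF that] by (auto simp: order_def iso_def dest: bij_betw_same_card)
  have pos: "order (S i) > 0" if "i \<in> I" for i
    using S[OF that] simple_group.order_gt_one[of "S i"] by auto
  have sz: "real (order (N i)) powr (1 / real K) \<le> real (order (N j))"
    "real (order (N j)) \<le> real (order (N i)) powr real K" if ij: "i \<in> {1..r}" "j \<in> {1..r}" for i j
  proof -
    have p: "real (order (N i)) > 0" "real (order (N j)) > 0" using ij pos bI card by auto
    have "real (order (N i)) \<le> real (order (N j)) ^ K"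
      using size[OF bI[OF ij(2)] bI[OF ij(1)]] ij card by (metis of_nat_le_iff of_nat_power)
    also have "\<dots> = real (order (N j)) powr real K" using p by (simp add: powr_realpow)
    finally have "real (order (N i)) powr (1 / real K) \<le> (real (order (N j)) powr real K) powr (1 / real K)"
      using p by (intro powr_mono2) auto
    thus "real (order (N i)) powr (1 / real K) \<le> real (order (N j))" using p K by (simp add: powr_powr)
    have "real (order (N j)) \<le> real (order (N i)) ^ K"
      using size[OF bI[OF ij(1)] bI[OF ij(2)]] ij card by (metis of_nat_le_iff of_nat_power)
    thus "real (order (N j)) \<le> real (order (N i)) powr real K" using p by (simp add: powr_realpow)
  qed
  have "(\<lambda>a. \<lambda>j\<in>{1..r}. h j (a (b j))) \<in> iso (product_group I S) (product_group {1..r} N)"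
    using N grp by (intro product_group_cong_iso[OF b]) auto
  hence isoN: "G \<cong> product_group {1..r} N" using iso_set_trans[OF iso] by (auto simp: is_iso_def)
  have simple: "simple_group (N j) \<and> finite (carrier (N j)) \<and> \<not> comm_group (N j)" if j: "j \<in> {1..r}" for j
  proof -
    have "simple_group (N j)" using simple_group.iso_simple[of "S (b j)"] S[OF bI[OF j]] N[OF j] by blast
    moreover have "finite (carrier (N j))"
      using S[OF bI[OF j]] N[OF j] by (auto simp: iso_def dest: bij_betw_finite)
    moreover have "\<not> comm_group (N j)" using comm_group_iso[of "N j" "S (b j)"] S[OF bI[OF j]] N[OF j] grp[OF bI[OF j]] by blast
    ultimately show ?thesis by blast
  qed
  have "finite (carrier (product_group I S))" using S I(1) by (auto intro!: finite_PiE)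
  hence "finite (carrier G)" using iso by (auto simp: iso_def dest: bij_betw_finite)
  thus ?thesis unfolding PS_def using G isoN simple sz by (intro conjI exI[of _ N]) auto
qed

text \<open>The simple factors embed in a group as soon as it acts nontrivially, since the kernel of the
  action misses at least one of them.\<close>

lemma PS_card_le:
  assumes PS: "PS C D r G" and D: "D \<ge> 1" and \<phi>: "\<phi> \<in> hom G (BijGroup A)" and A: "finite A"
    and nt: "g \<in> carrier G" "\<phi> g \<noteq> \<one>\<^bsub>BijGroup A\<^esub>"
  shows "real (card (carrier G)) \<le> real (fact (card A)) powr (D * real r)"
proof -
  obtain S :: "nat \<Rightarrow> nat monoid" where S: "\<And>i. i \<in> {1..r} \<Longrightarrow> simple_group (S i) \<and> finite (carrier (S i))"
    and iso: "G \<cong> product_group {1..r} S"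
    and size: "\<And>i j. i \<in> {1..r} \<Longrightarrow> j \<in> {1..r} \<Longrightarrow> real (order (S j)) \<le> real (order (S i)) powr D"
    and G: "group G" "finite (carrier G)"
    using PS unfolding PS_def by blast
  interpret G: group G by fact
  let ?P = "product_group {1..r} S"
  have grp: "group (S i)" if "i \<in> {1..r}" for i using S[OF that] by (simp add: simple_group_def)
  interpret P: group ?P using product_group[of "{1..r}" S] grp by blast
  have "?P \<cong> G" using G.iso_sym iso by blast
  then obtain \<psi> where \<psi>: "\<psi> \<in> iso ?P G" by (auto simp: is_iso_def)
  have \<psi>hom: "\<psi> \<in> hom ?P G" and \<psi>bij: "bij_betw \<psi> (carrier ?P) (carrier G)" using \<psi> by (auto simp: iso_def)
  define \<theta> where "\<theta> = \<phi> \<circ> \<psi>"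
  have \<theta>: "\<theta> \<in> hom ?P (BijGroup A)" unfolding \<theta>_def using hom_compose[OF \<psi>hom \<phi>] .
  interpret B: group "BijGroup A" by (rule group_BijGroup)
  interpret \<theta>: group_hom ?P "BijGroup A" \<theta> by unfold_locales (rule \<theta>)
  define \<iota> where "\<iota> = (\<lambda>i a. \<lambda>j\<in>{1..r}. if j = i then a else \<one>\<^bsub>S j\<^esub>)"
  have \<iota>c: "\<iota> i a \<in> carrier ?P" if "i \<in> {1..r}" "a \<in> carrier (S i)" for i a
    using that grp by (auto simp: \<iota>_def group.is_monoid monoid.one_closed)
  have \<iota>hom: "\<iota> i \<in> hom (S i) ?P" if i: "i \<in> {1..r}" for i
  proof (rule homI)
    show "\<iota> i a \<in> carrier ?P" if "a \<in> carrier (S i)" for a using \<iota>c[OF i that] .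
    show "\<iota> i (a \<otimes>\<^bsub>S i\<^esub> b) = \<iota> i a \<otimes>\<^bsub>?P\<^esub> \<iota> i b" for a b
      using grp by (auto simp: \<iota>_def fun_eq_iff group.is_monoid monoid.one_closed monoid.l_one)
  qed
  \<comment> \<open>The images of the coordinate inclusions \<open>\<iota> i\<close> generate the
    product; if all of them acted trivially, so would \<open>g\<close>.\<close>
  have ex: "\<exists>i\<in>{1..r}. \<exists>a\<in>carrier (S i). \<theta> (\<iota> i a) \<noteq> \<one>\<^bsub>BijGroup A\<^esub>"
  proof (rule ccontr)
    assume "\<not> ?thesis"
    hence triv: "\<theta> (\<iota> i a) = \<one>\<^bsub>BijGroup A\<^esub>" if "i \<in> {1..r}" "a \<in> carrier (S i)" for i a using that by blast
    have "finite J \<Longrightarrow> J \<subseteq> {1..r} \<Longrightarrow> x \<in> carrier ?P \<Longrightarrow> (\<And>j. j \<in> {1..r} - J \<Longrightarrow> x j = \<one>\<^bsub>S j\<^esub>) \<Longrightarrow> \<theta> x = \<one>\<^bsub>BijGroup A\<^esub>" for J x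
    proof (induction J arbitrary: x rule: finite_induct)
      case empty
      hence "x = \<one>\<^bsub>?P\<^esub>" by (intro extensionalityI[of _ "{1..r}"]) (auto simp: PiE_def)
      thus ?case using \<theta>.hom_one by metis
    next
      case (insert i J)
      have i: "i \<in> {1..r}" using insert by simp
      define y where "y = (\<lambda>j\<in>{1..r}. if j = i then \<one>\<^bsub>S j\<^esub> else x j)"
      have xj: "x j \<in> carrier (S j)" if "j \<in> {1..r}" for j using insert.prems(2) that by (simp add: PiE_iff)
      have y: "y \<in> carrier ?P"
        using xj grp by (auto simp: y_def group.is_monoid monoid.one_closed)
      have "x = \<iota> i (x i) \<otimes>\<^bsub>?P\<^esub> y"
        using insert.prems(2) xj grp
        by (intro extensionalityI[of _ "{1..r}"])
           (auto simp: \<iota>_def y_def PiE_def group.is_monoid monoid.l_one monoid.r_one)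
      moreover have "\<theta> (\<iota> i (x i) \<otimes>\<^bsub>?P\<^esub> y) = \<theta> (\<iota> i (x i)) \<otimes>\<^bsub>BijGroup A\<^esub> \<theta> y"
        using \<theta>.hom_mult[OF \<iota>c[OF i xj[OF i]] y] .
      moreover have "y j = \<one>\<^bsub>S j\<^esub>" if "j \<in> {1..r} - J" for j
        using insert.prems(3)[of j] that by (simp add: y_def)
      hence "\<theta> y = \<one>\<^bsub>BijGroup A\<^esub>" using insert.IH[OF _ y] insert.prems(1) by blast
      ultimately show ?case using triv[OF i xj[OF i]] B.one_closed B.l_one by metis
    qed
    from this[of "{1..r}"] have all: "\<theta> x = \<one>\<^bsub>BijGroup A\<^esub>" if "x \<in> carrier ?P" for x using that by auto
    have "g \<in> \<psi> ` carrier ?P" using \<psi>bij nt(1) unfolding bij_betw_def by blast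
    then obtain x where "x \<in> carrier ?P" "\<psi> x = g" by blast
    thus False using all nt(2) by (auto simp: \<theta>_def)
  qed
  then obtain i a where ia: "i \<in> {1..r}" "a \<in> carrier (S i)" "\<theta> (\<iota> i a) \<noteq> \<one>\<^bsub>BijGroup A\<^esub>" by blast
  define \<eta> where "\<eta> = \<theta> \<circ> \<iota> i"
  have \<eta>: "\<eta> \<in> hom (S i) (BijGroup A)" unfolding \<eta>_def using hom_compose[OF \<iota>hom[OF ia(1)] \<theta>] .
  interpret Si: simple_group "S i" using S[OF ia(1)] by blast
  interpret \<eta>: group_hom "S i" "BijGroup A" \<eta>
    by unfold_locales (rule \<eta>)
  have "kernel (S i) (BijGroup A) \<eta> = carrier (S i) \<or> kernel (S i) (BijGroup A) \<eta> = {\<one>\<^bsub>S i\<^esub>}"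
    using Si.no_real_normal_subgroup[OF \<eta>.normal_kernel] .
  moreover have "a \<notin> kernel (S i) (BijGroup A) \<eta>" using ia by (simp add: kernel_def \<eta>_def)
  ultimately have "kernel (S i) (BijGroup A) \<eta> = {\<one>\<^bsub>S i\<^esub>}" using ia(2) by blast
  hence inj: "inj_on \<eta> (carrier (S i))" using \<eta>.inj_iff_trivial_ker by blast
  have carB: "carrier (BijGroup A) = Bij A" by (simp add: BijGroup_def)
  \<comment> \<open>Elements of \<open>Bij A\<close> are \<open>undefined\<close> off
    \<open>A\<close>; putting the identity there gives permutations in the sense of
    \<open>permutes\<close>.\<close>
  have inj2: "inj_on (\<lambda>f x. if x \<in> A then f x else x) (Bij A)"
  proof (rule inj_onI)
    fix f f' assume ff: "f \<in> Bij A" "f' \<in> Bij A" "(\<lambda>x. if x \<in> A then f x else x) = (\<lambda>x. if x \<in> A then f' x else x)"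
    show "f = f'"
    proof (rule extensionalityI[of _ A])
      show "f \<in> extensional A" "f' \<in> extensional A" using ff by (auto simp: Bij_def)
      show "f x = f' x" if "x \<in> A" for x using fun_cong[OF ff(3), of x] that by simp
    qed
  qed
  have img: "(\<lambda>f x. if x \<in> A then f x else x) ` Bij A \<subseteq> {p. p permutes A}"
  proof clarify
    fix f assume "f \<in> Bij A"
    hence "bij_betw (\<lambda>x. if x \<in> A then f x else x) A A"
      by (subst bij_betw_cong[of _ _ f]) (auto simp: Bij_def)
    thus "(\<lambda>x. if x \<in> A then f x else x) permutes A" by (intro bij_imp_permutes) auto
  qed
  have cB: "card (Bij A) \<le> fact (card A)" "finite (Bij A)"
    using card_inj_on_le[OF inj2 img] finite_permutations[OF A] card_permutations[OF refl A]
      finite_imageD[OF finite_subset[OF img finite_permutations[OF A]] inj2] by auto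
  have "card (carrier (S i)) \<le> card (Bij A)"
    using card_inj_on_le[OF inj, of "Bij A"] hom_in_carrier[OF \<eta>] carB cB(2) by auto
  hence oi: "real (order (S i)) \<le> real (fact (card A))" using cB(1) by (simp add: order_def del: of_nat_fact)
  have opos: "real (order (S j)) > 0" if "j \<in> {1..r}" for j using S[OF that] simple_group.order_gt_one[of "S j"] by auto
  have "card (carrier G) = card (carrier ?P)" using bij_betw_same_card[OF \<psi>bij] by simp
  also have "\<dots> = (\<Prod>j\<in>{1..r}. order (S j))" by (simp add: card_PiE order_def)
  finally have "real (card (carrier G)) = (\<Prod>j\<in>{1..r}. real (order (S j)))" by simp
  \<comment> \<open>The one embedded factor controls the others, whose orders are at most its
    \<open>D\<close>-th power.\<close>
  also have "\<dots> \<le> (\<Prod>j\<in>{1..r}. real (order (S i)) powr D)"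
    using size[OF ia(1)] by (intro prod_mono) auto
  also have "\<dots> = (real (order (S i)) powr D) ^ r" by simp
  also have "\<dots> = real (order (S i)) powr (D * real r)" using opos[OF ia(1)] by (simp add: powr_powr flip: powr_realpow)
  also have "\<dots> \<le> real (fact (card A)) powr (D * real r)" using oi D opos[OF ia(1)] by (intro powr_mono2) auto
  finally show ?thesis .
qed

section \<open>Coding a shift of finite type by a graph\<close>

definition word_at :: "(int \<Rightarrow> 'a) \<Rightarrow> int \<Rightarrow> nat \<Rightarrow> 'a list" where
  "word_at x i n = map (\<lambda>j. x (i + int j)) [0..<n]"

lemma length_word_at [simp]: "length (word_at x i n) = n"
  by (simp add: word_at_def)

lemma nth_word_at [simp]: "j < n \<Longrightarrow> word_at x i n ! j = x (i + int j)"
  by (simp add: word_at_def)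

lemma word_at_shift_by [simp]: "word_at (shift_by a x) i n = word_at x (i + a) n"
  by (simp add: word_at_def shift_by_def algebra_simps)

lemma word_at_eq_iff: "word_at x i n = word_at y k n \<longleftrightarrow> (\<forall>j<n. x (i + int j) = y (k + int j))"
  by (auto simp: list_eq_iff_nth_eq)

lemma word_at_append: "word_at x i (m + n) = word_at x i m @ word_at x (i + int m) n"
  by (rule nth_equalityI) (auto simp: nth_append)

lemma take_word_at: "k \<le> n \<Longrightarrow> take k (word_at x i n) = word_at x i k"
  by (rule nth_equalityI) auto

lemma drop_word_at: "k \<le> n \<Longrightarrow> drop k (word_at x i n) = word_at x (i + int k) (n - k)"
  by (rule nth_equalityI) (auto simp: algebra_simps)

lemma shift_shift_by: "shift = shift_by 1"
  by (auto simp: shift_def shift_by_def fun_eq_iff)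

text \<open>The finite type condition in the form of a memory: windows of length \<open>M\<close>
  decide membership in \<open>X\<close>.\<close>

locale sft =
  fixes A :: "'a set" and X :: "(int \<Rightarrow> 'a) set" and M :: nat
  assumes sub: "subshift A X" and M_pos: "M > 0"
    and memory: "\<And>x. (\<And>i. word_at x i M \<in> language X) \<Longrightarrow> x \<in> X"
begin

lemma finite_A: "finite A" and X_ne: "X \<noteq> {}"
  using sub by (auto simp: subshift_def)

lemma in_A: "x \<in> X \<Longrightarrow> x i \<in> A"
proof -
  assume "x \<in> X"
  moreover have "X \<subseteq> topspace (full_shift_topology A)" using sub closedin_subset unfolding subshift_def by blast
  ultimately have "x \<in> topspace (full_shift_topology A)" by blast
  thus ?thesis by (auto simp: full_shift_topology_def)
qed

lemma shift_by_1: "shift_by 1 ` X = X"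
  using sub by (simp add: subshift_def shift_shift_by)

lemma shift_by_in [simp]: "x \<in> X \<Longrightarrow> shift_by a x \<in> X"
proof -
  have p: "shift_by (int n) x \<in> X" if "x \<in> X" for n x
    using that
  proof (induction n)
    case (Suc n)
    have "shift_by 1 (shift_by (int n) x) \<in> X" using Suc shift_by_1 by blast
    thus ?case by (simp add: add.commute)
  qed simp
  have m: "shift_by (- int n) x \<in> X" if "x \<in> X" for n x
    using that
  proof (induction n)
    case (Suc n)
    then obtain y where y: "y \<in> X" "shift_by (- int n) x = shift_by 1 y" using shift_by_1 by blast
    have "shift_by (- 1) (shift_by (- int n) x) = y" using y(2) by simp
    thus ?case using y(1) by (simp add: algebra_simps)
  qed simp
  assume "x \<in> X"
  thus ?thesis using p[of x "nat a"] m[of x "nat (- a)"] by (cases "a \<ge> 0") auto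
qed

lemma in_language_iff: "w \<in> language X \<longleftrightarrow> (\<exists>x\<in>X. word_at x i (length w) = w)"
proof
  assume "w \<in> language X"
  then obtain x k where x: "x \<in> X" "\<forall>j<length w. w ! j = x (k + int j)" by (auto simp: language_def occurs_in_def)
  have "word_at (shift_by (k - i) x) i (length w) = w" using x(2) by (intro nth_equalityI) (auto simp: shift_by_def algebra_simps)
  thus "\<exists>x\<in>X. word_at x i (length w) = w" using x(1) shift_by_in by blast
next
  assume "\<exists>x\<in>X. word_at x i (length w) = w"
  then obtain x where x: "x \<in> X" "word_at x i (length w) = w" by blast
  have "w ! j = x (i + int j)" if "j < length w" for j using x(2) that by (metis nth_word_at)
  thus "w \<in> language X" using x(1) by (auto simp: language_def occurs_in_def)
qed

lemma word_at_language [simp]: "x \<in> X \<Longrightarrow> word_at x i n \<in> language X"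
  by (subst in_language_iff[of _ i]) auto

lemma language_append: "u @ v \<in> language X \<Longrightarrow> u \<in> language X \<and> v \<in> language X"
proof -
  assume "u @ v \<in> language X"
  then obtain x where x: "x \<in> X" "word_at x 0 (length u + length v) = u @ v" by (auto simp: in_language_iff[of _ 0])
  hence "word_at x 0 (length u) = u" "word_at x (int (length u)) (length v) = v" by (auto simp: word_at_append)
  thus ?thesis using x(1) word_at_language by metis
qed

lemma memory_ge:
  assumes "n \<ge> M" "\<And>i. word_at x i n \<in> language X" shows "x \<in> X"
proof (rule memory)
  fix i
  have "word_at x i n = word_at x i M @ word_at x (i + int M) (n - M)"
    using word_at_append[of x i M "n - M"] assms(1) by simp
  thus "word_at x i M \<in> language X" using assms(2)[of i] language_append by metis
qed

text \<open>Both points agree on an interval of length \<open>M\<close> that contains the cut, so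
  every window of length \<open>M\<close> shows a window of one of them.\<close>

lemma splice:
  assumes "x \<in> X" "y \<in> X" "\<And>i. a \<le> i \<Longrightarrow> i < a + int M \<Longrightarrow> x i = y i" "a \<le> b" "b \<le> a + int M"
  shows "(\<lambda>i. if i < b then x i else y i) \<in> X" (is "?z \<in> X")
proof (rule memory)
  fix i
  have zx: "?z j = x j" if "j < a + int M" for j using that assms(3)[of j] assms(4) by auto
  have zy: "?z j = y j" if "a \<le> j" for j using that assms(3)[of j] assms(5) by auto
  have "word_at ?z i M = word_at x i M \<or> word_at ?z i M = word_at y i M"
  proof (cases "i < a")
    case True
    hence "word_at ?z i M = word_at x i M" unfolding word_at_eq_iff using zx by auto
    thus ?thesis ..
  next
    case False
    hence "word_at ?z i M = word_at y i M" unfolding word_at_eq_iff using zy by auto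
    thus ?thesis ..
  qed
  thus "word_at ?z i M \<in> language X" using assms(1,2) word_at_language by metis
qed

definition words :: "nat \<Rightarrow> 'a list set" where
  "words n = {w \<in> language X. length w = n}"

lemma words_alt: "words n = (\<lambda>x. word_at x 0 n) ` X"
proof
  show "words n \<subseteq> (\<lambda>x. word_at x 0 n) ` X" using in_language_iff[of _ 0] by (force simp: words_def)
  show "(\<lambda>x. word_at x 0 n) ` X \<subseteq> words n" by (auto simp: words_def)
qed

lemma words_sub: "words n \<subseteq> {w. set w \<subseteq> A \<and> length w = n}"
  unfolding words_alt using in_A by (auto simp: word_at_def)

lemma finite_words: "finite (words n)"
  using words_sub finite_lists_length_eq[OF finite_A] by (rule finite_subset)

text \<open>All windows of length \<open>M\<close> in the periodic repetition of
  \<open>u @ w\<close> already occur in \<open>u @ w @ u\<close>, because \<open>u\<close> is at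
  least as long as the memory.\<close>

lemma periodic_point:
  assumes "u @ w @ u \<in> language X" "length u \<ge> M" "p = length (u @ w)"
  shows "\<exists>x\<in>X. shift_by (int p) x = x \<and> word_at x 0 (length u) = u"
proof -
  have p: "p > 0" using assms M_pos by auto
  define x where "x = (\<lambda>i. (u @ w) ! nat (i mod int p))"
  have px: "x (i + int p * k) = x i" for i k by (simp add: x_def)
  have uw: "(u @ w @ u) ! j = x (int j)" if "j < p + length u" for j
  proof (cases "j < p")
    case True
    hence "((u @ w) @ u) ! j = (u @ w) ! j" using assms(3) by (simp only: nth_append if_True)
    thus ?thesis using True by (simp add: x_def)
  next
    case False
    define k where "k = j - p"
    have k: "j = p + k" "k < length u" using False that by (auto simp: k_def)
    have "x (int j) = x (int k)" using px[of "int k" 1] k by (simp add: add.commute)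
    also have "\<dots> = u ! k" using k assms(3) by (simp add: x_def nth_append)
    also have "\<dots> = ((u @ w) @ u) ! j" using k assms(3) by (simp only: nth_append_length_plus)
    finally show ?thesis by simp
  qed
  have "x \<in> X"
  proof (rule memory)
    fix i
    define r where "r = nat (i mod int p)"
    have r: "i = int r + int p * (i div int p)" "r < p" using p by (auto simp: r_def nat_less_iff)
    have lu: "length (u @ w @ u) = p + length u" using assms(3) by simp
    have "word_at x i M = take M (drop r (u @ w @ u))"
    proof (rule nth_equalityI)
      show "length (word_at x i M) = length (take M (drop r (u @ w @ u)))"
        using r(2) assms(2) unfolding length_word_at length_take length_drop lu by simp
      fix j assume "j < length (word_at x i M)"
      hence j: "j < M" by simp
      have "x (i + int j) = x (int (r + j))" using px[of "int (r + j)" "i div int p"] r(1) by (simp add: algebra_simps)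
      also have "\<dots> = (u @ w @ u) ! (r + j)" using uw[of "r + j"] r(2) j assms(2) by simp
      also have "\<dots> = take M (drop r (u @ w @ u)) ! j" 
      proof -
        have "r \<le> length (u @ w @ u)" using r(2) lu by linarith
        thus ?thesis by (simp only: nth_take[OF j] nth_drop)
      qed
      finally show "word_at x i M ! j = take M (drop r (u @ w @ u)) ! j" using j by simp
    qed
    moreover have "u @ w @ u = take r (u @ w @ u) @ take M (drop r (u @ w @ u)) @ drop M (drop r (u @ w @ u))"
      by (simp only: append_take_drop_id)
    ultimately show "word_at x i M \<in> language X" using language_append assms(1) by metis
  qed
  moreover have "shift_by (int p) x = x" using px[of _ 1] by (auto simp: shift_by_def fun_eq_iff)
  moreover have "word_at x 0 (length u) = u"
  proof (intro nth_equalityI)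
    fix j assume "j < length (word_at x 0 (length u))"
    hence j: "j < length u" by simp
    thus "word_at x 0 (length u) ! j = u ! j" using uw[of j] by (simp add: nth_append)
  qed simp
  ultimately show ?thesis by blast
qed

end

lemma sft_exists:
  assumes "shift_of_finite_type A X" shows "\<exists>M. sft A X M"
proof -
  obtain F where F: "subshift A X" "finite F" "X = {x. range x \<subseteq> A \<and> (\<forall>w\<in>F. \<not> occurs_in w x)}"
    using assms by (auto simp: shift_of_finite_type_def)
  \<comment> \<open>One more than the longest forbidden word, so that windows are nonempty and also
    control the alphabet.\<close>
  define M where "M = Suc (Max (insert 0 (length ` F)))"
  have len: "length w \<le> M" if "w \<in> F" for w
  proof -
    have "length w \<le> Max (insert 0 (length ` F))" using F(2) that by (intro Max_ge) auto
    thus ?thesis by (simp add: M_def)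
  qed
  have "x \<in> X" if x: "\<And>i. word_at x i M \<in> language X" for x
  proof -
    have win: "\<exists>y\<in>X. \<exists>k. \<forall>j<M. x (i + int j) = y (k + int j)" for i
      using x[of i] by (force simp: language_def occurs_in_def)
    have "x i \<in> A" for i
    proof -
      obtain y k where y: "y \<in> X" "\<forall>j<M. x (i + int j) = y (k + int j)" using win by blast
      hence "x i = y k" by (auto simp: M_def dest: spec[of _ 0])
      moreover have "y k \<in> A" using y(1) F(3) by auto
      ultimately show ?thesis by simp
    qed
    moreover have "\<not> occurs_in w x" if w: "w \<in> F" for w
    proof
      assume "occurs_in w x"
      then obtain i where i: "\<forall>j<length w. w ! j = x (i + int j)" by (auto simp: occurs_in_def)
      obtain y k where y: "y \<in> X" "\<forall>j<M. x (i + int j) = y (k + int j)" using win by blast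
      have "occurs_in w y" unfolding occurs_in_def using i y(2) len[OF w] by (intro exI[of _ k]) auto
      thus False using y(1) F(3) w by auto
    qed
    ultimately show ?thesis using F(3) by auto
  qed
  thus ?thesis using F(1) by (intro exI[of _ M]) (unfold_locales, auto simp: M_def)
qed

section \<open>Marker words with exponentially many returns\<close>

lemma pow2_gt_linear: "\<exists>t. (4 * L :: nat) < 2 ^ t"
  by (rule exI[of _ "4 * L"]) (rule less_exp)

definition cat :: "nat \<Rightarrow> (int \<Rightarrow> 'a list) \<Rightarrow> int \<Rightarrow> 'a" where
  "cat L s = (\<lambda>i. s (i div int L) ! nat (i mod int L))"

lemma cat_cong:
  assumes "L > 0" "\<And>j. m \<le> j \<Longrightarrow> j < n \<Longrightarrow> s j = s' j" "m * int L \<le> i" "i < n * int L"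
  shows "cat L s i = cat L s' i"
proof -
  have "m \<le> i div int L" using zdiv_mono1[OF assms(3), of "int L"] assms(1) by simp
  moreover have "i div int L < n"
  proof (rule ccontr)
    assume "\<not> ?thesis"
    hence "n * int L \<le> (i div int L) * int L" by (intro mult_right_mono) auto
    also have "\<dots> \<le> i" using assms(1) by (simp flip: minus_mod_eq_div_mult)
    finally show False using assms(4) by simp
  qed
  ultimately show ?thesis using assms(2) by (simp add: cat_def)
qed

lemma cat_shift_by: "L > 0 \<Longrightarrow> shift_by (q * int L) (cat L s) = cat L (\<lambda>j. s (j + q))"
  by (auto simp: cat_def shift_by_def fun_eq_iff add.commute)

lemma word_at_cat:
  assumes "L > 0" "\<And>j. length (s j) = L" shows "word_at (cat L s) (q * int L) L = s q"
  using block_glue[of L s q] assms by (simp add: cat_def word_at_def block_def)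

text \<open>Free concatenation embeds the full shift on two symbols, with the shift by
  \<open>L\<close>, into \<open>X\<close>.\<close>

locale free_pair = sft A X M for A :: "'a set" and X M +
  fixes \<alpha> \<beta> :: "'a list" and L :: nat
  assumes ne: "\<alpha> \<noteq> \<beta>" and len: "length \<alpha> = L" "length \<beta> = L" and LM: "M \<le> L"
    and free: "\<And>s. (\<And>j. s j \<in> {\<alpha>, \<beta>}) \<Longrightarrow> cat L s \<in> X"
begin

lemma L_pos: "L > 0" using LM M_pos by simp

text \<open>Repeating every word lowers the growth rate but keeps it positive. The doubled
  concatenations are thus rare enough to avoid a marker and numerous enough to fill the gaps between
  its occurrences.\<close>

definition doubled :: "(int \<Rightarrow> 'a list) \<Rightarrow> bool" where
  "doubled s \<longleftrightarrow> (\<forall>j. s j \<in> {\<alpha>, \<beta>}) \<and> (\<forall>j. s (2 * j + 1) = s (2 * j))"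

definition doubled_words :: "nat \<Rightarrow> 'a list set" where
  "doubled_words R = {word_at (cat L s) i R |s i. doubled s}"

lemma len_s: "(\<And>j. s j \<in> {\<alpha>, \<beta>}) \<Longrightarrow> length (s j) = L"
  using len by (metis insert_iff singletonD)

lemma card_lists: "card {l. set l \<subseteq> {\<alpha>, \<beta>} \<and> length l = n} = 2 ^ n"
  using card_lists_length_eq[of "{\<alpha>, \<beta>}" n] ne by (simp add: numeral_2_eq_2)

lemma finite_lists: "finite {l. set l \<subseteq> {\<alpha>, \<beta>} \<and> length l = n}"
  by (rule finite_lists_length_eq) simp

text \<open>The doubled concatenations have half the exponential growth rate of all
  concatenations, so they miss some word.\<close>

lemma card_doubled_words: "card (doubled_words (2 * L * t)) \<le> 2 * L * 2 ^ (t + 1)"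
proof -
  let ?G = "\<lambda>(r, l). word_at (cat L (\<lambda>j. l ! (nat j div 2))) (int r) (2 * L * t)"
  let ?S = "{..<2 * L} \<times> {l. set l \<subseteq> {\<alpha>, \<beta>} \<and> length l = t + 1}"
  have "doubled_words (2 * L * t) \<subseteq> ?G ` ?S"
  proof
    fix w assume "w \<in> doubled_words (2 * L * t)"
    then obtain s i where s: "doubled s" "w = word_at (cat L s) i (2 * L * t)" by (auto simp: doubled_words_def)
    define q where "q = i div int (2 * L)"
    define r where "r = nat (i mod int (2 * L))"
    have "i = q * int (2 * L) + i mod int (2 * L)" by (simp only: q_def div_mult_mod_eq)
    moreover have "int r = i mod int (2 * L)" "r < 2 * L" using L_pos by (simp_all add: r_def nat_less_iff)
    ultimately have r: "i = q * int (2 * L) + int r" "r < 2 * L" by simp_all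
    \<comment> \<open>Whatever the offset \<open>r < 2 * L\<close> is, a word of length
      \<open>2 * L * t\<close> meets at most \<open>t + 1\<close> doubled words.\<close>
    define l where "l = map (\<lambda>k. s (2 * q + 2 * int k)) [0..<t + 1]"
    have l: "set l \<subseteq> {\<alpha>, \<beta>}" "length l = t + 1" using s(1) by (auto simp: l_def doubled_def)
    have sl: "s (j + 2 * q) = l ! (nat j div 2)" if "0 \<le> j" "j < 2 * int t + 2" for j
    proof -
      have "nat j div 2 < t + 1" using that by auto
      hence "l ! (nat j div 2) = s (2 * q + 2 * int (nat j div 2))" by (simp add: l_def del: upt_Suc)
      moreover have "int (nat j div 2) = j div 2" using that by simp
      moreover have "s (j + 2 * q) = s (2 * q + 2 * (j div 2))"
      proof (cases "even j")
        case True
        thus ?thesis by (simp add: add.commute)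
      next
        case False
        hence "j + 2 * q = 2 * (q + j div 2) + 1" by presburger
        thus ?thesis using s(1) by (metis doubled_def distrib_left)
      qed
      ultimately show ?thesis by simp
    qed
    have "w = word_at (cat L (\<lambda>j. s (j + 2 * q))) (int r) (2 * L * t)"
    proof -
      have "shift_by (2 * q * int L) (cat L s) = cat L (\<lambda>j. s (j + 2 * q))" using cat_shift_by[OF L_pos] .
      moreover have "i = int r + 2 * q * int L" using r(1) by simp
      ultimately show ?thesis using s(2) by (metis word_at_shift_by)
    qed
    also have "\<dots> = ?G (r, l)"
      unfolding prod.case word_at_eq_iff
    proof (intro allI impI)
      fix k assume k: "k < 2 * L * t"
      show "cat L (\<lambda>j. s (j + 2 * q)) (int r + int k) = cat L (\<lambda>j. l ! (nat j div 2)) (int r + int k)"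
      proof (rule cat_cong[OF L_pos, of 0 "2 * int t + 2"])
        have "r + k < 2 * L + 2 * L * t" using k r(2) by linarith
        hence "int r + int k < int (2 * L + 2 * L * t)" by (metis of_nat_add of_nat_less_iff)
        also have "\<dots> = (2 * int t + 2) * int L" by (simp add: algebra_simps)
        finally show "int r + int k < (2 * int t + 2) * int L" .
      qed (use sl in auto)
    qed
    finally show "w \<in> ?G ` ?S" using r l by (intro image_eqI[of _ _ "(r, l)"]) auto
  qed
  hence "card (doubled_words (2 * L * t)) \<le> card ?S"
    using finite_lists by (meson card_image_le card_mono finite_SigmaI finite_imageI finite_lessThan order_trans)
  also have "\<dots> = 2 * L * 2 ^ (t + 1)" using card_lists[of "t + 1"] by (simp add: card_cartesian_product)
  finally show ?thesis .
qed

lemma card_words_ge: "2 ^ (2 * t) \<le> card (words (2 * L * t))"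
proof -
  let ?s = "\<lambda>l j. if 0 \<le> j \<and> j < 2 * int t then l ! nat j else \<alpha>"
  let ?G = "\<lambda>l. word_at (cat L (?s l)) 0 (2 * L * t)"
  let ?S = "{l. set l \<subseteq> {\<alpha>, \<beta>} \<and> length l = 2 * t}"
  have s: "?s l j \<in> {\<alpha>, \<beta>}" if "l \<in> ?S" for l j
  proof (cases "0 \<le> j \<and> j < 2 * int t")
    case True
    hence "nat j < length l" using that by auto
    hence "l ! nat j \<in> set l" by (rule nth_mem)
    thus ?thesis using that True by auto
  qed auto
  have "card ?S \<le> card (words (2 * L * t))"
  proof (rule card_inj_on_le[where f = ?G])
    show "?G ` ?S \<subseteq> words (2 * L * t)"
    proof
      fix w assume "w \<in> ?G ` ?S"
      then obtain l where l: "l \<in> ?S" "w = ?G l" by (rule imageE)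
      have "cat L (?s l) \<in> X" by (rule free[OF s[OF l(1)]])
      thus "w \<in> words (2 * L * t)" unfolding words_alt l(2) by (rule imageI)
    qed
    show "inj_on ?G ?S"
    proof (rule inj_onI)
      fix l l' assume l: "l \<in> ?S" "l' \<in> ?S" "?G l = ?G l'"
      have eq: "cat L (?s l) (int k) = cat L (?s l') (int k)" if "k < 2 * L * t" for k
        using l(3) that unfolding word_at_eq_iff by simp
      have "l ! j = l' ! j" if j: "j < 2 * t" for j
      proof -
        have "word_at (cat L (?s l)) (int j * int L) L = word_at (cat L (?s l')) (int j * int L) L"
          unfolding word_at_eq_iff
        proof (intro allI impI)
          fix k assume k: "k < L"
          have "(j + 1) * L \<le> 2 * t * L" using j by (intro mult_right_mono) auto
          hence "j * L + k < 2 * L * t" using k by (simp add: algebra_simps)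
          from eq[OF this] show "cat L (?s l) (int j * int L + int k) = cat L (?s l') (int j * int L + int k)" by simp
        qed
        moreover have "word_at (cat L (?s l)) (int j * int L) L = ?s l (int j)"
          by (rule word_at_cat[OF L_pos len_s[OF s[OF l(1)]]])
        moreover have "word_at (cat L (?s l')) (int j * int L) L = ?s l' (int j)"
          by (rule word_at_cat[OF L_pos len_s[OF s[OF l(2)]]])
        ultimately have "?s l (int j) = ?s l' (int j)" by (simp only:)
        thus ?thesis using j by simp
      qed
      thus "l = l'" using l by (intro nth_equalityI) auto
    qed
  qed (rule finite_words)
  thus ?thesis using card_lists by simp
qed

text \<open>Of the at least \<open>4 ^ t\<close> words of length \<open>2 * L * t\<close>, at most
  \<open>4 * L * 2 ^ t\<close> occur in doubled concatenations.\<close>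

lemma marker_word: "\<exists>t a. t > 0 \<and> a \<in> words (2 * L * t) \<and> a \<notin> doubled_words (2 * L * t)"
proof -
  obtain t where t: "4 * L < 2 ^ t" using pow2_gt_linear by blast
  have t0: "t > 0" using t L_pos by (cases t) auto
  have "2 * L * 2 ^ (t + 1) = 4 * L * 2 ^ t" by simp
  also have "\<dots> < 2 ^ t * 2 ^ t" using t by (intro mult_strict_right_mono) auto
  also have "\<dots> = 2 ^ (2 * t)" by (simp add: mult_2 power_add)
  finally have "card (doubled_words (2 * L * t)) < card (words (2 * L * t))"
    using card_doubled_words[of t] card_words_ge[of t] by linarith
  moreover have "finite (doubled_words (2 * L * t))"
  proof -
    have "doubled_words (2 * L * t) \<subseteq> words (2 * L * t)"
      using free by (auto simp: doubled_words_def doubled_def words_def intro!: word_at_language)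
    thus ?thesis using finite_words finite_subset by blast
  qed
  ultimately have "\<not> words (2 * L * t) \<subseteq> doubled_words (2 * L * t)" using card_mono by (metis leD)
  thus ?thesis using t0 by blast
qed

text \<open>The return words of \<open>a\<close> with return time \<open>l\<close>, each taken
  together with the closing occurrence of \<open>a\<close>.\<close>

definition returns :: "'a list \<Rightarrow> nat \<Rightarrow> 'a list set" where
  "returns a l = {word_at x 0 (l + length a) |x. x \<in> X \<and> word_at x 0 (length a) = a \<and> word_at x (int l) (length a) = a \<and>
     (\<forall>s. 0 < s \<and> s < l \<longrightarrow> word_at x (int s) (length a) \<noteq> a)}"

text \<open>Any doubled concatenation of \<open>2 * N\<close> words can be inserted between a point
  whose left half ends with a long run of \<open>\<alpha>\<close> and one whose right half begins
  with such a run. The inserted part contains no \<open>a\<close>, so the last occurrence before it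
  and the first one after it are consecutive, and their distance depends only on
  \<open>N\<close>.\<close>

lemma many_returns:
  assumes mix: "mixing X"
  shows "\<exists>a c. length a \<ge> M \<and> a \<in> language X \<and> c > 0 \<and> (\<forall>N. 2 ^ N \<le> card (returns a (2 * L * N + c)))"
proof -
  obtain t a where t: "t > 0" and a: "a \<in> words (2 * L * t)" "a \<notin> doubled_words (2 * L * t)" using marker_word by blast
  define R where "R = 2 * L * t"
  have R: "length a = R" "a \<in> language X" using a by (auto simp: words_def R_def)
  have RM: "R \<ge> M" "R > 0"
  proof -
    have "L * 1 \<le> L * (2 * t)" using t by (intro mult_left_mono) auto
    moreover have "R = L * (2 * t)" by (simp add: R_def)
    ultimately show "R \<ge> M" "R > 0" using LM L_pos by linarith+
  qed
  define J where "J = R"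
  define P where "P = cat L (\<lambda>_. \<alpha>)"
  have P: "P \<in> X" unfolding P_def by (intro free) auto
  have Pper: "P (i + q * int L) = P i" for i q
    using fun_cong[OF cat_shift_by[OF L_pos, of q "\<lambda>_. \<alpha>"], of i] by (simp add: P_def shift_by_def)
  \<comment> \<open>The run is at least as long as the memory, so that points can be spliced along
    it, and at least as long as \<open>a\<close>, so that no occurrence of \<open>a\<close> reaches
    across it from outside.\<close>
  define H where "H = 2 * L * J"
  have HR: "H \<ge> R" "H \<ge> M"
  proof -
    have "1 * J \<le> 2 * L * J" using L_pos by (intro mult_right_mono) auto
    hence "R \<le> H" by (simp add: H_def J_def)
    thus "H \<ge> R" "H \<ge> M" using RM by linarith+
  qed
  define v where "v = word_at P 0 H"
  have v: "v \<in> language X" "length v = H" using P by (auto simp: v_def)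
  obtain w where w: "a @ w @ v \<in> language X" using mix R(2) v(1) unfolding mixing_def by blast
  obtain w' where w': "v @ w' @ a \<in> language X" using mix R(2) v(1) unfolding mixing_def by blast
  obtain x1 where x1: "x1 \<in> X" "word_at x1 (- int (R + length w + H)) (R + (length w + H)) = a @ w @ v"
    using w R v in_language_iff[of "a @ w @ v" "- int (R + length w + H)"] by auto
  have x1a: "word_at x1 (- int (R + length w + H)) R = a"
    using x1(2) R by (simp add: word_at_append)
  have x1v: "word_at x1 (- int H) H = v"
  proof -
    have "word_at x1 (- int (R + length w + H)) R @ word_at x1 (- int (R + length w + H) + int R) (length w)
        @ word_at x1 (- int (R + length w + H) + int R + int (length w)) H = a @ w @ v"
      using x1(2) unfolding word_at_append .
    hence "word_at x1 (- int (R + length w + H) + int R + int (length w)) H = v" using R v by simp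
    moreover have "- int (R + length w + H) + int R + int (length w) = - int H" by simp
    ultimately show ?thesis by metis
  qed
  obtain y1 where y1: "y1 \<in> X" "word_at y1 0 (H + (length w' + R)) = v @ w' @ a"
    using w' R v in_language_iff[of "v @ w' @ a" 0] by auto
  have y1': "word_at y1 0 H = v" "word_at y1 (int H + int (length w')) R = a"
    using y1(2) R v unfolding word_at_append by auto
  \<comment> \<open>\<open>t1\<close> locates the last occurrence of \<open>a\<close> in
    \<open>x1\<close> that starts before the run, which occupies the positions from
    \<open>- H\<close> to \<open>- 1\<close>.\<close>
  define t1 where "t1 = (LEAST t. word_at x1 (- int H - 1 - int t) R = a)"
  have t1: "word_at x1 (- int H - 1 - int t1) R = a"
  proof -
    have "word_at x1 (- int H - 1 - int (length w + R - 1)) R = a"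
      using x1a RM by (simp add: of_nat_diff algebra_simps)
    thus ?thesis unfolding t1_def by (rule LeastI)
  qed
  have t1_min: "word_at x1 (- int H - 1 - int t) R \<noteq> a" if "t < t1" for t
    using that unfolding t1_def by (rule not_less_Least)
  \<comment> \<open>\<open>t2\<close> locates the first occurrence of \<open>a\<close> in
    \<open>y1\<close> that extends beyond the run; \<open>int H - int R + 1\<close> is the least
    start for which this happens.\<close>
  define t2 where "t2 = (LEAST t. word_at y1 (int H - int R + 1 + int t) R = a)"
  have t2: "word_at y1 (int H - int R + 1 + int t2) R = a"
  proof -
    have "word_at y1 (int H - int R + 1 + int (length w' + R - 1)) R = a"
      using y1'(2) RM by (simp add: of_nat_diff algebra_simps)
    thus ?thesis unfolding t2_def by (rule LeastI)
  qed
  have t2_min: "word_at y1 (int H - int R + 1 + int t) R \<noteq> a" if "t < t2" for t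
    using that unfolding t2_def by (rule not_less_Least)
  define c where "c = (H - R) + 1 + t2 + H + 1 + t1"
  have "2 ^ N \<le> card (returns a (2 * L * N + c))" for N
  proof -
    let ?S = "{l. set l \<subseteq> {\<alpha>, \<beta>} \<and> length l = N}"
    define s where "s = (\<lambda>l (j::int). if 0 \<le> j \<and> j < 2 * int N then l ! (nat j div 2) else \<alpha>)"
    define B where "B = int (2 * L * N)"
    define z where "z = (\<lambda>l i. if i < B then (if i < 0 then x1 i else cat L (s l) i) else y1 (i - B))"
    define i1 where "i1 = - int H - 1 - int t1"
    have B0: "B \<ge> 0" "B = 2 * int N * int L" by (simp_all add: B_def)
    have sd: "doubled (s l)" if "l \<in> ?S" for l
    proof -
      have "s l j \<in> {\<alpha>, \<beta>}" for j
      proof (cases "0 \<le> j \<and> j < 2 * int N")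
        case True
        hence "nat j div 2 < length l" using that by auto
        hence "l ! (nat j div 2) \<in> set l" by (rule nth_mem)
        thus ?thesis using that True by (auto simp: s_def)
      qed (auto simp: s_def)
      moreover have "s l (2 * j + 1) = s l (2 * j)" for j
      proof (cases "0 \<le> 2 * j \<and> 2 * j < 2 * int N")
        case True
        hence "nat (2 * j + 1) div 2 = nat (2 * j) div 2" by (simp add: nat_add_distrib nat_mult_distrib)
        thus ?thesis using True by (auto simp: s_def)
      next
        case False
        hence "\<not> (0 \<le> 2 * j + 1 \<and> 2 * j + 1 < 2 * int N)" by presburger
        thus ?thesis unfolding s_def using False by (simp only: if_False)
      qed
      ultimately show ?thesis by (simp add: doubled_def)
    qed
    have sin: "s l j \<in> {\<alpha>, \<beta>}" if "l \<in> ?S" for l j using sd[OF that] by (simp add: doubled_def)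
    have catX: "cat L (s l) \<in> X" if "l \<in> ?S" for l by (intro free sin[OF that])
    have HL: "int H = 2 * int J * int L" by (simp add: H_def)
    have cl: "cat L (s l) i = P i" if "- int H \<le> i" "i < 0" for l i
      unfolding P_def by (rule cat_cong[OF L_pos, of "- 2 * int J" 0]) (use that HL in \<open>auto simp: s_def\<close>)
    have cr: "cat L (s l) i = P i" if i: "B \<le> i" for l i
    proof -
      have "0 \<le> i + 1" using i B0(1) by linarith
      moreover have "1 \<le> int L" using L_pos by simp
      ultimately have le: "(i + 1) * 1 \<le> (i + 1) * int L" by (intro mult_left_mono) auto
      have lt: "i < (i + 1) * int L" by (rule order_less_le_trans[OF _ le]) simp
      show ?thesis unfolding P_def
      proof (rule cat_cong[OF L_pos _ _ lt])
        show "2 * int N * int L \<le> i" using i B0(2) by simp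
      qed (auto simp: s_def)
    qed
    have x1P: "x1 i = P i" if "- int H \<le> i" "i < 0" for i
    proof -
      define k where "k = nat (i + int H)"
      have k: "i = - int H + int k" "k < H" using that by (auto simp: k_def)
      have "word_at x1 (- int H) H ! k = v ! k" using x1v by simp
      hence "x1 i = P (int k)" using k by (simp add: v_def)
      also have "\<dots> = P (i + 2 * int J * int L)" using k HL by simp
      also have "\<dots> = P i" by (rule Pper)
      finally show ?thesis .
    qed
    have y1P: "y1 (i - B) = P i" if "B \<le> i" "i < B + int H" for i
    proof -
      define k where "k = nat (i - B)"
      have k: "i = B + int k" "k < H" using that by (auto simp: k_def)
      have "word_at y1 0 H ! k = v ! k" using y1' by simp
      hence "y1 (i - B) = P (int k)" using k by (simp add: v_def)
      also have "\<dots> = P (int k + 2 * int N * int L)" by (rule Pper[symmetric])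
      also have "\<dots> = P i" using k B0 by (simp add: add.commute)
      finally show ?thesis .
    qed
    have zX: "z l \<in> X" if l: "l \<in> ?S" for l
    proof -
      have 1: "(\<lambda>i. if i < 0 then x1 i else cat L (s l) i) \<in> X"
        by (rule splice[OF x1(1) catX[OF l], of "- int M"]) (use x1P cl HR in auto)
      have "(\<lambda>i. if i < B then (if i < 0 then x1 i else cat L (s l) i) else shift_by (- B) y1 i) \<in> X"
      proof (rule splice[OF 1 shift_by_in[OF y1(1)], of B])
        fix i assume i: "B \<le> i" "i < B + int M"
        hence "\<not> i < 0" "i < B + int H" using B0(1) HR by linarith+
        thus "(if i < 0 then x1 i else cat L (s l) i) = shift_by (- B) y1 i"
          using cr[OF i(1), of l] y1P[OF i(1)] by (simp add: shift_by_def)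
      qed auto
      moreover have "z l = (\<lambda>i. if i < B then (if i < 0 then x1 i else cat L (s l) i) else shift_by (- B) y1 i)"
        by (rule ext) (simp add: z_def shift_by_def)
      ultimately show ?thesis by (simp only:)
    qed
    have zx: "z l i = x1 i" if "i < 0" for l i using that B0(1) by (simp add: z_def)
    have zy: "z l i = y1 (i - B)" if "B \<le> i" for l i using that by (simp add: z_def)
    have zc: "z l i = cat L (s l) i" if "- int H \<le> i" "i < B + int H" for l i
      using that x1P[of i] cl[of i l] y1P[of i] cr[of i l] by (auto simp: z_def)
    \<comment> \<open>An occurrence in between would start before the left run, lie in the doubled
      part, or extend beyond the right run. The outer cases contradict the choice of
      \<open>t1\<close> and \<open>t2\<close>, the middle one the choice of
      \<open>a\<close>.\<close>
    have occ: "word_at (z l) i R \<noteq> a" if l: "l \<in> ?S" and i: "i1 < i" "i < i1 + int (2 * L * N + c)" for l i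
    proof -
      have i2: "i1 + int (2 * L * N + c) = B + int H - int R + 1 + int t2" using HR by (simp add: i1_def c_def B_def)
      consider "i < - int H" | "- int H \<le> i" "i + int R \<le> B + int H" | "i + int R > B + int H" by linarith
      thus ?thesis
      proof cases
        case 1
        define k where "k = nat (- int H - 1 - i)"
        have k: "i = - int H - 1 - int k" "k < t1" using 1 i by (auto simp: k_def i1_def)
        have "word_at (z l) i R = word_at x1 i R" unfolding word_at_eq_iff using zx 1 HR by auto
        thus ?thesis using t1_min[OF k(2)] k(1) by simp
      next
        case 2
        have "word_at (z l) i R = word_at (cat L (s l)) i R" unfolding word_at_eq_iff using zc 2 by auto
        hence "word_at (z l) i R \<in> doubled_words R" using sd[OF l] by (auto simp: doubled_words_def)
        thus ?thesis using a(2) by (auto simp: R_def)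
      next
        case 3
        define k where "k = nat (i - (B + int H - int R + 1))"
        have k: "i = B + int H - int R + 1 + int k" "k < t2" using 3 i i2 by (auto simp: k_def)
        have "word_at (z l) i R = word_at y1 (i - B) R" unfolding word_at_eq_iff
          using zy 3 HR by (auto simp: algebra_simps)
        moreover have "i - B = int H - int R + 1 + int k" using k by simp
        ultimately show ?thesis using t2_min[OF k(2)] by simp
      qed
    qed
    have o1: "word_at (z l) i1 R = a" for l
    proof -
      have "word_at (z l) i1 R = word_at x1 i1 R" unfolding word_at_eq_iff using zx HR by (auto simp: i1_def)
      thus ?thesis using t1 by (simp add: i1_def)
    qed
    have o2: "word_at (z l) (i1 + int (2 * L * N + c)) R = a" for l
    proof -
      have i2: "i1 + int (2 * L * N + c) = B + (int H - int R + 1 + int t2)" using HR by (simp add: i1_def c_def B_def)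
      have "word_at (z l) (B + (int H - int R + 1 + int t2)) R = word_at y1 (int H - int R + 1 + int t2) R"
        unfolding word_at_eq_iff using zy HR by (auto simp: algebra_simps)
      thus ?thesis using t2 i2 by simp
    qed
    let ?G = "\<lambda>l. word_at (shift_by i1 (z l)) 0 (2 * L * N + c + R)"
    have "card ?S \<le> card (returns a (2 * L * N + c))"
    proof (rule card_inj_on_le[where f = ?G])
      show "?G ` ?S \<subseteq> returns a (2 * L * N + c)"
      proof
        fix w assume "w \<in> ?G ` ?S"
        then obtain l where l: "l \<in> ?S" "w = ?G l" by blast
        have "word_at (shift_by i1 (z l)) (int k) R \<noteq> a" if "0 < k" "k < 2 * L * N + c" for k
        proof -
          have "int k < int (2 * L * N + c)" using that(2) by (simp only: of_nat_less_iff)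
          hence "i1 < i1 + int k" "i1 + int k < i1 + int (2 * L * N + c)" using that(1) by linarith+
          from occ[OF l(1) this] show ?thesis by (simp add: add.commute)
        qed
        thus "w \<in> returns a (2 * L * N + c)" unfolding returns_def R(1) using l zX o1[of l] o2[of l]
          by (auto simp: add.commute intro!: exI[of _ "shift_by i1 (z l)"])
      qed
      show "inj_on ?G ?S"
      proof (rule inj_onI)
        fix l l' assume l: "l \<in> ?S" "l' \<in> ?S" "?G l = ?G l'"
        have eq: "cat L (s l) i = cat L (s l') i" if i: "0 \<le> i" "i < B" for i
        proof -
          define k where "k = nat (i - i1)"
          have "int H + 1 + int t1 \<le> int c" by (simp add: c_def)
          moreover have "int (2 * L * N + c + R) = B + int c + int R" by (simp only: B_def of_nat_add)
          ultimately have "0 \<le> i - i1" "i - i1 < int (2 * L * N + c + R)" using i unfolding i1_def by linarith+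
          hence k: "i = int k + i1" "k < 2 * L * N + c + R" unfolding k_def by (simp_all only: nat_less_iff int_nat_eq if_True diff_add_cancel)
          have "shift_by i1 (z l) (0 + int k) = shift_by i1 (z l') (0 + int k)" using l(3) k(2) unfolding word_at_eq_iff by blast
          hence "z l i = z l' i" using k(1) by (simp add: shift_by_def)
          thus ?thesis using zc[of i] i by simp
        qed
        have "l ! j = l' ! j" if j: "j < N" for j
        proof -
          have "word_at (cat L (s l)) (int (2 * j) * int L) L = word_at (cat L (s l')) (int (2 * j) * int L) L"
            unfolding word_at_eq_iff
          proof (intro allI impI)
            fix k assume k: "k < L"
            have "(2 * j + 1) * L \<le> 2 * N * L" using j by (intro mult_right_mono) auto
            hence "2 * j * L + k < 2 * L * N" using k by (simp add: algebra_simps)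
            hence "int (2 * j) * int L + int k < B" unfolding B_def by (metis of_nat_add of_nat_less_iff of_nat_mult)
            from eq[OF _ this] show "cat L (s l) (int (2 * j) * int L + int k) = cat L (s l') (int (2 * j) * int L + int k)" by simp
          qed
          moreover have "word_at (cat L (s l)) (int (2 * j) * int L) L = s l (int (2 * j))"
            by (rule word_at_cat[OF L_pos len_s[OF sin[OF l(1)]]])
          moreover have "word_at (cat L (s l')) (int (2 * j) * int L) L = s l' (int (2 * j))"
            by (rule word_at_cat[OF L_pos len_s[OF sin[OF l(2)]]])
          ultimately have "s l (int (2 * j)) = s l' (int (2 * j))" by (simp only:)
          moreover have "nat (int (2 * j)) div 2 = j" by simp
          ultimately show ?thesis using j by (simp add: s_def)
        qed
        thus "l = l'" using l by (intro nth_equalityI) auto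
      qed
      show "finite (returns a (2 * L * N + c))"
        by (rule finite_subset[OF _ finite_words[of "2 * L * N + c + length a"]]) (auto simp: returns_def words_def)
    qed
    thus ?thesis using card_lists by simp
  qed
  thus ?thesis using R RM by (intro exI[of _ a] exI[of _ c]) (auto simp: c_def)
qed

end

section \<open>Free pairs of words from mixing\<close>

context sft
begin

text \<open>With a single letter the subshift would be one fixed point, hence trivial.\<close>

lemma two_letters:
  assumes "\<not> trivial_shift X" shows "\<exists>a b. a \<noteq> b \<and> [a] \<in> language X \<and> [b] \<in> language X"
proof (rule ccontr)
  assume n: "\<not> ?thesis"
  have one: "x i = y j" if "x \<in> X" "y \<in> X" for x y i j
  proof -
    have "word_at x i 1 = [x i]" "word_at y j 1 = [y j]" by (simp_all add: word_at_def)
    hence "[x i] \<in> language X" "[y j] \<in> language X" using that word_at_language by metis+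
    thus ?thesis using n by blast
  qed
  obtain x where x: "x \<in> X" using X_ne by blast
  have "shift_orbit x = {x}" unfolding shift_orbit_def using one[OF x x] by (auto simp: fun_eq_iff)
  moreover have "X = {x}" using one x by (auto simp: fun_eq_iff)
  ultimately have "trivial_shift X" unfolding trivial_shift_def by (intro exI[of _ x]) simp
  thus False using assms by simp
qed

text \<open>Both words start with the same \<open>u\<close> of length \<open>M\<close> and can be
  followed by \<open>u\<close>, so each window of a concatenation lies in some
  \<open>\<gamma> @ u\<close>.\<close>

lemma free_pair_exists:
  assumes mix: "mixing X" and nt: "\<not> trivial_shift X"
  shows "\<exists>\<alpha> \<beta> L. free_pair A X M \<alpha> \<beta> L"
proof -
  obtain a b where ab: "a \<noteq> b" "[a] \<in> language X" "[b] \<in> language X" using two_letters[OF nt] by blast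
  obtain x where x: "x \<in> X" using X_ne by blast
  define u where "u = word_at x 0 M"
  have u: "u \<in> language X" "length u = M" using x by (auto simp: u_def)
  obtain m1 where m1: "\<And>m. m \<ge> m1 \<Longrightarrow> \<exists>w. length w = m \<and> u @ w @ [a] \<in> language X"
    using mix u(1) ab(2) unfolding mixing_def by blast
  obtain m2 where m2: "\<And>m. m \<ge> m2 \<Longrightarrow> \<exists>w. length w = m \<and> u @ w @ [b] \<in> language X"
    using mix u(1) ab(3) unfolding mixing_def by blast
  \<comment> \<open>The common length \<open>m1 + m2\<close> puts the letters \<open>a\<close> and
    \<open>b\<close> at the same place, where the two words will differ.\<close>
  obtain w1 where w1: "length w1 = m1 + m2" "u @ w1 @ [a] \<in> language X" using m1[of "m1 + m2"] by auto
  obtain w2 where w2: "length w2 = m1 + m2" "u @ w2 @ [b] \<in> language X" using m2[of "m1 + m2"] by auto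
  obtain m3 where m3: "\<And>m. m \<ge> m3 \<Longrightarrow> \<exists>w. length w = m \<and> (u @ w1 @ [a]) @ w @ u \<in> language X"
    using mix u(1) w1(2) unfolding mixing_def by blast
  obtain m4 where m4: "\<And>m. m \<ge> m4 \<Longrightarrow> \<exists>w. length w = m \<and> (u @ w2 @ [b]) @ w @ u \<in> language X"
    using mix u(1) w2(2) unfolding mixing_def by blast
  obtain w3 where w3: "length w3 = m3 + m4" "(u @ w1 @ [a]) @ w3 @ u \<in> language X" using m3[of "m3 + m4"] by auto
  obtain w4 where w4: "length w4 = m3 + m4" "(u @ w2 @ [b]) @ w4 @ u \<in> language X" using m4[of "m3 + m4"] by auto
  define \<alpha> where "\<alpha> = u @ w1 @ [a] @ w3"
  define \<beta> where "\<beta> = u @ w2 @ [b] @ w4"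
  define L where "L = length \<alpha>"
  have len: "length \<alpha> = L" "length \<beta> = L" "M \<le> L" using w1 w2 w3 w4 u by (auto simp: L_def \<alpha>_def \<beta>_def)
  have L_pos: "L > 0" using len M_pos by simp
  have ne: "\<alpha> \<noteq> \<beta>" using ab(1) w1 w2 by (auto simp: \<alpha>_def \<beta>_def)
  have gu: "\<gamma> @ u \<in> language X" "take M \<gamma> = u" if "\<gamma> \<in> {\<alpha>, \<beta>}" for \<gamma>
    using that w3 w4 u(2) by (auto simp: \<alpha>_def \<beta>_def)
  have "cat L s \<in> X" if s: "\<And>j. s j \<in> {\<alpha>, \<beta>}" for s
  proof (rule memory)
    fix i
    define q where "q = i div int L"
    define r where "r = nat (i mod int L)"
    have r: "i = q * int L + int r" "r < L" using L_pos by (auto simp: q_def r_def nat_less_iff)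
    have ls: "length (s j) = L" for j using s[of j] len by auto
    have "word_at (cat L s) (q * int L) (L + L) = s q @ s (q + 1)"
      using word_at_cat[OF L_pos ls, where q = q] word_at_cat[OF L_pos ls, where q = "q + 1"]
      by (simp add: word_at_append distrib_right)
    hence "take (L + M) (word_at (cat L s) (q * int L) (L + L)) = s q @ take M (s (q + 1))" using ls by simp
    hence "word_at (cat L s) (q * int L) (L + M) = s q @ u"
      unfolding gu(2)[OF s] using take_word_at[of "L + M" "L + L" "cat L s" "q * int L"] len by (metis add_le_cancel_left)
    hence "word_at (cat L s) (q * int L) (L + M) \<in> language X" using gu(1)[OF s] by simp
    moreover have "word_at (cat L s) (q * int L) (L + M) =
        word_at (cat L s) (q * int L) r @ word_at (cat L s) i M @ word_at (cat L s) (i + int M) (L - r)"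
      using word_at_append[of "cat L s" "q * int L" r "M + (L - r)"] word_at_append[of "cat L s" i M "L - r"] r
      by (simp add: add.commute)
    ultimately show "word_at (cat L s) i M \<in> language X" using language_append by metis
  qed
  thus ?thesis using len ne by (intro exI[of _ \<alpha>] exI[of _ \<beta>] exI[of _ L]) (unfold_locales, auto)
qed

end

section \<open>The coding by windows between visits\<close>

datatype 'a state = Visit | Win nat | Gap "'a list" nat

datatype 'a edge = WStart "'a list" | WStep nat | Ord "'a list" nat

text \<open>An occurrence of the marker word \<open>a\<close> is a visit. Two consecutive visits at distance exactly
  \<open>l\<close> bound a window. The whole contents of a window are stored in its first edge, so that windows
  give rise to many parallel edges, while the number of states is only linear in \<open>l\<close>. Outside of
  windows a state records the time since the last visit, cut off at \<open>l\<close>.\<close>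

locale window_coding = sft A X M for A :: "'a set" and X M +
  fixes a :: "'a list" and l :: nat
  assumes aM: "M \<le> length a" and l2: "2 \<le> l"
begin

abbreviation "R \<equiv> length a"

lemma R_pos: "R > 0" using aM M_pos by linarith

definition visit :: "(int \<Rightarrow> 'a) \<Rightarrow> int \<Rightarrow> bool" where
  "visit x i \<longleftrightarrow> word_at x i R = a"

definition win :: "(int \<Rightarrow> 'a) \<Rightarrow> int \<Rightarrow> bool" where
  "win x i \<longleftrightarrow> visit x i \<and> visit x (i + int l) \<and> (\<forall>s. 0 < s \<and> s < l \<longrightarrow> \<not> visit x (i + int s))"

text \<open>The alternative \<open>t = l\<close> implements the cut-off.\<close>

definition age :: "(int \<Rightarrow> 'a) \<Rightarrow> int \<Rightarrow> nat" where
  "age x i = (LEAST t. t = l \<or> visit x (i - int t))"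

text \<open>An ordinary edge carries one letter more than a state, so that source and target can
  read off two overlapping words of length \<open>R\<close>.\<close>

definition code :: "(int \<Rightarrow> 'a) \<Rightarrow> int \<Rightarrow> 'a edge" where
  "code x i = (let t = age x i in
     if t < l \<and> win x (i - int t) then (if t = 0 then WStart (word_at x i (l + R)) else WStep t)
     else Ord (word_at x i (R + 1)) t)"

fun esrc :: "'a edge \<Rightarrow> 'a state" where
  "esrc (WStart c) = Visit"
| "esrc (WStep t) = Win t"
| "esrc (Ord w t) = (if t = 0 then Visit else Gap (take R w) t)"

fun etgt :: "'a edge \<Rightarrow> 'a state" where
  "etgt (WStart c) = Win 1"
| "etgt (WStep t) = (if t + 1 = l then Visit else Win (t + 1))"
| "etgt (Ord w t) = (if tl w = a then Visit else Gap (tl w) (min (t + 1) l))"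

definition EE :: "'a edge set" where "EE = {code x i |x i. x \<in> X}"

lemma win_not_visit:
  assumes "win x i" "0 < s" "s < l" shows "\<not> visit x (i + int s)"
proof -
  have "\<forall>s. 0 < s \<and> s < l \<longrightarrow> \<not> visit x (i + int s)" using assms(1) unfolding win_def by (elim conjE)
  from spec[OF this, of s] show ?thesis using assms(2,3) by blast
qed

lemma age_le: "age x i \<le> l"
  unfolding age_def by (rule Least_le) simp

lemma age_visit: "age x i < l \<Longrightarrow> visit x (i - int (age x i))"
  using LeastI[of "\<lambda>t. t = l \<or> visit x (i - int t)" l] unfolding age_def by auto

lemma age_min: "t < age x i \<Longrightarrow> \<not> visit x (i - int t)"
  using not_less_Least[of t "\<lambda>t. t = l \<or> visit x (i - int t)"] unfolding age_def by auto

lemma age_eqI: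
  assumes "t \<le> l" "t < l \<Longrightarrow> visit x (i - int t)" "\<And>s. s < t \<Longrightarrow> \<not> visit x (i - int s)"
  shows "age x i = t"
  unfolding age_def
proof (rule Least_equality)
  show "t = l \<or> visit x (i - int t)" using assms(1,2) by fastforce
  show "t \<le> s" if "s = l \<or> visit x (i - int s)" for s
    using that assms(1) assms(3)[of s] by (meson not_le_imp_less)
qed

lemma age_eq_0: "age x i = 0 \<longleftrightarrow> visit x i"
proof
  assume "age x i = 0"
  thus "visit x i" using age_visit[of x i] l2 by simp
next
  assume "visit x i"
  thus "age x i = 0" using l2 by (intro age_eqI) auto
qed

lemma age_Suc: "age x (i + 1) = (if visit x (i + 1) then 0 else min (age x i + 1) l)"
proof (cases "visit x (i + 1)")
  case True
  thus ?thesis using age_eq_0 by simp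
next
  case False
  have "age x (i + 1) = min (age x i + 1) l"
  proof (rule age_eqI)
    assume "min (age x i + 1) l < l"
    hence "age x i < l" "min (age x i + 1) l = age x i + 1" by auto
    thus "visit x (i + 1 - int (min (age x i + 1) l))" using age_visit[of x i] by simp
  next
    fix s assume s: "s < min (age x i + 1) l"
    show "\<not> visit x (i + 1 - int s)"
    proof (cases s)
      case 0
      thus ?thesis using False by simp
    next
      case (Suc r)
      hence "r < age x i" using s by simp
      from age_min[OF this] show ?thesis using Suc by (simp add: algebra_simps)
    qed
  qed simp
  thus ?thesis using False by simp
qed

definition in_win :: "(int \<Rightarrow> 'a) \<Rightarrow> int \<Rightarrow> bool" where
  "in_win x i \<longleftrightarrow> age x i < l \<and> win x (i - int (age x i))"

lemma code_eq:
  "code x i = (if in_win x i then (if age x i = 0 then WStart (word_at x i (l + R)) else WStep (age x i))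
     else Ord (word_at x i (R + 1)) (age x i))"
  by (simp add: code_def in_win_def Let_def)

lemma take_code_word: "take R (word_at x i (R + 1)) = word_at x i R"
  using take_word_at[of R "R + 1"] by simp

lemma tl_code_word: "tl (word_at x i (R + 1)) = word_at x (i + 1) R"
  using drop_word_at[of 1 "R + 1" x i] by (simp add: drop_Suc)

lemma esrc_code:
  "esrc (code x i) = (if visit x i then Visit else if in_win x i then Win (age x i) else Gap (word_at x i R) (age x i))"
  unfolding code_eq using age_eq_0[of x i] take_code_word[of x i] by simp

text \<open>A window ends exactly at its closing visit, and a window can be entered only at a
  visit.\<close>

lemma etgt_code: "etgt (code x i) = esrc (code x (i + 1))"
proof (cases "in_win x i")
  case True
  hence t: "age x i < l" "win x (i - int (age x i))" by (auto simp: in_win_def)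
  have e: "etgt (code x i) = (if age x i + 1 = l then Visit else Win (age x i + 1))"
    using True l2 by (auto simp: code_eq)
  show ?thesis
  proof (cases "age x i + 1 = l")
    case True
    have "visit x (i - int (age x i) + int l)" using t(2) by (simp add: win_def)
    moreover have "i - int (age x i) + int l = i + 1" using True by simp
    ultimately show ?thesis using e True esrc_code[of x "i + 1"] by simp
  next
    case False
    hence "age x i + 1 < l" using t(1) by simp
    hence nv: "\<not> visit x (i + 1)" using win_not_visit[OF t(2), of "age x i + 1"] by simp
    hence ag: "age x (i + 1) = age x i + 1" using age_Suc[of x i] t(1) by simp
    hence "in_win x (i + 1)" using t False by (simp add: in_win_def)
    thus ?thesis using e False nv ag esrc_code[of x "i + 1"] by simp
  qed
next
  case False
  have nw: "\<not> in_win x (i + 1)" if "\<not> visit x (i + 1)"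
  proof
    assume w: "in_win x (i + 1)"
    have ag: "age x (i + 1) = min (age x i + 1) l" using age_Suc[of x i] that by simp
    hence "age x i + 1 < l" using w by (auto simp: in_win_def)
    hence "age x (i + 1) = age x i + 1" using ag by simp
    hence "in_win x i" using w by (simp add: in_win_def algebra_simps)
    thus False using \<open>\<not> in_win x i\<close> by simp
  qed
  have "etgt (code x i) = (if visit x (i + 1) then Visit else Gap (word_at x (i + 1) R) (min (age x i + 1) l))"
    using False tl_code_word[of x i] by (simp add: code_eq visit_def)
  thus ?thesis using nw age_Suc[of x i] esrc_code[of x "i + 1"] by auto
qed

lemma visit_shift_by [simp]: "visit (shift_by b x) i = visit x (i + b)"
  by (simp add: visit_def)

lemma code_shift_by: "code (shift_by b x) i = code x (i + b)"
proof -
  have "age (shift_by b x) i = age x (i + b)" by (simp add: age_def algebra_simps)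
  moreover have "win (shift_by b x) j = win x (j + b)" for j by (simp add: win_def algebra_simps)
  ultimately show ?thesis by (simp add: code_def Let_def algebra_simps)
qed

lemma EE_alt: "EE = (\<lambda>x. code x 0) ` X"
proof
  show "EE \<subseteq> (\<lambda>x. code x 0) ` X"
  proof
    fix e assume "e \<in> EE"
    then obtain x i where x: "x \<in> X" "e = code x i" by (auto simp: EE_def)
    have "code (shift_by i x) 0 = e" using code_shift_by[of i x 0] x by simp
    thus "e \<in> (\<lambda>x. code x 0) ` X" using shift_by_in[OF x(1)] by blast
  qed
qed (auto simp: EE_def)

lemma finite_EE: "finite EE"
proof -
  have "EE \<subseteq> WStart ` words (l + R) \<union> WStep ` {..<l} \<union> (\<lambda>(w, t). Ord w t) ` (words (R + 1) \<times> {..l})"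
  proof
    fix e assume "e \<in> EE"
    then obtain x i where x: "x \<in> X" "e = code x i" by (auto simp: EE_def)
    have w: "word_at x i n \<in> words n" for n using x by (simp add: words_def)
    show "e \<in> WStart ` words (l + R) \<union> WStep ` {..<l} \<union> (\<lambda>(w, t). Ord w t) ` (words (R + 1) \<times> {..l})"
      unfolding x(2) code_eq using w[of "l + R"] w[of "R + 1"] age_le[of x i] by (auto simp: in_win_def)
  qed
  thus ?thesis by (rule finite_subset) (use finite_words in auto)
qed

sublocale eg: edge_graph EE esrc etgt
proof
  show "finite EE" by (rule finite_EE)
  show "esrc ` EE = etgt ` EE"
  proof
    show "esrc ` EE \<subseteq> etgt ` EE"
    proof clarify
      fix e assume "e \<in> EE"
      then obtain x i where x: "x \<in> X" "e = code x i" unfolding EE_def by blast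
      hence "esrc e = etgt (code x (i - 1))" using etgt_code[of x "i - 1"] by simp
      moreover have "code x (i - 1) \<in> EE" unfolding EE_def using x(1) by blast
      ultimately show "esrc e \<in> etgt ` EE" by (rule image_eqI)
    qed
    show "etgt ` EE \<subseteq> esrc ` EE"
    proof clarify
      fix e assume "e \<in> EE"
      then obtain x i where x: "x \<in> X" "e = code x i" unfolding EE_def by blast
      hence "etgt e = esrc (code x (i + 1))" using etgt_code[of x i] by simp
      moreover have "code x (i + 1) \<in> EE" unfolding EE_def using x(1) by blast
      ultimately show "etgt e \<in> esrc ` EE" by (rule image_eqI)
    qed
  qed
qed

abbreviation "Y \<equiv> eg.edge_shift"

definition enc :: "(int \<Rightarrow> 'a) \<Rightarrow> int \<Rightarrow> 'a edge" where "enc x = (\<lambda>i. code x i)"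

definition dec :: "(int \<Rightarrow> 'a edge) \<Rightarrow> int \<Rightarrow> 'a" where
  "dec y = (\<lambda>i. case y i of Ord w t \<Rightarrow> hd w | WStart c \<Rightarrow> hd c
     | WStep t \<Rightarrow> (case y (i - int t) of WStart c \<Rightarrow> c ! t | _ \<Rightarrow> undefined))"

lemma code_in_EE: "x \<in> X \<Longrightarrow> code x i \<in> EE"
  unfolding EE_def by blast

lemma enc_in: "x \<in> X \<Longrightarrow> enc x \<in> Y"
  by (simp add: enc_def eg.edge_shift_def code_in_EE etgt_code)

lemma enc_shift_by: "enc (shift_by b x) = shift_by b (enc x)"
  by (simp add: enc_def shift_by_def[of b "\<lambda>i. code x i"] code_shift_by fun_eq_iff)

lemma dec_shift_by: "dec (shift_by b y) = shift_by b (dec y)"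
  by (auto simp: dec_def shift_by_def fun_eq_iff algebra_simps split: edge.splits)

lemma hd_word_at: "n > 0 \<Longrightarrow> hd (word_at x i n) = x i"
  by (simp add: word_at_def hd_map)

lemma dec_enc: "dec (enc x) = x"
proof
  fix i
  show "dec (enc x) i = x i"
  proof (cases "in_win x i \<and> age x i \<noteq> 0")
    case True
    define k where "k = i - int (age x i)"
    have w: "win x k" "age x i < l" using True by (auto simp: in_win_def k_def)
    hence "age x k = 0" using age_eq_0 by (simp add: win_def)
    hence "code x k = WStart (word_at x k (l + R))" using w l2 by (simp add: code_eq in_win_def)
    moreover have "code x i = WStep (age x i)" using True by (simp add: code_eq)
    ultimately show ?thesis using w(2) by (simp add: dec_def enc_def k_def)
  next
    case False
    thus ?thesis using l2 R_pos by (auto simp: dec_def enc_def code_eq hd_word_at)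
  qed
qed

text \<open>The last clause for \<open>Ord\<close> holds because a visit right after age
  \<open>l - 1\<close> would close a window, and then the edge would not be ordinary. This clause
  later ensures that encoding a decoded point returns the same edges.\<close>

lemma edge_facts:
  assumes "e \<in> EE"
  shows "e = WStart c \<Longrightarrow> length c = l + R \<and> c \<in> language X \<and> take R c = a \<and> take R (drop l c) = a \<and>
        (\<forall>s. 0 < s \<and> s < l \<longrightarrow> take R (drop s c) \<noteq> a)"
    "e = WStep t \<Longrightarrow> 0 < t \<and> t < l"
    "e = Ord w t \<Longrightarrow> length w = R + 1 \<and> w \<in> language X \<and> t \<le> l \<and> (t = 0 \<longleftrightarrow> take R w = a) \<and> (t = l - 1 \<longrightarrow> tl w \<noteq> a)"
proof -
  obtain x where x: "x \<in> X" "e = code x 0" using assms EE_alt by auto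
  show "length c = l + R \<and> c \<in> language X \<and> take R c = a \<and> take R (drop l c) = a \<and>
        (\<forall>s. 0 < s \<and> s < l \<longrightarrow> take R (drop s c) \<noteq> a)" if "e = WStart c"
  proof -
    have c: "c = word_at x 0 (l + R)" "in_win x 0" "age x 0 = 0" using that x by (auto simp: code_eq split: if_splits)
    hence w: "win x 0" by (simp add: in_win_def)
    have "take R (drop s c) = word_at x (int s) R" if "s \<le> l" for s
      using that c(1) by (simp add: drop_word_at take_word_at)
    from this[of 0] this[of l] this show ?thesis using w c x(1) unfolding win_def visit_def by auto
  qed
  show "0 < t \<and> t < l" if "e = WStep t"
    using that x by (auto simp: code_eq in_win_def split: if_splits)
  show "length w = R + 1 \<and> w \<in> language X \<and> t \<le> l \<and> (t = 0 \<longleftrightarrow> take R w = a) \<and> (t = l - 1 \<longrightarrow> tl w \<noteq> a)" if "e = Ord w t"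
  proof -
    have c: "w = word_at x 0 (R + 1)" "\<not> in_win x 0" "age x 0 = t" using that x by (auto simp: code_eq split: if_splits)
    have "tl w \<noteq> a" if t: "t = l - 1"
    proof
      assume "tl w = a"
      hence v: "visit x 1" using c(1) tl_code_word[of x 0] by (simp add: visit_def)
      have tl: "t < l" "t \<ge> 1" using t l2 by auto
      have "visit x (0 - int t)" using age_visit[of x 0] c(3) tl by simp
      moreover have "\<not> visit x (0 - int t + int s)" if s: "0 < s" "s < l" for s
      proof -
        have "\<not> visit x (0 - int (t - s))" if "s \<le> t" using age_min[of "t - s" x 0] c(3) s that tl by auto
        thus ?thesis using s t by (auto simp: of_nat_diff algebra_simps)
      qed
      moreover have "0 - int t + int l = 1" using t l2 by simp
      ultimately have "win x (0 - int t)" using v by (simp add: win_def)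
      thus False using c(2,3) tl by (simp add: in_win_def)
    qed
    thus ?thesis using c x(1) age_le[of x 0] age_eq_0[of x 0] take_code_word[of x 0] by (auto simp: visit_def)
  qed
qed

lemma Y_D: "y \<in> Y \<Longrightarrow> y i \<in> EE" "y \<in> Y \<Longrightarrow> etgt (y i) = esrc (y (i + 1))"
  by (auto simp: eg.edge_shift_def)

text \<open>Inside a window the edges are forced backwards, one by one, down to the edge that opened
  it.\<close>

lemma step_back:
  assumes y: "y \<in> Y" and t: "y i = WStep t"
  shows "\<exists>c. y (i - int t) = WStart c"
  using t
proof (induction t arbitrary: i)
  case 0
  thus ?case using edge_facts(2)[OF Y_D(1)[OF y]] by fastforce
next
  case (Suc t)
  have "etgt (y (i - 1)) = Win (Suc t)" using Y_D(2)[OF y, of "i - 1"] Suc.prems by simp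
  hence "t = 0 \<and> (\<exists>c. y (i - 1) = WStart c) \<or> y (i - 1) = WStep t"
    by (cases "y (i - 1)") (auto split: if_splits)
  thus ?case
  proof
    assume "t = 0 \<and> (\<exists>c. y (i - 1) = WStart c)"
    thus ?thesis by simp
  next
    assume "y (i - 1) = WStep t"
    from Suc.IH[OF this] show ?thesis by (simp add: algebra_simps)
  qed
qed

lemma step_forward:
  assumes y: "y \<in> Y" and c: "y i = WStart c"
  shows "0 < s \<Longrightarrow> s < l \<Longrightarrow> y (i + int s) = WStep s" "esrc (y (i + int l)) = Visit"
proof -
  have win: "e = WStep t" if "esrc e = Win t" for e t using that by (cases e) (auto split: if_splits)
  have st0: "s + 1 < l \<Longrightarrow> y (i + int (s + 1)) = WStep (s + 1)" for s
  proof (induction s)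
    case 0
    thus ?case using Y_D(2)[OF y, of i] c win by simp
  next
    case (Suc s)
    hence "y (i + int (s + 1)) = WStep (s + 1)" by simp
    hence "esrc (y (i + int (s + 1) + 1)) = Win (s + 1 + 1)" using Y_D(2)[OF y, of "i + int (s + 1)"] Suc.prems by simp
    thus ?case using win by (simp add: algebra_simps)
  qed
  show st: "y (i + int s) = WStep s" if "0 < s" "s < l" for s
  proof (cases s)
    case 0
    thus ?thesis using that(1) by (rule_tac FalseE) (simp only: less_irrefl)
  next
    case (Suc r)
    have "r + 1 < l" using that(2) unfolding Suc by (simp only: Suc_eq_plus1)
    from st0[OF this] show ?thesis unfolding Suc by (simp only: Suc_eq_plus1)
  qed
  have "y (i + int (l - 1)) = WStep (l - 1)" using st[of "l - 1"] l2 by simp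
  thus "esrc (y (i + int l)) = Visit" using Y_D(2)[OF y, of "i + int (l - 1)"] l2 by (simp add: of_nat_diff algebra_simps)
qed

text \<open>The word of length \<open>R + 1\<close> that the decoded point shows at
  \<open>i\<close>. On the edge shift \<open>step_back\<close> excludes the \<open>undefined\<close>
  branch.\<close>

definition local_word :: "(int \<Rightarrow> 'a edge) \<Rightarrow> int \<Rightarrow> 'a list" where
  "local_word y i = (case y i of Ord w t \<Rightarrow> w | WStart c \<Rightarrow> take (R + 1) c
     | WStep t \<Rightarrow> (case y (i - int t) of WStart c \<Rightarrow> take (R + 1) (drop t c) | _ \<Rightarrow> undefined))"

lemma sublist_language: "w \<in> language X \<Longrightarrow> take k (drop j w) \<in> language X"
proof -
  assume "w \<in> language X"
  moreover have "w = take j w @ take k (drop j w) @ drop k (drop j w)" by (simp only: append_take_drop_id)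
  ultimately show ?thesis using language_append by metis
qed

lemma local_word_cases:
  assumes y: "y \<in> Y"
  obtains (ord) w t where "y i = Ord w t" "local_word y i = w" "length w = R + 1" "w \<in> language X" "t \<le> l"
      "t = 0 \<longleftrightarrow> take R w = a"
  | (win) t c where "t < l" "y (i - int t) = WStart c" "y i = (if t = 0 then WStart c else WStep t)"
      "local_word y i = take (R + 1) (drop t c)"
proof (cases "y i")
  case (Ord w t)
  thus ?thesis using ord edge_facts(3)[OF Y_D(1)[OF y] Ord] by (auto simp: local_word_def)
next
  case (WStart c)
  thus ?thesis using win[of 0 c] l2 by (simp add: local_word_def)
next
  case (WStep t)
  obtain c where "y (i - int t) = WStart c" using step_back[OF y WStep] by blast
  thus ?thesis using win[of t c] WStep edge_facts(2)[OF Y_D(1)[OF y] WStep] by (simp add: local_word_def)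
qed

lemma local_word_all:
  assumes y: "y \<in> Y"
  shows "length (local_word y i) = R + 1 \<and> local_word y i \<in> language X \<and> dec y i = hd (local_word y i) \<and>
    (take R (local_word y i) = a \<longleftrightarrow> esrc (y i) = Visit) \<and> (\<forall>w t. esrc (y i) = Gap w t \<longrightarrow> take R (local_word y i) = w)"
proof (cases rule: local_word_cases[OF y, of i])
  case (1 w' t')
  thus ?thesis by (auto simp: dec_def)
next
  case (2 t' c)
  note cf = edge_facts(1)[OF Y_D(1)[OF y] 2(2)]
  have h: "hd (take (R + 1) (drop t' c)) = c ! t'" using cf 2(1) by (simp add: hd_drop_conv_nth)
  have tk: "take R (take (R + 1) (drop t' c)) = take R (drop t' c)" by simp
  have h0: "c ! 0 = hd c" using cf l2 by (cases c) auto
  have len: "length (take (R + 1) (drop t' c)) = R + 1" using cf 2(1) by simp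
  have la: "take (R + 1) (drop t' c) \<in> language X" using sublist_language cf by blast
  show ?thesis
  proof (cases "t' = 0")
    case True
    thus ?thesis unfolding 2(4) using 2(3) h h0 tk len la cf by (simp add: dec_def)
  next
    case False
    hence "take R (drop t' c) \<noteq> a" using cf 2(1) by blast
    thus ?thesis unfolding 2(4) using 2(2,3) False h tk len la by (simp add: dec_def)
  qed
qed

lemma local_word:
  assumes "y \<in> Y"
  shows "length (local_word y i) = R + 1" "local_word y i \<in> language X" "dec y i = hd (local_word y i)"
    "take R (local_word y i) = a \<longleftrightarrow> esrc (y i) = Visit" "esrc (y i) = Gap w t \<Longrightarrow> take R (local_word y i) = w"
  using local_word_all[OF assms, of i] by blast+

text \<open>Inside a window both words are parts of the same stored word; at its end and outside
  windows the intermediate state prescribes the overlap.\<close>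

lemma local_word_next:
  assumes y: "y \<in> Y" shows "tl (local_word y i) = take R (local_word y (i + 1))"
proof (cases rule: local_word_cases[OF y, of i])
  case (1 w t)
  have e: "etgt (y i) = esrc (y (i + 1))" using Y_D(2)[OF y] .
  show ?thesis
  proof (cases "tl w = a")
    case True
    thus ?thesis using 1 e local_word(4)[OF y, of "i + 1"] by simp
  next
    case False
    hence "esrc (y (i + 1)) = Gap (tl w) (min (t + 1) l)" using 1 e by simp
    thus ?thesis using local_word(5)[OF y] 1 by simp
  qed
next
  case (2 t c)
  note cf = edge_facts(1)[OF Y_D(1)[OF y] 2(2)]
  have tl: "tl (local_word y i) = take R (drop (t + 1) c)"
    unfolding 2(4) by (simp add: tl_take tl_drop drop_Suc)
  show ?thesis
  proof (cases "t + 1 = l")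
    case True
    hence "i - int t + int l = i + 1" by simp
    hence "esrc (y (i + 1)) = Visit" using step_forward(2)[OF y 2(2)] by metis
    hence "take R (local_word y (i + 1)) = a" using local_word(4)[OF y, of "i + 1"] by simp
    moreover have "tl (local_word y i) = a" using tl True cf by metis
    ultimately show ?thesis by (simp only:)
  next
    case False
    hence "y (i - int t + int (t + 1)) = WStep (t + 1)" using step_forward(1)[OF y 2(2), of "t + 1"] 2(1) by simp
    hence "y (i + 1) = WStep (t + 1)" by simp
    moreover have "y (i + 1 - int (t + 1)) = WStart c" using 2(2) by simp
    ultimately show ?thesis using tl by (simp add: local_word_def)
  qed
qed

lemma word_at_dec:
  assumes y: "y \<in> Y" shows "word_at (dec y) i (R + 1) = local_word y i"
proof (rule nth_equalityI)
  show "length (word_at (dec y) i (R + 1)) = length (local_word y i)" using local_word(1)[OF y] by simp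
  have "j < R + 1 \<Longrightarrow> dec y (i + int j) = local_word y i ! j" for j i
  proof (induction j arbitrary: i)
    case 0
    thus ?case using local_word(1,3)[OF y, of i] by (simp add: hd_conv_nth[symmetric]) (metis Suc_eq_plus1 hd_conv_nth length_0_conv nat.simps(3))
  next
    case (Suc j)
    have "dec y (i + int (Suc j)) = local_word y (i + 1) ! j" using Suc.IH[of "i + 1"] Suc.prems by (simp add: algebra_simps)
    also have "\<dots> = take R (local_word y (i + 1)) ! j" using Suc.prems by simp
    also have "\<dots> = tl (local_word y i) ! j" using local_word_next[OF y] by simp
    also have "\<dots> = local_word y i ! Suc j" using Suc.prems local_word(1)[OF y, of i] by (simp add: nth_tl)
    finally show ?case .
  qed
  thus "word_at (dec y) i (R + 1) ! j = local_word y i ! j" if "j < length (word_at (dec y) i (R + 1))" for j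
    using that by simp
qed

lemma dec_in: "y \<in> Y \<Longrightarrow> dec y \<in> X"
  using word_at_dec local_word(2) aM by (intro memory_ge[of "R + 1"]) auto

lemma visit_dec: "y \<in> Y \<Longrightarrow> visit (dec y) i \<longleftrightarrow> esrc (y i) = Visit"
  using word_at_dec local_word(4) take_code_word by (metis visit_def)

lemma win_dec:
  assumes y: "y \<in> Y" and c: "y i = WStart c" shows "win (dec y) i" "word_at (dec y) i (l + R) = c"
proof -
  show "win (dec y) i"
    unfolding win_def visit_dec[OF y] using step_forward[OF y c] c by auto
  note cf = edge_facts(1)[OF Y_D(1)[OF y] c]
  show "word_at (dec y) i (l + R) = c"
  proof (rule nth_equalityI)
    fix j assume "j < length (word_at (dec y) i (l + R))"
    hence j: "j < l + R" by simp
    \<comment> \<open>The letters after the window are read off its last edge, at offset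
      \<open>l - 1\<close>, whose local word reaches \<open>R\<close> letters further.\<close>
    define t where "t = (if j < l then j else l - 1)"
    have t: "t < l" "t \<le> j" "j - t < R + 1" using l2 j by (auto simp: t_def)
    have "local_word y (i + int t) = take (R + 1) (drop t c)"
      using c step_forward(1)[OF y c, of t] t by (cases "t = 0") (auto simp: local_word_def)
    hence "word_at (dec y) (i + int t) (R + 1) = take (R + 1) (drop t c)" using word_at_dec[OF y] by simp
    hence "word_at (dec y) (i + int t) (R + 1) ! (j - t) = take (R + 1) (drop t c) ! (j - t)" by simp
    moreover have "i + int t + int (j - t) = i + int j" using t(2) by simp
    ultimately have "dec y (i + int j) = c ! j" using t cf by simp
    thus "word_at (dec y) i (l + R) ! j = c ! j" using j by simp
  qed (use cf in simp)
qed

lemma ord_back: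
  assumes y: "y \<in> Y" and o: "y i = Ord w t" "0 < t"
  shows "\<exists>w' t'. y (i - 1) = Ord w' t' \<and> t = min (t' + 1) l"
proof -
  have "etgt (y (i - 1)) = Gap (take R w) t" using Y_D(2)[OF y, of "i - 1"] o by simp
  thus ?thesis by (cases "y (i - 1)") (auto split: if_splits)
qed

text \<open>Going back along ordinary edges lowers the age by one, so from \<open>t < l\<close> age
  0 is reached after exactly \<open>t\<close> steps. From the cut-off only the lower bound
  \<open>l - s\<close> on the age is known, which still excludes visits.\<close>

lemma ord_age:
  assumes y: "y \<in> Y" and o: "y i = Ord w t"
  shows "age (dec y) i = t" "t < l \<Longrightarrow> \<exists>w'. y (i - int t) = Ord w' 0"
proof -
  have tl: "t \<le> l" using edge_facts(3)[OF Y_D(1)[OF y] o] by simp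
  have chain: "s \<le> t \<Longrightarrow> \<exists>w' t'. y (i - int s) = Ord w' t' \<and> t' \<le> l \<and> (if t < l then t' = t - s else t' \<ge> l - s)" for s
  proof (induction s)
    case 0
    thus ?case using o tl by auto
  next
    case (Suc s)
    then obtain w' t' where s: "y (i - int s) = Ord w' t'" "t' \<le> l" "if t < l then t' = t - s else t' \<ge> l - s" by auto
    have "t' > 0" using s(3) Suc.prems tl by (auto split: if_splits)
    from ord_back[OF y s(1) this] obtain w'' t'' where "y (i - int s - 1) = Ord w'' t''" "t' = min (t'' + 1) l" by blast
    moreover from this have "t'' \<le> l" using edge_facts(3)[OF Y_D(1)[OF y]] by blast
    moreover have "i - int s - 1 = i - int (Suc s)" by simp
    ultimately show ?case using s Suc.prems tl by (intro exI[of _ w''] exI[of _ t'']) (auto split: if_splits)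
  qed
  show 2: "\<exists>w'. y (i - int t) = Ord w' 0" if "t < l" using chain[of t] that by auto
  show "age (dec y) i = t"
  proof (rule age_eqI)
    show "t \<le> l" using tl .
    show "visit (dec y) (i - int t)" if t: "t < l"
    proof -
      obtain w' where w': "y (i - int t) = Ord w' 0" using 2[OF t] by blast
      show ?thesis unfolding visit_dec[OF y] w' by simp
    qed
    fix s assume s: "s < t"
    then obtain w' t' where s': "y (i - int s) = Ord w' t'" "if t < l then t' = t - s else t' \<ge> l - s" using chain[of s] by auto
    hence "t' > 0" using s tl by (auto split: if_splits)
    thus "\<not> visit (dec y) (i - int s)" unfolding visit_dec[OF y] s'(1) by simp
  qed
qed

lemma enc_dec:
  assumes y: "y \<in> Y" shows "enc (dec y) = y"
proof
  fix i
  show "enc (dec y) i = y i"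
  proof (cases rule: local_word_cases[OF y, of i])
    case (1 w t)
    note ag = ord_age[OF y 1(1)]
    \<comment> \<open>An ordinary edge inside a window of the decoded point would be followed by
      ordinary edges up to age \<open>l - 1\<close> and then by a visit, which
      \<open>edge_facts\<close> rules out.\<close>
    have "\<not> in_win (dec y) i"
    proof
      assume "in_win (dec y) i"
      hence w: "t < l" "win (dec y) (i - int t)" using ag by (auto simp: in_win_def)
      obtain w0 where w0: "y (i - int t) = Ord w0 0" using ag(2)[OF w(1)] by blast
      have fwd: "s < l \<Longrightarrow> \<exists>w'. y (i - int t + int s) = Ord w' s" for s
      proof (induction s)
        case 0
        thus ?case using w0 by simp
      next
        case (Suc s)
        then obtain w' where w': "y (i - int t + int s) = Ord w' s" by auto
        have nv: "\<not> visit (dec y) (i - int t + int (Suc s))" using win_not_visit[OF w(2), of "Suc s"] Suc.prems by simp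
        have pos: "i - int t + int s + 1 = i - int t + int (Suc s)" by simp
        have "etgt (y (i - int t + int s)) = esrc (y (i - int t + int (Suc s)))" using Y_D(2)[OF y, of "i - int t + int s"] pos by simp
        moreover have "esrc (y (i - int t + int (Suc s))) \<noteq> Visit" using nv visit_dec[OF y] by blast
        ultimately have "esrc (y (i - int t + int (Suc s))) = Gap (tl w') (Suc s)"
          using w' Suc.prems by (auto split: if_splits)
        thus ?case by (cases "y (i - int t + int (Suc s))") (auto split: if_splits)
      qed
      obtain w' where w': "y (i - int t + int (l - 1)) = Ord w' (l - 1)" using fwd[of "l - 1"] l2 by auto
      have pos: "i - int t + int (l - 1) + 1 = i - int t + int l" using l2 by simp
      have "visit (dec y) (i - int t + int l)" using w(2) by (simp add: win_def)
      hence "esrc (y (i - int t + int l)) = Visit" using visit_dec[OF y] by blast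
      hence "etgt (Ord w' (l - 1)) = Visit" using Y_D(2)[OF y, of "i - int t + int (l - 1)"] pos w' by metis
      hence "tl w' = a" by (simp split: if_splits)
      moreover have "tl w' \<noteq> a" using edge_facts(3)[OF Y_D(1)[OF y] w'] by blast
      ultimately show False by simp
    qed
    thus ?thesis using 1 ag(1) word_at_dec[OF y, of i] by (simp add: enc_def code_eq)
  next
    case (2 t c)
    note wd = win_dec[OF y 2(2)]
    have "age (dec y) i = t"
    proof (rule age_eqI)
      show "visit (dec y) (i - int t)" using wd(1) by (simp add: win_def)
      fix s assume s: "s < t"
      hence "\<not> visit (dec y) (i - int t + int (t - s))" using 2(1) by (intro win_not_visit[OF wd(1)]) auto
      thus "\<not> visit (dec y) (i - int s)" using s by (simp add: of_nat_diff)
    qed (use 2 in simp)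
    thus ?thesis using 2 wd by (auto simp: enc_def code_eq in_win_def)
  qed
qed

text \<open>The code at \<open>i\<close> inspects visits at distance at most \<open>l\<close> on
  either side, and every visit reads \<open>R\<close> letters.\<close>

lemma code_local:
  assumes "\<And>k. i - int l \<le> k \<Longrightarrow> k < i + int (l + R) \<Longrightarrow> x k = x' k"
  shows "code x i = code x' i"
proof -
  have v: "visit x j = visit x' j" if "i - int l \<le> j" "j \<le> i + int l" for j
  proof -
    have "word_at x j R = word_at x' j R" unfolding word_at_eq_iff using that assms by auto
    thus ?thesis by (simp add: visit_def)
  qed
  have "(t = l \<or> visit x (i - int t)) = (t = l \<or> visit x' (i - int t))" if "t \<le> l" for t using v that by auto
  have ag: "age x i = age x' i"
    using age_le[of x' i] v age_visit[of x' i] age_min[of _ x' i] by (intro age_eqI) auto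
  have w: "win x (i - int t) = win x' (i - int t)" if "t < l" for t
    unfolding win_def using v that by auto
  have "word_at x i (l + R) = word_at x' i (l + R)" unfolding word_at_eq_iff using assms by auto
  moreover have "word_at x i (R + 1) = word_at x' i (R + 1)" unfolding word_at_eq_iff using assms l2 by auto
  ultimately show ?thesis using w[of "age x' i"] unfolding code_def Let_def ag by auto
qed

lemma dec_local:
  assumes "y \<in> Y" "y' \<in> Y" "\<And>k. i - int l \<le> k \<Longrightarrow> k \<le> i \<Longrightarrow> y k = y' k"
  shows "dec y i = dec y' i"
proof -
  have "y i = y' i" using assms(3)[of i] by simp
  moreover have "y (i - int t) = y' (i - int t)" if "y i = WStep t" for t
    using edge_facts(2)[OF Y_D(1)[OF assms(1)] that] by (intro assms(3)) auto
  ultimately show ?thesis by (auto simp: dec_def split: edge.splits)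
qed

end

section \<open>Primitivity of the coding graph and its parallel edges\<close>

context window_coding
begin

definition states :: "'a state set" where "states = esrc ` EE"

lemma card_states_le: "card states \<le> (card (words R) + 1) * (l + 1)"
proof -
  have sub: "states \<subseteq> {Visit} \<union> Win ` {..<l} \<union> (\<lambda>(w, t). Gap w t) ` (words R \<times> {1..l})"
  proof
    fix u assume "u \<in> states"
    then obtain x i where x: "x \<in> X" "u = esrc (code x i)" unfolding states_def EE_def by blast
    have w: "word_at x i R \<in> words R" using x(1) by (simp add: words_def)
    show "u \<in> {Visit} \<union> Win ` {..<l} \<union> (\<lambda>(w, t). Gap w t) ` (words R \<times> {1..l})"
      unfolding x(2) esrc_code using w age_le[of x i] age_eq_0[of x i] by (auto simp: in_win_def)
  qed
  have "card states \<le> card ({Visit} \<union> Win ` {..<l} \<union> (\<lambda>(w, t). Gap w t) ` (words R \<times> {1..l}))"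
    using finite_words by (intro card_mono sub) auto
  also have "\<dots> \<le> card ({Visit} \<union> Win ` {..<l} :: 'a state set) + card ((\<lambda>(w, t). Gap w t) ` (words R \<times> {1..l}))"
    by (rule card_Un_le)
  also have "\<dots> \<le> (card {Visit :: 'a state} + card (Win ` {..<l} :: 'a state set)) + card (words R \<times> {1..l})"
    by (intro add_mono card_Un_le card_image_le) (use finite_words in auto)
  also have "\<dots> \<le> (1 + l) + card (words R) * l"
    using card_image_le[of "{..<l}" "Win :: nat \<Rightarrow> 'a state"] by (simp add: card_cartesian_product)
  also have "\<dots> \<le> (card (words R) + 1) * (l + 1)" by simp
  finally show ?thesis .
qed

text \<open>An edge is determined by a word of length \<open>D = 2 * l + R\<close> around it. Mixing
  of \<open>X\<close> joins two such words with any large gap, and the resulting point is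
  encoded.\<close>

lemma mixing_primitive:
  assumes mix: "mixing X"
  shows "\<exists>n0. \<forall>n\<ge>n0. \<forall>u\<in>states. \<forall>v\<in>states. \<exists>w\<in>eg.paths n. eg.ends w = (u, v)"
proof -
  define D where "D = 2 * l + R"
  have D_pos: "D > 0" using l2 by (simp add: D_def)
  have "\<exists>m0. \<forall>m\<ge>m0. \<exists>w\<in>eg.paths (D + m). eg.ends w = (u, v)" if uv: "u \<in> states" "v \<in> states" for u v
  proof -
    obtain x y where x: "x \<in> X" "u = esrc (code x 0)" and y: "y \<in> X" "v = esrc (code y 0)"
      using uv unfolding states_def EE_alt by blast
    have "word_at x (- int l) D \<in> language X" "word_at y (- int l) D \<in> language X" using x y by auto
    then obtain m0 where m0: "\<And>m. m \<ge> m0 \<Longrightarrow> \<exists>w. length w = m \<and> word_at x (- int l) D @ w @ word_at y (- int l) D \<in> language X"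
      using mix unfolding mixing_def by blast
    have "\<exists>w\<in>eg.paths (D + m). eg.ends w = (u, v)" if m: "m \<ge> m0" for m
    proof -
      obtain w where w: "length w = m" "word_at x (- int l) D @ w @ word_at y (- int l) D \<in> language X" using m0[OF m] by blast
      obtain z where z: "z \<in> X" "word_at z (- int l) (D + (m + D)) = word_at x (- int l) D @ w @ word_at y (- int l) D"
        using w in_language_iff[of "word_at x (- int l) D @ w @ word_at y (- int l) D" "- int l"] by auto
      have zw: "word_at z (- int l) D = word_at x (- int l) D" "word_at z (- int l + int D + int m) D = word_at y (- int l) D"
        using z(2) w(1) unfolding word_at_append by auto
      have c0: "code z 0 = code x 0"
      proof (rule code_local)
        fix k assume k: "0 - int l \<le> k" "k < 0 + int (l + R)"
        define j where "j = nat (k + int l)"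
        have j: "k = - int l + int j" "j < D" using k by (auto simp: j_def D_def)
        show "z k = x k" using zw(1) j unfolding word_at_eq_iff by blast
      qed
      have c1: "code (shift_by (int (D + m)) z) 0 = code y 0"
      proof (rule code_local)
        fix k assume k: "0 - int l \<le> k" "k < 0 + int (l + R)"
        define j where "j = nat (k + int l)"
        have j: "k = - int l + int j" "j < D" using k by (auto simp: j_def D_def)
        have "z (- int l + int D + int m + int j) = y (- int l + int j)" using zw(2) j unfolding word_at_eq_iff by blast
        moreover have "- int l + int D + int m + int j = k + int (D + m)" using j by simp
        ultimately show "shift_by (int (D + m)) z k = y k" unfolding shift_by_def using j(1) by metis
      qed
      have e: "eg.ends (block (D + m) (enc z) 0) = (esrc (code z 0), esrc (code z (int (D + m))))"
        using eg.block_ends[OF enc_in[OF z(1)], of "D + m" 0] D_pos by (simp add: enc_def)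
      have "code z (int (D + m)) = code y 0" using c1 code_shift_by[of "int (D + m)" z 0] by simp
      hence "eg.ends (block (D + m) (enc z) 0) = (u, v)" using e c0 x(2) y(2) by simp
      thus ?thesis using eg.block_in_paths[OF enc_in[OF z(1)]] by blast
    qed
    thus ?thesis by blast
  qed
  then obtain m where m: "\<And>u v k. u \<in> states \<Longrightarrow> v \<in> states \<Longrightarrow> k \<ge> m u v \<Longrightarrow> \<exists>w\<in>eg.paths (D + k). eg.ends w = (u, v)"
    by metis
  have fin: "finite states" using finite_EE by (simp add: states_def)
  define n1 where "n1 = Max (insert 0 ((\<lambda>(u, v). m u v) ` (states \<times> states)))"
  have n1: "m u v \<le> n1" if "u \<in> states" "v \<in> states" for u v
    unfolding n1_def by (rule Max_ge) (use fin that in auto)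
  have "\<exists>w\<in>eg.paths n. eg.ends w = (u, v)" if "n \<ge> D + n1" "u \<in> states" "v \<in> states" for n u v
  proof -
    have "n - D \<ge> m u v" "D + (n - D) = n" using n1[OF that(2,3)] that(1) by auto
    thus ?thesis using m[OF that(2,3)] by metis
  qed
  thus ?thesis by blast
qed

definition return_words :: "'a list set" where
  "return_words = {word_at x 0 (l + R) |x. x \<in> X \<and> win x 0}"

lemma WStart_in_EE: "c \<in> return_words \<Longrightarrow> WStart c \<in> EE"
proof -
  assume "c \<in> return_words"
  then obtain x where x: "x \<in> X" "win x 0" "c = word_at x 0 (l + R)" unfolding return_words_def by blast
  hence "age x 0 = 0" using age_eq_0 by (simp add: win_def)
  hence "code x 0 = WStart c" using x l2 by (simp add: code_eq in_win_def)
  thus ?thesis using code_in_EE[OF x(1), of 0] by simp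
qed

text \<open>All edges that open a window run from \<open>Visit\<close> to \<open>Win 1\<close>,
  hence are parallel; two of them are kept as the spare edges.\<close>

lemma parallel_graph_exists:
  assumes mix: "mixing X" and many: "16 * (card states)\<^sup>2 + 2 \<le> card return_words"
  shows "\<exists>E0 e1 e2 b. parallel_graph EE esrc etgt E0 e1 e2 \<and>
    bij_betw b ((states \<times> states) \<times> {..<8::nat} \<times> (UNIV :: bool set)) E0"
proof -
  have "card (WStart ` return_words) = card return_words" by (intro card_image) (auto simp: inj_on_def)
  then obtain U where U: "U \<subseteq> WStart ` return_words" "card U = 16 * (card states)\<^sup>2 + 2"
    using obtain_subset_with_card_n[of "16 * (card states)\<^sup>2 + 2" "WStart ` return_words"] many by auto
  have finU: "finite U" using U(2) by (intro card_ge_0_finite) simp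
  have "\<not> card U \<le> 1" using U(2) by simp
  then obtain e1 e2 where e: "e1 \<in> U" "e2 \<in> U" "e1 \<noteq> e2" using card_le_Suc0_iff_eq[OF finU] by auto
  define E0 where "E0 = U - {e1, e2}"
  have "card E0 = card U - 2" unfolding E0_def using e finU by (subst card_Diff_subset) auto
  hence cE0: "card E0 = 16 * (card states)\<^sup>2" using U(2) by simp
  have UE: "U \<subseteq> EE" using U(1) WStart_in_EE by blast
  have par: "esrc e = Visit \<and> etgt e = Win 1" if "e \<in> U" for e using U(1) that by auto
  have fin: "finite states" using finite_EE by (simp add: states_def)
  have "card ((states \<times> states) \<times> {..<8::nat} \<times> (UNIV :: bool set)) = card E0"
    unfolding cE0 by (simp add: card_cartesian_product power2_eq_square)
  then obtain b where b: "bij_betw b ((states \<times> states) \<times> {..<8::nat} \<times> (UNIV :: bool set)) E0"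
    using finite_same_card_bij[of "(states \<times> states) \<times> {..<8::nat} \<times> (UNIV :: bool set)" E0] fin finU by (auto simp: E0_def)
  have "parallel_graph EE esrc etgt E0 e1 e2"
  proof
    show "\<exists>n0. \<forall>n\<ge>n0. \<forall>u\<in>esrc ` EE. \<forall>v\<in>esrc ` EE. \<exists>w\<in>eg.paths n. eg.ends w = (u, v)"
      using mixing_primitive[OF mix] by (simp only: states_def)
  qed (use e UE par in \<open>auto simp: E0_def\<close>)
  thus ?thesis using b by blast
qed

end

context sft
begin

text \<open>A window of length \<open>2 * L * (4 * k) + c\<close> can be filled in at least
  \<open>2 ^ (4 * k)\<close> ways, while there are fewer than \<open>2 ^ k\<close> states when
  \<open>k\<close> is large; so the windows outnumber sixteen times the square of the number of
  states.\<close>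

lemma window_coding_exists:
  assumes mix: "mixing X" and nt: "\<not> trivial_shift X"
  shows "\<exists>a l. window_coding A X M a l \<and>
    16 * (card (window_coding.states X a l))\<^sup>2 + 2 \<le> card (window_coding.return_words X a l)"
proof -
  obtain \<alpha> \<beta> L where "free_pair A X M \<alpha> \<beta> L" using free_pair_exists[OF mix nt] by blast
  then interpret fp: free_pair A X M \<alpha> \<beta> L .
  obtain a c where ac: "length a \<ge> M" "c > 0" "\<And>N. 2 ^ N \<le> card (fp.returns a (2 * L * N + c))"
    using fp.many_returns[OF mix] by blast
  define W where "W = card (words (length a)) + 1"
  \<comment> \<open>\<open>p\<close> and \<open>q\<close> are the coefficients of a bound for the
    number of states that is linear in \<open>k\<close>.\<close>
  define p where "p = 4 * (W * (2 * L))"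
  define q where "q = W * (c + 1) + 1"
  define k where "k = p + q + 4"
  define l where "l = 2 * L * (4 * k) + c"
  have "k \<ge> 1" by (simp add: k_def)
  hence "2 * 1 * (4 * 1) \<le> 2 * L * (4 * k)" using fp.L_pos by (intro mult_mono) auto
  hence l2: "2 \<le> l" unfolding l_def by linarith
  interpret wc: window_coding A X M a l by unfold_locales (use ac l2 in auto)
  have "card wc.states \<le> W * (l + 1)" using wc.card_states_le by (simp add: W_def)
  also have "\<dots> = p * k + W * (c + 1)" by (simp add: l_def p_def algebra_simps)
  finally have "card wc.states + 1 \<le> p * k + q" by (simp add: q_def)
  also have "\<dots> \<le> 2 ^ k" by (rule linear_le_power_two) (simp add: k_def)
  finally have s: "card wc.states + 1 \<le> 2 ^ k" .
  have "16 * (card wc.states)\<^sup>2 + 2 \<le> 16 * (card wc.states + 1)\<^sup>2" by (simp add: power2_eq_square)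
  also have "\<dots> \<le> 16 * (2 ^ k)\<^sup>2" using s by (intro mult_left_mono power_mono) auto
  also have "\<dots> = 2 ^ (4 + k * 2)" by (simp add: power_add power_mult)
  also have "\<dots> \<le> 2 ^ (4 * k)" by (intro power_increasing) (auto simp: k_def)
  also have "\<dots> \<le> card (fp.returns a l)" using ac(3)[of "4 * k"] by (simp add: l_def)
  also have "fp.returns a l = wc.return_words"
    unfolding fp.returns_def wc.return_words_def wc.win_def wc.visit_def by simp
  finally show ?thesis using wc.window_coding_axioms by blast
qed

end

section \<open>Entropy and periodic points\<close>

context sft
begin

abbreviation "\<X> \<equiv> subshift_topology A X"

lemma closed_X: "closedin (full_shift_topology A) X"
  using sub by (simp add: subshift_def)

lemma topspace_X [simp]: "topspace \<X> = X"
  using closedin_subset[OF closed_X] by (auto simp: subshift_topology_def topspace_subtopology)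

lemma continuous_coordinate: "continuous_map \<X> (discrete_topology A) (\<lambda>x. x i)"
  unfolding subshift_topology_def full_shift_topology_def
  by (intro continuous_map_from_subtopology continuous_map_product_projection) simp

lemma open_coordinate: "openin \<X> {x \<in> X. x i = a}"
proof -
  have "openin \<X> {x \<in> topspace \<X>. x i \<in> {a} \<inter> A}"
    by (rule openin_continuous_map_preimage[OF continuous_coordinate]) auto
  moreover have "{x \<in> topspace \<X>. x i \<in> {a} \<inter> A} = {x \<in> X. x i = a}" using in_A by auto
  ultimately show ?thesis by simp
qed

lemma open_cylinder: "finite J \<Longrightarrow> openin \<X> {x \<in> X. \<forall>j\<in>J. x j = a j}"
proof (induction J rule: finite_induct)
  case empty
  show ?case using openin_topspace[of \<X>] by simp
next
  case (insert i J)
  have "{x \<in> X. \<forall>j\<in>insert i J. x j = a j} = {x \<in> X. x i = a i} \<inter> {x \<in> X. \<forall>j\<in>J. x j = a j}" by auto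
  thus ?case using insert.IH open_coordinate by (simp add: openin_Int)
qed

lemma open_contains_cylinder:
  assumes "openin \<X> U" "x \<in> U"
  shows "\<exists>m::nat. \<forall>y\<in>X. (\<forall>j. \<bar>j\<bar> \<le> int m \<longrightarrow> y j = x j) \<longrightarrow> y \<in> U"
proof -
  obtain S where S: "openin (full_shift_topology A) S" "U = S \<inter> X"
    using assms(1) by (auto simp: subshift_topology_def openin_subtopology)
  obtain B where B: "finite {i. B i \<noteq> A}" "x \<in> PiE UNIV B" "PiE UNIV B \<subseteq> S"
  proof -
    have "\<exists>B. finite {i \<in> UNIV. B i \<noteq> topspace (discrete_topology A)} \<and> (\<forall>i\<in>UNIV. openin (discrete_topology A) (B i)) \<and>
        x \<in> PiE UNIV B \<and> PiE UNIV B \<subseteq> S"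
      using S assms(2) unfolding full_shift_topology_def openin_product_topology_alt by blast
    thus ?thesis using that by auto
  qed
  define m where "m = Max (insert 0 ((\<lambda>i. nat \<bar>i\<bar>) ` {i. B i \<noteq> A}))"
  have m: "\<bar>i\<bar> \<le> int m" if "B i \<noteq> A" for i
  proof -
    have "nat \<bar>i\<bar> \<le> m" unfolding m_def using B(1) that by (intro Max_ge) auto
    thus ?thesis by simp
  qed
  have "y \<in> U" if y: "y \<in> X" "\<forall>j. \<bar>j\<bar> \<le> int m \<longrightarrow> y j = x j" for y
  proof -
    have "y i \<in> B i" for i
    proof (cases "B i = A")
      case True
      thus ?thesis using in_A[OF y(1)] by simp
    next
      case False
      hence "y i = x i" using y(2) m by blast
      thus ?thesis using B(2) by auto
    qed
    hence "y \<in> S" using B(3) by auto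
    thus ?thesis using S(2) y(1) by simp
  qed
  thus ?thesis by blast
qed

text \<open>The radius is measured from 0 and may depend on the coordinate \<open>i\<close>, since
  the maps in question need not commute with the shift.\<close>

definition local_map :: "((int \<Rightarrow> 'a) \<Rightarrow> int \<Rightarrow> 'b) \<Rightarrow> bool" where
  "local_map f \<longleftrightarrow> (\<forall>i. \<exists>m::nat. \<forall>x\<in>X. \<forall>y\<in>X. (\<forall>j. \<bar>j\<bar> \<le> int m \<longrightarrow> x j = y j) \<longrightarrow> f x i = f y i)"

lemma continuous_local_map:
  assumes "local_map f" "\<And>x. x \<in> X \<Longrightarrow> f x \<in> X" shows "continuous_map \<X> \<X> f"
proof -
  have "continuous_map \<X> (full_shift_topology A) f"
    unfolding full_shift_topology_def continuous_map_componentwise_UNIV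
  proof
    fix i
    obtain m where m: "\<And>x y. x \<in> X \<Longrightarrow> y \<in> X \<Longrightarrow> (\<And>j. \<bar>j\<bar> \<le> int m \<Longrightarrow> x j = y j) \<Longrightarrow> f x i = f y i"
      using assms(1) unfolding local_map_def by metis
    show "continuous_map \<X> (discrete_topology A) (\<lambda>x. f x i)"
      unfolding continuous_map_def
    proof (intro conjI allI impI)
      show "(\<lambda>x. f x i) \<in> topspace \<X> \<rightarrow> topspace (discrete_topology A)" using assms(2) in_A by auto
      fix U assume "openin (discrete_topology A) U"
      show "openin \<X> {x \<in> topspace \<X>. f x i \<in> U}"
      proof (subst openin_subopen, intro ballI)
        fix x assume "x \<in> {x \<in> topspace \<X>. f x i \<in> U}"
        hence x: "x \<in> X" "f x i \<in> U" by auto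
        let ?C = "{y \<in> X. \<forall>j\<in>{- int m..int m}. y j = x j}"
        have "openin \<X> ?C" by (rule open_cylinder) simp
        moreover have "x \<in> ?C" using x by simp
        moreover have "?C \<subseteq> {x \<in> topspace \<X>. f x i \<in> U}"
        proof
          fix y assume "y \<in> ?C"
          hence y: "y \<in> X" "\<And>j. \<bar>j\<bar> \<le> int m \<Longrightarrow> y j = x j" by (auto simp: abs_le_iff)
          hence "f y i = f x i" using m[of y x] x(1) by blast
          thus "y \<in> {x \<in> topspace \<X>. f x i \<in> U}" using x(2) y(1) by simp
        qed
        ultimately show "\<exists>T. openin \<X> T \<and> x \<in> T \<and> T \<subseteq> {x \<in> topspace \<X>. f x i \<in> U}" by blast
      qed
    qed
  qed
  hence "continuous_map \<X> (subtopology (full_shift_topology A) X) f"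
    unfolding continuous_map_in_subtopology using assms(2) by auto
  thus ?thesis by (simp only: subshift_topology_def)
qed

lemma compact_X: "compact_space \<X>"
proof -
  have "compact_space (full_shift_topology A)"
    unfolding full_shift_topology_def compact_space_product_topology
    using finite_A by (auto simp: compact_space_discrete_topology)
  hence "compactin (full_shift_topology A) X" using closed_X closedin_compact_space by blast
  thus ?thesis by (simp add: subshift_topology_def compact_space_subtopology)
qed

text \<open>Compactness selects finitely many cylinders. The largest of their radii works for all
  points, because agreement with a point of a cylinder up to that radius implies membership in the
  cylinder.\<close>

lemma lebesgue_number:
  assumes "open_cover \<X> \<U>"
  shows "\<exists>m::nat. \<forall>x\<in>X. \<exists>U\<in>\<U>. \<forall>y\<in>X. (\<forall>j. \<bar>j\<bar> \<le> int m \<longrightarrow> y j = x j) \<longrightarrow> y \<in> U"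
proof -
  have "\<exists>m::nat. \<exists>U\<in>\<U>. \<forall>y\<in>X. (\<forall>j. \<bar>j\<bar> \<le> int m \<longrightarrow> y j = x j) \<longrightarrow> y \<in> U" if x: "x \<in> X" for x
  proof -
    obtain U where "U \<in> \<U>" "x \<in> U" "openin \<X> U" using assms x unfolding open_cover_def by auto
    thus ?thesis using open_contains_cylinder by blast
  qed
  then obtain m :: "(int \<Rightarrow> 'a) \<Rightarrow> nat" where
    m: "\<And>x. x \<in> X \<Longrightarrow> \<exists>U\<in>\<U>. \<forall>y\<in>X. (\<forall>j. \<bar>j\<bar> \<le> int (m x) \<longrightarrow> y j = x j) \<longrightarrow> y \<in> U" by metis
  define C where "C = (\<lambda>x. {y \<in> X. \<forall>j\<in>{- int (m x)..int (m x)}. y j = x j})"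
  have "\<exists>\<F>. finite \<F> \<and> \<F> \<subseteq> C ` X \<and> topspace \<X> \<subseteq> \<Union>\<F>"
  proof (rule compact_X[unfolded compact_space_alt, THEN spec, THEN mp], rule conjI)
    show "\<forall>U\<in>C ` X. openin \<X> U" using open_cylinder by (auto simp: C_def)
    show "topspace \<X> \<subseteq> \<Union>(C ` X)" by (auto simp: C_def)
  qed
  then obtain F where F: "finite F" "F \<subseteq> X" "X \<subseteq> (\<Union>x\<in>F. C x)"
    by (metis finite_subset_image topspace_X)
  define n where "n = Max (insert 0 (m ` F))"
  have n: "m x \<le> n" if "x \<in> F" for x unfolding n_def using F(1) that by (intro Max_ge) auto
  have "\<exists>U\<in>\<U>. \<forall>y\<in>X. (\<forall>j. \<bar>j\<bar> \<le> int n \<longrightarrow> y j = x j) \<longrightarrow> y \<in> U" if x: "x \<in> X" for x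
  proof -
    obtain z where z: "z \<in> F" "x \<in> C z" using F(3) x by blast
    obtain U where U: "U \<in> \<U>" "\<And>y. y \<in> X \<Longrightarrow> (\<And>j. \<bar>j\<bar> \<le> int (m z) \<Longrightarrow> y j = z j) \<Longrightarrow> y \<in> U"
      using m[of z] z(1) F(2) by blast
    have "y \<in> U" if y: "y \<in> X" "\<forall>j. \<bar>j\<bar> \<le> int n \<longrightarrow> y j = x j" for y
    proof (rule U(2)[OF y(1)])
      fix j :: int assume j: "\<bar>j\<bar> \<le> int (m z)"
      hence "y j = x j" using y(2) n[OF z(1)] by auto
      moreover have "x j = z j" using z(2) j by (auto simp: C_def abs_le_iff)
      ultimately show "y j = z j" by simp
    qed
    thus ?thesis using U(1) by blast
  qed
  thus ?thesis by blast
qed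

section \<open>Word growth and topological entropy\<close>

abbreviation nwords :: "nat \<Rightarrow> real" where "nwords n \<equiv> real (card (words n))"

lemma words_ne: "words n \<noteq> {}"
  unfolding words_alt using X_ne by simp

lemma nwords_ge_1: "1 \<le> nwords n"
  using words_ne[of n] finite_words[of n] by (simp add: Suc_le_eq card_gt_0_iff)

lemma card_words_add: "card (words (m + n)) \<le> card (words m) * card (words n)"
proof -
  have "card (words (m + n)) \<le> card (words m \<times> words n)"
  proof (rule card_inj_on_le[where f = "\<lambda>w. (take m w, drop m w)"])
    show "inj_on (\<lambda>w. (take m w, drop m w)) (words (m + n))" by (auto simp: inj_on_def) (metis append_take_drop_id)
    show "(\<lambda>w. (take m w, drop m w)) ` words (m + n) \<subseteq> words m \<times> words n"
    proof clarify
      fix w assume w: "w \<in> words (m + n)"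
      have "take m w \<in> language X \<and> drop m w \<in> language X"
        using language_append[of "take m w" "drop m w"] w by (simp add: words_def)
      thus "take m w \<in> words m \<and> drop m w \<in> words n" using w by (simp add: words_def)
    qed
  qed (use finite_words in auto)
  thus ?thesis by (simp add: card_cartesian_product)
qed

lemma card_words_mono: "m \<le> n \<Longrightarrow> card (words m) \<le> card (words n)"
proof -
  assume mn: "m \<le> n"
  have "words m \<subseteq> take m ` words n"
  proof
    fix w assume "w \<in> words m"
    then obtain x where x: "x \<in> X" "w = word_at x 0 m" by (auto simp: words_alt)
    hence "w = take m (word_at x 0 n)" using mn by (simp add: take_word_at)
    thus "w \<in> take m ` words n" using x(1) by (auto simp: words_def)
  qed
  thus ?thesis using finite_words[of n] by (meson card_image_le card_mono finite_imageI order_trans)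
qed

lemma card_words_mult: "card (words (q * m)) \<le> card (words m) ^ q"
proof (induction q)
  case 0
  have "words 0 \<subseteq> {[]}" by (auto simp: words_def)
  thus ?case using card_mono[of "{[]}" "words 0"] by simp
next
  case (Suc q)
  have "card (words (Suc q * m)) \<le> card (words m) * card (words (q * m))" using card_words_add[of m "q * m"] by simp
  also have "\<dots> \<le> card (words m) * card (words m) ^ q" using Suc by (intro mult_left_mono) auto
  finally show ?case by simp
qed

text \<open>By subadditivity this infimum is a limit, the exponential growth rate of the
  language.\<close>

definition growth :: real where "growth = (INF n\<in>{1..}. ln (nwords n) / real n)"

lemma ln_nwords_nonneg: "0 \<le> ln (nwords n)"
  using nwords_ge_1 by simp

lemma growth_le:
  assumes "n \<ge> 1" shows "real n * growth \<le> ln (nwords n)"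
proof -
  have "growth \<le> ln (nwords n) / real n"
    unfolding growth_def using assms ln_nwords_nonneg
    by (intro cINF_lower bdd_belowI[of _ 0]) auto
  thus ?thesis using assms by (simp add: field_simps)
qed

text \<open>Rounding \<open>n\<close> up to a multiple of \<open>m\<close> costs at most one further
  factor \<open>nwords m\<close>.\<close>

lemma ln_nwords_le:
  assumes "m \<ge> 1" "n \<ge> 1" shows "ln (nwords n) / real n \<le> ln (nwords m) / real m + ln (nwords m) / real n"
proof -
  define q where "q = n div m"
  have "n \<le> (q + 1) * m" unfolding q_def using dividend_less_div_times[of m n] assms(1) by simp
  hence "card (words n) \<le> card (words m) ^ (q + 1)"
    using card_words_mono card_words_mult[of "q + 1" m] le_trans by blast
  hence "nwords n \<le> nwords m ^ (q + 1)" by (metis of_nat_le_iff of_nat_power)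
  hence "ln (nwords n) \<le> ln (nwords m ^ (q + 1))" using nwords_ge_1[of n] nwords_ge_1[of m] by (subst ln_le_cancel_iff) auto
  also have "\<dots> = real (q + 1) * ln (nwords m)" using nwords_ge_1[of m] by (subst ln_realpow) auto
  also have "\<dots> \<le> (real n / real m + 1) * ln (nwords m)"
  proof (rule mult_right_mono[OF _ ln_nwords_nonneg])
    have "real q \<le> real n / real m" unfolding q_def by (rule of_nat_div_le_of_nat)
    thus "real (q + 1) \<le> real n / real m + 1" by simp
  qed
  finally have "ln (nwords n) / real n \<le> (real n / real m + 1) * ln (nwords m) / real n" using assms by (intro divide_right_mono) auto
  also have "\<dots> = ln (nwords m) / real m + ln (nwords m) / real n" using assms by (simp add: field_simps)
  finally show ?thesis .
qed

lemma growth_tendsto: "(\<lambda>n. ln (nwords n) / real n) \<longlonglongrightarrow> growth"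
proof (rule LIMSEQ_I)
  fix r :: real assume r: "0 < r"
  have "\<exists>m\<in>{1..}. ln (nwords m) / real m < growth + r / 2"
    unfolding growth_def by (intro cINF_less_iff[THEN iffD1]) 
      (use r ln_nwords_nonneg in \<open>auto intro!: bdd_belowI[of _ 0]\<close>)
  then obtain m where m: "m \<ge> 1" "ln (nwords m) / real m < growth + r / 2" by auto
  obtain N :: nat where N: "ln (nwords m) * 2 / r < real N" using reals_Archimedean2 by blast
  have "norm (ln (nwords n) / real n - growth) < r" if n: "n \<ge> N + 1" for n
  proof -
    have n1: "n \<ge> 1" using n by simp
    have "ln (nwords m) * 2 / r < real n" using N n by simp
    hence "ln (nwords m) / real n < r / 2" using r n1 by (simp add: field_simps)
    hence "ln (nwords n) / real n < growth + r" using ln_nwords_le[OF m(1) n1] m(2) by linarith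
    moreover have "growth \<le> ln (nwords n) / real n" using growth_le[OF n1] n1 by (simp add: field_simps)
    ultimately show ?thesis by simp
  qed
  thus "\<exists>no. \<forall>n\<ge>no. norm (ln (nwords n) / real n - growth) < r" by blast
qed

lemma growth_tendsto_mult:
  assumes k: "k \<ge> 1"
  shows "(\<lambda>n. ln (nwords (k * n + q)) / real n) \<longlonglongrightarrow> real k * growth"
proof -
  have f: "filterlim (\<lambda>n. k * n + q) at_top at_top"
  proof (rule filterlim_at_top_mono[OF filterlim_ident])
    have "n \<le> k * n + q" for n using k by (simp add: trans_le_add1)
    thus "\<forall>\<^sub>F n in sequentially. n \<le> k * n + q" by simp
  qed
  have 1: "(\<lambda>n. ln (nwords (k * n + q)) / real (k * n + q)) \<longlonglongrightarrow> growth"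
    using filterlim_compose[OF growth_tendsto f] .
  have "(\<lambda>n. real q / real n) \<longlonglongrightarrow> 0" by (rule lim_const_over_n)
  hence 2: "(\<lambda>n. real k + real q / real n) \<longlonglongrightarrow> real k + 0" by (intro tendsto_intros)
  have "(\<lambda>n. (real k + real q / real n) * (ln (nwords (k * n + q)) / real (k * n + q))) \<longlonglongrightarrow> real k * growth"
    using tendsto_mult[OF 2 1] by simp
  moreover have "\<forall>\<^sub>F n in sequentially. (real k + real q / real n) * (ln (nwords (k * n + q)) / real (k * n + q))
      = ln (nwords (k * n + q)) / real n"
  proof (rule eventually_sequentiallyI[of 1])
    fix n :: nat assume n: "n \<ge> 1"
    have p: "real (k * n + q) > 0" using n k by (simp add: add_pos_nonneg)
    have "real k + real q / real n = real (k * n + q) / real n" using n by (simp add: field_simps)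
    thus "(real k + real q / real n) * (ln (nwords (k * n + q)) / real (k * n + q)) = ln (nwords (k * n + q)) / real n"
      using p by simp
  qed
  ultimately show ?thesis by (rule Lim_transform_eventually)
qed

lemma funpow_shift:
  assumes "\<And>x. x \<in> X \<Longrightarrow> T x = shift_by (int k) x" "x \<in> X"
  shows "(T ^^ i) x = shift_by (int (k * i)) x"
proof (induction i)
  case (Suc i)
  have "T (shift_by (int (k * i)) x) = shift_by (int k) (shift_by (int (k * i)) x)"
    using assms by simp
  thus ?case using Suc by simp
qed simp

text \<open>The word of length \<open>k * n + q\<close> that starts at \<open>- m\<close> fixes the
  first \<open>n\<close> iterates up to radius \<open>m\<close>, so one set of the join for each
  word suffices. The summand \<open>q = 2 * m + 1\<close> is the length of the window of radius
  \<open>m\<close>.\<close>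

lemma small_subcover:
  assumes T: "\<And>x. x \<in> X \<Longrightarrow> T x = shift_by (int k) x" and U: "open_cover \<X> \<U>"
  shows "\<exists>q. \<forall>n. \<exists>\<V>\<subseteq>iterated_join \<X> T \<U> n. finite \<V> \<and> card \<V> \<le> card (words (k * n + q)) \<and> \<Union>\<V> = topspace \<X>"
proof -
  obtain m :: nat where m: "\<And>x. x \<in> X \<Longrightarrow> \<exists>U\<in>\<U>. \<forall>y\<in>X. (\<forall>j. \<bar>j\<bar> \<le> int m \<longrightarrow> y j = x j) \<longrightarrow> y \<in> U"
    using lebesgue_number[OF U] by blast
  then obtain u where u: "\<And>x. x \<in> X \<Longrightarrow> u x \<in> \<U>"
    "\<And>x y. x \<in> X \<Longrightarrow> y \<in> X \<Longrightarrow> (\<And>j. \<bar>j\<bar> \<le> int m \<Longrightarrow> y j = x j) \<Longrightarrow> y \<in> u x" by metis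
  define q where "q = 2 * m + 1"
  have "\<exists>\<V>\<subseteq>iterated_join \<X> T \<U> n. finite \<V> \<and> card \<V> \<le> card (words (k * n + q)) \<and> \<Union>\<V> = topspace \<X>" for n
  proof -
    have "\<exists>x\<in>X. word_at x (- int m) (k * n + q) = w" if "w \<in> words (k * n + q)" for w
      using that in_language_iff[of w "- int m"] by (auto simp: words_def)
    then obtain p where p: "\<And>w. w \<in> words (k * n + q) \<Longrightarrow> p w \<in> X \<and> word_at (p w) (- int m) (k * n + q) = w" by metis
    define V where "V = (\<lambda>w. {x \<in> topspace \<X>. \<forall>i<n. (T ^^ i) x \<in> u ((T ^^ i) (p w))})"
    have TX: "(T ^^ i) x \<in> X" if "x \<in> X" for x i using funpow_shift[OF T that] that by simp
    have "V ` words (k * n + q) \<subseteq> iterated_join \<X> T \<U> n"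
    proof
      fix W assume "W \<in> V ` words (k * n + q)"
      then obtain w where w: "w \<in> words (k * n + q)" "W = V w" by (rule imageE)
      have "\<forall>i<n. u ((T ^^ i) (p w)) \<in> \<U>" using u(1)[OF TX[OF conjunct1[OF p[OF w(1)]]]] by simp
      thus "W \<in> iterated_join \<X> T \<U> n"
        unfolding w(2) V_def iterated_join_def by (intro CollectI exI[of _ "\<lambda>i. u ((T ^^ i) (p w))"] conjI refl)
    qed
    moreover have "\<Union>(V ` words (k * n + q)) = topspace \<X>"
    proof
      show "topspace \<X> \<subseteq> \<Union>(V ` words (k * n + q))"
      proof
        fix x assume "x \<in> topspace \<X>"
        hence x: "x \<in> X" by simp
        define w where "w = word_at x (- int m) (k * n + q)"
        have w: "w \<in> words (k * n + q)" using x by (simp add: w_def words_def)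
        have "(T ^^ i) x \<in> u ((T ^^ i) (p w))" if i: "i < n" for i
        proof (rule u(2)[OF TX TX])
          show "p w \<in> X" "x \<in> X" using p[OF w] x by auto
          fix j assume j: "\<bar>j\<bar> \<le> int m"
          define t where "t = nat (j + int (k * i) + int m)"
          have "k * i \<le> k * n" using i by simp
          hence "int (k * i) \<le> int (k * n)" by (simp only: of_nat_le_iff)
          moreover have "0 \<le> int (k * i)" by (rule of_nat_0_le_iff)
          moreover have "int (k * n + q) = int (k * n) + 2 * int m + 1" by (simp add: q_def)
          ultimately have "0 \<le> j + int (k * i) + int m" "j + int (k * i) + int m < int (k * n + q)" using j by linarith+
          hence t: "- int m + int t = j + int (k * i)" "int t < int (k * n + q)" unfolding t_def by linarith+
          have "word_at x (- int m) (k * n + q) = word_at (p w) (- int m) (k * n + q)" using p[OF w] w_def by simp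
          hence "x (- int m + int t) = p w (- int m + int t)" using t(2) unfolding word_at_eq_iff of_nat_less_iff by blast
          thus "(T ^^ i) x j = (T ^^ i) (p w) j"
            using funpow_shift[OF T x] funpow_shift[OF T, of "p w"] p[OF w] t(1) by (simp add: shift_by_def)
        qed
        hence "x \<in> V w" using x by (simp add: V_def)
        thus "x \<in> \<Union>(V ` words (k * n + q))" using w by blast
      qed
    qed (auto simp: V_def)
    ultimately show ?thesis using finite_words card_image_le[OF finite_words] by (intro exI[of _ "V ` words (k * n + q)"]) auto
  qed
  thus ?thesis by blast
qed

lemma topological_entropy_eq:
  assumes k: "k \<ge> 1" and T: "\<And>x. x \<in> X \<Longrightarrow> T x = shift_by (int k) x"
  shows "topological_entropy \<X> T = ereal (real k * growth)"
proof (rule antisym)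
  show "topological_entropy \<X> T \<le> ereal (real k * growth)"
    unfolding topological_entropy_def
  proof (rule SUP_least, clarify)
    fix \<U> assume U: "open_cover \<X> \<U>"
    obtain q where q: "\<And>n. \<exists>\<V>\<subseteq>iterated_join \<X> T \<U> n. finite \<V> \<and> card \<V> \<le> card (words (k * n + q)) \<and> \<Union>\<V> = topspace \<X>"
      using small_subcover[OF T U] by blast
    have le: "min_subcover \<X> (iterated_join \<X> T \<U> n) \<le> card (words (k * n + q))" for n
    proof -
      obtain \<V> where V: "\<V> \<subseteq> iterated_join \<X> T \<U> n" "finite \<V>" "card \<V> \<le> card (words (k * n + q))" "\<Union>\<V> = topspace \<X>"
        using q[of n] by blast
      have "min_subcover \<X> (iterated_join \<X> T \<U> n) \<le> card \<V>"
        unfolding min_subcover_def using V by (intro Least_le) blast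
      thus ?thesis using V(3) by simp
    qed
    have "limsup (\<lambda>n. ereal (ln (real (min_subcover \<X> (iterated_join \<X> T \<U> n))) / real n))
        \<le> limsup (\<lambda>n. ereal (ln (nwords (k * n + q)) / real n))"
    proof (rule Limsup_mono, rule always_eventually, rule allI)
      fix n
      have "ln (real (min_subcover \<X> (iterated_join \<X> T \<U> n))) \<le> ln (nwords (k * n + q))"
      proof (cases "min_subcover \<X> (iterated_join \<X> T \<U> n) = 0")
        case True
        thus ?thesis using ln_nwords_nonneg by simp
      next
        case False
        thus ?thesis using le[of n] by simp
      qed
      thus "ereal (ln (real (min_subcover \<X> (iterated_join \<X> T \<U> n))) / real n) \<le> ereal (ln (nwords (k * n + q)) / real n)"
        by (simp add: divide_right_mono)
    qed
    also have "\<dots> = ereal (real k * growth)"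
      using growth_tendsto_mult[OF k, of q] by (intro lim_imp_Limsup) auto
    finally show "limsup (\<lambda>n. ereal (ln (real (min_subcover \<X> (iterated_join \<X> T \<U> n))) / real n)) \<le> ereal (real k * growth)" .
  qed
next
  \<comment> \<open>The cover by cylinders of length \<open>k\<close> gives the lower bound: each
    set of its join determines the word of length \<open>k * n\<close>, so a subcover has at least
    one set for every word.\<close>
  define \<U> where "\<U> = (\<lambda>w. {x \<in> X. word_at x 0 k = w}) ` words k"
  have "openin \<X> {x \<in> X. word_at x 0 k = w}" if "w \<in> words k" for w
  proof -
    have "{x \<in> X. word_at x 0 k = w} = {x \<in> X. \<forall>j\<in>{0..<int k}. x j = w ! nat j}"
    proof (intro Collect_cong conj_cong refl iffI)
      fix x assume "word_at x 0 k = w"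
      hence w: "w ! j = x (int j)" if "j < k" for j using that nth_word_at[of j k x 0] by simp
      show "\<forall>j\<in>{0..<int k}. x j = w ! nat j"
      proof
        fix j assume "j \<in> {0..<int k}"
        thus "x j = w ! nat j" using w[of "nat j"] by auto
      qed
    next
      fix x assume "\<forall>j\<in>{0..<int k}. x j = w ! nat j"
      thus "word_at x 0 k = w" using that by (intro nth_equalityI) (auto simp: words_def)
    qed
    thus ?thesis using open_cylinder[of "{0..<int k}" "\<lambda>j. w ! nat j"] by simp
  qed
  hence U: "open_cover \<X> \<U>" by (auto simp: open_cover_def \<U>_def words_def)
  have ge: "card (words (k * n)) \<le> min_subcover \<X> (iterated_join \<X> T \<U> n)" for n
  proof -
    have "\<exists>\<V>\<subseteq>iterated_join \<X> T \<U> n. finite \<V> \<and> card \<V> = min_subcover \<X> (iterated_join \<X> T \<U> n) \<and> \<Union>\<V> = topspace \<X>"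
      unfolding min_subcover_def
    proof (rule LeastI_ex)
      show "\<exists>c. \<exists>\<V>\<subseteq>iterated_join \<X> T \<U> n. finite \<V> \<and> card \<V> = c \<and> \<Union>\<V> = topspace \<X>"
        using small_subcover[OF T U] by blast
    qed
    then obtain \<V> where V: "\<V> \<subseteq> iterated_join \<X> T \<U> n" "finite \<V>" "card \<V> = min_subcover \<X> (iterated_join \<X> T \<U> n)"
      "\<Union>\<V> = topspace \<X>" by blast
    have same: "word_at x 0 (k * n) = word_at y 0 (k * n)" if W: "W \<in> \<V>" "x \<in> W" "y \<in> W" for W x y
    proof -
      have "W \<in> iterated_join \<X> T \<U> n" using W(1) V(1) by blast
      then obtain U where U: "\<And>i. i < n \<Longrightarrow> U i \<in> \<U>" "W = {x \<in> topspace \<X>. \<forall>i<n. (T ^^ i) x \<in> U i}"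
        unfolding iterated_join_def by blast
      have xy: "x \<in> X" "y \<in> X" using W U(2) by auto
      have "x (int j) = y (int j)" if j: "j < k * n" for j
      proof -
        define i where "i = j div k"
        have i: "i < n" "j = i * k + j mod k" "j mod k < k"
          using j k by (auto simp: i_def less_mult_imp_div_less mult.commute)
        obtain w where w: "U i = {x \<in> X. word_at x 0 k = w}" using U(1)[OF i(1)] by (auto simp: \<U>_def)
        have "(T ^^ i) x \<in> U i" "(T ^^ i) y \<in> U i" using W(2,3) i(1) unfolding U(2) by auto
        hence "word_at ((T ^^ i) x) 0 k = word_at ((T ^^ i) y) 0 k" unfolding w by simp
        hence "(T ^^ i) x (0 + int (j mod k)) = (T ^^ i) y (0 + int (j mod k))" using i(3) unfolding word_at_eq_iff by blast
        hence "x (int (j mod k) + int (k * i)) = y (int (j mod k) + int (k * i))"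
          using funpow_shift[OF T xy(1)] funpow_shift[OF T xy(2)] by (simp add: shift_by_def)
        moreover have "int (j mod k) + int (k * i) = int j" using i(2) by (metis add.commute mult.commute of_nat_add)
        ultimately show ?thesis by simp
      qed
      thus ?thesis by (simp add: word_at_eq_iff)
    qed
    have "\<exists>W\<in>\<V>. \<exists>x\<in>W. x \<in> X \<and> word_at x 0 (k * n) = w" if "w \<in> words (k * n)" for w
    proof -
      obtain x where x: "x \<in> X" "word_at x 0 (k * n) = w" using \<open>w \<in> words (k * n)\<close> by (auto simp: words_alt)
      hence "x \<in> \<Union>\<V>" using V(4) by simp
      thus ?thesis using x by blast
    qed
    then obtain W where W: "\<And>w. w \<in> words (k * n) \<Longrightarrow> W w \<in> \<V> \<and> (\<exists>x\<in>W w. x \<in> X \<and> word_at x 0 (k * n) = w)" by metis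
    have "inj_on W (words (k * n))"
    proof (rule inj_onI)
      fix w w' assume w: "w \<in> words (k * n)" "w' \<in> words (k * n)" "W w = W w'"
      obtain x where x: "x \<in> W w" "word_at x 0 (k * n) = w" using W[OF w(1)] by blast
      obtain y where y: "y \<in> W w" "word_at y 0 (k * n) = w'" using W[OF w(2)] w(3) by auto
      show "w = w'" using same[of "W w" x y] W[OF w(1)] x y by simp
    qed
    hence "card (words (k * n)) \<le> card \<V>" using W V(2) by (intro card_inj_on_le) auto
    thus ?thesis using V(3) by simp
  qed
  have "ereal (real k * growth) = limsup (\<lambda>n. ereal (ln (nwords (k * n + 0)) / real n))"
    using growth_tendsto_mult[OF k, of 0] by (intro lim_imp_Limsup[symmetric]) auto
  also have "\<dots> \<le> limsup (\<lambda>n. ereal (ln (real (min_subcover \<X> (iterated_join \<X> T \<U> n))) / real n))"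
  proof (rule Limsup_mono, rule always_eventually, rule allI)
    fix n
    have "nwords (k * n) \<le> real (min_subcover \<X> (iterated_join \<X> T \<U> n))" using ge[of n] by simp
    hence "ln (nwords (k * n)) \<le> ln (real (min_subcover \<X> (iterated_join \<X> T \<U> n)))"
      using nwords_ge_1[of "k * n"] by (subst ln_le_cancel_iff) auto
    thus "ereal (ln (nwords (k * n + 0)) / real n) \<le> ereal (ln (real (min_subcover \<X> (iterated_join \<X> T \<U> n))) / real n)"
      by (simp add: divide_right_mono)
  qed
  also have "\<dots> \<le> topological_entropy \<X> T"
    unfolding topological_entropy_def using U by (intro SUP_upper) simp
  finally show "ereal (real k * growth) \<le> topological_entropy \<X> T" .
qed

section \<open>Periodic points\<close>

definition periodic :: "nat \<Rightarrow> (int \<Rightarrow> 'a) set" where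
  "periodic p = {x \<in> X. shift_by (int p) x = x}"

lemma card_periodic:
  assumes "p \<ge> 1" shows "finite (periodic p)" "card (periodic p) \<le> card (words p)"
proof -
  have inj: "inj_on (\<lambda>x. word_at x 0 p) (periodic p)"
  proof (rule inj_onI)
    fix x y assume xy: "x \<in> periodic p" "y \<in> periodic p" "word_at x 0 p = word_at y 0 p"
    have per: "z (i + int p * k) = z i" if "z \<in> periodic p" for z i k
    proof -
      have s: "z (i + int p) = z i" for i
      proof -
        have "shift_by (int p) z = z" using that by (simp add: periodic_def)
        from fun_cong[OF this, of i] show ?thesis by (simp add: shift_by_def)
      qed
      have n: "z (i + int p * int n) = z i" for i n
      proof (induction n)
        case (Suc n)
        thus ?case using s[of "i + int p * int n"] by (simp add: algebra_simps)
      qed simp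
      show ?thesis
      proof (cases "k \<ge> 0")
        case True
        thus ?thesis using n[of i "nat k"] by simp
      next
        case False
        thus ?thesis using n[of "i + int p * k" "nat (- k)"] by simp
      qed
    qed
    show "x = y"
    proof
      fix i
      define j where "j = nat (i mod int p)"
      have j: "i = int j + int p * (i div int p)" "j < p" using assms by (auto simp: j_def nat_less_iff)
      have "x (0 + int j) = y (0 + int j)" using xy(3) j(2) unfolding word_at_eq_iff by blast
      thus "x i = y i" using per[OF xy(1), of "int j" "i div int p"] per[OF xy(2), of "int j" "i div int p"] j(1) by simp
    qed
  qed
  have sub: "(\<lambda>x. word_at x 0 p) ` periodic p \<subseteq> words p" by (auto simp: periodic_def words_def)
  show "finite (periodic p)" using finite_imageD[OF finite_subset[OF sub finite_words] inj] .
  show "card (periodic p) \<le> card (words p)" by (rule card_inj_on_le[OF inj sub finite_words])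
qed

text \<open>By continuity \<open>f\<close> moves every point that agrees with \<open>x\<close> on a
  long window, and mixing closes the word in that window up to a periodic point of any large
  period.\<close>

lemma moves_periodic_points:
  assumes mix: "mixing X" and f: "continuous_map \<X> \<X> f" and x: "x \<in> X" "f x \<noteq> x"
  shows "\<exists>n1. \<forall>p\<ge>n1. \<exists>y\<in>periodic p. f y \<noteq> y"
proof -
  obtain t where t: "f x t \<noteq> x t" using x(2) by (auto simp: fun_eq_iff)
  have fX: "f z \<in> X" if "z \<in> X" for z using continuous_map_funspace[OF f] that by auto
  have "openin \<X> {z \<in> topspace \<X>. f z \<in> {u \<in> X. u t = f x t}}"
    by (rule openin_continuous_map_preimage[OF f open_coordinate])
  then obtain m0 :: nat where m0: "\<And>y. y \<in> X \<Longrightarrow> (\<And>j. \<bar>j\<bar> \<le> int m0 \<Longrightarrow> y j = x j) \<Longrightarrow> f y t = f x t"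
    using open_contains_cylinder[of "{z \<in> topspace \<X>. f z \<in> {u \<in> X. u t = f x t}}" x] x(1) fX by auto
  define m where "m = m0 + nat \<bar>t\<bar> + M"
  define u where "u = word_at x (- int m) (2 * m + 1)"
  have u: "u \<in> language X" "length u = 2 * m + 1" "length u \<ge> M" using x by (auto simp: u_def m_def)
  obtain n0 where n0: "\<And>n. n \<ge> n0 \<Longrightarrow> \<exists>w. length w = n \<and> u @ w @ u \<in> language X"
    using mix u(1) unfolding mixing_def by blast
  have "\<exists>y\<in>periodic p. f y \<noteq> y" if p: "p \<ge> n0 + length u" for p
  proof -
    have "p - length u \<ge> n0" using p by simp
    then obtain w where w: "length w = p - length u" "u @ w @ u \<in> language X" using n0 by blast
    have "p = length (u @ w)" using w(1) p by simp
    then obtain y0 where y0: "y0 \<in> X" "shift_by (int p) y0 = y0" "word_at y0 0 (length u) = u"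
      using periodic_point[OF w(2) u(3)] by blast
    define y where "y = shift_by (int m) y0"
    have yX: "y \<in> X" using y0(1) by (simp add: y_def)
    have yp: "y \<in> periodic p"
    proof -
      have "shift_by (int p) y = shift_by (int m) (shift_by (int p) y0)" unfolding y_def by (simp add: add.commute)
      thus ?thesis using yX y0(2) by (simp add: periodic_def y_def)
    qed
    have yx: "y j = x j" if "\<bar>j\<bar> \<le> int m" for j
    proof -
      define i where "i = nat (j + int m)"
      have i: "j = - int m + int i" "i < 2 * m + 1" using that by (auto simp: i_def)
      have "word_at y0 0 (2 * m + 1) = word_at x (- int m) (2 * m + 1)" using y0(3) u by (simp add: u_def)
      hence "y0 (0 + int i) = x (- int m + int i)" using i(2) unfolding word_at_eq_iff by blast
      thus ?thesis using i(1) by (simp add: y_def shift_by_def)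
    qed
    have "f y t = f x t" using m0[OF yX] yx by (simp add: m_def)
    moreover have "y t = x t" by (rule yx) (simp add: m_def)
    ultimately have "f y \<noteq> y" using t by auto
    thus ?thesis using yp by blast
  qed
  thus ?thesis by blast
qed

end

section \<open>The stabilized automorphism group\<close>

lemma homeo_group_simps [simp]:
  "carrier (homeo_group T) = {f \<in> Bij (topspace T). homeomorphic_map T T f}"
  "mult (homeo_group T) = mult (BijGroup (topspace T))" "one (homeo_group T) = one (BijGroup (topspace T))"
  by (simp_all add: homeo_group_def)

lemma mult_BijGroup: "f \<in> Bij S \<Longrightarrow> g \<in> Bij S \<Longrightarrow> f \<otimes>\<^bsub>BijGroup S\<^esub> g = compose S f g"
  by (simp add: BijGroup_def)

lemma group_homeo_group: "group (homeo_group T)"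
proof -
  let ?S = "topspace T"
  interpret B: group "BijGroup ?S" by (rule group_BijGroup)
  have cB: "carrier (BijGroup ?S) = Bij ?S" by (simp add: BijGroup_def)
  have "subgroup {f \<in> Bij ?S. homeomorphic_map T T f} (BijGroup ?S)"
  proof (rule B.subgroupI)
    show "{f \<in> Bij ?S. homeomorphic_map T T f} \<subseteq> carrier (BijGroup ?S)" using cB by auto
    have "homeomorphic_map T T (\<lambda>x\<in>?S. x)"
      by (rule homeomorphic_map_eq[OF homeomorphic_map_id[of T T, THEN iffD2]]) auto
    thus "{f \<in> Bij ?S. homeomorphic_map T T f} \<noteq> {}" using id_Bij[of ?S] by auto
  next
    fix f assume f: "f \<in> {f \<in> Bij ?S. homeomorphic_map T T f}"
    then obtain g where g: "homeomorphic_maps T T f g" using homeomorphic_map_maps by blast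
    have bij: "bij_betw f ?S ?S" using f by (auto simp: Bij_def)
    have "homeomorphic_map T T (\<lambda>x\<in>?S. inv_into ?S f x)"
    proof (rule homeomorphic_map_eq)
      show "homeomorphic_map T T g" using g homeomorphic_maps_sym homeomorphic_maps_imp_map by blast
      fix x assume x: "x \<in> ?S"
      have gx: "g x \<in> ?S" "f (g x) = x" using g x unfolding homeomorphic_maps_def continuous_map_def by auto
      show "g x = (\<lambda>x\<in>?S. inv_into ?S f x) x" using x gx bij_betw_inv_into_left[OF bij gx(1)] by simp
    qed
    moreover have "inv\<^bsub>BijGroup ?S\<^esub> f = (\<lambda>x\<in>?S. inv_into ?S f x)" using f by (intro inv_BijGroup) auto
    ultimately show "inv\<^bsub>BijGroup ?S\<^esub> f \<in> {f \<in> Bij ?S. homeomorphic_map T T f}"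
      using f restrict_inv_into_Bij[of f ?S] by simp
  next
    fix f g assume fg: "f \<in> {f \<in> Bij ?S. homeomorphic_map T T f}" "g \<in> {f \<in> Bij ?S. homeomorphic_map T T f}"
    have "homeomorphic_map T T (compose ?S f g)"
      by (rule homeomorphic_map_eq[of T T "f \<circ> g"]) (use fg in \<open>auto intro: homeomorphic_map_compose simp: compose_eq\<close>)
    thus "f \<otimes>\<^bsub>BijGroup ?S\<^esub> g \<in> {f \<in> Bij ?S. homeomorphic_map T T f}"
      using fg mult_BijGroup[of f ?S g] compose_Bij[of f ?S g] by simp
  qed
  from B.subgroup_imp_group[OF this] show ?thesis by (simp add: homeo_group_def)
qed

section \<open>Commutation with powers of the shift and the upper bound\<close>

context sft
begin

abbreviation "HG \<equiv> homeo_group \<X>"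
abbreviation "\<sigma> \<equiv> subshift_map X"

interpretation HG: group HG by (rule group_homeo_group)

lemma HG_D:
  assumes "f \<in> carrier HG"
  shows "f \<in> Bij X" "continuous_map \<X> \<X> f" "x \<in> X \<Longrightarrow> f x \<in> X" "f \<in> extensional X" "bij_betw f X X"
  using assms homeomorphic_imp_continuous_map by (auto simp: Bij_def bij_betw_def)

lemma HG_mult: "f \<in> carrier HG \<Longrightarrow> g \<in> carrier HG \<Longrightarrow> f \<otimes>\<^bsub>HG\<^esub> g = compose X f g"
  using mult_BijGroup[of f X g] by simp

lemma HG_one: "\<one>\<^bsub>HG\<^esub> = (\<lambda>x\<in>X. x)"
  by (simp add: BijGroup_def)

lemma HG_I:
  assumes "local_map f" "local_map g" "\<And>x. x \<in> X \<Longrightarrow> f x \<in> X" "\<And>x. x \<in> X \<Longrightarrow> g x \<in> X"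
    "\<And>x. x \<in> X \<Longrightarrow> g (f x) = x" "\<And>x. x \<in> X \<Longrightarrow> f (g x) = x"
  shows "restrict f X \<in> carrier HG"
proof -
  have "homeomorphic_maps \<X> \<X> f g"
    unfolding homeomorphic_maps_def using continuous_local_map assms by auto
  hence "homeomorphic_map \<X> \<X> f" by (rule homeomorphic_maps_imp_map)
  hence "homeomorphic_map \<X> \<X> (restrict f X)" by (rule homeomorphic_map_eq) simp
  moreover have "bij_betw f X X" using assms by (intro bij_betw_byWitness[where f' = g]) auto
  hence "bij_betw (restrict f X) X X" by (subst bij_betw_cong[of _ _ f]) auto
  ultimately show ?thesis by (auto simp: Bij_def)
qed

lemma local_shift_by: "local_map (shift_by c)"
  unfolding local_map_def
proof
  fix i
  show "\<exists>m::nat. \<forall>x\<in>X. \<forall>y\<in>X. (\<forall>j. \<bar>j\<bar> \<le> int m \<longrightarrow> x j = y j) \<longrightarrow> shift_by c x i = shift_by c y i"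
    by (rule exI[of _ "nat \<bar>i + c\<bar>"]) (auto simp: shift_by_def)
qed

lemma shift_in_HG: "restrict (shift_by c) X \<in> carrier HG"
  by (rule HG_I[of _ "shift_by (- c)"]) (auto intro: local_shift_by)

lemma sigma_alt: "\<sigma> = restrict (shift_by 1) X"
  by (simp add: subshift_map_def shift_shift_by)

text \<open>Stated for any structure \<open>K\<close> with this product and unit, as powers are
  taken both in \<open>HG\<close> and in \<open>SG\<close>.\<close>

lemma shift_pow:
  assumes "mult K = mult HG" "one K = one HG"
  shows "restrict (shift_by c) X [^]\<^bsub>K\<^esub> (n::nat) = restrict (shift_by (c * int n)) X"
proof (induction n)
  case 0
  have "restrict (shift_by 0) X = (\<lambda>x\<in>X. x)" by (rule restrict_ext) simp
  thus ?case using assms(2) HG_one by (simp add: nat_pow_def)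
next
  case (Suc n)
  have "restrict (shift_by c) X [^]\<^bsub>K\<^esub> Suc n = restrict (shift_by c) X [^]\<^bsub>K\<^esub> n \<otimes>\<^bsub>K\<^esub> restrict (shift_by c) X"
    by (simp add: nat_pow_def)
  also have "\<dots> = restrict (shift_by (c * int n)) X \<otimes>\<^bsub>HG\<^esub> restrict (shift_by c) X"
    unfolding Suc assms(1) ..
  also have "\<dots> = compose X (restrict (shift_by (c * int n)) X) (restrict (shift_by c) X)"
    by (rule HG_mult[OF shift_in_HG shift_in_HG])
  also have "\<dots> = restrict (shift_by (c * int (Suc n))) X"
    unfolding compose_def by (rule restrict_ext) (simp add: algebra_simps)
  finally show ?case .
qed

lemma sigma_pow: "\<sigma> [^]\<^bsub>HG\<^esub> (n::nat) = restrict (shift_by (int n)) X"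
  using shift_pow[of HG 1 n] sigma_alt by simp

text \<open>Integer exponents turn the admissible \<open>c\<close> into a subgroup of the integers,
  to which Bezout's identity applies.\<close>

definition commutes :: "((int \<Rightarrow> 'a) \<Rightarrow> int \<Rightarrow> 'a) \<Rightarrow> int \<Rightarrow> bool" where
  "commutes f c \<longleftrightarrow> (\<forall>x\<in>X. f (shift_by c x) = shift_by c (f x))"

lemma one_commutes: "commutes \<one>\<^bsub>HG\<^esub> c"
  unfolding commutes_def HG_one by simp

lemma commutes_iff:
  assumes "f \<in> carrier HG"
  shows "f \<otimes>\<^bsub>HG\<^esub> restrict (shift_by c) X = restrict (shift_by c) X \<otimes>\<^bsub>HG\<^esub> f \<longleftrightarrow> commutes f c"
  unfolding HG_mult[OF assms shift_in_HG] HG_mult[OF shift_in_HG assms]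
proof
  assume e: "compose X f (restrict (shift_by c) X) = compose X (restrict (shift_by c) X) f"
  show "commutes f c" unfolding commutes_def
  proof
    fix x assume x: "x \<in> X"
    show "f (shift_by c x) = shift_by c (f x)" using fun_cong[OF e, of x] x HG_D(3)[OF assms] by (simp add: compose_eq)
  qed
next
  assume c: "commutes f c"
  show "compose X f (restrict (shift_by c) X) = compose X (restrict (shift_by c) X) f"
    unfolding compose_def using c HG_D(3)[OF assms] by (intro restrict_ext) (simp add: commutes_def)
qed

lemma commutes_add: 
  assumes "commutes f c" "commutes f d" shows "commutes f (c + d)"
  unfolding commutes_def
proof
  fix x assume x: "x \<in> X"
  have "f (shift_by c (shift_by d x)) = shift_by c (f (shift_by d x))"
    using assms(1) shift_by_in[OF x] unfolding commutes_def by blast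
  moreover have "f (shift_by d x) = shift_by d (f x)" using assms(2) x unfolding commutes_def by blast
  ultimately show "f (shift_by (c + d) x) = shift_by (c + d) (f x)" by simp
qed

lemma commutes_minus:
  assumes "commutes f c" shows "commutes f (- c)"
  unfolding commutes_def
proof
  fix x assume x: "x \<in> X"
  have "f x = shift_by c (f (shift_by (- c) x))" using assms x shift_by_in[OF x, of "- c"] unfolding commutes_def by fastforce
  hence "shift_by (- c) (f x) = shift_by (- c) (shift_by c (f (shift_by (- c) x)))" by simp
  thus "f (shift_by (- c) x) = shift_by (- c) (f x)" by simp
qed

lemma commutes_mult: "commutes f c \<Longrightarrow> commutes f (k * c)"
proof -
  assume c: "commutes f c"
  have n: "commutes f (int n * c)" for n
  proof (induction n)
    case 0
    show ?case by (simp add: commutes_def)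
  next
    case (Suc n)
    thus ?case using commutes_add[OF c Suc] by (simp add: algebra_simps)
  qed
  show ?thesis
  proof (cases "k \<ge> 0")
    case True
    thus ?thesis using n[of "nat k"] by simp
  next
    case False
    thus ?thesis using commutes_minus[OF n[of "nat (- k)"]] by simp
  qed
qed

lemma commutes_gcd: "commutes f c \<Longrightarrow> commutes f d \<Longrightarrow> commutes f (gcd c d)"
  using bezout_int[of c d] commutes_mult commutes_add by metis

lemma commutes_dvd: "commutes f c \<Longrightarrow> c dvd d \<Longrightarrow> commutes f d"
  using commutes_mult by (metis dvd_def mult.commute)

abbreviation "SG \<equiv> stabilized_aut_group \<X> \<sigma>"

lemma SG_simps [simp]: "mult SG = mult HG" "one SG = one HG"
  by (simp_all add: stabilized_aut_group_def)

lemma aut_iff: "f \<in> aut \<X> (\<sigma> [^]\<^bsub>HG\<^esub> (n::nat)) \<longleftrightarrow> f \<in> carrier HG \<and> commutes f (int n)"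
  unfolding aut_def centralizer_def sigma_pow using commutes_iff by blast

lemma carrier_SG: "f \<in> carrier SG \<longleftrightarrow> f \<in> carrier HG \<and> (\<exists>n::nat. n \<ge> 1 \<and> commutes f (int n))"
proof -
  have "carrier SG = (\<Union>n\<in>{1::nat..}. aut \<X> (\<sigma> [^]\<^bsub>HG\<^esub> n))" by (simp add: stabilized_aut_group_def)
  thus ?thesis using aut_iff by auto
qed

lemma commutes_compose:
  assumes "f \<in> carrier HG" "g \<in> carrier HG" "commutes f c" "commutes g c"
  shows "commutes (f \<otimes>\<^bsub>HG\<^esub> g) c"
  unfolding HG_mult[OF assms(1,2)] commutes_def
proof
  fix x assume x: "x \<in> X"
  show "compose X f g (shift_by c x) = shift_by c (compose X f g x)"
    using x assms HG_D(3)[OF assms(2)] by (simp add: compose_eq commutes_def)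
qed

lemma commutes_inv:
  assumes "f \<in> carrier HG" "commutes f c" shows "commutes (inv\<^bsub>HG\<^esub> f) c"
proof -
  have s: "restrict (shift_by c) X \<in> carrier HG" by (rule shift_in_HG)
  have "f \<otimes>\<^bsub>HG\<^esub> restrict (shift_by c) X = restrict (shift_by c) X \<otimes>\<^bsub>HG\<^esub> f" using commutes_iff[OF assms(1)] assms(2) by blast
  hence "inv\<^bsub>HG\<^esub> f \<otimes>\<^bsub>HG\<^esub> restrict (shift_by c) X = restrict (shift_by c) X \<otimes>\<^bsub>HG\<^esub> inv\<^bsub>HG\<^esub> f"
    using HG.m_assoc HG.inv_closed[OF assms(1)] s assms(1) HG.l_inv HG.r_inv HG.l_one HG.r_one HG.m_closed by (metis (no_types, lifting))
  thus ?thesis using commutes_iff[OF HG.inv_closed[OF assms(1)]] by blast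
qed

lemma subgroup_SG: "subgroup (carrier SG) HG"
proof (rule HG.subgroupI)
  show "carrier SG \<subseteq> carrier HG" using carrier_SG by blast
  have "\<one>\<^bsub>HG\<^esub> \<in> carrier SG" unfolding carrier_SG
    using HG.one_closed one_commutes by blast
  thus "carrier SG \<noteq> {}" by blast
  show "inv\<^bsub>HG\<^esub> f \<in> carrier SG" if "f \<in> carrier SG" for f
    using that HG.inv_closed commutes_inv unfolding carrier_SG by blast
  show "f \<otimes>\<^bsub>HG\<^esub> g \<in> carrier SG" if fg: "f \<in> carrier SG" "g \<in> carrier SG" for f g
  proof -
    obtain m n :: nat where mn: "m \<ge> 1" "commutes f (int m)" "n \<ge> 1" "commutes g (int n)" using fg carrier_SG by blast
    have c: "commutes f (int (m * n))" "commutes g (int (m * n))"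
      using commutes_dvd[OF mn(2)] commutes_dvd[OF mn(4)] by auto
    have "m * n \<ge> 1" using mult_le_mono[OF mn(1,3)] by simp
    thus ?thesis using fg c commutes_compose HG.m_closed unfolding carrier_SG by blast
  qed
qed

lemma group_SG: "group SG"
proof -
  have "group (HG\<lparr>carrier := carrier SG\<rparr>)" using HG.subgroup_imp_group[OF subgroup_SG] .
  moreover have "HG\<lparr>carrier := carrier SG\<rparr> = SG" by (simp add: stabilized_aut_group_def)
  ultimately show ?thesis by simp
qed

lemma centralizer_SG:
  assumes "k \<ge> 1" "j \<ge> 1"
  shows "f \<in> centralizer SG ((\<sigma> [^]\<^bsub>HG\<^esub> (k::nat)) [^]\<^bsub>SG\<^esub> (j::nat)) \<longleftrightarrow> f \<in> carrier HG \<and> commutes f (int (k * j))"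
proof -
  have p: "(\<sigma> [^]\<^bsub>HG\<^esub> k) [^]\<^bsub>SG\<^esub> j = restrict (shift_by (int (k * j))) X"
    unfolding sigma_pow using shift_pow[of SG "int k" j] by simp
  have "k * j \<ge> 1" using mult_le_mono[OF assms] by simp
  hence "f \<in> carrier SG \<and> f \<otimes>\<^bsub>HG\<^esub> restrict (shift_by (int (k * j))) X = restrict (shift_by (int (k * j))) X \<otimes>\<^bsub>HG\<^esub> f
      \<longleftrightarrow> f \<in> carrier HG \<and> commutes f (int (k * j))"
    using commutes_iff[of f "int (k * j)"] carrier_SG[of f] by blast
  thus ?thesis unfolding p centralizer_def mem_Collect_eq SG_simps .
qed

lemma sigma_in_SG: "\<sigma> [^]\<^bsub>HG\<^esub> (k::nat) \<in> carrier SG"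
  unfolding sigma_pow carrier_SG using shift_in_HG
  by (auto intro!: exI[of _ 1] simp: commutes_def add.commute)

text \<open>If a power of the shift were trivial, all points would have a common period
  \<open>p\<close>; but mixing places two different letters at a distance divisible by
  \<open>p\<close>.\<close>

lemma leveled:
  assumes mix: "mixing X" and nt: "\<not> trivial_shift X" and k: "k \<ge> 1"
  shows "leveled_group SG (\<sigma> [^]\<^bsub>HG\<^esub> (k::nat))"
  unfolding leveled_group_def
proof (intro conjI allI impI)
  show "group SG" by (rule group_SG)
  show "\<sigma> [^]\<^bsub>HG\<^esub> k \<in> carrier SG" by (rule sigma_in_SG)
  fix n :: nat assume n: "n \<ge> 1"
  define p where "p = k * n"
  have p: "p \<ge> 1" unfolding p_def using mult_le_mono[OF k n] by simp
  show "(\<sigma> [^]\<^bsub>HG\<^esub> k) [^]\<^bsub>SG\<^esub> n \<noteq> \<one>\<^bsub>SG\<^esub>"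
  proof
    assume "(\<sigma> [^]\<^bsub>HG\<^esub> k) [^]\<^bsub>SG\<^esub> n = \<one>\<^bsub>SG\<^esub>"
    hence e: "restrict (shift_by (int p)) X = (\<lambda>x\<in>X. x)"
      unfolding sigma_pow p_def using shift_pow[of SG "int k" n] HG_one by simp
    have per: "shift_by (int p) x = x" if "x \<in> X" for x using fun_cong[OF e, of x] that by simp
    obtain a b where ab: "a \<noteq> b" "[a] \<in> language X" "[b] \<in> language X" using two_letters[OF nt] by blast
    then obtain m0 where m0: "\<And>m. m \<ge> m0 \<Longrightarrow> \<exists>w. length w = m \<and> [a] @ w @ [b] \<in> language X"
      using mix unfolding mixing_def by blast
    have le: "m0 * 1 \<le> m0 * p" using p by (intro mult_le_mono2)
    \<comment> \<open>This length of \<open>w\<close> puts the letter \<open>b\<close> at position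
      \<open>(m0 + 1) * p\<close>.\<close>
    have "m0 * p + (p - 1) \<ge> m0" using le by linarith
    then obtain w where w: "length w = m0 * p + (p - 1)" "[a] @ w @ [b] \<in> language X" using m0 by blast
    obtain x where x: "x \<in> X" "word_at x 0 (length ([a] @ w @ [b])) = [a] @ w @ [b]" using w(2) in_language_iff[of _ 0] by blast
    have nth: "([a] @ w @ [b]) ! i = x (int i)" if "i < length ([a] @ w @ [b])" for i
      using x(2) nth_word_at[OF that, of x 0] by simp
    have "x 0 = a" using nth[of 0] by simp
    moreover have "x (int (Suc (length w))) = b" using nth[of "Suc (length w)"] by (simp add: nth_append)
    moreover have "int (Suc (length w)) = int (m0 + 1) * int p"
      using w(1) p by (simp add: of_nat_diff algebra_simps)
    moreover have "x (int q * int p) = x 0" for q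
    proof (induction q)
      case (Suc q)
      have "x (int q * int p + int p) = x (int q * int p)"
        using fun_cong[OF per[OF x(1)], of "int q * int p"] by (simp add: shift_by_def)
      thus ?case using Suc by (simp add: algebra_simps)
    qed simp
    ultimately show False using ab(1) by metis
  qed
qed

lemma restrict_periodic_hom:
  assumes p: "p \<ge> 1" and Q: "Q \<subseteq> carrier HG" "\<And>f. f \<in> Q \<Longrightarrow> commutes f (int p)"
  shows "(\<lambda>f. restrict f (periodic p)) \<in> hom (SG\<lparr>carrier := Q\<rparr>) (BijGroup (periodic p))"
proof (rule homI)
  have per: "f x \<in> periodic p" if "f \<in> Q" "x \<in> periodic p" for f x
  proof -
    have x: "x \<in> X" "shift_by (int p) x = x" using that(2) by (auto simp: periodic_def)
    have "shift_by (int p) (f x) = f x" using Q(2)[OF that(1)] x unfolding commutes_def by metis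
    thus ?thesis using HG_D(3)[OF subsetD[OF Q(1) that(1)] x(1)] by (simp add: periodic_def)
  qed
  have bij: "restrict f (periodic p) \<in> Bij (periodic p)" if f: "f \<in> Q" for f
  proof -
    have "inj_on f X" using HG_D(5)[OF subsetD[OF Q(1) f]] by (simp add: bij_betw_def)
    hence "inj_on f (periodic p)" by (rule inj_on_subset) (auto simp: periodic_def)
    moreover have "f ` periodic p \<subseteq> periodic p" using per f by blast
    ultimately have "bij_betw f (periodic p) (periodic p)"
      using endo_inj_surj[OF card_periodic(1)[OF p]] by (simp add: bij_betw_def)
    hence "bij_betw (restrict f (periodic p)) (periodic p) (periodic p)" by (subst bij_betw_cong[of _ _ f]) auto
    thus ?thesis by (simp add: Bij_def)
  qed
  show "restrict f (periodic p) \<in> carrier (BijGroup (periodic p))" if "f \<in> carrier (SG\<lparr>carrier := Q\<rparr>)" for f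
    using that bij by (simp add: BijGroup_def)
  fix f g assume "f \<in> carrier (SG\<lparr>carrier := Q\<rparr>)" "g \<in> carrier (SG\<lparr>carrier := Q\<rparr>)"
  hence fg: "f \<in> Q" "g \<in> Q" by auto
  have "f \<otimes>\<^bsub>SG\<lparr>carrier := Q\<rparr>\<^esub> g = compose X f g" using HG_mult subsetD[OF Q(1) fg(1)] subsetD[OF Q(1) fg(2)] by simp
  moreover have "restrict (compose X f g) (periodic p) = compose (periodic p) (restrict f (periodic p)) (restrict g (periodic p))"
    unfolding compose_def[of "periodic p"]
  proof (rule restrict_ext)
    fix x assume x: "x \<in> periodic p"
    thus "compose X f g x = restrict f (periodic p) (restrict g (periodic p) x)"
      using per[OF fg(2) x] by (simp add: compose_eq periodic_def)
  qed
  ultimately show "restrict (f \<otimes>\<^bsub>SG\<lparr>carrier := Q\<rparr>\<^esub> g) (periodic p) =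
      restrict f (periodic p) \<otimes>\<^bsub>BijGroup (periodic p)\<^esub> restrict g (periodic p)"
    using mult_BijGroup[OF bij[OF fg(1)] bij[OF fg(2)]] by simp
qed

text \<open>With \<open>c\<close> the number of words of length \<open>k * n\<close>, two logarithms
  turn a fixed power of \<open>fact c\<close> into \<open>ln c\<close> plus a term of order
  \<open>ln n\<close>. Division by \<open>n\<close> leaves the growth rate of the words.\<close>

lemma local_entropy_le:
  assumes mix: "mixing X" and k: "k \<ge> 1" and D: "D \<ge> 1" and r: "r \<ge> 1"
    and H: "locally_in_class (PS C D r) SG (\<sigma> [^]\<^bsub>HG\<^esub> (k::nat)) H"
  shows "limsup (\<lambda>n. ereal (ln (ln (real (card (H \<inter> centralizer SG ((\<sigma> [^]\<^bsub>HG\<^esub> k) [^]\<^bsub>SG\<^esub> n))))) / real n))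
    \<le> ereal (real k * growth)"
proof -
  define Q where "Q = (\<lambda>n. H \<inter> centralizer SG ((\<sigma> [^]\<^bsub>HG\<^esub> k) [^]\<^bsub>SG\<^esub> (n::nat)))"
  have Q_iff: "f \<in> Q n \<longleftrightarrow> f \<in> H \<and> f \<in> carrier HG \<and> commutes f (int (k * n))" if "n \<ge> 1" for f n
    unfolding Q_def using centralizer_SG[OF k that] by blast
  have pow1: "(\<sigma> [^]\<^bsub>HG\<^esub> k) [^]\<^bsub>SG\<^esub> (1::nat) = \<sigma> [^]\<^bsub>HG\<^esub> k"
    unfolding sigma_pow using shift_pow[of SG "int k" 1] by simp
  have Hsub: "subgroup H SG" using H by (simp add: locally_in_class_def)
  obtain J where J: "\<And>n. n \<ge> J \<Longrightarrow> PS C D r (SG\<lparr>carrier := Q n\<rparr>)" using H unfolding locally_in_class_def Q_def by blast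
  have "Q 1 \<noteq> {\<one>\<^bsub>SG\<^esub>}" using H unfolding locally_in_class_def Q_def pow1 by blast
  moreover have "\<one>\<^bsub>SG\<^esub> \<in> Q 1"
  proof -
    show ?thesis using one_commutes Q_iff[of 1] subgroup.one_closed[OF Hsub] HG.one_closed by simp
  qed
  ultimately obtain h where h: "h \<in> Q 1" "h \<noteq> \<one>\<^bsub>SG\<^esub>" by blast
  have hc: "h \<in> H" "h \<in> carrier HG" "commutes h (int k)" using Q_iff[of 1 h] h(1) by auto
  have hQ: "h \<in> Q n" if "n \<ge> 1" for n using Q_iff[OF that, of h] hc commutes_dvd[OF hc(3), of "int (k * n)"] by simp
  have "\<exists>x\<in>X. h x \<noteq> x"
  proof (rule ccontr)
    assume "\<not> ?thesis"
    hence "h = (\<lambda>x\<in>X. x)" using HG_D(4)[OF hc(2)] by (intro extensionalityI[of h X]) auto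
    thus False using h(2) HG_one by simp
  qed
  then obtain x where "x \<in> X" "h x \<noteq> x" by blast
  then obtain n1 where n1: "\<And>p. p \<ge> n1 \<Longrightarrow> \<exists>y\<in>periodic p. h y \<noteq> y"
    using moves_periodic_points[OF mix HG_D(2)[OF hc(2)]] by blast
  \<comment> \<open>\<open>B\<close> collects the exponent \<open>D * r\<close> and the bound for
    \<open>ln c\<close> that is linear in \<open>n\<close>; the summand 1 keeps it positive.\<close>
  define B where "B = D * real r * real k * (ln (nwords 1) + 1)"
  have B: "B > 0" unfolding B_def using D r k ln_nwords_nonneg[of 1] by (intro mult_pos_pos) auto
  have bound: "ln (ln (real (card (Q n)))) \<le> ln B + ln (real n) + ln (nwords (k * n + 0))" if n: "n \<ge> J + n1 + 1" for n
  proof -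
    have n': "n \<ge> J" "n \<ge> 1" using n by auto
    define p where "p = k * n"
    have "1 * n \<le> k * n" using k by (intro mult_le_mono1)
    hence p: "p \<ge> n1" "p \<ge> 1" using n unfolding p_def by linarith+
    define c where "c = card (words p)"
    have c1: "real c \<ge> 1" unfolding c_def by (rule nwords_ge_1)
    have QHG: "Q n \<subseteq> carrier HG" "\<And>f. f \<in> Q n \<Longrightarrow> commutes f (int p)" using Q_iff[OF n'(2)] by (auto simp: p_def)
    obtain y where y: "y \<in> periodic p" "h y \<noteq> y" using n1[OF p(1)] by blast
    have ntr: "restrict h (periodic p) \<noteq> \<one>\<^bsub>BijGroup (periodic p)\<^esub>"
    proof
      assume "restrict h (periodic p) = \<one>\<^bsub>BijGroup (periodic p)\<^esub>"
      hence "restrict h (periodic p) y = y" using y(1) by (simp add: BijGroup_def)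
      thus False using y by simp
    qed
    have "real (card (carrier (SG\<lparr>carrier := Q n\<rparr>))) \<le> real (fact (card (periodic p))) powr (D * real r)"
      by (rule PS_card_le[OF J[OF n'(1)] D restrict_periodic_hom[OF p(2) QHG] card_periodic(1)[OF p(2)], of h])
        (use hQ[OF n'(2)] ntr in auto)
    hence cQ: "real (card (Q n)) \<le> real (fact (card (periodic p))) powr (D * real r)" by simp
    have "fact (card (periodic p)) \<le> (fact c :: nat)" unfolding c_def by (rule fact_mono[OF card_periodic(2)[OF p(2)]])
    also have "\<dots> \<le> c ^ c" using fact_le_power[of c, where 'a = nat] by simp
    finally have fc: "real (fact (card (periodic p))) \<le> real c ^ c" by (metis of_nat_le_iff of_nat_power)
    have "real (card (Q n)) \<le> (real c ^ c) powr (D * real r)"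
      using order_trans[OF cQ powr_mono2[OF _ _ fc]] D by simp
    also have "\<dots> = real c powr (real c * (D * real r))" using c1 by (simp add: powr_powr flip: powr_realpow)
    finally have "ln (real (card (Q n))) \<le> ln (real c powr (real c * (D * real r)))" if "card (Q n) > 0"
      using that c1 by (subst ln_le_cancel_iff) auto
    moreover have finQ: "finite (Q n)" using H n'(2) unfolding locally_in_class_def Q_def by blast
    have oneQ: "\<one>\<^bsub>SG\<^esub> \<in> Q n"
    proof -
      show ?thesis using one_commutes Q_iff[OF n'(2)] subgroup.one_closed[OF Hsub] HG.one_closed by simp
    qed
    \<comment> \<open>Two elements make the inner logarithm positive, as the monotonicity of the
      outer one requires.\<close>
    have "card {\<one>\<^bsub>SG\<^esub>, h} \<le> card (Q n)" using oneQ hQ[OF n'(2)] finQ by (intro card_mono) auto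
    hence c2: "card (Q n) \<ge> 2" using h(2) by simp
    ultimately have "ln (real (card (Q n))) \<le> real c * (D * real r) * ln (real c)" using c1 by (simp add: ln_powr)
    also have "\<dots> \<le> real c * (D * real r) * (real p * (ln (nwords 1) + 1))"
    proof (rule mult_left_mono)
      have "card (words (p * 1)) \<le> card (words 1) ^ p" by (rule card_words_mult)
      hence "real c \<le> nwords 1 ^ p" unfolding c_def by (metis mult.right_neutral of_nat_le_iff of_nat_power)
      hence "ln (real c) \<le> ln (nwords 1 ^ p)" using c1 nwords_ge_1[of 1] by (subst ln_le_cancel_iff) auto
      also have "\<dots> = real p * ln (nwords 1)" using nwords_ge_1[of 1] by (subst ln_realpow) auto
      finally show "ln (real c) \<le> real p * (ln (nwords 1) + 1)" by (simp add: algebra_simps)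
    qed (use D in simp)
    also have "\<dots> = B * real n * real c" by (simp add: B_def p_def algebra_simps)
    finally have le: "ln (real (card (Q n))) \<le> B * real n * real c" .
    have "ln (real (card (Q n))) > 0" using c2 by (intro ln_gt_zero) auto
    hence "ln (ln (real (card (Q n)))) \<le> ln (B * real n * real c)" using le by (subst ln_le_cancel_iff) auto
    also have "\<dots> = ln B + ln (real n) + ln (real c)" using B n'(2) c1 by (simp add: ln_mult)
    finally show ?thesis by (simp add: c_def p_def)
  qed
  have lim: "(\<lambda>n. (ln B + ln (real n) + ln (nwords (k * n + 0))) / real n) \<longlonglongrightarrow> real k * growth"
  proof -
    have "(\<lambda>n. ln B / real n) \<longlonglongrightarrow> 0" by (rule lim_const_over_n)
    moreover have "(\<lambda>n. ln (real n) / real n) \<longlonglongrightarrow> 0" by (rule lim_ln_over_n)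
    ultimately have "(\<lambda>n. ln B / real n + ln (real n) / real n + ln (nwords (k * n + 0)) / real n) \<longlonglongrightarrow> 0 + 0 + real k * growth"
      using growth_tendsto_mult[OF k, of 0] by (intro tendsto_add)
    thus ?thesis by (simp add: add_divide_distrib)
  qed
  have "limsup (\<lambda>n. ereal (ln (ln (real (card (Q n)))) / real n)) \<le>
      limsup (\<lambda>n. ereal ((ln B + ln (real n) + ln (nwords (k * n + 0))) / real n))"
  proof (rule Limsup_mono, rule eventually_sequentiallyI[of "J + n1 + 1"])
    fix n assume "J + n1 + 1 \<le> n"
    from bound[OF this] show "ereal (ln (ln (real (card (Q n)))) / real n) \<le>
        ereal ((ln B + ln (real n) + ln (nwords (k * n + 0))) / real n)" by (simp add: divide_right_mono)
  qed
  also have "\<dots> = ereal (real k * growth)" using lim by (intro lim_imp_Limsup) auto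
  finally show ?thesis by (simp only: Q_def)
qed

end

section \<open>Transport of block permutations to the subshift\<close>

locale coded = window_coding A X M a l for A :: "'a set" and X M a l +
  fixes E0 and e1 e2
  assumes graph: "parallel_graph EE esrc etgt E0 e1 e2"
begin

sublocale pg: parallel_graph EE esrc etgt E0 e1 e2 by (rule graph)

interpretation HG: group HG by (rule group_homeo_group)

definition lift_map :: "((int \<Rightarrow> 'a edge) \<Rightarrow> int \<Rightarrow> 'a edge) \<Rightarrow> (int \<Rightarrow> 'a) \<Rightarrow> int \<Rightarrow> 'a" where
  "lift_map F = restrict (\<lambda>x. dec (F (enc x))) X"

lemma lift_map_restrict: "lift_map (restrict F Y) = lift_map F"
  unfolding lift_map_def by (rule restrict_ext) (simp add: enc_in)

lemma block_act_in: "n > 0 \<Longrightarrow> eg.end_perm n g \<Longrightarrow> x \<in> X \<Longrightarrow> block_act n g (enc x) \<in> Y"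
  using eg.block_act_in_edge_shift enc_in by blast

lemma enc_lift_map:
  assumes "n > 0" "eg.end_perm n g" "x \<in> X"
  shows "lift_map (block_act n g) x \<in> X" "enc (lift_map (block_act n g) x) = block_act n g (enc x)"
  using block_act_in[OF assms] assms(3) dec_in enc_dec by (auto simp: lift_map_def)

lemma local_lift_map:
  assumes n: "n > 0" and g: "eg.end_perm n g"
  shows "local_map (\<lambda>x. dec (block_act n g (enc x)))"
  unfolding local_map_def
proof
  fix i
  \<comment> \<open>Decoding at \<open>i\<close> looks back by \<open>l\<close>, the action mixes
    the entries of a block of length \<open>n\<close>, and encoding an entry reads \<open>l\<close>
    letters to the left and less than \<open>l + R\<close> to the right.\<close>
  define m where "m = nat \<bar>i\<bar> + 2 * l + n + R"
  have "dec (block_act n g (enc x)) i = dec (block_act n g (enc x')) i"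
    if x: "x \<in> X" "x' \<in> X" "\<And>j. \<bar>j\<bar> \<le> int m \<Longrightarrow> x j = x' j" for x x'
  proof (rule dec_local[OF block_act_in[OF n g x(1)] block_act_in[OF n g x(2)]])
    fix t assume t: "i - int l \<le> t" "t \<le> i"
    define q where "q = t div int n"
    have q: "q * int n \<le> t" "t < q * int n + int n"
    proof -
      have e: "t = q * int n + t mod int n" by (simp add: q_def)
      have "0 \<le> t mod int n" "t mod int n < int n" using n by auto
      thus "q * int n \<le> t" "t < q * int n + int n" using e by linarith+
    qed
    have "code x s = code x' s" if s: "q * int n \<le> s" "s < q * int n + int n" for s
    proof (rule code_local)
      fix k assume k: "s - int l \<le> k" "k < s + int (l + R)"
      have "int m = \<bar>i\<bar> + 2 * int l + int n + int R" "int (l + R) = int l + int R" by (simp_all add: m_def)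
      hence "\<bar>k\<bar> \<le> int m" using k s q t by linarith
      thus "x k = x' k" by (rule x(3))
    qed
    hence "block n (enc x) q = block n (enc x') q" by (simp add: block_def enc_def)
    thus "block_act n g (enc x) t = block_act n g (enc x') t" by (simp add: block_act_def q_def)
  qed
  thus "\<exists>m::nat. \<forall>x\<in>X. \<forall>y\<in>X. (\<forall>j. \<bar>j\<bar> \<le> int m \<longrightarrow> x j = y j) \<longrightarrow>
      dec (block_act n g (enc x)) i = dec (block_act n g (enc y)) i" by blast
qed

lemma lift_map_in_HG:
  assumes n: "n > 0" and g: "eg.end_perm n g" shows "lift_map (block_act n g) \<in> carrier HG"
  unfolding lift_map_def
proof (rule HG_I[OF local_lift_map[OF n g] local_lift_map[OF n eg.end_perm_inv[OF g]]])
  fix x assume x: "x \<in> X"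
  note gi = eg.end_perm_inv[OF g]
  show "dec (block_act n g (enc x)) \<in> X" "dec (block_act n (finv g) (enc x)) \<in> X"
    using block_act_in[OF n g x] block_act_in[OF n gi x] dec_in by auto
  show "dec (block_act n (finv g) (enc (dec (block_act n g (enc x))))) = x"
    "dec (block_act n g (enc (dec (block_act n (finv g) (enc x))))) = x"
    using enc_dec block_act_in[OF n g x] block_act_in[OF n gi x] eg.block_act_inv[OF n g enc_in[OF x]] dec_enc by auto
qed

lemma lift_map_mult:
  assumes "n > 0" "eg.end_perm n g" "eg.end_perm n h"
  shows "lift_map (block_act n (g \<circ> h)) = lift_map (block_act n g) \<otimes>\<^bsub>HG\<^esub> lift_map (block_act n h)"
proof -
  have "lift_map (block_act n g) \<otimes>\<^bsub>HG\<^esub> lift_map (block_act n h) = compose X (lift_map (block_act n g)) (lift_map (block_act n h))"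
    using HG_mult lift_map_in_HG assms by blast
  also have "\<dots> = lift_map (block_act n (g \<circ> h))"
    unfolding lift_map_def[of "block_act n (g \<circ> h)"] compose_def
  proof (rule restrict_ext)
    fix x assume x: "x \<in> X"
    note hx = enc_lift_map[OF assms(1,3) x]
    show "lift_map (block_act n g) (lift_map (block_act n h) x) = dec (block_act n (g \<circ> h) (enc x))"
      using eg.block_act_comp[OF assms enc_in[OF x]] hx by (simp add: lift_map_def[of "block_act n g"])
  qed
  finally show ?thesis ..
qed

lemma commutes_lift_map:
  assumes n: "n > 0" and g: "eg.end_perm n g" and c: "int n dvd c"
  shows "commutes (lift_map (block_act n g)) c"
  unfolding commutes_def
proof
  fix x assume x: "x \<in> X"
  obtain d where d: "c = d * int n" using c by (metis dvd_def mult.commute)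
  have "dec (block_act n g (enc (shift_by c x))) = shift_by c (dec (block_act n g (enc x)))"
    unfolding enc_shift_by d using eg.block_act_shift_by[OF n g enc_in[OF x], of d] dec_shift_by by simp
  thus "lift_map (block_act n g) (shift_by c x) = shift_by c (lift_map (block_act n g) x)"
    using x by (simp add: lift_map_def)
qed

lemma lift_map_commutes_imp:
  assumes n: "n > 0" and g: "eg.end_perm n g" and c: "commutes (lift_map (block_act n g)) c" and y: "y \<in> Y"
  shows "block_act n g (shift_by c y) = shift_by c (block_act n g y)"
proof -
  have x: "dec y \<in> X" "enc (dec y) = y" using dec_in enc_dec y by auto
  have sx: "shift_by c (dec y) \<in> X" using x(1) by simp
  have "enc (lift_map (block_act n g) (shift_by c (dec y))) = enc (shift_by c (lift_map (block_act n g) (dec y)))"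
    using c x(1) by (simp add: commutes_def)
  thus ?thesis
    unfolding enc_lift_map(2)[OF n g sx] enc_shift_by enc_lift_map(2)[OF n g x(1)] x(2) .
qed

lemma lift_map_inject:
  assumes n: "n > 0" and g: "eg.end_perm n g" "eg.end_perm n h"
    and e: "lift_map (block_act n g) = lift_map (block_act n h)"
  shows "g = h"
proof (rule eg.block_act_inject[OF n g])
  fix y assume y: "y \<in> Y"
  have x: "dec y \<in> X" "enc (dec y) = y" using dec_in enc_dec y by auto
  show "block_act n g y = block_act n h y"
    using enc_lift_map(2)[OF n g(1) x(1)] enc_lift_map(2)[OF n g(2) x(1)] e x(2) by simp
qed

definition level_maps :: "nat \<Rightarrow> ('a edge list \<Rightarrow> 'a edge list) \<Rightarrow> ('a state \<times> 'a state \<Rightarrow> 'a edge list set)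
    \<Rightarrow> ((int \<Rightarrow> 'a) \<Rightarrow> int \<Rightarrow> 'a) set" where
  "level_maps n f T = (\<lambda>g. lift_map (block_act n g)) ` pg.level_group n f T"

lemma level_maps_alt: "level_maps n f T = lift_map ` pg.level_acts n f T"
  unfolding level_maps_def pg.level_acts_def image_image lift_map_restrict ..

lemma level_mapsE:
  assumes "pg.level n f d T" "F \<in> level_maps n f T"
  obtains g where "g \<in> pg.level_group n f T" "F = lift_map (block_act n g)" "eg.end_perm n g" "n > 0"
  using assms pg.level_group_facts(1)[OF assms(1)] by (auto simp: level_maps_def pg.level_def)

lemma level_maps_iso:
  assumes lev: "pg.level n f d T"
  shows "\<exists>\<phi>. \<phi> \<in> iso (SG\<lparr>carrier := level_maps n f T\<rparr>) (product_group (pg.V \<times> pg.V) (\<lambda>i. alt_on (T i)))"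
    and "subgroup (level_maps n f T) HG" and "card (level_maps n f T) = card (pg.level_group n f T)"
    and "finite (level_maps n f T)"
proof -
  interpret pp: paired_partition "pg.moved n" f d "pg.V \<times> pg.V" T using lev by (simp add: pg.level_def)
  have n: "n > 0" using lev by (simp add: pg.level_def)
  have G: "pg.level_group n f T = pp.paired_alt" by (simp add: pg.level_group_def)
  have ep: "eg.end_perm n g" if "g \<in> pg.level_group n f T" for g using pg.level_group_facts(1)[OF lev that] .
  have inj: "inj_on (\<lambda>g. lift_map (block_act n g)) (pg.level_group n f T)"
    using lift_map_inject[OF n ep ep] by (auto simp: inj_on_def)
  show card: "card (level_maps n f T) = card (pg.level_group n f T)" unfolding level_maps_def using inj by (rule card_image)
  show "finite (level_maps n f T)" unfolding level_maps_def using pg.level_group_closed(4)[OF lev] by simp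
  have sub: "level_maps n f T \<subseteq> carrier HG" using lift_map_in_HG[OF n ep] by (auto simp: level_maps_def simp del: homeo_group_simps)
  have hom: "(\<lambda>g. lift_map (block_act n g)) \<in> iso pp.paired_group (SG\<lparr>carrier := level_maps n f T\<rparr>)"
  proof (rule isoI)
    show "(\<lambda>g. lift_map (block_act n g)) \<in> hom pp.paired_group (SG\<lparr>carrier := level_maps n f T\<rparr>)"
    proof (rule homI)
      show "lift_map (block_act n g) \<in> carrier (SG\<lparr>carrier := level_maps n f T\<rparr>)" if "g \<in> carrier pp.paired_group" for g
        using that by (auto simp: level_maps_def pp.paired_group_def G)
      fix g h assume "g \<in> carrier pp.paired_group" "h \<in> carrier pp.paired_group"
      hence gh: "g \<in> pg.level_group n f T" "h \<in> pg.level_group n f T" by (simp_all add: pp.paired_group_def G)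
      show "lift_map (block_act n (g \<otimes>\<^bsub>pp.paired_group\<^esub> h)) =
          lift_map (block_act n g) \<otimes>\<^bsub>SG\<lparr>carrier := level_maps n f T\<rparr>\<^esub> lift_map (block_act n h)"
        using lift_map_mult[OF n ep[OF gh(1)] ep[OF gh(2)]] by (simp add: pp.paired_group_def)
    qed
    show "bij_betw (\<lambda>g. lift_map (block_act n g)) (carrier pp.paired_group) (carrier (SG\<lparr>carrier := level_maps n f T\<rparr>))"
      using inj by (simp add: bij_betw_def level_maps_def pp.paired_group_def G)
  qed
  have gp: "group pp.paired_group"
  proof (rule groupI)
    fix g assume g: "g \<in> carrier pp.paired_group"
    hence gp: "g \<in> pp.paired_alt" by (simp add: pp.paired_group_def)
    have "finv g \<circ> g = id" using permutes_inv_o(2)[OF pp.paired_altD(1)[OF gp]] .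
    thus "\<exists>y\<in>carrier pp.paired_group. y \<otimes>\<^bsub>pp.paired_group\<^esub> g = \<one>\<^bsub>pp.paired_group\<^esub>"
      using pp.paired_alt_inv[OF gp] by (auto simp: pp.paired_group_def)
  qed (auto simp: pp.paired_group_def comp_assoc simp del: id_apply intro: pp.paired_alt_comp pp.paired_alt_id)
  interpret PG: group pp.paired_group by (rule gp)
  have "inv_into (carrier pp.paired_group) (\<lambda>g. lift_map (block_act n g)) \<in> iso (SG\<lparr>carrier := level_maps n f T\<rparr>) pp.paired_group"
    using PG.iso_set_sym[OF hom] .
  thus "\<exists>\<phi>. \<phi> \<in> iso (SG\<lparr>carrier := level_maps n f T\<rparr>) (product_group (pg.V \<times> pg.V) (\<lambda>i. alt_on (T i)))"
    using iso_set_trans pp.paired_group_iso by blast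
  show "subgroup (level_maps n f T) HG"
  proof (rule HG.subgroupI)
    show "level_maps n f T \<noteq> {}" using pg.level_group_closed(1)[OF lev] by (auto simp: level_maps_def)
    show "F \<otimes>\<^bsub>HG\<^esub> F' \<in> level_maps n f T" if FF: "F \<in> level_maps n f T" "F' \<in> level_maps n f T" for F F'
    proof -
      obtain g h where gh: "g \<in> pg.level_group n f T" "h \<in> pg.level_group n f T"
        "F = lift_map (block_act n g)" "F' = lift_map (block_act n h)" using FF unfolding level_maps_def by blast
      hence "F \<otimes>\<^bsub>HG\<^esub> F' = lift_map (block_act n (g \<circ> h))" using lift_map_mult[OF n ep ep] by simp
      thus ?thesis using pg.level_group_closed(2)[OF lev gh(1,2)] unfolding level_maps_def by blast
    qed
    show "inv\<^bsub>HG\<^esub> F \<in> level_maps n f T" if F: "F \<in> level_maps n f T" for F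
    proof -
      obtain g where g: "g \<in> pg.level_group n f T" "F = lift_map (block_act n g)" using F unfolding level_maps_def by blast
      note gi = pg.level_group_closed(3)[OF lev g(1)]
      have "finv g \<circ> g = id" using permutes_inv_o(2)[of g "eg.paths n"] ep[OF g(1)] by (simp add: eg.end_perm_def)
      hence "lift_map (block_act n (finv g)) \<otimes>\<^bsub>HG\<^esub> F = lift_map (block_act n id)"
        unfolding g(2) using lift_map_mult[OF n ep[OF gi] ep[OF g(1)]] by simp
      also have "lift_map (block_act n id) = \<one>\<^bsub>HG\<^esub>"
        unfolding HG_one lift_map_def by (rule restrict_ext) (simp only: eg.block_act_id[OF n enc_in] dec_enc)
      finally have "inv\<^bsub>HG\<^esub> F = lift_map (block_act n (finv g))"
        using HG.inv_equality[OF _ subsetD[OF sub F] lift_map_in_HG[OF n ep[OF gi]]] by blast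
      thus ?thesis using gi unfolding level_maps_def by blast
    qed
  qed (rule sub)
qed

text \<open>The exponent of \<open>card_alt_perms_compare\<close> for classes whose sizes differ at
  most by the factor \<open>class_ratio\<close>.\<close>

definition exponent :: nat where
  "exponent = 2 * (pg.class_ratio * (pg.class_ratio + 1))"

lemma exponent_ge_1: "exponent \<ge> 1"
proof -
  have "pg.class_ratio \<ge> 1" unfolding pg.class_ratio_def by (simp only: one_le_power add_leD2 le_add2)
  hence "1 * (0 + 1) \<le> pg.class_ratio * (pg.class_ratio + 1)" by (intro mult_le_mono add_le_mono) auto
  thus ?thesis by (simp add: exponent_def)
qed

lemma PS_level_maps:
  assumes lev: "pg.level n f d T"
    and ratio: "\<And>i j. i \<in> pg.V \<times> pg.V \<Longrightarrow> j \<in> pg.V \<times> pg.V \<Longrightarrow> card (T j) \<le> pg.class_ratio * card (T i)"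
  shows "PS (1 / real exponent) (real exponent) ((card pg.V)\<^sup>2) (SG\<lparr>carrier := level_maps n f T\<rparr>)"
proof -
  interpret pp: paired_partition "pg.moved n" f d "pg.V \<times> pg.V" T using lev by (simp add: pg.level_def)
  have T8: "8 \<le> card (T i)" if "i \<in> pg.V \<times> pg.V" for i using lev that unfolding pg.level_def by blast
  obtain \<phi> where \<phi>: "\<phi> \<in> iso (SG\<lparr>carrier := level_maps n f T\<rparr>) (product_group (pg.V \<times> pg.V) (\<lambda>i. alt_on (T i)))"
    using level_maps_iso(1)[OF lev] by blast
  show ?thesis
  proof (rule PS_I[OF _ _ _ \<phi> _ exponent_ge_1])
    have "group (HG\<lparr>carrier := level_maps n f T\<rparr>)" using HG.subgroup_imp_group[OF level_maps_iso(2)[OF lev]] .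
    thus "group (SG\<lparr>carrier := level_maps n f T\<rparr>)" by (simp add: stabilized_aut_group_def)
    show "finite (pg.V \<times> pg.V)" using pg.finite_V by simp
    show "card (pg.V \<times> pg.V) = (card pg.V)\<^sup>2" by (simp add: card_cartesian_product power2_eq_square)
    show "simple_group (alt_on (T i)) \<and> finite (carrier (alt_on (T i))) \<and> \<not> comm_group (alt_on (T i))"
      if "i \<in> pg.V \<times> pg.V" for i
      using simple_alt_on[OF pp.finite_T[OF that] T8[OF that]] not_comm_alt_on[OF pp.finite_T[OF that] T8[OF that]]
        finite_alt_perms[OF pp.finite_T[OF that]] by simp
    show "order (alt_on (T j)) \<le> order (alt_on (T i)) ^ exponent" if "i \<in> pg.V \<times> pg.V" "j \<in> pg.V \<times> pg.V" for i j
      unfolding order_def exponent_def alt_on_simps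
      using card_alt_perms_compare[OF pp.finite_T[OF that(1)] pp.finite_T[OF that(2)] T8[OF that(1)] ratio[OF that]] .
  qed
qed

text \<open>The word is decoded from its own \<open>m\<close> edges and the \<open>l\<close> edges
  before it, as a window edge refers back to the edge that opened the window.\<close>

lemma card_words_le_paths: "card (words m) \<le> card (eg.paths (m + l))"
proof (rule card_le_if_inj_on_rel[where r = "\<lambda>w p. \<exists>x\<in>X. w = word_at x 0 m \<and> p = map (\<lambda>i. code x (int i - int l)) [0..<m + l]"])
  show "finite (eg.paths (m + l))" by simp
  fix w assume "w \<in> words m"
  then obtain x where x: "x \<in> X" "w = word_at x 0 m" by (auto simp: words_alt)
  have "block (m + l) (enc (shift_by (- int l) x)) 0 \<in> eg.paths (m + l)"
    using eg.block_in_paths[OF enc_in] x(1) by simp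
  moreover have "block (m + l) (enc (shift_by (- int l) x)) 0 = map (\<lambda>i. code x (int i - int l)) [0..<m + l]"
    by (simp add: block_def enc_def code_shift_by)
  ultimately show "\<exists>p. p \<in> eg.paths (m + l) \<and> (\<exists>x\<in>X. w = word_at x 0 m \<and> p = map (\<lambda>i. code x (int i - int l)) [0..<m + l])"
    using x by metis
next
  fix w w' p
  assume "w \<in> words m" "w' \<in> words m" "p \<in> eg.paths (m + l)"
    and r: "\<exists>x\<in>X. w = word_at x 0 m \<and> p = map (\<lambda>i. code x (int i - int l)) [0..<m + l]"
      "\<exists>x\<in>X. w' = word_at x 0 m \<and> p = map (\<lambda>i. code x (int i - int l)) [0..<m + l]"
  obtain x x' where x: "x \<in> X" "w = word_at x 0 m" "p = map (\<lambda>i. code x (int i - int l)) [0..<m + l]"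
    and x': "x' \<in> X" "w' = word_at x' 0 m" "p = map (\<lambda>i. code x' (int i - int l)) [0..<m + l]" using r by blast
  have code: "code x k = code x' k" if "- int l \<le> k" "k < int m" for k
  proof -
    define i where "i = nat (k + int l)"
    have i: "i < m + l" "k = int i - int l" using that by (auto simp: i_def)
    have "p ! i = code x k" "p ! i = code x' k" using i unfolding x(3) by simp (use i x'(3) x(3) in \<open>simp\<close>)
    thus ?thesis by simp
  qed
  have "x (0 + int j) = x' (0 + int j)" if "j < m" for j
  proof -
    have "dec (enc x) (int j) = dec (enc x') (int j)"
      by (rule dec_local[OF enc_in[OF x(1)] enc_in[OF x'(1)]]) (use code that in \<open>simp add: enc_def\<close>)
    thus ?thesis by (simp add: dec_enc)
  qed
  thus "w = w'" unfolding x(2) x'(2) word_at_eq_iff by blast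
qed

end

lemma two_power_le_fact: "2 ^ q \<le> 2 * (fact q :: nat)"
proof (induction q)
  case (Suc q)
  show ?case
  proof (cases "q = 0")
    case False
    hence "2 * fact q \<le> Suc q * (fact q :: nat)" by (intro mult_le_mono1) simp
    thus ?thesis using Suc unfolding fact_Suc power_Suc of_nat_id by linarith
  qed simp
qed simp

text \<open>The bound \<open>2 ^ q \<le> 2 * fact q\<close> is enough, since only a linear lower
  bound for \<open>ln G\<close> is wanted; \<open>10 \<le> p\<close> is what makes
  \<open>p / 8\<close> such a bound.\<close>

lemma ln_ln_ge:
  assumes "fact (p div 2) \<le> 2 * G" "10 \<le> p"
  shows "ln (real p) - ln 8 \<le> ln (ln (real (G::nat)))"
proof -
  define q where "q = p div 2"
  have "2 ^ q \<le> 4 * G" using two_power_le_fact[of q] assms(1) by (simp add: q_def)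
  hence le: "2 ^ q \<le> 4 * real G" by (metis of_nat_le_iff of_nat_mult of_nat_numeral of_nat_power)
  have G: "G > 0" using \<open>2 ^ q \<le> 4 * G\<close> by (cases "G = 0") auto
  have "real q * ln 2 = ln (2 ^ q)" by (simp add: ln_realpow)
  also have "\<dots> \<le> ln (4 * real G)" using le G by (subst ln_le_cancel_iff) auto
  also have "\<dots> = 2 * ln 2 + ln (real G)" using G ln_realpow[of 2 2] by (simp add: ln_mult)
  finally have "(real q - 2) * ln 2 \<le> ln (real G)" by (simp add: algebra_simps)
  moreover have q: "real p \<le> 2 * real q + 1" and p: "10 \<le> real p" unfolding q_def using assms(2) by linarith+
  moreover have "(real q - 2) * (1 / 2) \<le> (real q - 2) * ln 2"
    using q p ln2_ge_two_thirds by (intro mult_left_mono) auto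
  ultimately have "real p / 8 \<le> ln (real G)" by argo
  hence "ln (real p / 8) \<le> ln (ln (real G))" using assms(2) by (subst ln_le_cancel_iff) auto
  thus ?thesis using assms(2) by (simp add: ln_div)
qed

section \<open>The union of the tower and its local entropy\<close>

context coded
begin

interpretation HG: group HG by (rule group_homeo_group)

text \<open>This covers both kinds of levels: the lowest, whose classes have eight elements each,
  and the others, whose classes are given by the end vertices.\<close>

definition balanced_level where
  "balanced_level n f d T \<longleftrightarrow> pg.level n f d T \<and>
    (\<forall>i\<in>pg.V \<times> pg.V. \<forall>j\<in>pg.V \<times> pg.V. card (T j) \<le> pg.class_ratio * card (T i))"

lemma level_maps_D:
  assumes "pg.level n f d T" "F \<in> level_maps n f T"
  shows "F \<in> carrier HG" "int n dvd c \<Longrightarrow> commutes F c"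
proof -
  obtain g where g: "g \<in> pg.level_group n f T" "F = lift_map (block_act n g)" "eg.end_perm n g" "n > 0"
    using level_mapsE[OF assms] .
  show "F \<in> carrier HG" using lift_map_in_HG[OF g(4,3)] g(2) by blast
  show "commutes F c" if "int n dvd c" using commutes_lift_map[OF g(4,3) that] g(2) by blast
qed

lemma card_level_maps_gt_1:
  assumes lev: "pg.level n f d T" shows "1 < card (level_maps n f T)"
proof -
  interpret pp: paired_partition "pg.moved n" f d "pg.V \<times> pg.V" T using lev by (simp add: pg.level_def)
  obtain u where u: "u \<in> pg.V" using pg.V_ne by blast
  hence uu: "(u, u) \<in> pg.V \<times> pg.V" by simp
  have "8 \<le> card (T (u, u))" using lev uu unfolding pg.level_def by blast
  hence "fact 8 \<le> (fact (card (T (u, u))) :: nat)" by (rule fact_mono)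
  hence "fact 8 \<le> 2 * card (alt_perms (T (u, u)))"
    using fact_le_card_alt_perms[OF pp.finite_T[OF uu]] by linarith
  moreover have "card (alt_perms (T (u, u))) \<le> card (pg.level_group n f T)"
    unfolding pg.level_group_def using pp.card_paired_alt_ge[OF uu] .
  ultimately show ?thesis unfolding level_maps_iso(3)[OF lev] by (simp add: fact_numeral)
qed

text \<open>\<open>F\<close> commutes with the shifts by \<open>n\<close> and by
  \<open>k * j\<close>, hence with the shift by their greatest common divisor
  \<open>k * 3 ^ w\<close>. As \<open>n\<close> does not divide \<open>k * j\<close>,
  \<open>w \<le> u\<close>, so \<open>F\<close> commutes with the shift by \<open>k * 3 ^ u\<close>,
  where rigidity applies.\<close>

lemma level_maps_descend:
  assumes lev: "pg.level n f d T" and F: "F \<in> level_maps n f T"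
    and n: "n = k * 3 ^ Suc u" and j: "\<not> n dvd k * j" and c: "commutes F (int (k * j))"
    and step: "\<And>F. F \<in> pg.level_acts n f T \<Longrightarrow>
      (\<And>y. y \<in> Y \<Longrightarrow> F (shift_by (int (k * 3 ^ u)) y) = shift_by (int (k * 3 ^ u)) (F y)) \<Longrightarrow>
      F \<in> pg.level_acts n' f' T'"
  shows "F \<in> level_maps n' f' T'"
proof -
  obtain g where g: "g \<in> pg.level_group n f T" "F = lift_map (block_act n g)" "eg.end_perm n g" "n > 0"
    using level_mapsE[OF lev F] .
  have p3: "prime (3::nat)" by simp
  have "gcd (3 ^ Suc u) j dvd (3::nat) ^ Suc u" by simp
  then obtain w where w: "w \<le> Suc u" "gcd (3 ^ Suc u) j = 3 ^ w" using divides_primepow_nat[OF p3] by blast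
  have "w \<noteq> Suc u"
  proof
    assume "w = Suc u"
    hence "3 ^ Suc u dvd j" using w(2) gcd_dvd2[of "3 ^ Suc u" j] by metis
    hence "n dvd k * j" unfolding n by (intro mult_dvd_mono) auto
    thus False using j by blast
  qed
  hence "w \<le> u" using w(1) by simp
  hence d: "k * 3 ^ w dvd k * 3 ^ u" by (intro mult_dvd_mono le_imp_power_dvd) auto
  have "gcd n (k * j) = k * 3 ^ w" unfolding n w(2)[symmetric] by (rule gcd_mult_distrib_nat[symmetric])
  hence "gcd (int n) (int (k * j)) = int (k * 3 ^ w)" by (metis gcd_int_int_eq)
  moreover have "commutes F (gcd (int n) (int (k * j)))"
    using commutes_gcd[OF level_maps_D(2)[OF lev F dvd_refl] c] .
  ultimately have cF: "commutes F (int (k * 3 ^ u))" using commutes_dvd d by (metis of_nat_dvd_iff)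
  have "restrict (block_act n g) Y \<in> pg.level_acts n' f' T'"
  proof (rule step)
    show "restrict (block_act n g) Y \<in> pg.level_acts n f T" using g(1) unfolding pg.level_acts_def by blast
    fix y assume y: "y \<in> Y"
    have "block_act n g (shift_by (int (k * 3 ^ u)) y) = shift_by (int (k * 3 ^ u)) (block_act n g y)"
      using lift_map_commutes_imp[OF g(4,3) cF[unfolded g(2)] y] .
    thus "restrict (block_act n g) Y (shift_by (int (k * 3 ^ u)) y) = shift_by (int (k * 3 ^ u)) (restrict (block_act n g) Y y)"
      using y eg.shift_by_edge_shift[OF y] by simp
  qed
  hence "lift_map (restrict (block_act n g) Y) \<in> level_maps n' f' T'" unfolding level_maps_alt by blast
  thus ?thesis unfolding lift_map_restrict g(2) .
qed

text \<open>The level that equals the intersection is the highest one whose length divides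
  \<open>k * j\<close>. The sequence \<open>r\<close> lists the exponents at which the levels above
  the lowest appear, which is all that a limit superior asks for.\<close>

lemma level_tower:
  assumes b: "bij_betw b ((pg.V \<times> pg.V) \<times> {..<8::nat} \<times> (UNIV :: bool set)) E0" and k: "k \<ge> 1"
  shows "\<exists>H. subgroup H SG \<and>
    (\<forall>j\<ge>1. \<exists>n f d T. balanced_level n f d T \<and>
       H \<inter> centralizer SG ((\<sigma> [^]\<^bsub>HG\<^esub> (k::nat)) [^]\<^bsub>SG\<^esub> (j::nat)) = level_maps n f T) \<and>
    (\<exists>r :: nat \<Rightarrow> nat. strict_mono r \<and> (\<forall>i. r i \<ge> 1 \<and> (\<exists>f d. pg.level (k * r i) f d (pg.end_classes (k * r i) d) \<and>
       level_maps (k * r i) f (pg.end_classes (k * r i) d) \<subseteq>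
         H \<inter> centralizer SG ((\<sigma> [^]\<^bsub>HG\<^esub> k) [^]\<^bsub>SG\<^esub> (r i)))))"
proof -
  have k0: "k > 0" using k by simp
  obtain f0 d0 T0 where base: "pg.level 1 f0 d0 T0" "\<And>i. i \<in> pg.V \<times> pg.V \<Longrightarrow> card (T0 i) = 8"
    using pg.level_base[OF b] by blast
  obtain N f d T where N0: "N 0 = 1" and T0: "T 0 = T0"
    and chain: "\<And>i. pg.level (N i) (f i) (d i) (T i) \<and> T (Suc i) = pg.end_classes (N (Suc i)) (d (Suc i)) \<and>
      pg.level_acts (N i) (f i) (T i) \<subseteq> pg.level_acts (N (Suc i)) (f (Suc i)) (T (Suc i)) \<and>
      (\<exists>u. N (Suc i) = k * 3 ^ Suc u \<and> N i dvd k * 3 ^ u \<and>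
       (\<forall>F\<in>pg.level_acts (N (Suc i)) (f (Suc i)) (T (Suc i)).
          (\<forall>y\<in>Y. F (shift_by (int (k * 3 ^ u)) y) = shift_by (int (k * 3 ^ u)) (F y))
          \<longrightarrow> F \<in> pg.level_acts (N i) (f i) (T i)))"
    using pg.level_chain[OF base(1) k0] by blast
  have "\<forall>i. \<exists>u. N (Suc i) = k * 3 ^ Suc u \<and> N i dvd k * 3 ^ u \<and>
       (\<forall>F\<in>pg.level_acts (N (Suc i)) (f (Suc i)) (T (Suc i)).
          (\<forall>y\<in>Y. F (shift_by (int (k * 3 ^ u)) y) = shift_by (int (k * 3 ^ u)) (F y))
          \<longrightarrow> F \<in> pg.level_acts (N i) (f i) (T i))" using chain by blast
  from choice[OF this] obtain u where u: "\<And>i. N (Suc i) = k * 3 ^ Suc (u i)" "\<And>i. N i dvd k * 3 ^ u i"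
    "\<And>i F. F \<in> pg.level_acts (N (Suc i)) (f (Suc i)) (T (Suc i)) \<Longrightarrow>
        (\<And>y. y \<in> Y \<Longrightarrow> F (shift_by (int (k * 3 ^ u i)) y) = shift_by (int (k * 3 ^ u i)) (F y)) \<Longrightarrow>
        F \<in> pg.level_acts (N i) (f i) (T i)" by blast
  have lev: "pg.level (N i) (f i) (d i) (T i)" for i using chain[of i] by blast
  have Npos: "N i > 0" for i using lev[of i] by (simp add: pg.level_def)
  have Nless: "N i < N (Suc i)" for i
  proof -
    have "k * 3 ^ u i > 0" using k0 by simp
    hence "N i \<le> k * 3 ^ u i" using dvd_imp_le[OF u(2)] by blast
    moreover have "N (Suc i) = 3 * (k * 3 ^ u i)" unfolding u(1) by simp
    ultimately show ?thesis using Npos[of i] by linarith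
  qed
  have Nmono: "strict_mono N" using Nless by (simp add: strict_mono_Suc_iff)
  define h where "h = (\<lambda>i. level_maps (N i) (f i) (T i))"
  have hSuc: "h i \<subseteq> h (Suc i)" for i unfolding h_def level_maps_alt using chain[of i] by (intro image_mono) blast
  have hmono: "h i \<subseteq> h j" if "i \<le> j" for i j using lift_Suc_mono_le[of h, OF hSuc that] .
  have hD: "F \<in> carrier HG" "int (N i) dvd c \<Longrightarrow> commutes F c" if "F \<in> h i" for F i c
    using level_maps_D[OF lev] that unfolding h_def by blast+
  have bal: "balanced_level (N i) (f i) (d i) (T i)" for i
    unfolding balanced_level_def
  proof (intro conjI lev ballI)
    fix p q assume pq: "p \<in> pg.V \<times> pg.V" "q \<in> pg.V \<times> pg.V"
    show "card (T i q) \<le> pg.class_ratio * card (T i p)"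
    proof (cases i)
      case 0
      have "pg.class_ratio \<ge> 1" unfolding pg.class_ratio_def by (simp only: one_le_power add_leD2 le_add2)
      thus ?thesis unfolding 0 T0 base(2)[OF pq(1)] base(2)[OF pq(2)] by simp
    next
      case (Suc i')
      have e: "T i = pg.end_classes (N i) (d i)" unfolding Suc using chain[of i'] by blast
      show ?thesis unfolding e by (rule pg.end_classes_ratio[OF lev[of i, unfolded e] pq])
    qed
  qed
  define H where "H = (\<Union>i. h i)"
  have sub: "subgroup (h i) HG" for i unfolding h_def by (rule level_maps_iso(2)[OF lev])
  have HSG: "H \<subseteq> carrier SG"
  proof
    fix F assume "F \<in> H"
    then obtain i where i: "F \<in> h i" unfolding H_def by blast
    have "N i \<ge> 1" using Npos[of i] by simp
    thus "F \<in> carrier SG" unfolding carrier_SG using hD(1)[OF i] hD(2)[OF i dvd_refl] by (intro conjI exI[of _ "N i"])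
  qed
  interpret SG: group SG by (rule group_SG)
  have subH: "subgroup H SG"
  proof (rule SG.subgroupI[OF HSG])
    have "\<one>\<^bsub>HG\<^esub> \<in> h 0" using subgroup.one_closed[OF sub] .
    thus "H \<noteq> {}" unfolding H_def by blast
    show "inv\<^bsub>SG\<^esub> F \<in> H" if F: "F \<in> H" for F
    proof -
      obtain i where i: "F \<in> h i" using F unfolding H_def by blast
      have Fi: "inv\<^bsub>HG\<^esub> F \<in> h i" using subgroup.m_inv_closed[OF sub i] .
      hence FH: "inv\<^bsub>HG\<^esub> F \<in> H" unfolding H_def by blast
      have "inv\<^bsub>HG\<^esub> F \<otimes>\<^bsub>SG\<^esub> F = \<one>\<^bsub>SG\<^esub>" using HG.l_inv[OF hD(1)[OF i]] by (simp only: SG_simps)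
      hence "inv\<^bsub>SG\<^esub> F = inv\<^bsub>HG\<^esub> F" using SG.inv_equality HSG F FH by blast
      thus ?thesis using FH by simp
    qed
    show "F \<otimes>\<^bsub>SG\<^esub> F' \<in> H" if FF: "F \<in> H" "F' \<in> H" for F F'
    proof -
      obtain i i' where i: "F \<in> h i" "F' \<in> h i'" using FF unfolding H_def by blast
      have "F \<in> h (max i i')" "F' \<in> h (max i i')" using i hmono[of i "max i i'"] hmono[of i' "max i i'"] by auto
      hence "F \<otimes>\<^bsub>HG\<^esub> F' \<in> h (max i i')" using subgroup.m_closed[OF sub] by blast
      thus ?thesis unfolding H_def SG_simps by blast
    qed
  qed
  \<comment> \<open>An element of a higher level is brought down one level at a time, as none of the
    lengths above \<open>N i\<close> divides \<open>k * j\<close>.\<close>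
  have cent: "H \<inter> centralizer SG ((\<sigma> [^]\<^bsub>HG\<^esub> k) [^]\<^bsub>SG\<^esub> j) = h i"
    if j: "j \<ge> 1" and i: "N i dvd k * j" "\<And>q. i < q \<Longrightarrow> \<not> N q dvd k * j" for i j
  proof (rule equalityI; rule subsetI)
    fix F assume F: "F \<in> h i"
    have "int (N i) dvd int (k * j)" using i(1) by (simp only: of_nat_dvd_iff)
    thus "F \<in> H \<inter> centralizer SG ((\<sigma> [^]\<^bsub>HG\<^esub> k) [^]\<^bsub>SG\<^esub> j)"
      using centralizer_SG[OF k j, of F] hD[OF F] F unfolding H_def by blast
  next
    fix F assume F: "F \<in> H \<inter> centralizer SG ((\<sigma> [^]\<^bsub>HG\<^esub> k) [^]\<^bsub>SG\<^esub> j)"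
    hence c: "commutes F (int (k * j))" using centralizer_SG[OF k j, of F] by blast
    have down: "F \<in> h (i + m) \<Longrightarrow> F \<in> h i" for m
    proof (induction m)
      case (Suc m)
      have "F \<in> h (i + m)" unfolding h_def
      proof (rule level_maps_descend[OF lev _ u(1) _ c u(3)])
        show "F \<in> level_maps (N (Suc (i + m))) (f (Suc (i + m))) (T (Suc (i + m)))" using Suc.prems by (simp add: h_def)
        show "\<not> N (Suc (i + m)) dvd k * j" using i(2) by simp
      qed
      thus ?case by (rule Suc.IH)
    qed simp
    obtain q where "F \<in> h q" using F unfolding H_def by blast
    hence "F \<in> h (i + q)" using hmono[of q "i + q"] by auto
    thus "F \<in> h i" by (rule down)
  qed
  have levels: "\<exists>n f d T. balanced_level n f d T \<and> H \<inter> centralizer SG ((\<sigma> [^]\<^bsub>HG\<^esub> k) [^]\<^bsub>SG\<^esub> j) = level_maps n f T"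
    if j: "j \<ge> 1" for j :: nat
  proof -
    \<comment> \<open>The set is nonempty because \<open>N 0 = 1\<close>, and finite because
      \<open>N\<close> is strictly increasing.\<close>
    define D where "D = {i. N i dvd k * j}"
    have kj: "k * j > 0" using k j by simp
    have Dle: "i \<le> k * j" if "i \<in> D" for i
    proof -
      have "i \<le> N i" using Nmono by (rule strict_mono_imp_increasing)
      also have "N i \<le> k * j" using that kj by (intro dvd_imp_le) (auto simp: D_def)
      finally show ?thesis .
    qed
    have fin: "finite D" using Dle by (intro finite_subset[of D "{..k * j}"]) auto
    have "0 \<in> D" by (simp add: D_def N0)
    hence Max: "Max D \<in> D" using fin by (intro Max_in) auto
    have "\<not> N q dvd k * j" if "Max D < q" for q
    proof
      assume "N q dvd k * j"
      hence "q \<le> Max D" using fin by (intro Max_ge) (auto simp: D_def)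
      thus False using that by simp
    qed
    moreover have "N (Max D) dvd k * j" using Max by (simp add: D_def)
    ultimately show ?thesis using cent[OF j] bal unfolding h_def by blast
  qed
  define r where "r = (\<lambda>i. 3 ^ Suc (u i) :: nat)"
  have r: "N (Suc i) = k * r i" for i unfolding r_def u(1) ..
  have rmono: "strict_mono r"
    unfolding strict_mono_Suc_iff
  proof
    fix i
    have "k * r i < k * r (Suc i)" using Nless[of "Suc i"] unfolding r .
    thus "r i < r (Suc i)" using k0 by simp
  qed
  have big: "r i \<ge> 1 \<and> (\<exists>f d. pg.level (k * r i) f d (pg.end_classes (k * r i) d) \<and>
       level_maps (k * r i) f (pg.end_classes (k * r i) d) \<subseteq>
         H \<inter> centralizer SG ((\<sigma> [^]\<^bsub>HG\<^esub> k) [^]\<^bsub>SG\<^esub> (r i)))" for i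
  proof (intro conjI exI)
    show r1: "r i \<ge> 1" unfolding r_def by simp
    have e: "T (Suc i) = pg.end_classes (k * r i) (d (Suc i))" using chain[of i] unfolding r by blast
    show "pg.level (k * r i) (f (Suc i)) (d (Suc i)) (pg.end_classes (k * r i) (d (Suc i)))"
      using lev[of "Suc i"] unfolding r e .
    have "h (Suc i) \<subseteq> H \<inter> centralizer SG ((\<sigma> [^]\<^bsub>HG\<^esub> k) [^]\<^bsub>SG\<^esub> (r i))"
    proof
      fix F assume F: "F \<in> h (Suc i)"
      have "commutes F (int (k * r i))" by (rule hD(2)[OF F]) (simp only: r dvd_refl)
      thus "F \<in> H \<inter> centralizer SG ((\<sigma> [^]\<^bsub>HG\<^esub> k) [^]\<^bsub>SG\<^esub> (r i))"
        using centralizer_SG[OF k r1, of F] hD(1)[OF F] F unfolding H_def by blast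
    qed
    thus "level_maps (k * r i) (f (Suc i)) (pg.end_classes (k * r i) (d (Suc i))) \<subseteq>
         H \<inter> centralizer SG ((\<sigma> [^]\<^bsub>HG\<^esub> k) [^]\<^bsub>SG\<^esub> (r i))" unfolding h_def r e .
  qed
  show ?thesis
  proof (rule exI[of _ H], rule conjI[OF subH], rule conjI)
    show "\<forall>j\<ge>1. \<exists>n f d T. balanced_level n f d T \<and> H \<inter> centralizer SG ((\<sigma> [^]\<^bsub>HG\<^esub> k) [^]\<^bsub>SG\<^esub> (j::nat)) = level_maps n f T"
      by (intro allI impI) (rule levels)
  qed (rule exI[of _ r], rule conjI[OF rmono], rule allI, rule big)
qed

text \<open>The group contains an alternating group on at least half as many points as there are
  paths of length \<open>n - (3 * conn_len + 1)\<close>, and these paths are at least as numerous as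
  the words shorter by another \<open>l\<close>.\<close>

lemma ln_ln_card_level_maps_ge:
  "\<exists>n0. \<forall>n\<ge>n0. \<forall>f d. pg.level n f d (pg.end_classes n d) \<longrightarrow>
    (real n - real (3 * pg.conn_len + 1 + l)) * growth - ln 8 \<le> ln (ln (real (card (level_maps n f (pg.end_classes n d)))))"
proof -
  obtain Q0 where Q0: "\<And>Q u v. Q \<ge> Q0 \<Longrightarrow> u \<in> pg.V \<Longrightarrow> v \<in> pg.V \<Longrightarrow> 1 * Q + 1 < card {w \<in> pg.still Q. eg.ends w = (u, v)}"
    using pg.card_still_large[of 1] by blast
  obtain u where u: "u \<in> pg.V" using pg.V_ne by blast
  have "(real n - real (3 * pg.conn_len + 1 + l)) * growth - ln 8 \<le> ln (ln (real (card (level_maps n f (pg.end_classes n d)))))"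
    if n: "n \<ge> 3 * pg.conn_len + 1 + (Q0 + 10 + l + 1)" and lev: "pg.level n f d (pg.end_classes n d)" for n f d
  proof -
    define n' where "n' = n - (3 * pg.conn_len + 1)"
    have n': "n = n' + 3 * pg.conn_len + 1" "n' \<ge> Q0" "n' \<ge> 10" "n' > l" using n by (auto simp: n'_def)
    define p where "p = card (eg.paths n')"
    have "n' + 1 < card {w \<in> pg.still n'. eg.ends w = (u, u)}" using Q0[OF n'(2) u u] by simp
    also have "\<dots> \<le> p" unfolding p_def by (intro card_mono) (auto simp: pg.still_def)
    finally have p: "p \<ge> 10" using n'(3) by simp
    have n'0: "n' > 0" using n'(3) by simp
    have "fact (p div 2) \<le> 2 * card (level_maps n f (pg.end_classes n d))"
      unfolding level_maps_iso(3)[OF lev] p_def by (rule pg.card_level_group_ge[OF lev n'(1) n'0])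
    hence "ln (real p) - ln 8 \<le> ln (ln (real (card (level_maps n f (pg.end_classes n d)))))" using p by (rule ln_ln_ge)
    moreover have "real (n' - l) * growth \<le> ln (nwords (n' - l))" using n'(4) by (intro growth_le) simp
    moreover have "nwords (n' - l) \<le> real p" unfolding p_def using card_words_le_paths[of "n' - l"] n'(4) by simp
    hence "ln (nwords (n' - l)) \<le> ln (real p)" using nwords_ge_1[of "n' - l"] by (subst ln_le_cancel_iff) auto
    moreover have "real (n' - l) = real n - real (3 * pg.conn_len + 1 + l)" using n'(1,4) by simp
    ultimately show ?thesis by (simp only:)
  qed
  thus ?thesis by blast
qed

abbreviation "local_class \<equiv> PS (1 / real exponent) (real exponent) ((card pg.V)\<^sup>2)"

theorem local_entropy_stabilized:
  assumes mix: "mixing X" and k: "k \<ge> 1"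
    and b: "bij_betw b ((pg.V \<times> pg.V) \<times> {..<8::nat} \<times> (UNIV :: bool set)) E0"
  shows "local_entropy_exists local_class SG (\<sigma> [^]\<^bsub>HG\<^esub> (k::nat))"
    and "local_entropy local_class SG (\<sigma> [^]\<^bsub>HG\<^esub> k) = topological_entropy \<X> (\<sigma> [^]\<^bsub>HG\<^esub> k)"
proof -
  let ?C = "\<lambda>j::nat. centralizer SG ((\<sigma> [^]\<^bsub>HG\<^esub> k) [^]\<^bsub>SG\<^esub> j)"
  obtain H and r :: "nat \<Rightarrow> nat" where H: "subgroup H SG"
    and cent: "\<forall>j\<ge>1. \<exists>n f d T. balanced_level n f d T \<and> H \<inter> ?C j = level_maps n f T"
    and r: "strict_mono r"
    and big: "\<forall>i. r i \<ge> 1 \<and> (\<exists>f d. pg.level (k * r i) f d (pg.end_classes (k * r i) d) \<and>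
       level_maps (k * r i) f (pg.end_classes (k * r i) d) \<subseteq> H \<inter> ?C (r i))"
    using level_tower[OF b k] by (elim exE conjE) (rule that)
  note cent = cent[rule_format] and big = big[rule_format]
  have fin: "finite (H \<inter> ?C j)" and cls: "local_class (SG\<lparr>carrier := H \<inter> ?C j\<rparr>)" and gt1: "1 < card (H \<inter> ?C j)"
    if j: "j \<ge> 1" for j
  proof -
    obtain n f d T where nf: "balanced_level n f d T" "H \<inter> ?C j = level_maps n f T" using cent[OF j] by blast
    have lev: "pg.level n f d T" using nf(1) by (simp add: balanced_level_def)
    show "finite (H \<inter> ?C j)" "1 < card (H \<inter> ?C j)"
      unfolding nf(2) using level_maps_iso(4)[OF lev] card_level_maps_gt_1[OF lev] by auto
    show "local_class (SG\<lparr>carrier := H \<inter> ?C j\<rparr>)"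
      unfolding nf(2) by (rule PS_level_maps[OF lev]) (use nf(1) balanced_level_def in blast)
  qed
  have pow1: "(\<sigma> [^]\<^bsub>HG\<^esub> k) [^]\<^bsub>SG\<^esub> (1::nat) = \<sigma> [^]\<^bsub>HG\<^esub> k"
    unfolding sigma_pow using shift_pow[of SG "int k" 1] by simp
  have "H \<inter> ?C 1 \<noteq> {\<one>\<^bsub>SG\<^esub>}" using gt1[of 1] by auto
  hence ntr: "H \<inter> centralizer SG (\<sigma> [^]\<^bsub>HG\<^esub> k) \<noteq> {\<one>\<^bsub>SG\<^esub>}" unfolding pow1 .
  have loc: "locally_in_class local_class SG (\<sigma> [^]\<^bsub>HG\<^esub> k) H"
    unfolding locally_in_class_def
  proof (intro conjI allI impI)
    show "\<exists>J::nat. J \<ge> 1 \<and> (\<forall>j\<ge>J. local_class (SG\<lparr>carrier := H \<inter> ?C j\<rparr>))"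
      using cls by blast
  qed (use H fin ntr in blast)+
  thus "local_entropy_exists local_class SG (\<sigma> [^]\<^bsub>HG\<^esub> k)" unfolding local_entropy_exists_def by blast
  define lnln where "lnln = (\<lambda>H n. ereal (ln (ln (real (card (H \<inter> ?C n)))) / real n))"
  define C0 where "C0 = real (3 * pg.conn_len + 1 + l)"
  obtain n0 where n0: "\<And>n f d. n \<ge> n0 \<Longrightarrow> pg.level n f d (pg.end_classes n d) \<Longrightarrow>
    (real n - C0) * growth - ln 8 \<le> ln (ln (real (card (level_maps n f (pg.end_classes n d)))))"
    using ln_ln_card_level_maps_ge unfolding C0_def by blast
  have lower: "ereal (((real k * real (r i) - C0) * growth - ln 8) / real (r i)) \<le> (lnln H \<circ> r) i" if i: "i \<ge> n0" for i
  proof -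
    obtain f d where fd: "pg.level (k * r i) f d (pg.end_classes (k * r i) d)"
       "level_maps (k * r i) f (pg.end_classes (k * r i) d) \<subseteq> H \<inter> ?C (r i)" using big[of i] by blast
    have r1: "r i \<ge> 1" using big[of i] by blast
    have "n0 \<le> r i" using i strict_mono_imp_increasing[OF r, of i] by linarith
    also have "1 * r i \<le> k * r i" using k by (intro mult_le_mono1)
    finally have n: "n0 \<le> k * r i" by simp
    define c where "c = card (level_maps (k * r i) f (pg.end_classes (k * r i) d))"
    have c1: "1 < c" unfolding c_def by (rule card_level_maps_gt_1[OF fd(1)])
    have cc: "c \<le> card (H \<inter> ?C (r i))" unfolding c_def by (rule card_mono[OF fin[OF r1] fd(2)])
    have "(real (k * r i) - C0) * growth - ln 8 \<le> ln (ln (real c))" unfolding c_def by (rule n0[OF n fd(1)])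
    also have "\<dots> \<le> ln (ln (real (card (H \<inter> ?C (r i)))))"
    proof -
      have "ln (real c) \<le> ln (real (card (H \<inter> ?C (r i))))" using c1 cc by (subst ln_le_cancel_iff) auto
      moreover have "0 < ln (real c)" using c1 by simp
      ultimately show ?thesis by (subst ln_le_cancel_iff) auto
    qed
    finally show ?thesis by (simp add: lnln_def divide_right_mono)
  qed
  have "(\<lambda>n. real k * growth - (C0 * growth + ln 8) / real n) \<longlonglongrightarrow> real k * growth - 0"
    by (intro tendsto_diff tendsto_const lim_const_over_n)
  moreover have "\<forall>\<^sub>F n in sequentially. real k * growth - (C0 * growth + ln 8) / real n
      = ((real k * real n - C0) * growth - ln 8) / real n"
    by (rule eventually_sequentiallyI[of 1]) (simp add: field_simps)
  ultimately have lim0: "(\<lambda>n. ((real k * real n - C0) * growth - ln 8) / real n) \<longlonglongrightarrow> real k * growth"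
    using Lim_transform_eventually by fastforce
  have "(\<lambda>i. ((real k * real (r i) - C0) * growth - ln 8) / real (r i)) \<longlonglongrightarrow> real k * growth"
    using LIMSEQ_subseq_LIMSEQ[OF lim0 r] by (simp add: o_def)
  \<comment> \<open>The lower bound is available only along \<open>r\<close>, but the limit superior
    over all \<open>n\<close> dominates that along a subsequence.\<close>
  hence "ereal (real k * growth) = limsup (\<lambda>i. ereal (((real k * real (r i) - C0) * growth - ln 8) / real (r i)))"
    by (intro lim_imp_Limsup[symmetric]) auto
  also have "\<dots> \<le> limsup (lnln H \<circ> r)"
    by (rule Limsup_mono, rule eventually_sequentiallyI[of n0], rule lower)
  also have "\<dots> \<le> limsup (lnln H)" by (rule limsup_subseq_mono[OF r])
  finally have ge: "ereal (real k * growth) \<le> limsup (lnln H)" .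
  have r1: "1 \<le> (card pg.V)\<^sup>2" using pg.finite_V pg.V_ne by (simp add: Suc_le_eq card_gt_0_iff)
  have D1: "1 \<le> real exponent" using exponent_ge_1 by simp
  have le: "limsup (lnln H') \<le> ereal (real k * growth)" if "locally_in_class local_class SG (\<sigma> [^]\<^bsub>HG\<^esub> k) H'" for H'
    unfolding lnln_def by (rule local_entropy_le[OF mix k D1 r1 that])
  have "local_entropy local_class SG (\<sigma> [^]\<^bsub>HG\<^esub> k) =
      (SUP H\<in>{H. locally_in_class local_class SG (\<sigma> [^]\<^bsub>HG\<^esub> k) H}. limsup (lnln H))"
    unfolding local_entropy_def lnln_def ..
  also have "\<dots> = ereal (real k * growth)"
  proof (rule antisym)
    show "(SUP H\<in>{H. locally_in_class local_class SG (\<sigma> [^]\<^bsub>HG\<^esub> k) H}. limsup (lnln H)) \<le> ereal (real k * growth)"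
      using le by (intro SUP_least) blast
    show "ereal (real k * growth) \<le> (SUP H\<in>{H. locally_in_class local_class SG (\<sigma> [^]\<^bsub>HG\<^esub> k) H}. limsup (lnln H))"
      using loc ge by (intro SUP_upper2[of H]) auto
  qed
  also have "\<dots> = topological_entropy \<X> (\<sigma> [^]\<^bsub>HG\<^esub> k)"
    by (rule topological_entropy_eq[symmetric, OF k]) (simp add: sigma_pow)
  finally show "local_entropy local_class SG (\<sigma> [^]\<^bsub>HG\<^esub> k) = topological_entropy \<X> (\<sigma> [^]\<^bsub>HG\<^esub> k)" .
qed

end

theorem theorem1:
  fixes A :: "'a set" and X :: "(int \<Rightarrow> 'a) set"
  assumes "shift_of_finite_type A X" and "mixing X" and "\<not> trivial_shift X"
  defines "\<X> \<equiv> subshift_topology A X"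
    and "\<sigma> \<equiv> subshift_map X"
  shows "\<exists>(E::real) (F::real) (s::nat). 0 < E \<and> E \<le> 1 \<and> 1 \<le> F \<and> 1 \<le> s \<and>
           (\<forall>k::nat. k \<ge> 1 \<longrightarrow>
              (let G = stabilized_aut_group \<X> \<sigma>;
                   \<sigma>k = \<sigma> [^]\<^bsub>homeo_group \<X>\<^esub> k
               in leveled_group G \<sigma>k \<and>
                  local_entropy_exists (PS E F (s\<^sup>2)) G \<sigma>k \<and>
                  local_entropy (PS E F (s\<^sup>2)) G \<sigma>k = topological_entropy \<X> \<sigma>k))"
proof -
  obtain M where "sft A X M" using sft_exists[OF assms(1)] by blast
  then interpret sft A X M .
  obtain a l where al: "window_coding A X M a l"
    "16 * (card (window_coding.states X a l))\<^sup>2 + 2 \<le> card (window_coding.return_words X a l)"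
    using window_coding_exists[OF assms(2,3)] by blast
  interpret w: window_coding A X M a l by (rule al(1))
  obtain E0 e1 e2 b where g: "parallel_graph w.EE w.esrc w.etgt E0 e1 e2"
    and b: "bij_betw b ((w.states \<times> w.states) \<times> {..<8::nat} \<times> (UNIV :: bool set)) E0"
    using w.parallel_graph_exists[OF assms(2) al(2)] by blast
  \<comment> \<open>The graph is fixed before \<open>k\<close> enters, and with it
    \<open>exponent\<close> and the number of vertices; this is why the constants do not depend on
    \<open>k\<close>.\<close>
  interpret c: coded A X M a l E0 e1 e2 by (rule coded.intro[OF al(1) coded_axioms.intro[OF g]])
  have b': "bij_betw b ((c.pg.V \<times> c.pg.V) \<times> {..<8::nat} \<times> (UNIV :: bool set)) E0"
    using b unfolding c.pg.V_def w.states_def .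
  have s: "1 \<le> card c.pg.V" using c.pg.finite_V c.pg.V_ne by (simp add: Suc_le_eq card_gt_0_iff)
  have e: "0 < 1 / real c.exponent" "1 / real c.exponent \<le> 1" "1 \<le> real c.exponent" using c.exponent_ge_1 by auto
  show ?thesis
    unfolding Let_def \<X>_def \<sigma>_def
    using s e leveled[OF assms(2,3)] c.local_entropy_stabilized[OF assms(2) _ b'] by blast
qed

end
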